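(* Let $\mathscr M=(\mathscr C,\gamma)$, $\mathscr C=(C,F)$, be a Morse tuple. Suppose there exist real numbers $a\le b$ and a continuous function $\Phi:\mathbb R\setminus(a,b)\to\mathbb R_{>0}$ such that for every component $c\subset C$, $$\left|\frac{\partial F_3(c(r))}{\partial r}\right|\le\Phi\big(F_3(c(r))\big)\quad\text{(wherever } F_3(c(r))\notin(a,b)\text{)},\qquad \int_b^\infty\frac{1}{\Phi(s)}\,ds=\infty,\qquad \int_{-\infty}^a\frac1{\Phi(s)}\,ds=\infty .$$ Then Morse homology is invariant: for all $r_0,r_1\in[0,1]\setminus\Lambda$, $\mathrm{HM}(\mathscr M,r_0)\cong\mathrm{HM}(\mathscr M,r_1)$.
   Context: **Cerf tuple.** On $\mathbb{R}\times[0,1]\times\mathbb{R}$ with coordinates $(x,y,z)$ use the contact form $dz+x\,dy$. A Cerf tuple $\mathscr{C}=(C,F)$ consists of a one-dimensional manifold $C$ with boundary, each of whose connected components is compact (there may be infinitely many components), and a smooth map $F=(F_1,F_2,F_3):C\to\mathbb{R}\times[0,1]\times\mathbb{R}$ such that $F_3$ is proper and, on each component $c\subset C$, $F|_c$ is either a Legendrian knot (Legendrian embedding of a circle) or a Legendrian chord (Legendrian embedding of a compact interval) which begins and ends on $\{y=0\}$ or $\{y=1\}$. A point of $C$ with $F_2$-value $r$ is written $c(r)$; sums "over $c\subset C$" at parameter $r$ run over the points of $F_2^{-1}(r)$. The derivative $\partial F_3(c(r))/\partial r$ is the derivative of $F_3$ along the curve with respect to the parameter $r=F_2$, at points where $dF_2\neq0$.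 The interval $(a,b)$ may be empty. Interior local minima of $F_2$ are called births, interior local maxima deaths; these form discrete subsets of $C$. Near a birth at parameter $r_B$ the curve has, for $r$ slightly larger than $r_B$, two branches $c_B^+(r),c_B^-(r)$; near a death at $r_D$ it has, for $r$ slightly smaller than $r_D$, two branches $c_D^+(r),c_D^-(r)$. **Flow line counter.** Let $\mathbb{F}$ be a principal ideal domain. Let $C\times_{F_2}C=\{(c_1,c_2)\in C\times C: F_2(c_1)=F_2(c_2)\}$; write $(c_1,c_2)(r)$ for a pair at parameter $r$. Let $\mathcal{D}$ (resp. $\mathcal{B}$) be the set of pairs at least one of whose entries is a death (resp. birth), and $\mathcal V_{\mathscr C}=\mathcal D\cup\mathcal B$. A graph structure on a space $G$ is a discrete subset $V$ such that $G\setminus V$ is a 1-manifold (whose components are the edges); a supergraph structure is a graph structure containing $V$. A flow line counter is a function $\gamma:C\times_{F_2}C\to\mathbb{F}$ which is constant on each edge of some supergraph structure $\mathcal V_{\mathscr M}\supseteq\mathcal V_{\mathscr C}$, together with a jump function $\delta:\mathcal H:=\mathcal V_{\mathscr M}\setminus\mathcal V_{\mathscr C}\to\mathbb{F}$ ($\mathcal H$ is the set of handle-slides), satisfying the axioms below. Write $\gamma_r(c_1,c_2)$, $\delta_r(c_1,c_2)$ for the values at $(c_1,c_2)(r)$, and $\gamma_r^\pm(c_1,c_2)=\lim_{\epsilon\to0^+}\gamma_{r\pm\epsilon}(c_1,c_2)$. Let $F_2(\mathcal D),F_2(\mathcal B),F_2(\mathcal H)\subset[0,1]$ be the sets of parameters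 at which the respective vertices occur; they are assumed disjoint, and births and deaths are assumed to occur one at a time. Let $\Lambda=F_2(\mathcal D)\cup F_2(\mathcal B)\cup F_2(\mathcal H)$ (possibly infinite). ($\gamma1$) For $r\in[0,1]\setminus\Lambda$, $\gamma_r(c_1,c_2)=0$ if $F_3(c_2(r))\ge F_3(c_1(r))$; for $(c_1,c_2)(r_H)\in\mathcal H$, $\delta_{r_H}(c_1,c_2)=0$ if $F_3(c_2(r_H))\ge F_3(c_1(r_H))$. ($\gamma2$) For $r\in[0,1]\setminus\Lambda$ and all $c_1,c_3$: $\sum_{c_2}\gamma_r(c_1,c_2)\gamma_r(c_2,c_3)=0$. ($\gamma3$) At $r_H\in F_2(\mathcal H)$: $\gamma_{r_H}^+(c_1,c_3)=\gamma_{r_H}^-(c_1,c_3)+\sum_{c_2:(c_1,c_2)(r_H)\in\mathcal H}\delta_{r_H}(c_1,c_2)\gamma_{r_H}^-(c_2,c_3)-\sum_{c_2:(c_2,c_3)(r_H)\in\mathcal H}\delta_{r_H}(c_2,c_3)\gamma_{r_H}^+(c_1,c_2)$. ($\gamma4$) At $r_B\in F_2(\mathcal B)$: $\gamma^+_{r_B}(c_B^+,c_B^-)$ is invertible in $\mathbb F$; $\gamma_{r_B}^+(c_1,c_2)=\gamma^-_{r_B}(c_1,c_2)+\gamma^+_{r_B}(c_1,c_B^-)\gamma^+_{r_B}(c_B^+,c_B^-)^{-1}\gamma^+_{r_B}(c_B^+,c_2)$; and $\gamma_{r_B}^+(c_1,c_B^+)=\gamma_{r_B}^+(c_B^-,c_1)=\gamma_{r_B}^+(c_B^+,c_2)=0$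 for $c_2\ne c_B^-$. ($\gamma5$) At $r_D\in F_2(\mathcal D)$: $\gamma^-_{r_D}(c_D^+,c_D^-)$ is invertible in $\mathbb F$; $\gamma_{r_D}^+(c_1,c_2)=\gamma^-_{r_D}(c_1,c_2)-\gamma^-_{r_D}(c_1,c_D^-)\gamma^-_{r_D}(c_D^+,c_D^-)^{-1}\gamma^-_{r_D}(c_D^+,c_2)$; and $\gamma_{r_D}^-(c_1,c_D^+)=\gamma_{r_D}^-(c_D^-,c_1)=\gamma_{r_D}^-(c_D^+,c_2)=0$ for $c_2\ne c_D^-$. A Morse tuple is a pair $\mathscr M=(\mathscr C,\gamma)$ of a Cerf tuple and a flow line counter on it. **Morse homology.** For $r\in[0,1]\setminus\Lambda$ and $a'\le b'$, $\mathrm{CM}^{(a',b')}(\mathscr M,r)$ is the free $\mathbb F$-module on the (finitely many) points $c(r)$ with $F_3(c(r))\in(a',b')$, with boundary operator $c_1(r)\mapsto\sum_{c_2}\gamma_r(c_1,c_2)\,c_2(r)$ (sum over generators in the window). Let $\mathrm{HM}^{(a',b')}(\mathscr M,r)$ be its homology and $\mathrm{HM}(\mathscr M,r)=\varinjlim_{b'\to\infty}\varprojlim_{a'\to-\infty}\mathrm{HM}^{(a',b')}(\mathscr M,r)$. *)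

theory Defs
  imports "HOL-Analysis.Analysis" "HOL-Library.Poly_Mapping" "HOL-Algebra.Module"
    "HOL-Algebra.AbelCoset" "HOL-Algebra.Ring_Divisibility"
begin

section \<open>Cerf tuples\<close>

text \<open>
  A one-dimensional manifold with compact components is a disjoint union of circles and compact
  intervals. The components are indexed by the set \<open>comps\<close>; those indexed by \<open>circles\<close> are the unit
  circle of the complex plane, the others are the segment from 0 to 1 of the real axis. A point of
  the curve is a pair of an index and a complex number, and \<open>Fmap\<close> is the map \<open>F\<close> into the space
  with coordinates \<open>(x, y, z)\<close>.
\<close>

record 'i cerf =
  comps :: "'i set"
  circles :: "'i set"
  Fmap :: "'i \<times> complex \<Rightarrow> real \<times> real \<times> real"

definition F1 :: "('i, 'z) cerf_scheme \<Rightarrow> 'i \<times> complex \<Rightarrow> real" where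
  "F1 C p = fst (Fmap C p)"

definition F2 :: "('i, 'z) cerf_scheme \<Rightarrow> 'i \<times> complex \<Rightarrow> real" where
  "F2 C p = fst (snd (Fmap C p))"

definition F3 :: "('i, 'z) cerf_scheme \<Rightarrow> 'i \<times> complex \<Rightarrow> real" where
  "F3 C p = snd (snd (Fmap C p))"

definition pdom :: "('i, 'z) cerf_scheme \<Rightarrow> 'i \<Rightarrow> real set" where
  "pdom C i = (if i \<in> circles C then UNIV else {0..1})"

definition param :: "('i, 'z) cerf_scheme \<Rightarrow> 'i \<Rightarrow> real \<Rightarrow> complex" where
  "param C i = (if i \<in> circles C then cis else complex_of_real)"

definition arc_at :: "('i, 'z) cerf_scheme \<Rightarrow> 'i \<Rightarrow> real \<Rightarrow> 'i \<times> complex" where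
  "arc_at C i t = (i, param C i t)"

definition curve_top :: "('i, 'z) cerf_scheme \<Rightarrow> ('i \<times> complex) topology" where
  "curve_top C = sum_topology (\<lambda>i. top_of_set (param C i ` pdom C i)) (comps C)"

definition pts :: "('i, 'z) cerf_scheme \<Rightarrow> ('i \<times> complex) set" where
  "pts C = (SIGMA i:comps C. param C i ` pdom C i)"

lemma topspace_curve_top: "topspace (curve_top C) = pts C"
  by (auto simp: curve_top_def pts_def)

definition endpts :: "('i, 'z) cerf_scheme \<Rightarrow> ('i \<times> complex) set" where
  "endpts C = (comps C - circles C) \<times> {0, 1}"

definition smooth_curve_on :: "real set \<Rightarrow> (real \<Rightarrow> 'v::real_normed_vector) \<Rightarrow> bool" where
  "smooth_curve_on T f \<longleftrightarrow>
     (\<exists>D :: nat \<Rightarrow> real \<Rightarrow> 'v. D 0 = f \<and>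
        (\<forall>k. \<forall>t\<in>T. (D k has_vector_derivative D (Suc k) t) (at t within T)))"

definition vel :: "('i, 'z) cerf_scheme \<Rightarrow> 'i \<Rightarrow> real \<Rightarrow> real \<times> real \<times> real" where
  "vel C i t = vector_derivative (\<lambda>s. Fmap C (arc_at C i s)) (at t within pdom C i)"

text \<open>
  Components are compact, so an injective immersion is an embedding. The last clause says that the
  contact form \<open>dz + x dy\<close> vanishes on the velocity.
\<close>

definition legendrian_component :: "('i, 'z) cerf_scheme \<Rightarrow> 'i \<Rightarrow> bool" where
  "legendrian_component C i \<longleftrightarrow>
     smooth_curve_on (pdom C i) (\<lambda>t. Fmap C (arc_at C i t)) \<and>
     inj_on (Fmap C) ({i} \<times> param C i ` pdom C i) \<and>
     (\<forall>t\<in>pdom C i. vel C i t \<noteq> 0) \<and>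
     (\<forall>t\<in>pdom C i. snd (snd (vel C i t)) + F1 C (arc_at C i t) * fst (snd (vel C i t)) = 0)"

definition births :: "('i, 'z) cerf_scheme \<Rightarrow> ('i \<times> complex) set" where
  "births C = {c \<in> pts C - endpts C.
     \<exists>U. openin (curve_top C) U \<and> c \<in> U \<and> (\<forall>p\<in>U. F2 C c \<le> F2 C p)}"

definition deaths :: "('i, 'z) cerf_scheme \<Rightarrow> ('i \<times> complex) set" where
  "deaths C = {c \<in> pts C - endpts C.
     \<exists>U. openin (curve_top C) U \<and> c \<in> U \<and> (\<forall>p\<in>U. F2 C p \<le> F2 C c)}"

definition discrete_in :: "'a topology \<Rightarrow> 'a set \<Rightarrow> bool" where
  "discrete_in X S \<longleftrightarrow> S \<subseteq> topspace X \<and> subtopology X S = discrete_topology S"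

definition cerf_tuple :: "('i, 'z) cerf_scheme \<Rightarrow> bool" where
  "cerf_tuple C \<longleftrightarrow>
     F2 C ` pts C \<subseteq> {0..1} \<and>
     proper_map (curve_top C) euclideanreal (F3 C) \<and>
     (\<forall>i\<in>comps C. legendrian_component C i) \<and>
     F2 C ` endpts C \<subseteq> {0, 1} \<and>
     discrete_in (curve_top C) (births C) \<and>
     discrete_in (curve_top C) (deaths C)"

definition fib :: "('i, 'z) cerf_scheme \<Rightarrow> real \<Rightarrow> ('i \<times> complex) set" where
  "fib C r = {c \<in> pts C. F2 C c = r}"

text \<open>
  The germ of \<open>branch C c\<close> at \<open>F2 C c\<close> is the path \<open>r \<mapsto> c(r)\<close> in the curve through \<open>c\<close>; such a path
  exists and its germ is unique when \<open>c\<close> is neither a birth nor a death. It is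
  one-sided if \<open>F2 C c\<close> is 0 or 1.
\<close>

definition is_branch ::
    "('i, 'z) cerf_scheme \<Rightarrow> 'i \<times> complex \<Rightarrow> (real \<Rightarrow> 'i \<times> complex) \<Rightarrow> bool" where
  "is_branch C c \<sigma> \<longleftrightarrow> \<sigma> (F2 C c) = c \<and>
     (\<exists>e>0. continuous_map (top_of_set ({F2 C c - e<..<F2 C c + e} \<inter> {0..1})) (curve_top C) \<sigma> \<and>
        (\<forall>t\<in>{F2 C c - e<..<F2 C c + e} \<inter> {0..1}. F2 C (\<sigma> t) = t))"

definition branch :: "('i, 'z) cerf_scheme \<Rightarrow> 'i \<times> complex \<Rightarrow> real \<Rightarrow> 'i \<times> complex" where
  "branch C c = (SOME \<sigma>. is_branch C c \<sigma>)"

definition birth_branches :: "('i, 'z) cerf_scheme \<Rightarrow> 'i \<times> complex \<Rightarrow>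
    (real \<Rightarrow> 'i \<times> complex) \<Rightarrow> (real \<Rightarrow> 'i \<times> complex) \<Rightarrow> bool" where
  "birth_branches C c \<sigma> \<tau> \<longleftrightarrow> \<sigma> (F2 C c) = c \<and> \<tau> (F2 C c) = c \<and>
     (\<exists>e>0. continuous_map (top_of_set {F2 C c..<F2 C c + e}) (curve_top C) \<sigma> \<and>
        continuous_map (top_of_set {F2 C c..<F2 C c + e}) (curve_top C) \<tau> \<and>
        (\<forall>t\<in>{F2 C c<..<F2 C c + e}. F2 C (\<sigma> t) = t \<and> F2 C (\<tau> t) = t \<and> \<sigma> t \<noteq> \<tau> t))"

definition death_branches :: "('i, 'z) cerf_scheme \<Rightarrow> 'i \<times> complex \<Rightarrow>
    (real \<Rightarrow> 'i \<times> complex) \<Rightarrow> (real \<Rightarrow> 'i \<times> complex) \<Rightarrow> bool" where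
  "death_branches C c \<sigma> \<tau> \<longleftrightarrow> \<sigma> (F2 C c) = c \<and> \<tau> (F2 C c) = c \<and>
     (\<exists>e>0. continuous_map (top_of_set {F2 C c - e<..F2 C c}) (curve_top C) \<sigma> \<and>
        continuous_map (top_of_set {F2 C c - e<..F2 C c}) (curve_top C) \<tau> \<and>
        (\<forall>t\<in>{F2 C c - e<..<F2 C c}. F2 C (\<sigma> t) = t \<and> F2 C (\<tau> t) = t \<and> \<sigma> t \<noteq> \<tau> t))"

definition F2_regular :: "('i, 'z) cerf_scheme \<Rightarrow> 'i \<times> complex \<Rightarrow> bool" where
  "F2_regular C c \<longleftrightarrow>
     (\<exists>t\<in>pdom C (fst c). arc_at C (fst c) t = c \<and>
        vector_derivative (\<lambda>s. F2 C (arc_at C (fst c) s)) (at t within pdom C (fst c)) \<noteq> 0)"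

definition dF3_dr :: "('i, 'z) cerf_scheme \<Rightarrow> 'i \<times> complex \<Rightarrow> real" where
  "dF3_dr C c = vector_derivative (\<lambda>r. F3 C (branch C c r)) (at (F2 C c) within {0..1})"


section \<open>Graph structures and flow line counters\<close>

definition one_manifold :: "'a topology \<Rightarrow> bool" where
  "one_manifold X \<longleftrightarrow> Hausdorff_space X \<and> second_countable X \<and>
     (\<forall>x\<in>topspace X. \<exists>U. openin X U \<and> x \<in> U \<and>
        (subtopology X U homeomorphic_space euclideanreal \<or>
         subtopology X U homeomorphic_space top_of_set {0::real..}))"

definition graph_structure :: "'a topology \<Rightarrow> 'a set \<Rightarrow> bool" where
  "graph_structure X V \<longleftrightarrow> discrete_in X V \<and> one_manifold (subtopology X (topspace X - V))"

definition constant_on_edges :: "'a topology \<Rightarrow> 'a set \<Rightarrow> ('a \<Rightarrow> 'k) \<Rightarrow> bool" where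
  "constant_on_edges X V g \<longleftrightarrow>
     (\<forall>E\<in>connected_components_of (subtopology X (topspace X - V)). \<forall>p\<in>E. \<forall>q\<in>E. g p = g q)"

type_synonym 'i cpair = "('i \<times> complex) \<times> ('i \<times> complex)"

definition pair_top :: "('i, 'z) cerf_scheme \<Rightarrow> 'i cpair topology" where
  "pair_top C = subtopology (prod_topology (curve_top C) (curve_top C))
     {(c1, c2). F2 C c1 = F2 C c2}"

definition pair_param :: "('i, 'z) cerf_scheme \<Rightarrow> 'i cpair \<Rightarrow> real" where
  "pair_param C p = F2 C (fst p)"

definition birth_pairs :: "('i, 'z) cerf_scheme \<Rightarrow> 'i cpair set" where
  "birth_pairs C = {p \<in> topspace (pair_top C). fst p \<in> births C \<or> snd p \<in> births C}"

definition death_pairs :: "('i, 'z) cerf_scheme \<Rightarrow> 'i cpair set" where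
  "death_pairs C = {p \<in> topspace (pair_top C). fst p \<in> deaths C \<or> snd p \<in> deaths C}"

text \<open>
  \<open>verts\<close> is the set of vertices of the supergraph structure; the functions \<open>\<gamma>\<close> and \<open>\<delta>\<close> are
  relevant only on the pairs over a common parameter and on the handle-slides, respectively.
\<close>

record ('i, 'k) morse = "'i cerf" +
  verts :: "'i cpair set"
  \<gamma> :: "'i cpair \<Rightarrow> 'k"
  \<delta> :: "'i cpair \<Rightarrow> 'k"

definition handle_slides :: "('i, 'k) morse \<Rightarrow> 'i cpair set" where
  "handle_slides M = verts M - (death_pairs M \<union> birth_pairs M)"

definition \<Lambda> :: "('i, 'k) morse \<Rightarrow> real set" where
  "\<Lambda> M = pair_param M ` death_pairs M \<union> pair_param M ` birth_pairs M \<union>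
     pair_param M ` handle_slides M"

text \<open>
  One-sided limits along two paths in the curve; the coefficients carry the discrete topology,
  so that the limit is the value eventually taken.
\<close>

definition \<gamma>plus :: "('i, 'k) morse \<Rightarrow> real \<Rightarrow>
    (real \<Rightarrow> 'i \<times> complex) \<Rightarrow> (real \<Rightarrow> 'i \<times> complex) \<Rightarrow> 'k" where
  "\<gamma>plus M r \<sigma> \<tau> = (THE v. eventually (\<lambda>t. \<gamma> M (\<sigma> t, \<tau> t) = v) (at_right r))"

definition \<gamma>minus :: "('i, 'k) morse \<Rightarrow> real \<Rightarrow>
    (real \<Rightarrow> 'i \<times> complex) \<Rightarrow> (real \<Rightarrow> 'i \<times> complex) \<Rightarrow> 'k" where
  "\<gamma>minus M r \<sigma> \<tau> = (THE v. eventually (\<lambda>t. \<gamma> M (\<sigma> t, \<tau> t) = v) (at_left r))"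

definition axiom_\<gamma>1 :: "('i, 'k::idom) morse \<Rightarrow> bool" where
  "axiom_\<gamma>1 M \<longleftrightarrow>
     (\<forall>r\<in>{0..1} - \<Lambda> M. \<forall>c1\<in>fib M r. \<forall>c2\<in>fib M r. F3 M c2 \<ge> F3 M c1 \<longrightarrow> \<gamma> M (c1, c2) = 0) \<and>
     (\<forall>(c1, c2)\<in>handle_slides M. F3 M c2 \<ge> F3 M c1 \<longrightarrow> \<delta> M (c1, c2) = 0)"

text \<open>
  The fibres of \<open>F2\<close> may be infinite. In the sums below only finitely many terms are nonzero, by
  the first axiom and properness of \<open>F3\<close>, and \<^const>\<open>Sum_any\<close> adds these up.
\<close>

definition axiom_\<gamma>2 :: "('i, 'k::idom) morse \<Rightarrow> bool" where
  "axiom_\<gamma>2 M \<longleftrightarrow>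
     (\<forall>r\<in>{0..1} - \<Lambda> M. \<forall>c1\<in>fib M r. \<forall>c3\<in>fib M r.
        Sum_any (\<lambda>c2. \<gamma> M (c1, c2) * \<gamma> M (c2, c3) when c2 \<in> fib M r) = 0)"

text \<open>
  Equations comparing the two sides of a parameter \<open>r\<close> are imposed when both sides lie in
  \<open>[0,1]\<close>, that is for \<open>0 < r < 1\<close>.
\<close>

definition axiom_\<gamma>3 :: "('i, 'k::idom) morse \<Rightarrow> bool" where
  "axiom_\<gamma>3 M \<longleftrightarrow>
     (\<forall>r\<in>pair_param M ` handle_slides M. 0 < r \<and> r < 1 \<longrightarrow>
       (\<forall>c1\<in>fib M r. \<forall>c3\<in>fib M r.
          \<gamma>plus M r (branch M c1) (branch M c3) =
            \<gamma>minus M r (branch M c1) (branch M c3)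
            + Sum_any (\<lambda>c2. \<delta> M (c1, c2) * \<gamma>minus M r (branch M c2) (branch M c3)
                            when (c1, c2) \<in> handle_slides M)
            - Sum_any (\<lambda>c2. \<delta> M (c2, c3) * \<gamma>plus M r (branch M c1) (branch M c2)
                            when (c2, c3) \<in> handle_slides M)))"

text \<open>In the next two definitions \<open>u\<close> is the inverse of the invertible coefficient.\<close>

definition axiom_\<gamma>4 :: "('i, 'k::idom) morse \<Rightarrow> bool" where
  "axiom_\<gamma>4 M \<longleftrightarrow>
     (\<forall>cB\<in>births M. \<exists>p m u. let r = F2 M cB; S = branch M ` (fib M r - {cB}) in
        birth_branches M cB p m \<and>
        \<gamma>plus M r p m * u = 1 \<and>
        (0 < r \<longrightarrow> (\<forall>s1\<in>S. \<forall>s2\<in>S.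
           \<gamma>plus M r s1 s2 = \<gamma>minus M r s1 s2 + \<gamma>plus M r s1 m * u * \<gamma>plus M r p s2)) \<and>
        (\<forall>s\<in>S \<union> {p, m}. \<gamma>plus M r s p = 0 \<and> \<gamma>plus M r m s = 0) \<and>
        (\<forall>s\<in>S \<union> {p}. \<gamma>plus M r p s = 0))"

definition axiom_\<gamma>5 :: "('i, 'k::idom) morse \<Rightarrow> bool" where
  "axiom_\<gamma>5 M \<longleftrightarrow>
     (\<forall>cD\<in>deaths M. \<exists>p m u. let r = F2 M cD; S = branch M ` (fib M r - {cD}) in
        death_branches M cD p m \<and>
        \<gamma>minus M r p m * u = 1 \<and>
        (r < 1 \<longrightarrow> (\<forall>s1\<in>S. \<forall>s2\<in>S.
           \<gamma>plus M r s1 s2 = \<gamma>minus M r s1 s2 - \<gamma>minus M r s1 m * u * \<gamma>minus M r p s2)) \<and>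
        (\<forall>s\<in>S \<union> {p, m}. \<gamma>minus M r s p = 0 \<and> \<gamma>minus M r m s = 0) \<and>
        (\<forall>s\<in>S \<union> {p}. \<gamma>minus M r p s = 0))"

definition morse_tuple :: "('i, 'k::idom) morse \<Rightarrow> bool" where
  "morse_tuple M \<longleftrightarrow>
     cerf_tuple M \<and>
     death_pairs M \<union> birth_pairs M \<subseteq> verts M \<and>
     graph_structure (pair_top M) (verts M) \<and>
     constant_on_edges (pair_top M) (verts M) (\<gamma> M) \<and>
     pair_param M ` death_pairs M \<inter> pair_param M ` birth_pairs M = {} \<and>
     pair_param M ` death_pairs M \<inter> pair_param M ` handle_slides M = {} \<and>
     pair_param M ` birth_pairs M \<inter> pair_param M ` handle_slides M = {} \<and>
     inj_on (F2 M) (births M) \<and> inj_on (F2 M) (deaths M) \<and>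
     axiom_\<gamma>1 M \<and> axiom_\<gamma>2 M \<and> axiom_\<gamma>3 M \<and> axiom_\<gamma>4 M \<and> axiom_\<gamma>5 M"


section \<open>Modules, homology and limits\<close>

definition ring_of_type :: "'k::comm_ring_1 ring" where
  "ring_of_type = \<lparr>carrier = UNIV, mult = (*), one = 1, zero = 0, add = (+)\<rparr>"

text \<open>
  Modules over the ring of all elements of a type. The record fields \<open>mult\<close> and \<open>one\<close> have no
  meaning for a module and are left unspecified.
\<close>

definition mk_module ::
    "'m set \<Rightarrow> 'm \<Rightarrow> ('m \<Rightarrow> 'm \<Rightarrow> 'm) \<Rightarrow> ('k \<Rightarrow> 'm \<Rightarrow> 'm) \<Rightarrow> ('k, 'm) module" where
  "mk_module A z pl sm =
     \<lparr>carrier = A, mult = undefined, one = undefined, zero = z, add = pl, smult = sm\<rparr>"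

definition modules_isomorphic :: "('k, 'm) module \<Rightarrow> ('k, 'n) module \<Rightarrow> bool" where
  "modules_isomorphic A B \<longleftrightarrow>
     (\<exists>f\<in>iso (add_monoid A) (add_monoid B).
        \<forall>k. \<forall>x\<in>carrier A. f (k \<odot>\<^bsub>A\<^esub> x) = k \<odot>\<^bsub>B\<^esub> f x)"

definition free_module :: "'p set \<Rightarrow> ('k::comm_ring_1, 'p \<Rightarrow>\<^sub>0 'k) module" where
  "free_module S = mk_module {x. Poly_Mapping.keys x \<subseteq> S} 0 (+) (\<lambda>k. Poly_Mapping.map ((*) k))"

definition homology_module :: "('k, 'm) module \<Rightarrow> ('m \<Rightarrow> 'm) \<Rightarrow> ('k, 'm set) module" where
  "homology_module A d = (let Z = {x \<in> carrier A. d x = \<zero>\<^bsub>A\<^esub>}; B = d ` carrier A in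
     mk_module ((\<lambda>x. B +>\<^bsub>A\<^esub> x) ` Z) B (set_add A) (\<lambda>k X. \<Union>x\<in>X. B +>\<^bsub>A\<^esub> (k \<odot>\<^bsub>A\<^esub> x)))"

definition homology_map ::
    "('k, 'n) module \<Rightarrow> ('n \<Rightarrow> 'n) \<Rightarrow> ('m \<Rightarrow> 'n) \<Rightarrow> 'm set \<Rightarrow> 'n set" where
  "homology_map A d f X = (\<Union>x\<in>X. (d ` carrier A) +>\<^bsub>A\<^esub> f x)"

text \<open>The transition map from index \<open>i\<close> to index \<open>j\<close>, where \<open>i \<le> j\<close>, is \<open>f i j\<close>.\<close>

definition inverse_limit ::
    "('j::linorder \<Rightarrow> ('k, 'm) module) \<Rightarrow> ('j \<Rightarrow> 'j \<Rightarrow> 'm \<Rightarrow> 'm) \<Rightarrow> ('k, 'j \<Rightarrow> 'm) module" where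
  "inverse_limit A f = mk_module
     {h. (\<forall>i. h i \<in> carrier (A i)) \<and> (\<forall>i j. i \<le> j \<longrightarrow> f i j (h i) = h j)}
     (\<lambda>i. \<zero>\<^bsub>A i\<^esub>) (\<lambda>g h i. g i \<oplus>\<^bsub>A i\<^esub> h i) (\<lambda>k h i. k \<odot>\<^bsub>A i\<^esub> h i)"

definition direct_limit_rel ::
    "('j::linorder \<Rightarrow> ('k, 'm) module) \<Rightarrow> ('j \<Rightarrow> 'j \<Rightarrow> 'm \<Rightarrow> 'm) \<Rightarrow> (('j \<times> 'm) \<times> ('j \<times> 'm)) set" where
  "direct_limit_rel A f = {((i, x), (j, y)). x \<in> carrier (A i) \<and> y \<in> carrier (A j) \<and>
     (\<exists>l. i \<le> l \<and> j \<le> l \<and> f i l x = f j l y)}"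

definition direct_limit ::
    "('j::linorder \<Rightarrow> ('k, 'm) module) \<Rightarrow> ('j \<Rightarrow> 'j \<Rightarrow> 'm \<Rightarrow> 'm) \<Rightarrow> ('k, ('j \<times> 'm) set) module" where
  "direct_limit A f = (let R = direct_limit_rel A f in mk_module
     ((SIGMA i:UNIV. carrier (A i)) // R)
     (\<Union>i. R `` {(i, \<zero>\<^bsub>A i\<^esub>)})
     (\<lambda>X Y. \<Union>(i, x)\<in>X. \<Union>(j, y)\<in>Y.
        R `` {(max i j, f i (max i j) x \<oplus>\<^bsub>A (max i j)\<^esub> f j (max i j) y)})
     (\<lambda>k X. \<Union>(i, x)\<in>X. R `` {(i, k \<odot>\<^bsub>A i\<^esub> x)}))"


section \<open>Morse homology\<close>

definition gens :: "('i, 'z) cerf_scheme \<Rightarrow> real \<Rightarrow> real \<Rightarrow> real \<Rightarrow> ('i \<times> complex) set" where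
  "gens C a b r = {c \<in> fib C r. a < F3 C c \<and> F3 C c < b}"

definition CM :: "('i, 'k::idom) morse \<Rightarrow> real \<Rightarrow> real \<Rightarrow> real \<Rightarrow>
    ('k, ('i \<times> complex) \<Rightarrow>\<^sub>0 'k) module" where
  "CM M a b r = free_module (gens M a b r)"

definition bdry :: "('i, 'k::idom) morse \<Rightarrow> real \<Rightarrow> real \<Rightarrow> real \<Rightarrow>
    (('i \<times> complex) \<Rightarrow>\<^sub>0 'k) \<Rightarrow> (('i \<times> complex) \<Rightarrow>\<^sub>0 'k)" where
  "bdry M a b r x =
     (\<Sum>c1\<in>Poly_Mapping.keys x. \<Sum>c2\<in>gens M a b r. Poly_Mapping.single c2 (Poly_Mapping.lookup x c1 * \<gamma> M (c1, c2)))"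

definition HMw :: "('i, 'k::idom) morse \<Rightarrow> real \<Rightarrow> real \<Rightarrow> real \<Rightarrow>
    ('k, (('i \<times> complex) \<Rightarrow>\<^sub>0 'k) set) module" where
  "HMw M a b r = homology_module (CM M a b r) (bdry M a b r)"

text \<open>
  For \<open>a \<le> a'\<close> and \<open>b \<le> b'\<close> the canonical chain map from the window \<open>(a,b)\<close> to the window \<open>(a',b')\<close>
  discards the generators outside the target window: it is the projection to the quotient complex
  if \<open>b = b'\<close>, and the inclusion of a subcomplex if \<open>a = a'\<close>.
\<close>

definition window_map :: "('i, 'k::idom) morse \<Rightarrow> real \<Rightarrow> real \<Rightarrow> real \<Rightarrow>
    (('i \<times> complex) \<Rightarrow>\<^sub>0 'k) \<Rightarrow> (('i \<times> complex) \<Rightarrow>\<^sub>0 'k)" where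
  "window_map M a' b' r x =
     (\<Sum>c\<in>Poly_Mapping.keys x \<inter> gens M a' b' r. Poly_Mapping.single c (Poly_Mapping.lookup x c))"

definition HMw_map :: "('i, 'k::idom) morse \<Rightarrow> real \<Rightarrow> real \<Rightarrow> real \<Rightarrow>
    (('i \<times> complex) \<Rightarrow>\<^sub>0 'k) set \<Rightarrow> (('i \<times> complex) \<Rightarrow>\<^sub>0 'k) set" where
  "HMw_map M a' b' r = homology_map (CM M a' b' r) (bdry M a' b' r) (window_map M a' b' r)"

text \<open>
  The inverse limit runs over all real \<open>a\<close>: for \<open>a \<ge> b\<close> the window \<open>(a,b)\<close> is empty and its homology
  is zero, so these indices do not affect the limit.
\<close>

definition HM_below :: "('i, 'k::idom) morse \<Rightarrow> real \<Rightarrow> real \<Rightarrow>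
    ('k, real \<Rightarrow> (('i \<times> complex) \<Rightarrow>\<^sub>0 'k) set) module" where
  "HM_below M r b = inverse_limit (\<lambda>a. HMw M a b r) (\<lambda>a a'. HMw_map M a' b r)"

definition HM :: "('i, 'k::idom) morse \<Rightarrow> real \<Rightarrow>
    ('k, (real \<times> (real \<Rightarrow> (('i \<times> complex) \<Rightarrow>\<^sub>0 'k) set)) set) module" where
  "HM M r = direct_limit (HM_below M r) (\<lambda>b b' h a. HMw_map M a b' r (h a))"

end

theory Submission
  imports Defs
begin

text \<open>
  Near a parameter \<open>\<tau>\<close>, and as long as the curve avoids the two ends of the window, the window complex
  changes only in two ways: a handle-slide changes it by a unitriangular change of basis, and a birth
  or a death adds or removes two generators which cancel each other because the coefficient between
  them is invertible. Both changes are hidden by a model complex at \<open>\<tau>\<close>, spanned by the points over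
  \<open>\<tau>\<close> that are neither births nor deaths: every nearby regular complex maps onto it by a surjective
  chain map with acyclic kernel (\<open>local_fibration\<close>). Two classes at parameters close to \<open>\<tau>\<close> are called
  linked if they have the same image in the homology of the model. Linking is the graph of an
  isomorphism (\<open>link_near\<close>), it is compatible with raising the ends of the window (\<open>link_push\<close>), and
  links centred at neighbouring parameters agree (\<open>link_compatible\<close>).

  These comparisons alone do not give a comparison over all of \<open>[0,1]\<close>, since the curve may cross every
  fixed level, so that no fixed window survives. This is where the bound on the slopes enters. The
  divergence of the two integrals provides a coordinate \<open>T\<close> of the third axis, with derivative \<open>1/\<Phi>\<close>
  outside \<open>[a,b]\<close>, whose values fill the real line (\<open>time_coordinate\<close>). Measured in \<open>T\<close>, the branches
  outside \<open>[a,b]\<close> move at speed at most one (\<open>stretched_lipschitz\<close>). A line of slope two cannot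
  stay on a branch, hence it can be replaced by a staircase, a function which locally takes finitely
  many values and which the curve never meets (\<open>rising_stair\<close>). Over an interval of length at most one
  such a staircase climbs by at most three, so there are staircases above every level and
  below every level, both rising and falling (\<open>stair_above\<close>, \<open>stair_below\<close>).

  Let both ends of the window follow staircases. A step upwards is realised by the canonical map
  between the homologies of the two windows. So in the direction in which the staircases rise a
  class can be transported (\<open>flat_exists\<close>), in only one way (\<open>flat_unique\<close>). Both facts are local, and they are
  glued together by compactness of the interval (\<open>chain_on_dense\<close>). An element of the inverse limit over
  the lower ends is transported along one upper staircase and, for each lower end, along a lower
  staircase below it; the results fit together by uniqueness (\<open>flat_section_exists\<close>). The outcome
  lies in a window with higher upper end, which is harmless in the direct limit. Two transported elements which
  agree at the source agree everywhere after raising the upper end (\<open>flat_section_unique\<close>). The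
  relation "being the two ends of one transported family" between the direct limits at two regular
  parameters is therefore additive, homogeneous and compatible with the identifications in the
  direct limits. Transport from left to right shows that it is total, transport from right to left
  that it is onto, so that it is an isomorphism (\<open>limits_isomorphic\<close>).
\<close>

section \<open>Gluing along an interval\<close>

text \<open>
  A compactness argument for a transitive relation that holds near every point of an interval, but
  only between points of a dense subset. The set \<open>D\<close> need not contain the points at which an
  interval is bisected; the induction therefore speaks about all pairs in a slightly larger
  interval, and density supplies a point of \<open>D\<close> in the overlap.
\<close>

lemma chain_on_dense:
  fixes D :: "real set"
  assumes dense: "\<And>x y. x \<in> {lo..hi} \<Longrightarrow> y \<in> {lo..hi} \<Longrightarrow> x < y \<Longrightarrow> \<exists>z\<in>D. x < z \<and> z < y"
    and lo: "lo \<in> D" and hi: "hi \<in> D" and lohi: "lo \<le> hi"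
    and trans: "\<And>x y z. x \<in> D \<inter> {lo..hi} \<Longrightarrow> y \<in> D \<inter> {lo..hi} \<Longrightarrow> z \<in> D \<inter> {lo..hi} \<Longrightarrow>
        x \<le> y \<Longrightarrow> y \<le> z \<Longrightarrow> Q x y \<Longrightarrow> Q y z \<Longrightarrow> Q x z"
    and local: "\<And>\<tau>. \<tau> \<in> {lo..hi} \<Longrightarrow> \<exists>d>0. \<forall>x\<in>D \<inter> {lo..hi}. \<forall>y\<in>D \<inter> {lo..hi}.
        \<bar>x - \<tau>\<bar> < d \<longrightarrow> \<bar>y - \<tau>\<bar> < d \<longrightarrow> x \<le> y \<longrightarrow> Q x y"
  shows "Q lo hi"
proof -
  (* The margin e makes the intervals of neighbouring steps overlap. *)
  define P where "P x y \<longleftrightarrow> (lo \<le> x \<and> y \<le> hi \<longrightarrow> (\<exists>e>0. \<forall>s\<in>D \<inter> {lo..hi}. \<forall>t\<in>D \<inter> {lo..hi}.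
    x - e < s \<and> s \<le> t \<and> t < y + e \<longrightarrow> Q s t))" for x y :: real
  from lohi have "P lo hi"
  proof (induct rule: Bolzano)
    case (trans a b c)
    show ?case unfolding P_def
    proof (intro impI)
      assume ac: "lo \<le> a \<and> c \<le> hi"
      obtain e1 where e1: "e1 > 0" "\<And>s t. \<lbrakk>s\<in>D \<inter> {lo..hi}; t\<in>D \<inter> {lo..hi}; a - e1 < s; s \<le> t; t < b + e1\<rbrakk> \<Longrightarrow> Q s t"
        using trans(1,3,4) ac unfolding P_def by force
      obtain e2 where e2: "e2 > 0" "\<And>s t. \<lbrakk>s\<in>D \<inter> {lo..hi}; t\<in>D \<inter> {lo..hi}; b - e2 < s; s \<le> t; t < c + e2\<rbrakk> \<Longrightarrow> Q s t"
        using trans(2,3,4) ac unfolding P_def by force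
      define e where "e = min e1 e2"
      have "Q s t" if st: "s\<in>D \<inter> {lo..hi}" "t\<in>D \<inter> {lo..hi}" "a - e < s" "s \<le> t" "t < c + e" for s t
      proof (cases "t < b + e \<or> s > b - e")
        case True
        then show ?thesis using e1 e2 st unfolding e_def by auto
      next
        case False
        have "e > 0" using e1 e2 by (simp add: e_def)
        (* s and t lie on different sides of b and not near b: pass through a point of D near b. *)
        then obtain z where z: "z \<in> D" "b - e < z" "z < b + e"
          using dense[of "b - e" "b + e"] False st by force
        then have zz: "z \<in> D \<inter> {lo..hi}" "s \<le> z" "z \<le> t" using False st by auto
        have "Q s z" by (rule e1(2)) (use st zz z in \<open>auto simp: e_def\<close>)
        moreover have "Q z t" by (rule e2(2)) (use st zz z in \<open>auto simp: e_def\<close>)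
        ultimately show ?thesis using assms(5)[of s z t] st zz by blast
      qed
      moreover have "e > 0" using e1 e2 by (simp add: e_def)
      ultimately show "\<exists>e>0. \<forall>s\<in>D \<inter> {lo..hi}. \<forall>t\<in>D \<inter> {lo..hi}. a - e < s \<and> s \<le> t \<and> t < c + e \<longrightarrow> Q s t"
        by blast
    qed
  next
    case (local x)
    then obtain d where d: "d > 0" "\<forall>s\<in>D \<inter> {lo..hi}. \<forall>t\<in>D \<inter> {lo..hi}.
        \<bar>s - x\<bar> < d \<longrightarrow> \<bar>t - x\<bar> < d \<longrightarrow> s \<le> t \<longrightarrow> Q s t" using assms(6)[of x] by auto
    have "P a b" if ab: "a \<le> x" "x \<le> b" "b - a < d/2" for a b
      unfolding P_def
    proof (intro impI exI[of _ "d/2"] conjI ballI)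
      fix s t assume st: "s\<in>D \<inter> {lo..hi}" "t\<in>D \<inter> {lo..hi}" "a - d/2 < s \<and> s \<le> t \<and> t < b + d/2"
      have "\<bar>s - x\<bar> < d" "\<bar>t - x\<bar> < d" using ab st(3) d(1) by (simp_all add: abs_less_iff field_simps)
      then show "Q s t" using d st by blast
    qed (use d in auto)
    then show ?case using d(1) by (intro exI[of _ "d/2"]) auto
  qed
  then show ?thesis using lo hi lohi unfolding P_def by auto
qed

lemma finite_common_radius:
  fixes P :: "'a \<Rightarrow> real \<Rightarrow> bool"
  assumes "finite S" "\<And>x. x \<in> S \<Longrightarrow> \<exists>e>0. P x e"
    and mono: "\<And>x e e'. x \<in> S \<Longrightarrow> P x e \<Longrightarrow> 0 < e' \<Longrightarrow> e' \<le> e \<Longrightarrow> P x e'"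
  shows "\<exists>e>0. \<forall>x\<in>S. P x e"
proof -
  obtain r where r: "\<And>x. x \<in> S \<Longrightarrow> r x > 0 \<and> P x (r x)" using assms(2) by metis
  define e where "e = Min (insert 1 (r ` S))"
  have "e > 0" using r assms(1) by (auto simp: e_def)
  moreover have "P x e" if "x \<in> S" for x
    by (rule mono[OF that, of "r x"]) (use r that assms(1) \<open>e > 0\<close> in \<open>auto simp: e_def\<close>)
  ultimately show ?thesis by blast
qed

text \<open>
  A staircase: near each parameter it takes finitely many values, and at that parameter none of
  these levels lies in \<open>Z\<close>. Below, \<open>Z\<close> is the trace of the curve, so that no generator crosses the
  end of a window which follows a staircase. A value taken only near \<open>\<tau>\<close> also has to avoid \<open>Z\<close> at
  \<open>\<tau>\<close>; this is what allows one to use a comparison centred at \<open>\<tau>\<close>.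
\<close>

definition step_on :: "(real \<times> real) set \<Rightarrow> real \<Rightarrow> real \<Rightarrow> (real \<Rightarrow> real) \<Rightarrow> bool" where
  "step_on Z lo hi \<alpha> \<longleftrightarrow> (\<forall>\<tau>\<in>{lo..hi}. \<exists>d>0. \<exists>A. finite A \<and> (\<forall>l\<in>A. (\<tau>, l) \<notin> Z) \<and>
     (\<forall>s\<in>{lo..hi}. \<bar>s - \<tau>\<bar> < d \<longrightarrow> \<alpha> s \<in> A))"

lemma step_on_max:
  assumes "step_on Z lo hi \<alpha>" "step_on Z lo hi \<beta>"
  shows "step_on Z lo hi (\<lambda>s. max (\<alpha> s) (\<beta> s))"
  unfolding step_on_def
proof
  fix \<tau> assume t: "\<tau> \<in> {lo..hi}"
  obtain d A where A: "d > 0" "finite A" "\<forall>l\<in>A. (\<tau>, l) \<notin> Z" "\<forall>s\<in>{lo..hi}. \<bar>s - \<tau>\<bar> < d \<longrightarrow> \<alpha> s \<in> A"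
    using assms(1) t unfolding step_on_def by blast
  obtain e B where B: "e > 0" "finite B" "\<forall>l\<in>B. (\<tau>, l) \<notin> Z" "\<forall>s\<in>{lo..hi}. \<bar>s - \<tau>\<bar> < e \<longrightarrow> \<beta> s \<in> B"
    using assms(2) t unfolding step_on_def by blast
  show "\<exists>d>0. \<exists>A. finite A \<and> (\<forall>l\<in>A. (\<tau>, l) \<notin> Z) \<and>
     (\<forall>s\<in>{lo..hi}. \<bar>s - \<tau>\<bar> < d \<longrightarrow> max (\<alpha> s) (\<beta> s) \<in> A)"
    by (rule exI[of _ "min d e"], rule conjI, use A B in simp, rule exI[of _ "A \<union> B"])
       (use A B in \<open>auto simp: max_def\<close>)
qed

section \<open>Direct limits\<close>

definition directed_system :: "('j::linorder \<Rightarrow> ('k, 'm) module) \<Rightarrow> ('j \<Rightarrow> 'j \<Rightarrow> 'm \<Rightarrow> 'm) \<Rightarrow> bool" where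
  "directed_system A g \<longleftrightarrow>
     (\<forall>i j x. i \<le> j \<longrightarrow> x \<in> carrier (A i) \<longrightarrow> g i j x \<in> carrier (A j)) \<and>
     (\<forall>i x. x \<in> carrier (A i) \<longrightarrow> g i i x = x) \<and>
     (\<forall>i j l x. i \<le> j \<longrightarrow> j \<le> l \<longrightarrow> x \<in> carrier (A i) \<longrightarrow> g j l (g i j x) = g i l x) \<and>
     (\<forall>i x y. x \<in> carrier (A i) \<longrightarrow> y \<in> carrier (A i) \<longrightarrow> x \<oplus>\<^bsub>A i\<^esub> y \<in> carrier (A i)) \<and>
     (\<forall>i k x. x \<in> carrier (A i) \<longrightarrow> k \<odot>\<^bsub>A i\<^esub> x \<in> carrier (A i)) \<and>
     (\<forall>i j x y. i \<le> j \<longrightarrow> x \<in> carrier (A i) \<longrightarrow> y \<in> carrier (A i) \<longrightarrow>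
        g i j (x \<oplus>\<^bsub>A i\<^esub> y) = g i j x \<oplus>\<^bsub>A j\<^esub> g i j y) \<and>
     (\<forall>i j k x. i \<le> j \<longrightarrow> x \<in> carrier (A i) \<longrightarrow> g i j (k \<odot>\<^bsub>A i\<^esub> x) = k \<odot>\<^bsub>A j\<^esub> g i j x)"

lemma mk_module_simps [simp]:
  "carrier (mk_module A z pl sm) = A" "zero (mk_module A z pl sm) = z"
  "add (mk_module A z pl sm) = pl" "smult (mk_module A z pl sm) = sm"
  by (simp_all add: mk_module_def)

context
  fixes A :: "'j::linorder \<Rightarrow> ('k, 'm) module" and g :: "'j \<Rightarrow> 'j \<Rightarrow> 'm \<Rightarrow> 'm"
  assumes sys: "directed_system A g"
begin

lemma
  shows sys_in: "i \<le> j \<Longrightarrow> x \<in> carrier (A i) \<Longrightarrow> g i j x \<in> carrier (A j)"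
    and sys_id: "x \<in> carrier (A i) \<Longrightarrow> g i i x = x"
    and sys_comp: "i \<le> j \<Longrightarrow> j \<le> l \<Longrightarrow> x \<in> carrier (A i) \<Longrightarrow> g j l (g i j x) = g i l x"
    and sys_add_in: "x \<in> carrier (A i) \<Longrightarrow> y \<in> carrier (A i) \<Longrightarrow> x \<oplus>\<^bsub>A i\<^esub> y \<in> carrier (A i)"
    and sys_smult_in: "x \<in> carrier (A i) \<Longrightarrow> k \<odot>\<^bsub>A i\<^esub> x \<in> carrier (A i)"
    and sys_add: "i \<le> j \<Longrightarrow> x \<in> carrier (A i) \<Longrightarrow> y \<in> carrier (A i) \<Longrightarrow>
        g i j (x \<oplus>\<^bsub>A i\<^esub> y) = g i j x \<oplus>\<^bsub>A j\<^esub> g i j y"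
    and sys_smult: "i \<le> j \<Longrightarrow> x \<in> carrier (A i) \<Longrightarrow> g i j (k \<odot>\<^bsub>A i\<^esub> x) = k \<odot>\<^bsub>A j\<^esub> g i j x"
  using sys by (simp_all add: directed_system_def)

lemma direct_limit_equiv: "equiv (SIGMA i:UNIV. carrier (A i)) (direct_limit_rel A g)"
proof (rule equivI)
  show "direct_limit_rel A g \<subseteq> (SIGMA i:UNIV. carrier (A i)) \<times> (SIGMA i:UNIV. carrier (A i))"
    by (auto simp: direct_limit_rel_def)
  show "refl_on (SIGMA i:UNIV. carrier (A i)) (direct_limit_rel A g)"
    by (rule refl_onI) (auto simp: direct_limit_rel_def)
  show "sym (direct_limit_rel A g)"
    by (rule symI) (force simp: direct_limit_rel_def)
  show "trans (direct_limit_rel A g)"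
  proof (rule transI)
    fix p q r assume "(p, q) \<in> direct_limit_rel A g" "(q, r) \<in> direct_limit_rel A g"
    then obtain i x j y k z l l' where pqr: "p = (i, x)" "q = (j, y)" "r = (k, z)"
      "x \<in> carrier (A i)" "y \<in> carrier (A j)" "z \<in> carrier (A k)"
      "i \<le> l" "j \<le> l" "g i l x = g j l y" "j \<le> l'" "k \<le> l'" "g j l' y = g k l' z"
      by (auto simp: direct_limit_rel_def)
    have "g i (max l l') x = g k (max l l') z"
      using pqr sys_comp[of i l "max l l'" x] sys_comp[of j l "max l l'" y]
        sys_comp[of j l' "max l l'" y] sys_comp[of k l' "max l l'" z] by simp
    then show "(p, r) \<in> direct_limit_rel A g"
      using pqr by (auto simp: direct_limit_rel_def le_max_iff_disj intro!: exI[of _ "max l l'"])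
  qed
qed

lemma direct_limit_relI:
  "x \<in> carrier (A i) \<Longrightarrow> y \<in> carrier (A j) \<Longrightarrow> i \<le> l \<Longrightarrow> j \<le> l \<Longrightarrow> g i l x = g j l y \<Longrightarrow>
    ((i, x), (j, y)) \<in> direct_limit_rel A g"
  by (auto simp: direct_limit_rel_def)

lemma direct_limit_class_eq:
  assumes "x \<in> carrier (A i)" "y \<in> carrier (A j)"
  shows "direct_limit_rel A g `` {(i, x)} = direct_limit_rel A g `` {(j, y)} \<longleftrightarrow>
    ((i, x), (j, y)) \<in> direct_limit_rel A g"
  using eq_equiv_class_iff[OF direct_limit_equiv, of "(i,x)" "(j,y)"] assms by simp

lemma direct_limit_rel_upto:
  assumes "((i, x), (j, y)) \<in> direct_limit_rel A g"
  obtains l where "l \<ge> m" "i \<le> l" "j \<le> l" "g i l x = g j l y"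
proof -
  obtain l where l: "i \<le> l" "j \<le> l" "g i l x = g j l y" "x \<in> carrier (A i)" "y \<in> carrier (A j)"
    using assms by (auto simp: direct_limit_rel_def)
  have "g i (max l m) x = g j (max l m) y"
    using sys_comp[of i l "max l m" x] sys_comp[of j l "max l m" y] l by simp
  then show ?thesis using that[of "max l m"] l by (simp add: le_max_iff_disj)
qed

lemma direct_limit_add:
  assumes x: "x \<in> carrier (A i)" and y: "y \<in> carrier (A j)"
  shows "direct_limit_rel A g `` {(i, x)} \<oplus>\<^bsub>direct_limit A g\<^esub> direct_limit_rel A g `` {(j, y)} =
    direct_limit_rel A g `` {(max i j, g i (max i j) x \<oplus>\<^bsub>A (max i j)\<^esub> g j (max i j) y)}"
    (is "?X \<oplus>\<^bsub>_\<^esub> ?Y = ?S (i, x) (j, y)")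
proof -
  let ?S = "\<lambda>(i, x) (j, y). direct_limit_rel A g ``
    {(max i j, g i (max i j) x \<oplus>\<^bsub>A (max i j)\<^esub> g j (max i j) y)}"
  have "?S p q = ?S (i, x) (j, y)" if "p \<in> ?X" "q \<in> ?Y" for p q
  proof -
    obtain i' x' j' y' where pq: "p = (i', x')" "q = (j', y')" by (metis surj_pair)
    have r1: "((i, x), (i', x')) \<in> direct_limit_rel A g" and r2: "((j, y), (j', y')) \<in> direct_limit_rel A g"
      using that pq by auto
    then have c: "x' \<in> carrier (A i')" "y' \<in> carrier (A j')" by (auto simp: direct_limit_rel_def)
    obtain l where l: "i \<le> l" "i' \<le> l" "g i l x = g i' l x'" "l \<ge> max j j'"
      using direct_limit_rel_upto[OF r1, of "max j j'"] by metis
    obtain m where m: "m \<ge> l" "j \<le> m" "j' \<le> m" "g j m y = g j' m y'"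
      using direct_limit_rel_upto[OF r2, of l] by metis
    have e1: "g i m x = g i' m x'" using sys_comp[of i l m x] sys_comp[of i' l m x'] l m c x by simp
    have "g (max i j) m (g i (max i j) x \<oplus>\<^bsub>A (max i j)\<^esub> g j (max i j) y) =
       g (max i' j') m (g i' (max i' j') x' \<oplus>\<^bsub>A (max i' j')\<^esub> g j' (max i' j') y')"
      using x y c l m e1 by (simp add: sys_add sys_in sys_comp)
    then have "((max i j, g i (max i j) x \<oplus>\<^bsub>A (max i j)\<^esub> g j (max i j) y),
       (max i' j', g i' (max i' j') x' \<oplus>\<^bsub>A (max i' j')\<^esub> g j' (max i' j') y')) \<in> direct_limit_rel A g"
      by (intro direct_limit_relI[where l = m]) (use x y c l m in \<open>auto intro!: sys_add_in sys_in\<close>)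
    then show ?thesis
      unfolding pq prod.case by (intro sym[OF direct_limit_class_eq[THEN iffD2]])
        (use x y c in \<open>auto intro!: sys_add_in sys_in\<close>)
  qed
  moreover have "(i, x) \<in> ?X" "(j, y) \<in> ?Y"
    using x y by (auto simp: direct_limit_rel_def)
  ultimately have "(\<Union>p\<in>?X. \<Union>q\<in>?Y. ?S p q) = ?S (i, x) (j, y)" by blast
  then show ?thesis by (simp add: direct_limit_def Let_def case_prod_unfold)
qed

lemma direct_limit_smult:
  assumes x: "x \<in> carrier (A i)"
  shows "k \<odot>\<^bsub>direct_limit A g\<^esub> (direct_limit_rel A g `` {(i, x)}) =
    direct_limit_rel A g `` {(i, k \<odot>\<^bsub>A i\<^esub> x)}" (is "_ \<odot>\<^bsub>_\<^esub> ?X = _")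
proof -
  let ?S = "\<lambda>(i, x). direct_limit_rel A g `` {(i, k \<odot>\<^bsub>A i\<^esub> x)}"
  have "?S p = ?S (i, x)" if pX: "p \<in> ?X" for p
  proof -
    obtain j y where p: "p = (j, y)" by (metis surj_pair)
    then obtain l where l: "i \<le> l" "j \<le> l" "g i l x = g j l y" "y \<in> carrier (A j)"
      using pX by (auto simp: direct_limit_rel_def)
    then have "((i, k \<odot>\<^bsub>A i\<^esub> x), (j, k \<odot>\<^bsub>A j\<^esub> y)) \<in> direct_limit_rel A g"
      using x by (intro direct_limit_relI[where l = l]) (auto simp: sys_smult intro!: sys_smult_in)
    then show ?thesis
      unfolding p prod.case by (intro sym[OF direct_limit_class_eq[THEN iffD2]])
        (use x l in \<open>auto intro!: sys_smult_in\<close>)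
  qed
  moreover have "(i, x) \<in> ?X" using x by (auto simp: direct_limit_rel_def)
  ultimately have "(\<Union>p\<in>?X. ?S p) = ?S (i, x)" by blast
  then show ?thesis by (simp add: direct_limit_def Let_def case_prod_unfold)
qed

lemma direct_limit_carrier:
  "carrier (direct_limit A g) = {direct_limit_rel A g `` {(i, x)} | i x. x \<in> carrier (A i)}"
  by (auto simp: direct_limit_def Let_def quotient_def)

end

text \<open>
  Transport is not a function on representatives, because it involves choices of staircases. A
  relation that is total, onto and compatible with the structure is enough: \<open>uni\<close> makes it a
  well-defined and injective function on the classes.
\<close>

lemma direct_limits_isomorphic:
  fixes A :: "'j::linorder \<Rightarrow> ('k, 'm) module" and B :: "'j \<Rightarrow> ('k, 'n) module"
  assumes A: "directed_system A g" and B: "directed_system B h"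
    and tot: "\<And>i x. x \<in> carrier (A i) \<Longrightarrow> \<exists>j y. y \<in> carrier (B j) \<and> L i x j y"
    and onto: "\<And>j y. y \<in> carrier (B j) \<Longrightarrow> \<exists>i x. x \<in> carrier (A i) \<and> L i x j y"
    and uni: "\<And>i x j y i' x' j' y'. \<lbrakk>L i x j y; L i' x' j' y'; x \<in> carrier (A i); y \<in> carrier (B j);
        x' \<in> carrier (A i'); y' \<in> carrier (B j')\<rbrakk> \<Longrightarrow>
        ((i, x), (i', x')) \<in> direct_limit_rel A g \<longleftrightarrow> ((j, y), (j', y')) \<in> direct_limit_rel B h"
    and add: "\<And>i x j y i' x' j' y'. \<lbrakk>L i x j y; L i' x' j' y'; x \<in> carrier (A i); y \<in> carrier (B j);
        x' \<in> carrier (A i'); y' \<in> carrier (B j')\<rbrakk> \<Longrightarrow>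
        L (max i i') (g i (max i i') x \<oplus>\<^bsub>A (max i i')\<^esub> g i' (max i i') x')
          (max j j') (h j (max j j') y \<oplus>\<^bsub>B (max j j')\<^esub> h j' (max j j') y')"
    and smult: "\<And>k i x j y. \<lbrakk>L i x j y; x \<in> carrier (A i); y \<in> carrier (B j)\<rbrakk> \<Longrightarrow>
        L i (k \<odot>\<^bsub>A i\<^esub> x) j (k \<odot>\<^bsub>B j\<^esub> y)"
  shows "modules_isomorphic (direct_limit A g) (direct_limit B h)"
proof -
  let ?R = "direct_limit_rel A g" and ?S = "direct_limit_rel B h"
  define \<phi> where "\<phi> X = (SOME Y. \<exists>i x j y. x \<in> carrier (A i) \<and> y \<in> carrier (B j) \<and> L i x j y \<and>
     X = ?R `` {(i, x)} \<and> Y = ?S `` {(j, y)})" for X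
  have \<phi>: "\<phi> (?R `` {(i, x)}) = ?S `` {(j, y)}"
    if l: "L i x j y" "x \<in> carrier (A i)" "y \<in> carrier (B j)" for i x j y
    unfolding \<phi>_def
  proof (rule some_equality)
    show "\<exists>i' x' j' y'. x' \<in> carrier (A i') \<and> y' \<in> carrier (B j') \<and> L i' x' j' y' \<and>
      ?R `` {(i, x)} = ?R `` {(i', x')} \<and> ?S `` {(j, y)} = ?S `` {(j', y')}" using l by blast
  next
    fix Y assume "\<exists>i' x' j' y'. x' \<in> carrier (A i') \<and> y' \<in> carrier (B j') \<and> L i' x' j' y' \<and>
      ?R `` {(i, x)} = ?R `` {(i', x')} \<and> Y = ?S `` {(j', y')}"
    then obtain i' x' j' y' where "x' \<in> carrier (A i')" "y' \<in> carrier (B j')" "L i' x' j' y'"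
      "?R `` {(i, x)} = ?R `` {(i', x')}" "Y = ?S `` {(j', y')}" by blast
    then show "Y = ?S `` {(j, y)}"
      using uni[OF l(1) _ l(2,3)] direct_limit_class_eq[OF A] direct_limit_class_eq[OF B] l by metis
  qed
  have bij: "bij_betw \<phi> (carrier (direct_limit A g)) (carrier (direct_limit B h))"
    unfolding bij_betw_def
  proof
    show "inj_on \<phi> (carrier (direct_limit A g))"
    proof (rule inj_onI)
      fix X Y assume "X \<in> carrier (direct_limit A g)" "Y \<in> carrier (direct_limit A g)" and e: "\<phi> X = \<phi> Y"
      then obtain i x i' x' where X: "X = ?R `` {(i, x)}" "x \<in> carrier (A i)"
        and Y: "Y = ?R `` {(i', x')}" "x' \<in> carrier (A i')" by (auto simp: direct_limit_carrier[OF A])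
      obtain j y where j: "y \<in> carrier (B j)" "L i x j y" using tot X by blast
      obtain j' y' where j': "y' \<in> carrier (B j')" "L i' x' j' y'" using tot Y by blast
      have "((j, y), (j', y')) \<in> ?S"
        using e \<phi>[OF j(2) X(2) j(1)] \<phi>[OF j'(2) Y(2) j'(1)] X Y direct_limit_class_eq[OF B j(1) j'(1)] by simp
      then show "X = Y" using uni[OF j(2) j'(2) X(2) j(1) Y(2) j'(1)] direct_limit_class_eq[OF A X(2) Y(2)] X Y by simp
    qed
    have "\<phi> X \<in> carrier (direct_limit B h)" if X0: "X \<in> carrier (direct_limit A g)" for X
    proof -
      obtain i x where X: "X = ?R `` {(i, x)}" "x \<in> carrier (A i)"
        using X0 by (auto simp: direct_limit_carrier[OF A])
      obtain j y where j: "y \<in> carrier (B j)" "L i x j y" using tot X by blast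
      show ?thesis using \<phi>[OF j(2) X(2) j(1)] j X by (auto simp: direct_limit_carrier[OF B])
    qed
    moreover have "Y \<in> \<phi> ` carrier (direct_limit A g)" if Y0: "Y \<in> carrier (direct_limit B h)" for Y
    proof -
      obtain j y where Y: "Y = ?S `` {(j, y)}" "y \<in> carrier (B j)"
        using Y0 by (auto simp: direct_limit_carrier[OF B])
      obtain i x where i: "x \<in> carrier (A i)" "L i x j y" using onto Y by blast
      show ?thesis using \<phi>[OF i(2) i(1) Y(2)] i Y by (force simp: direct_limit_carrier[OF A])
    qed
    ultimately show "\<phi> ` carrier (direct_limit A g) = carrier (direct_limit B h)" by blast
  qed
  have hom: "\<phi> (X \<oplus>\<^bsub>direct_limit A g\<^esub> Y) = \<phi> X \<oplus>\<^bsub>direct_limit B h\<^esub> \<phi> Y"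
    if XY: "X \<in> carrier (direct_limit A g)" "Y \<in> carrier (direct_limit A g)" for X Y
  proof -
    obtain i x i' x' where X: "X = ?R `` {(i, x)}" "x \<in> carrier (A i)"
      and Y: "Y = ?R `` {(i', x')}" "x' \<in> carrier (A i')" using XY by (auto simp: direct_limit_carrier[OF A])
    obtain j y where j: "y \<in> carrier (B j)" "L i x j y" using tot X by blast
    obtain j' y' where j': "y' \<in> carrier (B j')" "L i' x' j' y'" using tot Y by blast
    have "\<phi> (X \<oplus>\<^bsub>direct_limit A g\<^esub> Y) =
      ?S `` {(max j j', h j (max j j') y \<oplus>\<^bsub>B (max j j')\<^esub> h j' (max j j') y')}"
      unfolding X(1) Y(1) direct_limit_add[OF A X(2) Y(2)]
      by (rule \<phi>[OF add[OF j(2) j'(2) X(2) j(1) Y(2) j'(1)]])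
         (use X Y j j' in \<open>auto intro!: sys_add_in[OF A] sys_in[OF A] sys_add_in[OF B] sys_in[OF B]\<close>)
    also have "\<dots> = \<phi> X \<oplus>\<^bsub>direct_limit B h\<^esub> \<phi> Y"
      using \<phi>[OF j(2) X(2) j(1)] \<phi>[OF j'(2) Y(2) j'(1)] X Y direct_limit_add[OF B j(1) j'(1)] by simp
    finally show ?thesis .
  qed
  have sm: "\<phi> (k \<odot>\<^bsub>direct_limit A g\<^esub> X) = k \<odot>\<^bsub>direct_limit B h\<^esub> \<phi> X"
    if X0: "X \<in> carrier (direct_limit A g)" for k X
  proof -
    obtain i x where X: "X = ?R `` {(i, x)}" "x \<in> carrier (A i)"
      using X0 by (auto simp: direct_limit_carrier[OF A])
    obtain j y where j: "y \<in> carrier (B j)" "L i x j y" using tot X by blast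
    show ?thesis
      using \<phi>[OF j(2) X(2) j(1)] \<phi>[OF smult[OF j(2) X(2) j(1)] sys_smult_in[OF A X(2)] sys_smult_in[OF B j(1)]]
        direct_limit_smult[OF A X(2)] direct_limit_smult[OF B j(1)] X by simp
  qed
  have "\<phi> \<in> iso (add_monoid (direct_limit A g)) (add_monoid (direct_limit B h))"
    using bij hom by (auto simp: iso_def hom_def bij_betw_def)
  then show ?thesis using sm unfolding modules_isomorphic_def by blast
qed

section \<open>Transport of homology classes along staircases\<close>

text \<open>
  The window ends may only rise in the direction of transport. The boolean selects this direction,
  so that both directions are treated at once; transport starts at \<open>source\<close>.
\<close>

definition along :: "bool \<Rightarrow> real \<Rightarrow> real \<Rightarrow> (real \<Rightarrow> real) \<Rightarrow> bool" where
  "along forward lo hi \<alpha> \<longleftrightarrow> (if forward then mono_on {lo..hi} \<alpha> else antimono_on {lo..hi} \<alpha>)"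

definition source :: "bool \<Rightarrow> real \<Rightarrow> real \<Rightarrow> real" where
  "source forward lo hi = (if forward then lo else hi)"

lemma along_max: "along fw lo hi \<alpha> \<Longrightarrow> along fw lo hi \<beta> \<Longrightarrow> along fw lo hi (\<lambda>s. max (\<alpha> s) (\<beta> s))"
  by (cases fw) (auto simp: along_def intro!: monotone_onI max.mono dest: monotone_onD)

text \<open>
  The formal properties of Morse homology that invariance depends on: \<open>H r a b\<close> stands for the
  homology of the window \<open>(a,b)\<close> at the parameter \<open>r\<close>, \<open>f r a' b'\<close> for the map to the window
  \<open>(a',b')\<close>, \<open>Z\<close> for the pairs of a parameter and a level which the curve occupies, and
  \<open>lnk \<tau> a b s t X Y\<close> for the relation that \<open>X\<close> at \<open>s\<close> and \<open>Y\<close> at \<open>t\<close> correspond to each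
  other under the comparison centred at \<open>\<tau>\<close>. The ends of the window have to be free at \<open>\<tau>\<close>, and
  how close \<open>s\<close> and \<open>t\<close> have to be depends on \<open>\<tau>\<close> and on the window.
\<close>

locale continuation =
  fixes D :: "real set" and H :: "real \<Rightarrow> real \<Rightarrow> real \<Rightarrow> ('k, 'h) module"
    and f :: "real \<Rightarrow> real \<Rightarrow> real \<Rightarrow> 'h \<Rightarrow> 'h"
    and Z :: "(real \<times> real) set"
    and lnk :: "real \<Rightarrow> real \<Rightarrow> real \<Rightarrow> real \<Rightarrow> real \<Rightarrow> 'h \<Rightarrow> 'h \<Rightarrow> bool"
  assumes D01: "D \<subseteq> {0..1}"
    and D_dense: "\<And>x y. \<lbrakk>x \<in> {0..1}; y \<in> {0..1}; x < y\<rbrakk> \<Longrightarrow> \<exists>z\<in>D. x < z \<and> z < y"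
    and H_add: "\<And>r a b X Y. \<lbrakk>r \<in> D; X \<in> carrier (H r a b); Y \<in> carrier (H r a b)\<rbrakk> \<Longrightarrow>
        X \<oplus>\<^bsub>H r a b\<^esub> Y \<in> carrier (H r a b)"
    and H_smult: "\<And>r a b k X. \<lbrakk>r \<in> D; X \<in> carrier (H r a b)\<rbrakk> \<Longrightarrow> k \<odot>\<^bsub>H r a b\<^esub> X \<in> carrier (H r a b)"
    and f_in: "\<And>r a b a' b' X. \<lbrakk>r \<in> D; a \<le> a'; b \<le> b'; X \<in> carrier (H r a b)\<rbrakk> \<Longrightarrow>
        f r a' b' X \<in> carrier (H r a' b')"
    and f_id: "\<And>r a b X. \<lbrakk>r \<in> D; X \<in> carrier (H r a b)\<rbrakk> \<Longrightarrow> f r a b X = X"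
    and f_comp: "\<And>r a b a' b' a'' b'' X. \<lbrakk>r \<in> D; a \<le> a'; b \<le> b'; a' \<le> a''; b' \<le> b'';
        X \<in> carrier (H r a b)\<rbrakk> \<Longrightarrow> f r a'' b'' (f r a' b' X) = f r a'' b'' X"
    and f_add: "\<And>r a b a' b' X Y. \<lbrakk>r \<in> D; a \<le> a'; b \<le> b'; X \<in> carrier (H r a b); Y \<in> carrier (H r a b)\<rbrakk> \<Longrightarrow>
        f r a' b' (X \<oplus>\<^bsub>H r a b\<^esub> Y) = f r a' b' X \<oplus>\<^bsub>H r a' b'\<^esub> f r a' b' Y"
    and f_smult: "\<And>r a b a' b' k X. \<lbrakk>r \<in> D; a \<le> a'; b \<le> b'; X \<in> carrier (H r a b)\<rbrakk> \<Longrightarrow>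
        f r a' b' (k \<odot>\<^bsub>H r a b\<^esub> X) = k \<odot>\<^bsub>H r a' b'\<^esub> f r a' b' X"
    and lnk_sym: "\<And>\<tau> a b s t X Y. lnk \<tau> a b s t X Y \<Longrightarrow> lnk \<tau> a b t s Y X"
    and lnk_trans: "\<And>\<tau> a b s t u X Y W. lnk \<tau> a b s t X Y \<Longrightarrow> lnk \<tau> a b t u Y W \<Longrightarrow> lnk \<tau> a b s u X W"
    and lnk_near: "\<And>\<tau> a b. \<lbrakk>\<tau> \<in> {0..1}; (\<tau>, a) \<notin> Z; (\<tau>, b) \<notin> Z\<rbrakk> \<Longrightarrow>
        \<exists>e>0. \<forall>s\<in>D. \<forall>t\<in>D. \<bar>s - \<tau>\<bar> < e \<longrightarrow> \<bar>t - \<tau>\<bar> < e \<longrightarrow> (\<forall>X\<in>carrier (H s a b).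
          (\<exists>Y\<in>carrier (H t a b). lnk \<tau> a b s t X Y) \<and>
          (\<forall>Y\<in>carrier (H t a b). \<forall>Y'\<in>carrier (H t a b). lnk \<tau> a b s t X Y \<longrightarrow> lnk \<tau> a b s t X Y' \<longrightarrow> Y = Y') \<and>
          (\<forall>X'\<in>carrier (H s a b). \<forall>Y\<in>carrier (H t a b). \<forall>Y'\<in>carrier (H t a b).
             lnk \<tau> a b s t X Y \<longrightarrow> lnk \<tau> a b s t X' Y' \<longrightarrow>
             lnk \<tau> a b s t (X \<oplus>\<^bsub>H s a b\<^esub> X') (Y \<oplus>\<^bsub>H t a b\<^esub> Y')) \<and>
          (\<forall>k. \<forall>Y\<in>carrier (H t a b). lnk \<tau> a b s t X Y \<longrightarrow> lnk \<tau> a b s t (k \<odot>\<^bsub>H s a b\<^esub> X) (k \<odot>\<^bsub>H t a b\<^esub> Y)))"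
    and lnk_nat: "\<And>\<tau> a b a' b'. \<lbrakk>\<tau> \<in> {0..1}; (\<tau>, a) \<notin> Z; (\<tau>, b) \<notin> Z; (\<tau>, a') \<notin> Z; (\<tau>, b') \<notin> Z;
        a \<le> a'; b \<le> b'\<rbrakk> \<Longrightarrow> \<exists>e>0. \<forall>s\<in>D. \<forall>t\<in>D. \<bar>s - \<tau>\<bar> < e \<longrightarrow> \<bar>t - \<tau>\<bar> < e \<longrightarrow>
          (\<forall>X\<in>carrier (H s a b). \<forall>Y\<in>carrier (H t a b). lnk \<tau> a b s t X Y \<longrightarrow> lnk \<tau> a' b' s t (f s a' b' X) (f t a' b' Y))"
    and lnk_compat: "\<And>\<tau> a b. \<lbrakk>\<tau> \<in> {0..1}; (\<tau>, a) \<notin> Z; (\<tau>, b) \<notin> Z\<rbrakk> \<Longrightarrow>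
        \<exists>e>0. \<forall>\<tau>'\<in>{0..1}. \<bar>\<tau>' - \<tau>\<bar> < e \<longrightarrow> (\<tau>', a) \<notin> Z \<and> (\<tau>', b) \<notin> Z \<and>
          (\<exists>e'>0. \<forall>s\<in>D. \<forall>t\<in>D. \<bar>s - \<tau>'\<bar> < e' \<longrightarrow> \<bar>t - \<tau>'\<bar> < e' \<longrightarrow>
            (\<forall>X\<in>carrier (H s a b). \<forall>Y\<in>carrier (H t a b). lnk \<tau> a b s t X Y \<longleftrightarrow> lnk \<tau>' a b s t X Y))"
    and stair_above: "\<And>fw lo hi l. \<lbrakk>0 \<le> lo; lo \<le> hi; hi \<le> 1\<rbrakk> \<Longrightarrow>
        \<exists>l' \<alpha>. step_on Z lo hi \<alpha> \<and> along fw lo hi \<alpha> \<and> (\<forall>s\<in>{lo..hi}. l \<le> \<alpha> s \<and> \<alpha> s \<le> l')"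
    and stair_below: "\<And>fw lo hi l. \<lbrakk>0 \<le> lo; lo \<le> hi; hi \<le> 1\<rbrakk> \<Longrightarrow>
        \<exists>\<alpha>. step_on Z lo hi \<alpha> \<and> along fw lo hi \<alpha> \<and> (\<forall>s\<in>{lo..hi}. \<alpha> s \<le> l)"
begin

definition link_iso_at :: "real \<Rightarrow> real \<Rightarrow> real \<Rightarrow> real \<Rightarrow> bool" where
  "link_iso_at \<tau> a b e \<longleftrightarrow> (\<forall>s\<in>D. \<forall>t\<in>D. \<bar>s - \<tau>\<bar> < e \<longrightarrow> \<bar>t - \<tau>\<bar> < e \<longrightarrow> (\<forall>X\<in>carrier (H s a b).
          (\<exists>Y\<in>carrier (H t a b). lnk \<tau> a b s t X Y) \<and>
          (\<forall>Y\<in>carrier (H t a b). \<forall>Y'\<in>carrier (H t a b). lnk \<tau> a b s t X Y \<longrightarrow> lnk \<tau> a b s t X Y' \<longrightarrow> Y = Y') \<and>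
          (\<forall>X'\<in>carrier (H s a b). \<forall>Y\<in>carrier (H t a b). \<forall>Y'\<in>carrier (H t a b).
             lnk \<tau> a b s t X Y \<longrightarrow> lnk \<tau> a b s t X' Y' \<longrightarrow>
             lnk \<tau> a b s t (X \<oplus>\<^bsub>H s a b\<^esub> X') (Y \<oplus>\<^bsub>H t a b\<^esub> Y')) \<and>
          (\<forall>k. \<forall>Y\<in>carrier (H t a b). lnk \<tau> a b s t X Y \<longrightarrow> lnk \<tau> a b s t (k \<odot>\<^bsub>H s a b\<^esub> X) (k \<odot>\<^bsub>H t a b\<^esub> Y))))"

definition link_natural_at :: "real \<Rightarrow> real \<Rightarrow> real \<Rightarrow> real \<Rightarrow> real \<Rightarrow> real \<Rightarrow> bool" where
  "link_natural_at \<tau> a b a' b' e \<longleftrightarrow> (\<forall>s\<in>D. \<forall>t\<in>D. \<bar>s - \<tau>\<bar> < e \<longrightarrow> \<bar>t - \<tau>\<bar> < e \<longrightarrow>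
     (\<forall>X\<in>carrier (H s a b). \<forall>Y\<in>carrier (H t a b). lnk \<tau> a b s t X Y \<longrightarrow> lnk \<tau> a' b' s t (f s a' b' X) (f t a' b' Y)))"

text \<open>
  One radius \<open>e\<close> which serves all windows with ends in \<open>A\<close> and all maps between them.
\<close>

definition good_at :: "real \<Rightarrow> real set \<Rightarrow> real \<Rightarrow> bool" where
  "good_at \<tau> A e \<longleftrightarrow> (\<forall>a\<in>A. \<forall>b\<in>A. link_iso_at \<tau> a b e) \<and>
     (\<forall>a\<in>A. \<forall>b\<in>A. \<forall>a'\<in>A. \<forall>b'\<in>A. a \<le> a' \<longrightarrow> b \<le> b' \<longrightarrow> link_natural_at \<tau> a b a' b' e)"

lemma good_at_exists:
  assumes "\<tau> \<in> {0..1}" "finite A" "\<forall>l\<in>A. (\<tau>, l) \<notin> Z"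
  obtains e where "e > 0" "good_at \<tau> A e"
proof -
  have 1: "\<exists>e>0. \<forall>(a, b)\<in>A \<times> A. link_iso_at \<tau> a b e"
  proof (rule finite_common_radius)
    fix x e e' assume "case x of (a, b) \<Rightarrow> link_iso_at \<tau> a b e" and e': "e' \<le> (e::real)"
    then show "case x of (a, b) \<Rightarrow> link_iso_at \<tau> a b e'"
      unfolding link_iso_at_def by (auto split: prod.splits intro: less_le_trans[OF _ e'])
  qed (use assms lnk_near in \<open>auto simp: link_iso_at_def split: prod.splits\<close>)
  have 2: "\<exists>e>0. \<forall>(a, b, a', b')\<in>A \<times> A \<times> A \<times> A. a \<le> a' \<longrightarrow> b \<le> b' \<longrightarrow> link_natural_at \<tau> a b a' b' e"
  proof (rule finite_common_radius)
    fix x assume "x \<in> A \<times> A \<times> A \<times> A"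
    then obtain a b a' b' where x: "x = (a, b, a', b')" "a \<in> A" "b \<in> A" "a' \<in> A" "b' \<in> A" by auto
    show "\<exists>e>0. case x of (a, b, a', b') \<Rightarrow> a \<le> a' \<longrightarrow> b \<le> b' \<longrightarrow> link_natural_at \<tau> a b a' b' e"
      using lnk_nat[OF assms(1), of a b a' b'] x assms(3) unfolding link_natural_at_def
      by (cases "a \<le> a' \<and> b \<le> b'") (auto intro: exI[of _ 1])
  next
    fix x e e' assume "case x of (a, b, a', b') \<Rightarrow> a \<le> a' \<longrightarrow> b \<le> b' \<longrightarrow> link_natural_at \<tau> a b a' b' e"
      and e': "e' \<le> (e::real)"
    then show "case x of (a, b, a', b') \<Rightarrow> a \<le> a' \<longrightarrow> b \<le> b' \<longrightarrow> link_natural_at \<tau> a b a' b' e'"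
      unfolding link_natural_at_def by (auto split: prod.splits intro: less_le_trans[OF _ e'])
  qed (use assms in auto)
  obtain e1 e2 where e: "e1 > 0" "e2 > 0" "\<forall>(a, b)\<in>A \<times> A. link_iso_at \<tau> a b e1"
    "\<forall>(a, b, a', b')\<in>A \<times> A \<times> A \<times> A. a \<le> a' \<longrightarrow> b \<le> b' \<longrightarrow> link_natural_at \<tau> a b a' b' e2"
    using 1 2 by blast
  have "good_at \<tau> A (min e1 e2)"
    using e(3,4) unfolding good_at_def link_iso_at_def link_natural_at_def by simp
  then show ?thesis using that[of "min e1 e2"] e by simp
qed

context
  fixes \<tau> A e s t a b
  assumes g: "good_at \<tau> A e" and s: "s \<in> D" "\<bar>s - \<tau>\<bar> < e" and t: "t \<in> D" "\<bar>t - \<tau>\<bar> < e"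
    and ab: "a \<in> A" "b \<in> A"
begin

lemma good_iso: "link_iso_at \<tau> a b e"
  using g ab unfolding good_at_def by blast

lemma good_ex: "X \<in> carrier (H s a b) \<Longrightarrow> \<exists>Y\<in>carrier (H t a b). lnk \<tau> a b s t X Y"
  using good_iso s t unfolding link_iso_at_def by blast

lemma good_uniq: "lnk \<tau> a b s t X Y \<Longrightarrow> lnk \<tau> a b s t X Y' \<Longrightarrow> X \<in> carrier (H s a b) \<Longrightarrow>
    Y \<in> carrier (H t a b) \<Longrightarrow> Y' \<in> carrier (H t a b) \<Longrightarrow> Y = Y'"
  using good_iso s t unfolding link_iso_at_def by blast

lemma good_add: "lnk \<tau> a b s t X Y \<Longrightarrow> lnk \<tau> a b s t X' Y' \<Longrightarrow> X \<in> carrier (H s a b) \<Longrightarrow>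
    Y \<in> carrier (H t a b) \<Longrightarrow> X' \<in> carrier (H s a b) \<Longrightarrow> Y' \<in> carrier (H t a b) \<Longrightarrow>
    lnk \<tau> a b s t (X \<oplus>\<^bsub>H s a b\<^esub> X') (Y \<oplus>\<^bsub>H t a b\<^esub> Y')"
  using good_iso s t unfolding link_iso_at_def by blast

lemma good_smult: "lnk \<tau> a b s t X Y \<Longrightarrow> X \<in> carrier (H s a b) \<Longrightarrow>
    Y \<in> carrier (H t a b) \<Longrightarrow> lnk \<tau> a b s t (k \<odot>\<^bsub>H s a b\<^esub> X) (k \<odot>\<^bsub>H t a b\<^esub> Y)"
  using good_iso s t unfolding link_iso_at_def by blast

lemma good_nat: "lnk \<tau> a b s t X Y \<Longrightarrow> a' \<in> A \<Longrightarrow> b' \<in> A \<Longrightarrow> a \<le> a' \<Longrightarrow> b \<le> b' \<Longrightarrow>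
    X \<in> carrier (H s a b) \<Longrightarrow> Y \<in> carrier (H t a b) \<Longrightarrow> lnk \<tau> a' b' s t (f s a' b' X) (f t a' b' Y)"
  using g ab s t unfolding good_at_def link_natural_at_def by blast

end

lemma good_refl:
  assumes "good_at \<tau> A e" "s \<in> D" "\<bar>s - \<tau>\<bar> < e" "a \<in> A" "b \<in> A" "X \<in> carrier (H s a b)"
  shows "lnk \<tau> a b s s X X"
  using good_ex[OF assms(1,2,3,2,3,4,5,6)] lnk_sym lnk_trans by blast

text \<open>
  Between \<open>s\<close> and \<open>t\<close> a window end may take a step. The two classes are compared in the smallest
  window that both can be mapped to.
\<close>

abbreviation matched :: "real \<Rightarrow> (real \<Rightarrow> real) \<Rightarrow> (real \<Rightarrow> real) \<Rightarrow> (real \<Rightarrow> 'h) \<Rightarrow> real \<Rightarrow> real \<Rightarrow> bool" where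
  "matched \<tau> \<alpha> \<beta> X s t \<equiv> lnk \<tau> (max (\<alpha> s) (\<alpha> t)) (max (\<beta> s) (\<beta> t)) s t
     (f s (max (\<alpha> s) (\<alpha> t)) (max (\<beta> s) (\<beta> t)) (X s)) (f t (max (\<alpha> s) (\<alpha> t)) (max (\<beta> s) (\<beta> t)) (X t))"

definition flat :: "real \<Rightarrow> real \<Rightarrow> (real \<Rightarrow> real) \<Rightarrow> (real \<Rightarrow> real) \<Rightarrow> (real \<Rightarrow> 'h) \<Rightarrow> bool" where
  "flat lo hi \<alpha> \<beta> X \<longleftrightarrow> (\<forall>s\<in>D \<inter> {lo..hi}. X s \<in> carrier (H s (\<alpha> s) (\<beta> s))) \<and>
     (\<forall>\<tau>\<in>{lo..hi}. \<exists>d>0. \<forall>s\<in>D \<inter> {lo..hi}. \<forall>t\<in>D \<inter> {lo..hi}. \<bar>s - \<tau>\<bar> < d \<longrightarrow> \<bar>t - \<tau>\<bar> < d \<longrightarrow>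
        matched \<tau> \<alpha> \<beta> X s t)"

lemma flat_carrier: "flat lo hi \<alpha> \<beta> X \<Longrightarrow> s \<in> D \<Longrightarrow> lo \<le> s \<Longrightarrow> s \<le> hi \<Longrightarrow> X s \<in> carrier (H s (\<alpha> s) (\<beta> s))"
  unfolding flat_def by auto

lemma flat_lnk:
  assumes "flat lo hi \<alpha> \<beta> X" "\<tau> \<in> {lo..hi}"
  obtains d where "d > 0" "\<And>s t. \<lbrakk>s \<in> D \<inter> {lo..hi}; t \<in> D \<inter> {lo..hi}; \<bar>s - \<tau>\<bar> < d; \<bar>t - \<tau>\<bar> < d\<rbrakk> \<Longrightarrow>
     matched \<tau> \<alpha> \<beta> X s t"
  using assms unfolding flat_def by blast

lemma stairs_common_levels:
  assumes "step_on Z lo hi \<alpha>" "step_on Z lo hi \<beta>" "\<tau> \<in> {lo..hi}" "0 \<le> lo" "hi \<le> 1"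
    and B: "finite B" "\<forall>l\<in>B. (\<tau>, l) \<notin> Z"
  shows "\<exists>d>0. \<exists>A. finite A \<and> B \<subseteq> A \<and> good_at \<tau> A d \<and> (\<forall>l\<in>A. (\<tau>, l) \<notin> Z) \<and>
    (\<forall>s\<in>{lo..hi}. \<bar>s - \<tau>\<bar> < d \<longrightarrow> \<alpha> s \<in> A \<and> \<beta> s \<in> A)"
proof -
  obtain d1 A1 where 1: "d1 > 0" "finite A1" "\<forall>l\<in>A1. (\<tau>, l) \<notin> Z" "\<forall>s\<in>{lo..hi}. \<bar>s - \<tau>\<bar> < d1 \<longrightarrow> \<alpha> s \<in> A1"
    using assms(1,3) unfolding step_on_def by blast
  obtain d2 A2 where 2: "d2 > 0" "finite A2" "\<forall>l\<in>A2. (\<tau>, l) \<notin> Z" "\<forall>s\<in>{lo..hi}. \<bar>s - \<tau>\<bar> < d2 \<longrightarrow> \<beta> s \<in> A2"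
    using assms(2,3) unfolding step_on_def by blast
  define A where "A = A1 \<union> A2 \<union> B"
  have A: "finite A" "\<forall>l\<in>A. (\<tau>, l) \<notin> Z" using 1 2 B by (auto simp: A_def)
  obtain e where e: "e > 0" "good_at \<tau> A e" using good_at_exists[OF _ A] assms by auto
  define d where "d = min e (min d1 d2)"
  have "good_at \<tau> A d"
    using e(2) unfolding good_at_def link_iso_at_def link_natural_at_def d_def by simp
  then show ?thesis using 1 2 e A by (intro exI[of _ d] conjI exI[of _ A]) (auto simp: d_def A_def)
qed

lemma max_in: "x \<in> A \<Longrightarrow> y \<in> A \<Longrightarrow> max x y \<in> (A :: real set)"
  by (auto simp: max_def)

text \<open>
  Links are natural, so the images of linked classes in a common window are linked; that the maps
  between windows compose brings them into the required form.
\<close>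

lemma flat_push:
  assumes st: "step_on Z lo hi \<alpha>" "step_on Z lo hi \<beta>" "step_on Z lo hi \<alpha>'" "step_on Z lo hi \<beta>'"
    and le: "\<And>s. s \<in> {lo..hi} \<Longrightarrow> \<alpha> s \<le> \<alpha>' s \<and> \<beta> s \<le> \<beta>' s"
    and X: "flat lo hi \<alpha> \<beta> X" and lohi: "0 \<le> lo" "hi \<le> 1"
  shows "flat lo hi \<alpha>' \<beta>' (\<lambda>s. f s (\<alpha>' s) (\<beta>' s) (X s))"
  unfolding flat_def
proof (intro conjI ballI)
  fix s assume "s \<in> D \<inter> {lo..hi}"
  then show "f s (\<alpha>' s) (\<beta>' s) (X s) \<in> carrier (H s (\<alpha>' s) (\<beta>' s))"
    using le[of s] flat_carrier[OF X, of s] f_in[of s "\<alpha> s" "\<alpha>' s" "\<beta> s" "\<beta>' s"] by auto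
next
  fix \<tau> assume \<tau>: "\<tau> \<in> {lo..hi}"
  obtain d0 A0 where 0: "d0 > 0" "finite A0" "good_at \<tau> A0 d0" "\<forall>l\<in>A0. (\<tau>, l) \<notin> Z"
    "\<forall>s\<in>{lo..hi}. \<bar>s - \<tau>\<bar> < d0 \<longrightarrow> \<alpha> s \<in> A0 \<and> \<beta> s \<in> A0"
    using stairs_common_levels[OF st(1,2) \<tau> lohi, of "{}"] by blast
  obtain d1 A where 1: "d1 > 0" "A0 \<subseteq> A" "good_at \<tau> A d1"
    "\<forall>s\<in>{lo..hi}. \<bar>s - \<tau>\<bar> < d1 \<longrightarrow> \<alpha>' s \<in> A \<and> \<beta>' s \<in> A"
    using stairs_common_levels[OF st(3,4) \<tau> lohi 0(2,4)] by blast
  obtain d2 where 2: "d2 > 0" "\<And>s t. \<lbrakk>s \<in> D \<inter> {lo..hi}; t \<in> D \<inter> {lo..hi}; \<bar>s - \<tau>\<bar> < d2; \<bar>t - \<tau>\<bar> < d2\<rbrakk> \<Longrightarrow>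
     matched \<tau> \<alpha> \<beta> X s t"
    using flat_lnk[OF X \<tau>] by blast
  show "\<exists>d>0. \<forall>s\<in>D \<inter> {lo..hi}. \<forall>t\<in>D \<inter> {lo..hi}. \<bar>s - \<tau>\<bar> < d \<longrightarrow> \<bar>t - \<tau>\<bar> < d \<longrightarrow>
        lnk \<tau> (max (\<alpha>' s) (\<alpha>' t)) (max (\<beta>' s) (\<beta>' t)) s t
          (f s (max (\<alpha>' s) (\<alpha>' t)) (max (\<beta>' s) (\<beta>' t)) (f s (\<alpha>' s) (\<beta>' s) (X s)))
          (f t (max (\<alpha>' s) (\<alpha>' t)) (max (\<beta>' s) (\<beta>' t)) (f t (\<alpha>' t) (\<beta>' t) (X t)))"
  proof (intro exI[of _ "min d0 (min d1 d2)"] conjI ballI impI)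
    fix s t assume s: "s \<in> D \<inter> {lo..hi}" "\<bar>s - \<tau>\<bar> < min d0 (min d1 d2)"
      and t: "t \<in> D \<inter> {lo..hi}" "\<bar>t - \<tau>\<bar> < min d0 (min d1 d2)"
    let ?a = "max (\<alpha> s) (\<alpha> t)" and ?b = "max (\<beta> s) (\<beta> t)"
    let ?a' = "max (\<alpha>' s) (\<alpha>' t)" and ?b' = "max (\<beta>' s) (\<beta>' t)"
    have in0: "\<alpha> s \<in> A" "\<alpha> t \<in> A" "\<beta> s \<in> A" "\<beta> t \<in> A" using 0(5) 1(2) s t by auto
    have in1: "\<alpha>' s \<in> A" "\<alpha>' t \<in> A" "\<beta>' s \<in> A" "\<beta>' t \<in> A" using 1(4) s t by auto
    have Xc: "X s \<in> carrier (H s (\<alpha> s) (\<beta> s))" "X t \<in> carrier (H t (\<alpha> t) (\<beta> t))"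
      using flat_carrier[OF X] s t by auto
    have les: "\<alpha> s \<le> \<alpha>' s" "\<beta> s \<le> \<beta>' s" "\<alpha> t \<le> \<alpha>' t" "\<beta> t \<le> \<beta>' t" using le s t by auto
    then have lem: "?a \<le> ?a'" "?b \<le> ?b'" by auto
    have Xm: "f s ?a ?b (X s) \<in> carrier (H s ?a ?b)" "f t ?a ?b (X t) \<in> carrier (H t ?a ?b)"
      using Xc s t by (auto intro!: f_in[OF _ _ _ Xc(1)] f_in[OF _ _ _ Xc(2)])
    have l: "lnk \<tau> ?a ?b s t (f s ?a ?b (X s)) (f t ?a ?b (X t))" using 2(2)[of s t] s t by auto
    have "lnk \<tau> ?a' ?b' s t (f s ?a' ?b' (f s ?a ?b (X s))) (f t ?a' ?b' (f t ?a ?b (X t)))"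
      by (rule good_nat[OF 1(3) _ _ _ _ _ _ l]) (use s t in0 in1 lem Xm in \<open>auto intro!: max_in\<close>)
    moreover have "f s ?a' ?b' (f s ?a ?b (X s)) = f s ?a' ?b' (f s (\<alpha>' s) (\<beta>' s) (X s))"
      using f_comp[OF _ _ _ _ _ Xc(1), of ?a ?b ?a' ?b'] f_comp[OF _ _ _ _ _ Xc(1), of "\<alpha>' s" "\<beta>' s" ?a' ?b'] s les lem by simp
    moreover have "f t ?a' ?b' (f t ?a ?b (X t)) = f t ?a' ?b' (f t (\<alpha>' t) (\<beta>' t) (X t))"
      using f_comp[OF _ _ _ _ _ Xc(2), of ?a ?b ?a' ?b'] f_comp[OF _ _ _ _ _ Xc(2), of "\<alpha>' t" "\<beta>' t" ?a' ?b'] t les lem by simp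
    ultimately show "lnk \<tau> ?a' ?b' s t (f s ?a' ?b' (f s (\<alpha>' s) (\<beta>' s) (X s)))
          (f t ?a' ?b' (f t (\<alpha>' t) (\<beta>' t) (X t)))" by simp
  qed (use 0 1 2 in auto)
qed

text \<open>
  If the window ends at \<open>t\<close> are at least those at \<open>s\<close>, then \<open>s\<close> and \<open>t\<close> are compared in the window
  of \<open>t\<close>, where \<open>X t\<close> is linked to the image of \<open>X s\<close>. Links determine their second argument.
\<close>

lemma flat_unique_local:
  assumes st: "step_on Z lo hi \<alpha>" "step_on Z lo hi \<beta>" and lohi: "0 \<le> lo" "hi \<le> 1" and \<tau>: "\<tau> \<in> {lo..hi}"
    and X: "flat lo hi \<alpha> \<beta> X" and Y: "flat lo hi \<alpha> \<beta> Y"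
  shows "\<exists>d>0. \<forall>s\<in>D \<inter> {lo..hi}. \<forall>t\<in>D \<inter> {lo..hi}. \<bar>s - \<tau>\<bar> < d \<longrightarrow> \<bar>t - \<tau>\<bar> < d \<longrightarrow>
      \<alpha> s \<le> \<alpha> t \<longrightarrow> \<beta> s \<le> \<beta> t \<longrightarrow> X s = Y s \<longrightarrow> X t = Y t"
proof -
  obtain d0 A where 0: "d0 > 0" "finite A" "good_at \<tau> A d0" 
    "\<forall>s\<in>{lo..hi}. \<bar>s - \<tau>\<bar> < d0 \<longrightarrow> \<alpha> s \<in> A \<and> \<beta> s \<in> A"
    using stairs_common_levels[OF st(1,2) \<tau> lohi, of "{}"] by blast
  obtain d1 where 1: "d1 > 0" "\<And>s t. \<lbrakk>s \<in> D \<inter> {lo..hi}; t \<in> D \<inter> {lo..hi}; \<bar>s - \<tau>\<bar> < d1; \<bar>t - \<tau>\<bar> < d1\<rbrakk> \<Longrightarrow>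
     matched \<tau> \<alpha> \<beta> X s t"
    using flat_lnk[OF X \<tau>] by blast
  obtain d2 where 2: "d2 > 0" "\<And>s t. \<lbrakk>s \<in> D \<inter> {lo..hi}; t \<in> D \<inter> {lo..hi}; \<bar>s - \<tau>\<bar> < d2; \<bar>t - \<tau>\<bar> < d2\<rbrakk> \<Longrightarrow>
     matched \<tau> \<alpha> \<beta> Y s t"
    using flat_lnk[OF Y \<tau>] by blast
  show ?thesis
  proof (intro exI[of _ "min d0 (min d1 d2)"] conjI ballI impI)
    fix s t assume s: "s \<in> D \<inter> {lo..hi}" "\<bar>s - \<tau>\<bar> < min d0 (min d1 d2)"
      and t: "t \<in> D \<inter> {lo..hi}" "\<bar>t - \<tau>\<bar> < min d0 (min d1 d2)"
      and le: "\<alpha> s \<le> \<alpha> t" "\<beta> s \<le> \<beta> t" and eq: "X s = Y s"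
    have m: "max (\<alpha> s) (\<alpha> t) = \<alpha> t" "max (\<beta> s) (\<beta> t) = \<beta> t" using le by auto
    have c: "X t \<in> carrier (H t (\<alpha> t) (\<beta> t))" "Y t \<in> carrier (H t (\<alpha> t) (\<beta> t))"
      "X s \<in> carrier (H s (\<alpha> s) (\<beta> s))"
      using flat_carrier[OF X] flat_carrier[OF Y] s t by auto
    have lX: "lnk \<tau> (\<alpha> t) (\<beta> t) s t (f s (\<alpha> t) (\<beta> t) (X s)) (X t)"
      using 1(2)[of s t] s t f_id[OF _ c(1)] by (simp add: m)
    have lY: "lnk \<tau> (\<alpha> t) (\<beta> t) s t (f s (\<alpha> t) (\<beta> t) (X s)) (Y t)"
      using 2(2)[of s t] s t f_id[OF _ c(2)] by (simp add: m eq)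
    show "X t = Y t"
      by (rule good_uniq[OF 0(3) _ _ _ _ _ _ lX lY])
         (use 0 s t c le in \<open>auto intro!: f_in[OF _ _ _ c(3)]\<close>)
  qed (use 0 1 2 in auto)
qed

lemma D_dense_within: "0 \<le> lo \<Longrightarrow> hi \<le> 1 \<Longrightarrow> x \<in> {lo..hi} \<Longrightarrow> y \<in> {lo..hi} \<Longrightarrow> x < y \<Longrightarrow> \<exists>z\<in>D. x < z \<and> z < y"
  using D_dense[of x y] by simp

text \<open>
  All classes linked to \<open>X0\<close> are found in the fixed window \<open>(\<alpha> p,\<beta> p)\<close>; they are then pushed up
  into the windows of the staircases. The resulting family is linked through comparisons centred
  at \<open>\<tau>\<close>, whereas flatness at another point \<open>\<tau>'\<close> refers to comparisons centred at \<open>\<tau>'\<close>; this is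
  what \<open>lnk_compat\<close> is for.
\<close>

lemma flat_exists_local:
  assumes st: "step_on Z lo hi \<alpha>" "step_on Z lo hi \<beta>" and lohi: "0 \<le> lo" "hi \<le> 1" and \<tau>: "\<tau> \<in> {lo..hi}"
  shows "\<exists>d>0. \<forall>x\<in>D \<inter> {lo..hi}. \<forall>y\<in>D \<inter> {lo..hi}. \<forall>p\<in>D \<inter> {x..y}. \<bar>x - \<tau>\<bar> < d \<longrightarrow> \<bar>y - \<tau>\<bar> < d \<longrightarrow>
      (\<forall>s\<in>{x..y}. \<alpha> p \<le> \<alpha> s \<and> \<beta> p \<le> \<beta> s) \<longrightarrow>
      (\<forall>X0\<in>carrier (H p (\<alpha> p) (\<beta> p)). \<exists>X. flat x y \<alpha> \<beta> X \<and> X p = X0)"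
proof -
  obtain d0 A where 0: "d0 > 0" "finite A" "good_at \<tau> A d0" "\<forall>l\<in>A. (\<tau>, l) \<notin> Z"
    "\<forall>s\<in>{lo..hi}. \<bar>s - \<tau>\<bar> < d0 \<longrightarrow> \<alpha> s \<in> A \<and> \<beta> s \<in> A"
    using stairs_common_levels[OF st(1,2) \<tau> lohi, of "{}"] by blast
  have "\<exists>e>0. \<forall>(a, b)\<in>A \<times> A. \<forall>\<tau>'\<in>{0..1}. \<bar>\<tau>' - \<tau>\<bar> < e \<longrightarrow> (\<tau>', a) \<notin> Z \<and> (\<tau>', b) \<notin> Z \<and>
          (\<exists>e'>0. \<forall>s\<in>D. \<forall>t\<in>D. \<bar>s - \<tau>'\<bar> < e' \<longrightarrow> \<bar>t - \<tau>'\<bar> < e' \<longrightarrow>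
            (\<forall>X\<in>carrier (H s a b). \<forall>Y\<in>carrier (H t a b). lnk \<tau> a b s t X Y \<longleftrightarrow> lnk \<tau>' a b s t X Y))"
  proof (rule finite_common_radius)
    fix x assume "x \<in> A \<times> A"
    then obtain a b where "x = (a, b)" "a \<in> A" "b \<in> A" by auto
    then show "\<exists>e>0. case x of (a, b) \<Rightarrow> \<forall>\<tau>'\<in>{0..1}. \<bar>\<tau>' - \<tau>\<bar> < e \<longrightarrow> (\<tau>', a) \<notin> Z \<and> (\<tau>', b) \<notin> Z \<and>
          (\<exists>e'>0. \<forall>s\<in>D. \<forall>t\<in>D. \<bar>s - \<tau>'\<bar> < e' \<longrightarrow> \<bar>t - \<tau>'\<bar> < e' \<longrightarrow>
            (\<forall>X\<in>carrier (H s a b). \<forall>Y\<in>carrier (H t a b). lnk \<tau> a b s t X Y \<longleftrightarrow> lnk \<tau>' a b s t X Y))"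
      using lnk_compat[of \<tau> a b] 0(4) \<tau> lohi by simp
  qed (use 0 in \<open>auto split: prod.splits\<close>)
  then obtain e where e: "e > 0" "\<And>a b \<tau>'. \<lbrakk>a \<in> A; b \<in> A; \<tau>'\<in>{0..1}; \<bar>\<tau>' - \<tau>\<bar> < e\<rbrakk> \<Longrightarrow> (\<tau>', a) \<notin> Z \<and> (\<tau>', b) \<notin> Z \<and>
          (\<exists>e'>0. \<forall>s\<in>D. \<forall>t\<in>D. \<bar>s - \<tau>'\<bar> < e' \<longrightarrow> \<bar>t - \<tau>'\<bar> < e' \<longrightarrow>
            (\<forall>X\<in>carrier (H s a b). \<forall>Y\<in>carrier (H t a b). lnk \<tau> a b s t X Y \<longleftrightarrow> lnk \<tau>' a b s t X Y))"
    by auto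
  define d where "d = min d0 e"
  show ?thesis
  proof (intro exI[of _ d] conjI ballI impI)
    show "d > 0" using 0 e by (simp add: d_def)
    fix x y p X0 assume xy: "x \<in> D \<inter> {lo..hi}" "y \<in> D \<inter> {lo..hi}" "\<bar>x - \<tau>\<bar> < d" "\<bar>y - \<tau>\<bar> < d"
      and p: "p \<in> D \<inter> {x..y}" and le: "\<forall>s\<in>{x..y}. \<alpha> p \<le> \<alpha> s \<and> \<beta> p \<le> \<beta> s"
      and X0: "X0 \<in> carrier (H p (\<alpha> p) (\<beta> p))"
    have near: "\<bar>s - \<tau>\<bar> < d0" "\<bar>s - \<tau>\<bar> < e" "s \<in> {lo..hi}" if "s \<in> {x..y}" for s
      using that xy unfolding d_def by (auto simp: abs_less_iff)
    have pA: "\<alpha> p \<in> A" "\<beta> p \<in> A" using 0(5)[rule_format, of p] near[of p] p by auto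
    have "\<forall>s\<in>D \<inter> {x..y}. \<exists>Y\<in>carrier (H s (\<alpha> p) (\<beta> p)). lnk \<tau> (\<alpha> p) (\<beta> p) p s X0 Y"
      using good_ex[OF 0(3) _ _ _ _ pA X0] near p by blast
    then obtain Y where Y: "\<And>s. s \<in> D \<inter> {x..y} \<Longrightarrow> Y s \<in> carrier (H s (\<alpha> p) (\<beta> p))"
      "\<And>s. s \<in> D \<inter> {x..y} \<Longrightarrow> lnk \<tau> (\<alpha> p) (\<beta> p) p s X0 (Y s)" by metis
    (* The choice of Y at p is forced, as X0 is linked to itself. *)
    have Yp: "Y p = X0"
      by (rule good_uniq[OF 0(3) _ _ _ _ pA Y(2)[OF p] good_refl[OF 0(3) _ _ pA X0]])
         (use p near[of p] X0 Y in auto)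
    define X where "X s = f s (\<alpha> s) (\<beta> s) (Y s)" for s
    have "flat x y \<alpha> \<beta> X" unfolding flat_def
    proof (intro conjI ballI)
      fix s assume s: "s \<in> D \<inter> {x..y}"
      then show "X s \<in> carrier (H s (\<alpha> s) (\<beta> s))"
        unfolding X_def using le by (intro f_in[OF _ _ _ Y(1)[OF s]]) auto
    next
      fix \<tau>' assume \<tau>': "\<tau>' \<in> {x..y}"
      obtain e' where e': "e' > 0" "\<And>s t X Y. \<lbrakk>s\<in>D; t\<in>D; \<bar>s - \<tau>'\<bar> < e'; \<bar>t - \<tau>'\<bar> < e';
          X\<in>carrier (H s (\<alpha> p) (\<beta> p)); Y\<in>carrier (H t (\<alpha> p) (\<beta> p))\<rbrakk> \<Longrightarrow>
          lnk \<tau> (\<alpha> p) (\<beta> p) s t X Y \<longleftrightarrow> lnk \<tau>' (\<alpha> p) (\<beta> p) s t X Y" "(\<tau>', \<alpha> p) \<notin> Z" "(\<tau>', \<beta> p) \<notin> Z"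
        using e(2)[OF pA, of \<tau>'] near[OF \<tau>'] lohi by auto
      obtain d1 A1 where 1: "d1 > 0" "{\<alpha> p, \<beta> p} \<subseteq> A1" "good_at \<tau>' A1 d1"
        "\<forall>s\<in>{lo..hi}. \<bar>s - \<tau>'\<bar> < d1 \<longrightarrow> \<alpha> s \<in> A1 \<and> \<beta> s \<in> A1"
        using stairs_common_levels[OF st(1,2) near(3)[OF \<tau>'] lohi, of "{\<alpha> p, \<beta> p}"] e' by auto
      show "\<exists>d>0. \<forall>s\<in>D \<inter> {x..y}. \<forall>t\<in>D \<inter> {x..y}. \<bar>s - \<tau>'\<bar> < d \<longrightarrow> \<bar>t - \<tau>'\<bar> < d \<longrightarrow>
        matched \<tau>' \<alpha> \<beta> X s t"
      proof (intro exI[of _ "min e' d1"] conjI ballI impI)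
        fix s t assume s: "s\<in>D \<inter> {x..y}" "\<bar>s - \<tau>'\<bar> < min e' d1" and t: "t\<in>D \<inter> {x..y}" "\<bar>t - \<tau>'\<bar> < min e' d1"
        let ?a = "max (\<alpha> s) (\<alpha> t)" and ?b = "max (\<beta> s) (\<beta> t)"
        have les: "\<alpha> p \<le> \<alpha> s" "\<beta> p \<le> \<beta> s" "\<alpha> p \<le> \<alpha> t" "\<beta> p \<le> \<beta> t" using le s t by auto
        have inA: "\<alpha> s \<in> A1" "\<beta> s \<in> A1" "\<alpha> t \<in> A1" "\<beta> t \<in> A1" using 1(4) near s t by auto
        have "lnk \<tau> (\<alpha> p) (\<beta> p) s t (Y s) (Y t)"
          using Y(2)[OF s(1)] Y(2)[OF t(1)] lnk_sym lnk_trans by blast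
        then have "lnk \<tau>' (\<alpha> p) (\<beta> p) s t (Y s) (Y t)" using e'(2) Y(1) s t by auto
        then have "lnk \<tau>' ?a ?b s t (f s ?a ?b (Y s)) (f t ?a ?b (Y t))"
          by (rule good_nat[OF 1(3), rotated 6]) (use s t 1 les inA Y in \<open>auto intro!: max_in simp: le_max_iff_disj\<close>)
        moreover have "f s ?a ?b (X s) = f s ?a ?b (Y s)"
          unfolding X_def using s les by (intro f_comp[OF _ _ _ _ _ Y(1)]) auto
        moreover have "f t ?a ?b (X t) = f t ?a ?b (Y t)"
          unfolding X_def using t les by (intro f_comp[OF _ _ _ _ _ Y(1)]) auto
        ultimately show "lnk \<tau>' ?a ?b s t (f s ?a ?b (X s)) (f t ?a ?b (X t))" by simp
      qed (use e' 1 in auto)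
    qed
    moreover have "X p = X0" using Yp f_id[of p X0] X0 p by (simp add: X_def)
    ultimately show "\<exists>X. flat x y \<alpha> \<beta> X \<and> X p = X0" by blast
  qed
qed

text \<open>
  Only a pair with \<open>s \<le> y \<le> t\<close> is new. It is linked through the common value at \<open>y\<close>, which can
  be mapped to the common window of \<open>s\<close> and \<open>t\<close> by the hypothesis on the window ends.
\<close>

lemma flat_glue:
  assumes st: "step_on Z lo hi \<alpha>" "step_on Z lo hi \<beta>" and lohi: "0 \<le> lo" "hi \<le> 1"
    and xyz: "lo \<le> x" "x \<le> y" "y \<le> z" "z \<le> hi" "y \<in> D"
    and le: "\<And>s t. \<lbrakk>x \<le> s; s \<le> y; y \<le> t; t \<le> z\<rbrakk> \<Longrightarrow> \<alpha> y \<le> max (\<alpha> s) (\<alpha> t) \<and> \<beta> y \<le> max (\<beta> s) (\<beta> t)"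
    and X: "flat x y \<alpha> \<beta> X" and Y: "flat y z \<alpha> \<beta> Y" and eq: "X y = Y y"
  shows "flat x z \<alpha> \<beta> (\<lambda>s. if s \<le> y then X s else Y s)" (is "flat _ _ _ _ ?W")
  unfolding flat_def
proof (intro conjI ballI)
  fix s assume "s \<in> D \<inter> {x..z}"
  then show "?W s \<in> carrier (H s (\<alpha> s) (\<beta> s))" using flat_carrier[OF X] flat_carrier[OF Y] by auto
next
  have W2: "?W s = Y s" if "y \<le> s" for s using that eq by (cases "s = y") auto
  let ?L = "\<lambda>\<tau> s t. matched \<tau> \<alpha> \<beta> ?W s t"
  fix \<tau> assume \<tau>: "\<tau> \<in> {x..z}"
  consider "\<tau> < y" | "\<tau> > y" | "\<tau> = y" by linarith
  then show "\<exists>d>0. \<forall>s\<in>D \<inter> {x..z}. \<forall>t\<in>D \<inter> {x..z}. \<bar>s - \<tau>\<bar> < d \<longrightarrow> \<bar>t - \<tau>\<bar> < d \<longrightarrow> ?L \<tau> s t"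
  proof cases
    case 1
    then obtain d where d: "d > 0" "\<And>s t. \<lbrakk>s \<in> D \<inter> {x..y}; t \<in> D \<inter> {x..y}; \<bar>s - \<tau>\<bar> < d; \<bar>t - \<tau>\<bar> < d\<rbrakk> \<Longrightarrow>
     matched \<tau> \<alpha> \<beta> X s t"
      using flat_lnk[OF X, of \<tau>] \<tau> by auto
    show ?thesis
    proof (intro exI[of _ "min d (y - \<tau>)"] conjI ballI impI)
      fix s t assume s: "s\<in>D \<inter> {x..z}" "\<bar>s - \<tau>\<bar> < min d (y - \<tau>)" and t: "t\<in>D \<inter> {x..z}" "\<bar>t - \<tau>\<bar> < min d (y - \<tau>)"
      then have "s \<le> y" "t \<le> y" by auto
      then show "?L \<tau> s t" using d(2)[of s t] s t by auto
    qed (use 1 d in auto)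
  next
    case 2
    then obtain d where d: "d > 0" "\<And>s t. \<lbrakk>s \<in> D \<inter> {y..z}; t \<in> D \<inter> {y..z}; \<bar>s - \<tau>\<bar> < d; \<bar>t - \<tau>\<bar> < d\<rbrakk> \<Longrightarrow>
     matched \<tau> \<alpha> \<beta> Y s t"
      using flat_lnk[OF Y, of \<tau>] \<tau> by auto
    show ?thesis
    proof (intro exI[of _ "min d (\<tau> - y)"] conjI ballI impI)
      fix s t assume s: "s\<in>D \<inter> {x..z}" "\<bar>s - \<tau>\<bar> < min d (\<tau> - y)" and t: "t\<in>D \<inter> {x..z}" "\<bar>t - \<tau>\<bar> < min d (\<tau> - y)"
      then have "\<not> s \<le> y" "\<not> t \<le> y" by auto
      then show "?L \<tau> s t" using d(2)[of s t] s t by auto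
    qed (use 2 d in auto)
  next
    case 3
    have yhi: "y \<in> {lo..hi}" using xyz by auto
    obtain d0 A where 0: "d0 > 0" "finite A" "good_at y A d0" 
      "\<forall>s\<in>{lo..hi}. \<bar>s - y\<bar> < d0 \<longrightarrow> \<alpha> s \<in> A \<and> \<beta> s \<in> A"
      using stairs_common_levels[OF st(1,2) yhi lohi, of "{}"] by blast
    obtain d1 where d1: "d1 > 0" "\<And>s t. \<lbrakk>s \<in> D \<inter> {x..y}; t \<in> D \<inter> {x..y}; \<bar>s - y\<bar> < d1; \<bar>t - y\<bar> < d1\<rbrakk> \<Longrightarrow>
     matched y \<alpha> \<beta> X s t"
      using flat_lnk[OF X, of y] xyz by auto
    obtain d2 where d2: "d2 > 0" "\<And>s t. \<lbrakk>s \<in> D \<inter> {y..z}; t \<in> D \<inter> {y..z}; \<bar>s - y\<bar> < d2; \<bar>t - y\<bar> < d2\<rbrakk> \<Longrightarrow>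
     matched y \<alpha> \<beta> Y s t"
      using flat_lnk[OF Y, of y] xyz by auto
    define d where "d = min d0 (min d1 d2)"
    have main: "?L y s t" if s: "s\<in>D" "x \<le> s" "s \<le> y" "\<bar>s - y\<bar> < d" and t: "t\<in>D" "t \<le> z" "y \<le> t" "\<bar>t - y\<bar> < d" for s t
    proof -
      let ?a = "max (\<alpha> s) (\<alpha> t)" and ?b = "max (\<beta> s) (\<beta> t)"
      let ?a1 = "max (\<alpha> s) (\<alpha> y)" and ?b1 = "max (\<beta> s) (\<beta> y)"
      let ?a2 = "max (\<alpha> y) (\<alpha> t)" and ?b2 = "max (\<beta> y) (\<beta> t)"
      have inA: "\<alpha> s \<in> A" "\<beta> s \<in> A" "\<alpha> t \<in> A" "\<beta> t \<in> A" "\<alpha> y \<in> A" "\<beta> y \<in> A"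
        using 0(4)[rule_format, of s] 0(4)[rule_format, of t] 0(4)[rule_format, of y] s t xyz 0(1) by (auto simp: d_def)
      have lem: "?a1 \<le> ?a" "?b1 \<le> ?b" "?a2 \<le> ?a" "?b2 \<le> ?b" using le[of s t] s t by auto
      have c: "X s \<in> carrier (H s (\<alpha> s) (\<beta> s))" "X y \<in> carrier (H y (\<alpha> y) (\<beta> y))"
        "Y y \<in> carrier (H y (\<alpha> y) (\<beta> y))" "Y t \<in> carrier (H t (\<alpha> t) (\<beta> t))"
        using flat_carrier[OF X] flat_carrier[OF Y] s t xyz by auto
      have ds: "\<bar>s - y\<bar> < d0" "\<bar>s - y\<bar> < d1" "\<bar>t - y\<bar> < d0" "\<bar>t - y\<bar> < d2" using s t by (auto simp: d_def)
      have "lnk y ?a1 ?b1 s y (f s ?a1 ?b1 (X s)) (f y ?a1 ?b1 (X y))"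
        using d1(2)[of s y] s ds xyz d1(1) by auto
      then have "lnk y ?a ?b s y (f s ?a ?b (f s ?a1 ?b1 (X s))) (f y ?a ?b (f y ?a1 ?b1 (X y)))"
        by (rule good_nat[OF 0(3), rotated 6])
           (use s t ds 0(1) inA lem xyz c in \<open>auto intro!: max_in f_in[OF _ _ _ c(1)] f_in[OF _ _ _ c(2)]\<close>)
      then have 1: "lnk y ?a ?b s y (f s ?a ?b (X s)) (f y ?a ?b (X y))"
        using f_comp[OF _ _ _ _ _ c(1), of ?a1 ?b1 ?a ?b] f_comp[OF _ _ _ _ _ c(2), of ?a1 ?b1 ?a ?b] s lem xyz by simp
      have "lnk y ?a2 ?b2 y t (f y ?a2 ?b2 (Y y)) (f t ?a2 ?b2 (Y t))"
        using d2(2)[of y t] t ds xyz d2(1) by auto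
      then have "lnk y ?a ?b y t (f y ?a ?b (f y ?a2 ?b2 (Y y))) (f t ?a ?b (f t ?a2 ?b2 (Y t)))"
        by (rule good_nat[OF 0(3), rotated 6])
           (use s t ds 0(1) inA lem xyz c in \<open>auto intro!: max_in f_in[OF _ _ _ c(3)] f_in[OF _ _ _ c(4)]\<close>)
      then have 2: "lnk y ?a ?b y t (f y ?a ?b (Y y)) (f t ?a ?b (Y t))"
        using f_comp[OF _ _ _ _ _ c(3), of ?a2 ?b2 ?a ?b] f_comp[OF _ _ _ _ _ c(4), of ?a2 ?b2 ?a ?b] t lem xyz by simp
      have "lnk y ?a ?b s t (f s ?a ?b (X s)) (f t ?a ?b (Y t))"
        using lnk_trans[OF 1] 2 eq by simp
      then show ?thesis using s W2[OF t(3)] by simp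
    qed
    show ?thesis unfolding 3
    proof (intro exI[of _ d] conjI ballI impI)
      show "d > 0" using 0 d1 d2 by (simp add: d_def)
      fix s t assume s: "s\<in>D \<inter> {x..z}" "\<bar>s - y\<bar> < d" and t: "t\<in>D \<inter> {x..z}" "\<bar>t - y\<bar> < d"
      consider "s \<le> y" "t \<le> y" | "s \<ge> y" "t \<ge> y" | "s \<le> y" "t \<ge> y" | "s \<ge> y" "t \<le> y" by linarith
      then show "?L y s t"
      proof cases
        case 1
        then show ?thesis using d1(2)[of s t] s t by (auto simp: d_def)
      next
        case 2
        then show ?thesis using d2(2)[of s t] s t W2[of s] W2[of t] by (auto simp: d_def)
      next
        case 3
        then show ?thesis using main[of s t] s t by auto
      next
        case 4
        then have "?L y t s" using main[of t s] s t by auto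
        then have "lnk y (max (\<alpha> t) (\<alpha> s)) (max (\<beta> t) (\<beta> s)) s t
          (f s (max (\<alpha> t) (\<alpha> s)) (max (\<beta> t) (\<beta> s)) (?W s)) (f t (max (\<alpha> t) (\<alpha> s)) (max (\<beta> t) (\<beta> s)) (?W t))"
          by (rule lnk_sym)
        then show ?thesis unfolding max.commute[of "\<alpha> t" "\<alpha> s"] max.commute[of "\<beta> t" "\<beta> s"] .
      qed
    qed
  qed
qed

context
  fixes lo hi assumes lo: "lo \<in> D" and hi: "hi \<in> D" and lohi: "lo \<le> hi"
begin

lemma lohi01: "0 \<le> lo" "hi \<le> 1"
  using D01 lo hi by auto

lemma source_in: "source fw lo hi \<in> D" "lo \<le> source fw lo hi" "source fw lo hi \<le> hi"
  using lo hi lohi by (auto simp: source_def)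

text \<open>
  The local statement propagates equality from the source to the other end of a short interval;
  \<open>source (\<not> fw)\<close> denotes that other end.
\<close>

lemma flat_unique:
  assumes st: "step_on Z lo hi \<alpha>" "step_on Z lo hi \<beta>" and al: "along fw lo hi \<alpha>" "along fw lo hi \<beta>"
    and X: "flat lo hi \<alpha> \<beta> X" and Y: "flat lo hi \<alpha> \<beta> Y" and eq: "X (source fw lo hi) = Y (source fw lo hi)"
    and q: "q \<in> D" "lo \<le> q" "q \<le> hi"
  shows "X q = Y q"
proof -
  have "X (source fw x y) = Y (source fw x y) \<longrightarrow> X (source (\<not> fw) x y) = Y (source (\<not> fw) x y)"
    if xy: "x \<in> D" "y \<in> D" "lo \<le> x" "x \<le> y" "y \<le> hi" for x y
  proof (rule chain_on_dense[where D = D and lo = x and hi = y])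
    fix \<tau> assume "\<tau> \<in> {x..y}"
    then obtain d where d: "d > 0" "\<forall>s\<in>D \<inter> {lo..hi}. \<forall>t\<in>D \<inter> {lo..hi}. \<bar>s - \<tau>\<bar> < d \<longrightarrow> \<bar>t - \<tau>\<bar> < d \<longrightarrow>
      \<alpha> s \<le> \<alpha> t \<longrightarrow> \<beta> s \<le> \<beta> t \<longrightarrow> X s = Y s \<longrightarrow> X t = Y t"
      using flat_unique_local[OF st lohi01 _ X Y, of \<tau>] xy by force
    have "X (source fw s t) = Y (source fw s t) \<longrightarrow> X (source (\<not> fw) s t) = Y (source (\<not> fw) s t)"
      if s: "s \<in> D \<inter> {x..y}" "t \<in> D \<inter> {x..y}" "\<bar>s - \<tau>\<bar> < d" "\<bar>t - \<tau>\<bar> < d" "s \<le> t" for s t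
    proof (cases fw)
      case True
      then show ?thesis using al d(2)[rule_format, of s t] s xy monotone_onD[of "{lo..hi}" "(\<le>)" "(\<le>)" _ s t]
        by (auto simp: along_def source_def)
    next
      case False
      then show ?thesis using al d(2)[rule_format, of t s] s xy monotone_onD[of "{lo..hi}" "(\<le>)" "(\<ge>)" _ s t]
        by (auto simp: along_def source_def)
    qed
    then show "\<exists>d>0. \<forall>s\<in>D \<inter> {x..y}. \<forall>t\<in>D \<inter> {x..y}. \<bar>s - \<tau>\<bar> < d \<longrightarrow> \<bar>t - \<tau>\<bar> < d \<longrightarrow> s \<le> t \<longrightarrow>
       X (source fw s t) = Y (source fw s t) \<longrightarrow> X (source (\<not> fw) s t) = Y (source (\<not> fw) s t)"
      using d(1) by blast
  qed (use D_dense_within[of x y] xy lohi01 in \<open>auto simp: source_def split: if_splits\<close>)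
  from this[of lo q] this[of q hi] show ?thesis using eq q lo hi lohi by (cases fw) (auto simp: source_def)
qed

lemma flat_exists:
  assumes st: "step_on Z lo hi \<alpha>" "step_on Z lo hi \<beta>" and al: "along fw lo hi \<alpha>" "along fw lo hi \<beta>"
    and X0: "X0 \<in> carrier (H (source fw lo hi) (\<alpha> (source fw lo hi)) (\<beta> (source fw lo hi)))"
  shows "\<exists>X. flat lo hi \<alpha> \<beta> X \<and> X (source fw lo hi) = X0"
proof -
  define Q where "Q x y \<longleftrightarrow> (\<forall>X0\<in>carrier (H (source fw x y) (\<alpha> (source fw x y)) (\<beta> (source fw x y))).
    \<exists>X. flat x y \<alpha> \<beta> X \<and> X (source fw x y) = X0)" for x y
  have mono: "if fw then \<gamma> s \<le> \<gamma> t else \<gamma> t \<le> \<gamma> s" if "\<gamma> = \<alpha> \<or> \<gamma> = \<beta>" "s \<in> {lo..hi}" "t \<in> {lo..hi}" "s \<le> t" for \<gamma> s t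
    using al that monotone_onD[of "{lo..hi}" "(\<le>)" _ \<gamma> s t] by (auto simp: along_def)
  have "Q lo hi"
  proof (rule chain_on_dense[where D = D and lo = lo and hi = hi])
    fix x y z assume xyz: "x \<in> D \<inter> {lo..hi}" "y \<in> D \<inter> {lo..hi}" "z \<in> D \<inter> {lo..hi}" "x \<le> y" "y \<le> z"
      and xy: "Q x y" and yz: "Q y z"
    show "Q x z" unfolding Q_def
    proof
      fix X0 assume X0: "X0 \<in> carrier (H (source fw x z) (\<alpha> (source fw x z)) (\<beta> (source fw x z)))"
      have "\<exists>X Y. flat x y \<alpha> \<beta> X \<and> flat y z \<alpha> \<beta> Y \<and> X y = Y y \<and> (if fw then X x = X0 else Y z = X0)"
      proof (cases fw)
        case True
        then obtain X where X: "flat x y \<alpha> \<beta> X" "X x = X0" using xy X0 unfolding Q_def source_def by auto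
        then have "X y \<in> carrier (H y (\<alpha> y) (\<beta> y))" using flat_carrier xyz by auto
        then obtain Y where "flat y z \<alpha> \<beta> Y" "Y y = X y" using yz True unfolding Q_def source_def by auto
        then show ?thesis using X True by (intro exI[of _ X] exI[of _ Y]) auto
      next
        case False
        then obtain Y where Y: "flat y z \<alpha> \<beta> Y" "Y z = X0" using yz X0 unfolding Q_def source_def by auto
        then have "Y y \<in> carrier (H y (\<alpha> y) (\<beta> y))" using flat_carrier xyz by auto
        then obtain X where "flat x y \<alpha> \<beta> X" "X y = Y y" using xy False unfolding Q_def source_def by auto
        then show ?thesis using Y False by (intro exI[of _ X] exI[of _ Y]) auto
      qed
      then obtain X Y where XY: "flat x y \<alpha> \<beta> X" "flat y z \<alpha> \<beta> Y" "X y = Y y" "if fw then X x = X0 else Y z = X0" by blast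
      have "flat x z \<alpha> \<beta> (\<lambda>s. if s \<le> y then X s else Y s)"
      proof (rule flat_glue[OF st lohi01 _ _ _ _ _ _ XY(1,2)])
        fix s t assume "x \<le> s" "s \<le> y" "y \<le> t" "t \<le> z"
        then show "\<alpha> y \<le> max (\<alpha> s) (\<alpha> t) \<and> \<beta> y \<le> max (\<beta> s) (\<beta> t)"
          using mono[of \<alpha> s y] mono[of \<alpha> y t] mono[of \<beta> s y] mono[of \<beta> y t] xyz by (auto split: if_splits)
      qed (use xyz XY in auto)
      moreover have "(if source fw x z \<le> y then X (source fw x z) else Y (source fw x z)) = X0"
        using XY(3,4) xyz by (auto simp: source_def split: if_splits)
      ultimately show "\<exists>X. flat x z \<alpha> \<beta> X \<and> X (source fw x z) = X0" by blast
    qed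
  next
    fix \<tau> assume t: "\<tau> \<in> {lo..hi}"
    then obtain d where d: "d > 0" "\<forall>x\<in>D \<inter> {lo..hi}. \<forall>y\<in>D \<inter> {lo..hi}. \<forall>p\<in>D \<inter> {x..y}.
      \<bar>x - \<tau>\<bar> < d \<longrightarrow> \<bar>y - \<tau>\<bar> < d \<longrightarrow> (\<forall>s\<in>{x..y}. \<alpha> p \<le> \<alpha> s \<and> \<beta> p \<le> \<beta> s) \<longrightarrow>
      (\<forall>X0\<in>carrier (H p (\<alpha> p) (\<beta> p)). \<exists>X. flat x y \<alpha> \<beta> X \<and> X p = X0)"
      using flat_exists_local[OF st lohi01 t] by blast
    have "Q x y" if xy: "x \<in> D \<inter> {lo..hi}" "y \<in> D \<inter> {lo..hi}" "\<bar>x - \<tau>\<bar> < d" "\<bar>y - \<tau>\<bar> < d" "x \<le> y" for x y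
    proof -
      let ?p = "source fw x y"
      have p: "?p \<in> D \<inter> {x..y}" using xy by (auto simp: source_def)
      have "\<gamma> ?p \<le> \<gamma> s" if "\<gamma> = \<alpha> \<or> \<gamma> = \<beta>" "s \<in> {x..y}" for \<gamma> s
        using mono[of \<gamma> x s] mono[of \<gamma> s y] that xy by (auto simp: source_def split: if_splits)
      then show ?thesis unfolding Q_def using d(2)[rule_format, OF xy(1,2) p xy(3,4)] by blast
    qed
    then show "\<exists>d>0. \<forall>x\<in>D \<inter> {lo..hi}. \<forall>y\<in>D \<inter> {lo..hi}. \<bar>x - \<tau>\<bar> < d \<longrightarrow> \<bar>y - \<tau>\<bar> < d \<longrightarrow> x \<le> y \<longrightarrow> Q x y"
      using d(1) by blast
  qed (use D_dense_within[OF lohi01] lo hi lohi in auto)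
  then show ?thesis using X0 unfolding Q_def by blast
qed

end

section \<open>Transport in the iterated limit\<close>

abbreviation HB :: "real \<Rightarrow> real \<Rightarrow> ('k, real \<Rightarrow> 'h) module" where
  "HB r b \<equiv> inverse_limit (\<lambda>a. H r a b) (\<lambda>a a'. f r a' b)"

abbreviation HBmap :: "real \<Rightarrow> real \<Rightarrow> real \<Rightarrow> (real \<Rightarrow> 'h) \<Rightarrow> real \<Rightarrow> 'h" where
  "HBmap r \<equiv> (\<lambda>b b' h a. f r a b' (h a))"

lemma HB_iff: "h \<in> carrier (HB r b) \<longleftrightarrow> (\<forall>i. h i \<in> carrier (H r i b)) \<and> (\<forall>i j. i \<le> j \<longrightarrow> f r j b (h i) = h j)"
  by (simp add: inverse_limit_def)

lemma HB_carrier: "h \<in> carrier (HB r b) \<Longrightarrow> h i \<in> carrier (H r i b)"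
  by (simp add: HB_iff)

lemma HB_restrict:
  assumes "r \<in> D" "h \<in> carrier (HB r b)" "i \<le> j" "b \<le> b'"
  shows "f r j b' (h i) = f r j b' (h j)"
proof -
  have "f r j b' (h j) = f r j b' (f r j b (h i))" using assms by (simp add: HB_iff)
  also have "\<dots> = f r j b' (h i)" by (rule f_comp[OF assms(1,3) _ _ assms(4)]) (use assms HB_carrier in auto)
  finally show ?thesis by simp
qed

lemma HB_directed:
  assumes r: "r \<in> D"
  shows "directed_system (HB r) (HBmap r)"
  unfolding directed_system_def
proof (intro conjI allI impI)
  fix i j x assume "i \<le> j" "x \<in> carrier (HB r i)"
  then show "HBmap r i j x \<in> carrier (HB r j)"
    unfolding HB_iff using r by (auto intro: f_in simp: f_comp) (metis f_comp order.refl)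
next
  fix i x assume "x \<in> carrier (HB r i)"
  then show "HBmap r i i x = x" using r by (auto simp: HB_iff f_id)
next
  fix i j l x assume ij: "i \<le> j" "j \<le> l" and x: "x \<in> carrier (HB r i)"
  show "HBmap r j l (HBmap r i j x) = HBmap r i l x"
    by (rule ext, rule f_comp[OF r order.refl ij(1) order.refl ij(2) HB_carrier[OF x]])
next
  fix i x y assume xy: "x \<in> carrier (HB r i)" "y \<in> carrier (HB r i)"
  then show "x \<oplus>\<^bsub>HB r i\<^esub> y \<in> carrier (HB r i)"
    unfolding HB_iff using r by (auto simp: inverse_limit_def H_add f_add)
next
  fix i k x assume xy: "x \<in> carrier (HB r i)"
  then show "k \<odot>\<^bsub>HB r i\<^esub> x \<in> carrier (HB r i)"
    unfolding HB_iff using r by (auto simp: inverse_limit_def H_smult f_smult)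
next
  fix i j x y assume "i \<le> j" "x \<in> carrier (HB r i)" "y \<in> carrier (HB r i)"
  then show "HBmap r i j (x \<oplus>\<^bsub>HB r i\<^esub> y) = HBmap r i j x \<oplus>\<^bsub>HB r j\<^esub> HBmap r i j y"
    unfolding HB_iff using r by (auto simp: inverse_limit_def f_add)
next
  fix i j k x assume "i \<le> j" "x \<in> carrier (HB r i)"
  then show "HBmap r i j (k \<odot>\<^bsub>HB r i\<^esub> x) = k \<odot>\<^bsub>HB r j\<^esub> HBmap r i j x"
    unfolding HB_iff using r by (auto simp: inverse_limit_def f_smult)
qed

abbreviation coherent :: "real \<Rightarrow> real \<Rightarrow> real \<Rightarrow> real \<Rightarrow> real \<Rightarrow> real \<Rightarrow> (real \<Rightarrow> real \<Rightarrow> 'h) \<Rightarrow> bool" where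
  "coherent lo hi \<tau> d x y \<xi> \<equiv> \<forall>s\<in>D \<inter> {lo..hi}. \<forall>t\<in>D \<inter> {lo..hi}. \<bar>s - \<tau>\<bar> < d \<longrightarrow> \<bar>t - \<tau>\<bar> < d \<longrightarrow>
     lnk \<tau> x y s t (f s x y (\<xi> s x)) (f t x y (\<xi> t x))"

text \<open>
  A family of elements of the inverse limits over all lower ends, for the upper end \<open>B\<close>. The level
  \<open>B\<close> itself may be occupied by the curve; hence the components are compared only after mapping
  them to windows whose ends are free.
\<close>

definition flat_section :: "real \<Rightarrow> real \<Rightarrow> real \<Rightarrow> (real \<Rightarrow> real \<Rightarrow> 'h) \<Rightarrow> bool" where
  "flat_section lo hi B \<xi> \<longleftrightarrow> (\<forall>s\<in>D \<inter> {lo..hi}. \<xi> s \<in> carrier (HB s B)) \<and>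
     (\<forall>\<tau>\<in>{lo..hi}. \<forall>x y. (\<tau>, x) \<notin> Z \<longrightarrow> (\<tau>, y) \<notin> Z \<longrightarrow> B \<le> y \<longrightarrow>
       (\<exists>d>0. coherent lo hi \<tau> d x y \<xi>))"

context
  fixes lo hi assumes lo: "lo \<in> D" and hi: "hi \<in> D" and lohi: "lo \<le> hi"
begin

lemma flat_section_carrier: "flat_section lo hi B \<xi> \<Longrightarrow> s \<in> D \<Longrightarrow> lo \<le> s \<Longrightarrow> s \<le> hi \<Longrightarrow> \<xi> s \<in> carrier (HB s B)"
  by (simp add: flat_section_def)

lemma flat_section_lnk:
  assumes "flat_section lo hi B \<xi>" "\<tau> \<in> {lo..hi}" "(\<tau>, x) \<notin> Z" "(\<tau>, y) \<notin> Z" "B \<le> y"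
  shows "\<exists>d>0. coherent lo hi \<tau> d x y \<xi>"
  using assms by (simp add: flat_section_def)

lemma flat_section_push:
  assumes \<xi>: "flat_section lo hi B \<xi>" and BC: "B \<le> C"
  shows "flat_section lo hi C (\<lambda>s. HBmap s B C (\<xi> s))"
  unfolding flat_section_def
proof (intro conjI ballI allI impI)
  fix s assume "s \<in> D \<inter> {lo..hi}"
  then show "HBmap s B C (\<xi> s) \<in> carrier (HB s C)"
    using sys_in[OF HB_directed BC, of s "\<xi> s"] flat_section_carrier[OF \<xi>] by auto
next
  fix \<tau> x y assume t: "\<tau> \<in> {lo..hi}" "(\<tau>, x) \<notin> Z" "(\<tau>, y) \<notin> Z" "C \<le> y"
  have "f s x y (f s x C (\<xi> s x)) = f s x y (\<xi> s x)" if "s \<in> D \<inter> {lo..hi}" for s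
    by (rule f_comp[of _ _ x B C]) (use that t BC HB_carrier[OF flat_section_carrier[OF \<xi>]] in auto)
  then show "\<exists>d>0. \<forall>s\<in>D \<inter> {lo..hi}. \<forall>t\<in>D \<inter> {lo..hi}. \<bar>s - \<tau>\<bar> < d \<longrightarrow> \<bar>t - \<tau>\<bar> < d \<longrightarrow>
          lnk \<tau> x y s t (f s x y (f s x C (\<xi> s x))) (f t x y (f t x C (\<xi> t x)))"
    using flat_section_lnk[OF \<xi> t(1-3)] t(4) BC by simp
qed

lemma flat_section_add:
  assumes \<xi>: "flat_section lo hi B \<xi>" and \<zeta>: "flat_section lo hi B \<zeta>"
  shows "flat_section lo hi B (\<lambda>s. \<xi> s \<oplus>\<^bsub>HB s B\<^esub> \<zeta> s)"
  unfolding flat_section_def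
proof (intro conjI ballI allI impI)
  fix s assume "s \<in> D \<inter> {lo..hi}"
  then show "\<xi> s \<oplus>\<^bsub>HB s B\<^esub> \<zeta> s \<in> carrier (HB s B)"
    using sys_add_in[OF HB_directed, of s "\<xi> s" B "\<zeta> s"] flat_section_carrier[OF \<xi>] flat_section_carrier[OF \<zeta>] by auto
next
  fix \<tau> x y assume t: "\<tau> \<in> {lo..hi}" "(\<tau>, x) \<notin> Z" "(\<tau>, y) \<notin> Z" "B \<le> y"
  obtain d1 where d1: "d1 > 0" "coherent lo hi \<tau> d1 x y \<xi>" using flat_section_lnk[OF \<xi> t] by blast
  obtain d2 where d2: "d2 > 0" "coherent lo hi \<tau> d2 x y \<zeta>" using flat_section_lnk[OF \<zeta> t] by blast
  obtain e where e: "e > 0" "good_at \<tau> {x, y} e"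
    using good_at_exists[of \<tau> "{x, y}"] t lohi01[OF lo hi lohi] by auto
  have c: "\<xi> s x \<in> carrier (H s x B)" "\<zeta> s x \<in> carrier (H s x B)" if "s \<in> D \<inter> {lo..hi}" for s
    using that HB_carrier[OF flat_section_carrier[OF \<xi>]] HB_carrier[OF flat_section_carrier[OF \<zeta>]] by auto
  show "\<exists>d>0. \<forall>s\<in>D \<inter> {lo..hi}. \<forall>t\<in>D \<inter> {lo..hi}. \<bar>s - \<tau>\<bar> < d \<longrightarrow> \<bar>t - \<tau>\<bar> < d \<longrightarrow>
          lnk \<tau> x y s t (f s x y ((\<xi> s \<oplus>\<^bsub>HB s B\<^esub> \<zeta> s) x)) (f t x y ((\<xi> t \<oplus>\<^bsub>HB t B\<^esub> \<zeta> t) x))"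
  proof (intro exI[of _ "min e (min d1 d2)"] conjI ballI impI)
    fix s u assume s: "s \<in> D \<inter> {lo..hi}" "\<bar>s - \<tau>\<bar> < min e (min d1 d2)"
      and u: "u \<in> D \<inter> {lo..hi}" "\<bar>u - \<tau>\<bar> < min e (min d1 d2)"
    have "lnk \<tau> x y s u (f s x y (\<xi> s x) \<oplus>\<^bsub>H s x y\<^esub> f s x y (\<zeta> s x)) (f u x y (\<xi> u x) \<oplus>\<^bsub>H u x y\<^esub> f u x y (\<zeta> u x))"
      by (rule good_add[OF e(2)]) (use s u d1 d2 c t in \<open>auto intro!: f_in[where a = x and b = B]\<close>)
    then show "lnk \<tau> x y s u (f s x y ((\<xi> s \<oplus>\<^bsub>HB s B\<^esub> \<zeta> s) x)) (f u x y ((\<xi> u \<oplus>\<^bsub>HB u B\<^esub> \<zeta> u) x))"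
      using s u c t by (simp add: inverse_limit_def f_add)
  qed (use e d1 d2 in auto)
qed

lemma flat_section_smult:
  assumes \<xi>: "flat_section lo hi B \<xi>"
  shows "flat_section lo hi B (\<lambda>s. k \<odot>\<^bsub>HB s B\<^esub> \<xi> s)"
  unfolding flat_section_def
proof (intro conjI ballI allI impI)
  fix s assume "s \<in> D \<inter> {lo..hi}"
  then show "k \<odot>\<^bsub>HB s B\<^esub> \<xi> s \<in> carrier (HB s B)"
    using sys_smult_in[OF HB_directed, of s "\<xi> s" B k] flat_section_carrier[OF \<xi>] by auto
next
  fix \<tau> x y assume t: "\<tau> \<in> {lo..hi}" "(\<tau>, x) \<notin> Z" "(\<tau>, y) \<notin> Z" "B \<le> y"
  obtain d1 where d1: "d1 > 0" "coherent lo hi \<tau> d1 x y \<xi>" using flat_section_lnk[OF \<xi> t] by blast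
  obtain e where e: "e > 0" "good_at \<tau> {x, y} e"
    using good_at_exists[of \<tau> "{x, y}"] t lohi01[OF lo hi lohi] by auto
  have c: "\<xi> s x \<in> carrier (H s x B)" if "s \<in> D \<inter> {lo..hi}" for s
    using that HB_carrier[OF flat_section_carrier[OF \<xi>]] by auto
  show "\<exists>d>0. \<forall>s\<in>D \<inter> {lo..hi}. \<forall>t\<in>D \<inter> {lo..hi}. \<bar>s - \<tau>\<bar> < d \<longrightarrow> \<bar>t - \<tau>\<bar> < d \<longrightarrow>
          lnk \<tau> x y s t (f s x y ((k \<odot>\<^bsub>HB s B\<^esub> \<xi> s) x)) (f t x y ((k \<odot>\<^bsub>HB t B\<^esub> \<xi> t) x))"
  proof (intro exI[of _ "min e d1"] conjI ballI impI)
    fix s u assume s: "s \<in> D \<inter> {lo..hi}" "\<bar>s - \<tau>\<bar> < min e d1"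
      and u: "u \<in> D \<inter> {lo..hi}" "\<bar>u - \<tau>\<bar> < min e d1"
    have "lnk \<tau> x y s u (k \<odot>\<^bsub>H s x y\<^esub> f s x y (\<xi> s x)) (k \<odot>\<^bsub>H u x y\<^esub> f u x y (\<xi> u x))"
      by (rule good_smult[OF e(2)]) (use s u d1 c t in \<open>auto intro!: f_in[where a = x and b = B]\<close>)
    then show "lnk \<tau> x y s u (f s x y ((k \<odot>\<^bsub>HB s B\<^esub> \<xi> s) x)) (f u x y ((k \<odot>\<^bsub>HB u B\<^esub> \<xi> u) x))"
      using s u c t by (simp add: inverse_limit_def f_smult)
  qed (use e d1 in auto)
qed

text \<open>
  A flat section restricts to a flat family for every pair of staircases. Near \<open>\<tau>\<close> the staircases
  take finitely many values, and one radius serves them all.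
\<close>

lemma flat_section_flat:
  assumes \<xi>: "flat_section lo hi B \<xi>" and st: "step_on Z lo hi \<alpha>" "step_on Z lo hi \<beta>"
    and B: "\<And>s. s \<in> {lo..hi} \<Longrightarrow> B \<le> \<beta> s"
  shows "flat lo hi \<alpha> \<beta> (\<lambda>s. f s (\<alpha> s) (\<beta> s) (\<xi> s (\<alpha> s)))"
  unfolding flat_def
proof (intro conjI ballI)
  fix s assume s: "s \<in> D \<inter> {lo..hi}"
  then show "f s (\<alpha> s) (\<beta> s) (\<xi> s (\<alpha> s)) \<in> carrier (H s (\<alpha> s) (\<beta> s))"
    using B HB_carrier[OF flat_section_carrier[OF \<xi>]] by (intro f_in[where a = "\<alpha> s" and b = B]) auto
next
  fix \<tau> assume \<tau>: "\<tau> \<in> {lo..hi}"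
  obtain d0 A where 0: "d0 > 0" "finite A" "\<forall>l\<in>A. (\<tau>, l) \<notin> Z"
    "\<forall>s\<in>{lo..hi}. \<bar>s - \<tau>\<bar> < d0 \<longrightarrow> \<alpha> s \<in> A \<and> \<beta> s \<in> A"
    using stairs_common_levels[OF st \<tau> lohi01[OF lo hi lohi], of "{}"] by blast
  have "\<exists>d>0. \<forall>(x, y)\<in>A \<times> (A \<inter> {B..}). coherent lo hi \<tau> d x y \<xi>"
  proof (rule finite_common_radius)
    fix p assume "p \<in> A \<times> (A \<inter> {B..})"
    then obtain x y where "p = (x, y)" "x \<in> A" "y \<in> A" "B \<le> y" by auto
    then show "\<exists>d>0. case p of (x, y) \<Rightarrow> coherent lo hi \<tau> d x y \<xi>"
      using flat_section_lnk[OF \<xi> \<tau>, of x y] 0(3) by simp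
  qed (use 0 in auto)
  then obtain d where d: "d > 0" "\<And>x y s t. \<lbrakk>x \<in> A; y \<in> A; B \<le> y; s\<in>D \<inter> {lo..hi}; t\<in>D \<inter> {lo..hi}; \<bar>s - \<tau>\<bar> < d; \<bar>t - \<tau>\<bar> < d\<rbrakk> \<Longrightarrow>
          lnk \<tau> x y s t (f s x y (\<xi> s x)) (f t x y (\<xi> t x))" by fastforce
  have key: "f s a b (f s (\<alpha> s) (\<beta> s) (\<xi> s (\<alpha> s))) = f s a b (\<xi> s a)"
    if "s \<in> D \<inter> {lo..hi}" "\<alpha> s \<le> a" "\<beta> s \<le> b" for s a b
  proof -
    have "f s a b (f s (\<alpha> s) (\<beta> s) (\<xi> s (\<alpha> s))) = f s a b (\<xi> s (\<alpha> s))"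
      by (rule f_comp[where a = "\<alpha> s" and b = B]) (use that B HB_carrier[OF flat_section_carrier[OF \<xi>]] in auto)
    also have "\<dots> = f s a b (\<xi> s a)"
      by (rule HB_restrict[where b = B]) (use that B[of s] flat_section_carrier[OF \<xi>] in auto)
    finally show ?thesis .
  qed
  show "\<exists>d>0. \<forall>s\<in>D \<inter> {lo..hi}. \<forall>t\<in>D \<inter> {lo..hi}. \<bar>s - \<tau>\<bar> < d \<longrightarrow> \<bar>t - \<tau>\<bar> < d \<longrightarrow>
        lnk \<tau> (max (\<alpha> s) (\<alpha> t)) (max (\<beta> s) (\<beta> t)) s t
          (f s (max (\<alpha> s) (\<alpha> t)) (max (\<beta> s) (\<beta> t)) (f s (\<alpha> s) (\<beta> s) (\<xi> s (\<alpha> s))))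
          (f t (max (\<alpha> s) (\<alpha> t)) (max (\<beta> s) (\<beta> t)) (f t (\<alpha> t) (\<beta> t) (\<xi> t (\<alpha> t))))"
  proof (intro exI[of _ "min d0 d"] conjI ballI impI)
    fix s t assume s: "s \<in> D \<inter> {lo..hi}" "\<bar>s - \<tau>\<bar> < min d0 d" and t: "t \<in> D \<inter> {lo..hi}" "\<bar>t - \<tau>\<bar> < min d0 d"
    have "B \<le> max (\<beta> s) (\<beta> t)" using B[of s] s by auto
    then show "lnk \<tau> (max (\<alpha> s) (\<alpha> t)) (max (\<beta> s) (\<beta> t)) s t
          (f s (max (\<alpha> s) (\<alpha> t)) (max (\<beta> s) (\<beta> t)) (f s (\<alpha> s) (\<beta> s) (\<xi> s (\<alpha> s))))
          (f t (max (\<alpha> s) (\<alpha> t)) (max (\<beta> s) (\<beta> t)) (f t (\<alpha> t) (\<beta> t) (\<xi> t (\<alpha> t))))"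
      using key[OF s(1)] key[OF t(1)] d(2)[OF _ _ _ s(1) t(1)] 0(4) s t by (simp add: max_in)
  qed (use 0 d in auto)
qed

text \<open>
  For each lower end \<open>a\<close> the two sections are restricted to a staircase below \<open>a\<close> and to a
  staircase between \<open>B\<close> and \<open>l\<close>, where transport is unique. The level \<open>l\<close> does not depend on \<open>a\<close>,
  so the equality holds in the inverse limit.
\<close>

lemma flat_section_unique:
  assumes \<xi>: "flat_section lo hi B \<xi>" and \<zeta>: "flat_section lo hi B \<zeta>"
    and eq: "\<xi> (source fw lo hi) = \<zeta> (source fw lo hi)" and q: "q \<in> D" "lo \<le> q" "q \<le> hi"
  shows "\<exists>l\<ge>B. HBmap q B l (\<xi> q) = HBmap q B l (\<zeta> q)"
proof -
  obtain l \<beta> where \<beta>: "step_on Z lo hi \<beta>" "along fw lo hi \<beta>" "\<And>s. s \<in> {lo..hi} \<Longrightarrow> B \<le> \<beta> s \<and> \<beta> s \<le> l"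
    using stair_above[OF lohi01(1)[OF lo hi lohi] lohi lohi01(2)[OF lo hi lohi]] by blast
  have "f q a l (\<xi> q a) = f q a l (\<zeta> q a)" for a
  proof -
    obtain \<alpha> where \<alpha>: "step_on Z lo hi \<alpha>" "along fw lo hi \<alpha>" "\<And>s. s \<in> {lo..hi} \<Longrightarrow> \<alpha> s \<le> a"
      using stair_below[OF lohi01(1)[OF lo hi lohi] lohi lohi01(2)[OF lo hi lohi]] by blast
    have e: "f q (\<alpha> q) (\<beta> q) (\<xi> q (\<alpha> q)) = f q (\<alpha> q) (\<beta> q) (\<zeta> q (\<alpha> q))"
      by (rule flat_unique[OF lo hi lohi \<alpha>(1) \<beta>(1) \<alpha>(2) \<beta>(2) flat_section_flat[OF \<xi> \<alpha>(1) \<beta>(1)]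
            flat_section_flat[OF \<zeta> \<alpha>(1) \<beta>(1)] _ q]) (use \<beta> eq in auto)
    have "f q a l (\<xi>' q a) = f q a l (f q (\<alpha> q) (\<beta> q) (\<xi>' q (\<alpha> q)))" if "flat_section lo hi B \<xi>'" for \<xi>'
    proof -
      have c: "\<xi>' q \<in> carrier (HB q B)" by (rule flat_section_carrier[OF that q])
      have "f q a l (f q (\<alpha> q) (\<beta> q) (\<xi>' q (\<alpha> q))) = f q a l (\<xi>' q (\<alpha> q))"
        by (rule f_comp[where a = "\<alpha> q" and b = B]) (use q \<alpha>(3)[of q] \<beta>(3)[of q] HB_carrier[OF c] in auto)
      also have "\<dots> = f q a l (\<xi>' q a)"
        by (rule HB_restrict[where b = B]) (use q \<alpha>(3)[of q] \<beta>(3)[of q] c in auto)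
      finally show ?thesis by simp
    qed
    then show ?thesis using \<xi> \<zeta> e by metis
  qed
  moreover have "B \<le> l" using \<beta>(3)[of lo] lohi by auto
  ultimately show ?thesis by auto
qed

text \<open>
  For each lower end \<open>a\<close> the class is transported with the lower window end on a staircase \<open>\<alpha> a\<close>
  below \<open>a\<close>, and then mapped to the window \<open>(a,B)\<close>. The staircases for different \<open>a\<close> are
  unrelated; the transported classes for \<open>i\<close> and \<open>j\<close> are compared along the maximum of both
  staircases, where they agree by uniqueness.
\<close>

lemma flat_section_exists:
  assumes h: "h \<in> carrier (HB p b)" and p: "p = source fw lo hi"
  shows "\<exists>B\<ge>b. \<exists>\<xi>. flat_section lo hi B \<xi> \<and> \<xi> p = HBmap p b B h"
proof -
  note 01 = lohi01[OF lo hi lohi]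
  have pD: "p \<in> D" "lo \<le> p" "p \<le> hi" using source_in[OF lo hi lohi] p by auto
  obtain B \<beta> where \<beta>: "step_on Z lo hi \<beta>" "along fw lo hi \<beta>" "\<And>s. s \<in> {lo..hi} \<Longrightarrow> b \<le> \<beta> s \<and> \<beta> s \<le> B"
    using stair_above[OF 01(1) lohi 01(2)] by blast
  have "\<forall>a. \<exists>\<alpha>. step_on Z lo hi \<alpha> \<and> along fw lo hi \<alpha> \<and> (\<forall>s\<in>{lo..hi}. \<alpha> s \<le> a)"
    using stair_below[OF 01(1) lohi 01(2)] by blast
  then obtain \<alpha> where \<alpha>: "\<And>a. step_on Z lo hi (\<alpha> a)" "\<And>a. along fw lo hi (\<alpha> a)" "\<And>a s. s \<in> {lo..hi} \<Longrightarrow> \<alpha> a s \<le> a"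
    by metis
  define X0 where "X0 a = f p (\<alpha> a p) (\<beta> p) (h (\<alpha> a p))" for a
  have X0c: "X0 a \<in> carrier (H p (\<alpha> a p) (\<beta> p))" for a
    unfolding X0_def by (rule f_in[where a = "\<alpha> a p" and b = b]) (use pD \<beta>(3)[of p] HB_carrier[OF h] in auto)
  have "\<forall>a. \<exists>X. flat lo hi (\<alpha> a) \<beta> X \<and> X p = X0 a"
    using flat_exists[OF lo hi lohi \<alpha>(1) \<beta>(1) \<alpha>(2) \<beta>(2), of "X0 _"] X0c unfolding p by blast
  then obtain X where X: "\<And>a. flat lo hi (\<alpha> a) \<beta> (X a)" "\<And>a. X a p = X0 a" by metis
  have Xc: "X a s \<in> carrier (H s (\<alpha> a s) (\<beta> s))" if "s \<in> D \<inter> {lo..hi}" for a s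
    using flat_carrier[OF X(1)] that by auto
  define \<xi> where "\<xi> s a = f s a B (X a s)" for s a
  have Xpush: "f s a' b' (f s a B (X a s)) = f s a' b' (X a s)" if "s \<in> D \<inter> {lo..hi}" "a \<le> a'" "B \<le> b'" for s a a' b'
    by (rule f_comp[OF _ _ _ _ _ Xc]) (use that \<alpha>(3)[of s a] \<beta>(3)[of s] in auto)
  have compat: "f s j B (X i s) = f s j B (X j s)" if s: "s \<in> D \<inter> {lo..hi}" and ij: "i \<le> j" for s i j
  proof -
    let ?g = "\<lambda>s. max (\<alpha> i s) (\<alpha> j s)"
    have g: "step_on Z lo hi ?g" "along fw lo hi ?g" by (rule step_on_max[OF \<alpha>(1) \<alpha>(1)]) (rule along_max[OF \<alpha>(2) \<alpha>(2)])
    have F: "flat lo hi ?g \<beta> (\<lambda>s. f s (?g s) (\<beta> s) (X i s))" "flat lo hi ?g \<beta> (\<lambda>s. f s (?g s) (\<beta> s) (X j s))"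
      by (rule flat_push[OF \<alpha>(1) \<beta>(1) g(1) \<beta>(1) _ X(1) 01], simp)+
    have init: "f p (?g p) (\<beta> p) (X k p) = f p (?g p) (\<beta> p) (h (?g p))" if "\<alpha> k p \<le> ?g p" for k
    proof -
      have "f p (?g p) (\<beta> p) (X k p) = f p (?g p) (\<beta> p) (h (\<alpha> k p))"
        unfolding X X0_def by (rule f_comp[where a = "\<alpha> k p" and b = b]) (use pD \<beta>(3)[of p] HB_carrier[OF h] that in auto)
      also have "\<dots> = f p (?g p) (\<beta> p) (h (?g p))"
        by (rule HB_restrict[where b = b]) (use pD \<beta>(3)[of p] h that in auto)
      finally show ?thesis .
    qed
    have "f s (?g s) (\<beta> s) (X i s) = f s (?g s) (\<beta> s) (X j s)"
      by (rule flat_unique[OF lo hi lohi g(1) \<beta>(1) g(2) \<beta>(2) F]) (use s init[of i] init[of j] p in auto)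
    moreover have "f s j B (f s (?g s) (\<beta> s) (X k s)) = f s j B (X k s)" if "\<alpha> k s \<le> ?g s" for k
      by (rule f_comp[OF _ _ _ _ _ Xc]) (use s ij that \<alpha>(3)[of s i] \<alpha>(3)[of s j] \<beta>(3)[of s] in auto)
    ultimately show ?thesis by (metis max.cobounded1 max.cobounded2)
  qed
  have bB: "b \<le> B" using \<beta>(3)[of lo] lohi by auto
  have "flat_section lo hi B \<xi>" unfolding flat_section_def
  proof (intro conjI ballI allI impI)
    fix s assume s: "s \<in> D \<inter> {lo..hi}"
    have "\<xi> s i \<in> carrier (H s i B)" for i
      unfolding \<xi>_def by (rule f_in[OF _ _ _ Xc]) (use s \<alpha>(3)[of s i] \<beta>(3)[of s] in auto)
    moreover have "f s j B (\<xi> s i) = \<xi> s j" if "i \<le> j" for i j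
      unfolding \<xi>_def using Xpush[OF s that order.refl] compat[OF s that] by simp
    ultimately show "\<xi> s \<in> carrier (HB s B)" unfolding HB_iff by simp
  next
    fix \<tau> x y assume t: "\<tau> \<in> {lo..hi}" "(\<tau>, x) \<notin> Z" "(\<tau>, y) \<notin> Z" "B \<le> y"
    obtain d0 A where 0: "d0 > 0" "finite A" "{x, y} \<subseteq> A" "good_at \<tau> A d0"
      "\<forall>s\<in>{lo..hi}. \<bar>s - \<tau>\<bar> < d0 \<longrightarrow> \<alpha> x s \<in> A \<and> \<beta> s \<in> A"
      using stairs_common_levels[OF \<alpha>(1)[of x] \<beta>(1) t(1) 01, of "{x, y}"] t by auto
    obtain d where d: "d > 0" "\<And>s t. \<lbrakk>s \<in> D \<inter> {lo..hi}; t \<in> D \<inter> {lo..hi}; \<bar>s - \<tau>\<bar> < d; \<bar>t - \<tau>\<bar> < d\<rbrakk> \<Longrightarrow>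
     matched \<tau> (\<alpha> x) \<beta> (X x) s t"
      using flat_lnk[OF X(1) t(1)] by blast
    show "\<exists>d>0. coherent lo hi \<tau> d x y \<xi>"
    proof (intro exI[of _ "min d0 d"] conjI ballI impI)
      fix s u assume s: "s \<in> D \<inter> {lo..hi}" "\<bar>s - \<tau>\<bar> < min d0 d" and u: "u \<in> D \<inter> {lo..hi}" "\<bar>u - \<tau>\<bar> < min d0 d"
      let ?a = "max (\<alpha> x s) (\<alpha> x u)" and ?b = "max (\<beta> s) (\<beta> u)"
      have le: "?a \<le> x" "?b \<le> y" using \<alpha>(3)[of s x] \<alpha>(3)[of u x] \<beta>(3)[of s] \<beta>(3)[of u] s u t by auto
      have l: "lnk \<tau> ?a ?b s u (f s ?a ?b (X x s)) (f u ?a ?b (X x u))" using d(2)[of s u] s u by auto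
      have "lnk \<tau> x y s u (f s x y (f s ?a ?b (X x s))) (f u x y (f u ?a ?b (X x u)))"
        by (rule good_nat[OF 0(4) _ _ _ _ _ _ l])
           (use 0 s u le in \<open>auto intro!: max_in f_in[OF _ _ _ Xc]\<close>)
      moreover have "f s x y (f s ?a ?b (X x s)) = f s x y (X x s)" "f u x y (f u ?a ?b (X x u)) = f u x y (X x u)"
        using s u le by (auto intro!: f_comp[OF _ _ _ _ _ Xc])
      ultimately show "lnk \<tau> x y s u (f s x y (\<xi> s x)) (f u x y (\<xi> u x))"
        unfolding \<xi>_def using Xpush[OF s(1) order.refl t(4), of x] Xpush[OF u(1) order.refl t(4), of x] by simp
    qed (use 0 d in auto)
  qed
  moreover have "\<xi> p = HBmap p b B h"
  proof
    fix a
    have "\<xi> p a = f p a B (h (\<alpha> a p))"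
      unfolding \<xi>_def X X0_def by (rule f_comp[where a = "\<alpha> a p" and b = b]) (use pD \<alpha>(3)[of p a] \<beta>(3)[of p] HB_carrier[OF h] in auto)
    also have "\<dots> = f p a B (h a)"
      by (rule HB_restrict[where b = b]) (use pD \<alpha>(3)[of p a] h bB in auto)
    finally show "\<xi> p a = HBmap p b B h a" .
  qed
  ultimately show ?thesis using bB by blast
qed

lemma flat_section_rel:
  assumes \<xi>: "flat_section lo hi B \<xi>" and \<zeta>: "flat_section lo hi C \<zeta>" and p: "p = source fw lo hi"
    and rel: "((B, \<xi> p), (C, \<zeta> p)) \<in> direct_limit_rel (HB p) (HBmap p)"
    and q: "q \<in> D" "lo \<le> q" "q \<le> hi"
  shows "((B, \<xi> q), (C, \<zeta> q)) \<in> direct_limit_rel (HB q) (HBmap q)"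
proof -
  obtain l where l: "B \<le> l" "C \<le> l" "HBmap p B l (\<xi> p) = HBmap p C l (\<zeta> p)"
    using rel unfolding direct_limit_rel_def by blast
  obtain m where m: "m \<ge> l" "HBmap q l m (HBmap q B l (\<xi> q)) = HBmap q l m (HBmap q C l (\<zeta> q))"
    using flat_section_unique[OF flat_section_push[OF \<xi> l(1)] flat_section_push[OF \<zeta> l(2)] _ q, of fw] l(3) p by blast
  have c: "\<xi> q \<in> carrier (HB q B)" "\<zeta> q \<in> carrier (HB q C)"
    using flat_section_carrier[OF \<xi> q] flat_section_carrier[OF \<zeta> q] by auto
  show ?thesis
    using sys_comp[OF HB_directed[OF q(1)] l(1) m(1) c(1)] sys_comp[OF HB_directed[OF q(1)] l(2) m(1) c(2)] m(2)
    by (intro direct_limit_relI[OF HB_directed[OF q(1)] c, of m]) (use l m in auto)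
qed

text \<open>
  Both elements may be raised to a higher level first; in the direct limits this changes nothing.
\<close>

definition continues :: "real \<Rightarrow> (real \<Rightarrow> 'h) \<Rightarrow> real \<Rightarrow> (real \<Rightarrow> 'h) \<Rightarrow> bool" where
  "continues b h b' h' \<longleftrightarrow> (\<exists>B \<xi>. b \<le> B \<and> b' \<le> B \<and> flat_section lo hi B \<xi> \<and>
      \<xi> lo = HBmap lo b B h \<and> \<xi> hi = HBmap hi b' B h')"

lemma continues_upto:
  assumes c: "continues b h b' h'" and h: "h \<in> carrier (HB lo b)" "h' \<in> carrier (HB hi b')"
  shows "\<exists>B\<ge>m. \<exists>\<xi>. b \<le> B \<and> b' \<le> B \<and> flat_section lo hi B \<xi> \<and>
      \<xi> lo = HBmap lo b B h \<and> \<xi> hi = HBmap hi b' B h'"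
proof -
  obtain B \<xi> where B: "b \<le> B" "b' \<le> B" "flat_section lo hi B \<xi>" "\<xi> lo = HBmap lo b B h" "\<xi> hi = HBmap hi b' B h'"
    using c unfolding continues_def by blast
  have le: "B \<le> max B m" by simp
  show ?thesis
    using flat_section_push[OF B(3) le] sys_comp[OF HB_directed[OF lo] B(1) le h(1)]
      sys_comp[OF HB_directed[OF hi] B(2) le h(2)] B
    by (intro exI[of _ "max B m"] conjI exI[of _ "\<lambda>s. HBmap s B (max B m) (\<xi> s)"]) auto
qed

text \<open>
  Transport from left to right.
\<close>

lemma continues_total:
  assumes h: "h \<in> carrier (HB lo b)"
  shows "\<exists>b' h'. h' \<in> carrier (HB hi b') \<and> continues b h b' h'"
proof -
  obtain B \<xi> where B: "b \<le> B" "flat_section lo hi B \<xi>" "\<xi> lo = HBmap lo b B h"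
    using flat_section_exists[OF h, of True] by (auto simp: source_def)
  have c: "\<xi> hi \<in> carrier (HB hi B)" using flat_section_carrier[OF B(2) hi lohi] by simp
  show ?thesis unfolding continues_def
    using c B sys_id[OF HB_directed[OF hi] c] by (intro exI[of _ B] exI[of _ "\<xi> hi"] conjI exI[of _ "\<xi>"]) auto
qed

text \<open>
  Transport from right to left. It runs along falling staircases, so it is not the inverse of the
  transport from left to right, but it produces a section of the same kind.
\<close>

lemma continues_onto:
  assumes h: "h' \<in> carrier (HB hi b')"
  shows "\<exists>b h. h \<in> carrier (HB lo b) \<and> continues b h b' h'"
proof -
  obtain B \<xi> where B: "b' \<le> B" "flat_section lo hi B \<xi>" "\<xi> hi = HBmap hi b' B h'"
    using flat_section_exists[OF h, of False] by (auto simp: source_def)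
  have c: "\<xi> lo \<in> carrier (HB lo B)" using flat_section_carrier[OF B(2) lo _ lohi] by simp
  show ?thesis unfolding continues_def
    using c B sys_id[OF HB_directed[OF lo] c] by (intro exI[of _ B] exI[of _ "\<xi> lo"] conjI exI[of _ "\<xi>"]) auto
qed

lemma direct_limit_rel_push:
  assumes "r \<in> D" "b \<le> B" "h \<in> carrier (HB r b)"
  shows "((b, h), (B, HBmap r b B h)) \<in> direct_limit_rel (HB r) (HBmap r)"
  using sys_in[OF HB_directed[OF assms(1)] assms(2,3)] sys_id[OF HB_directed[OF assms(1)], of "HBmap r b B h" B] assms
  by (intro direct_limit_relI[OF HB_directed[OF assms(1)], of _ _ _ _ B]) auto

text \<open>
  Elements of the direct limit may be raised on both sides before they are compared.
\<close>

lemma rel_push_iff: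
  assumes r: "r \<in> D" and "b \<le> B" "h \<in> carrier (HB r b)" "c \<le> C" "g \<in> carrier (HB r c)"
  shows "((b, h), (c, g)) \<in> direct_limit_rel (HB r) (HBmap r) \<longleftrightarrow>
    ((B, HBmap r b B h), (C, HBmap r c C g)) \<in> direct_limit_rel (HB r) (HBmap r)"
proof -
  note E = direct_limit_equiv[OF HB_directed[OF r]]
  have 1: "((b, h), (B, HBmap r b B h)) \<in> direct_limit_rel (HB r) (HBmap r)"
    by (rule direct_limit_rel_push) (use assms in auto)
  have 2: "((c, g), (C, HBmap r c C g)) \<in> direct_limit_rel (HB r) (HBmap r)"
    by (rule direct_limit_rel_push) (use assms in auto)
  show ?thesis using 1 2 E unfolding equiv_def by (meson symE transE)
qed

text \<open>
  The two isomorphisms come from one relation and its converse, and the hypotheses on a relation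
  between directed systems are symmetric.
\<close>

theorem limits_isomorphic:
  "modules_isomorphic (direct_limit (HB lo) (HBmap lo)) (direct_limit (HB hi) (HBmap hi))"
  "modules_isomorphic (direct_limit (HB hi) (HBmap hi)) (direct_limit (HB lo) (HBmap lo))"
proof -
  have uni: "((i, x), (i', x')) \<in> direct_limit_rel (HB lo) (HBmap lo) \<longleftrightarrow>
     ((j, y), (j', y')) \<in> direct_limit_rel (HB hi) (HBmap hi)"
    if L: "continues i x j y" "continues i' x' j' y'"
      and c: "x \<in> carrier (HB lo i)" "y \<in> carrier (HB hi j)" "x' \<in> carrier (HB lo i')" "y' \<in> carrier (HB hi j')"
    for i x j y i' x' j' y'
  proof -
    obtain B \<xi> where B: "i \<le> B" "j \<le> B" "flat_section lo hi B \<xi>" "\<xi> lo = HBmap lo i B x" "\<xi> hi = HBmap hi j B y"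
      using L(1) unfolding continues_def by blast
    obtain C \<zeta> where C: "i' \<le> C" "j' \<le> C" "flat_section lo hi C \<zeta>" "\<zeta> lo = HBmap lo i' C x'" "\<zeta> hi = HBmap hi j' C y'"
      using L(2) unfolding continues_def by blast
    have "((B, \<xi> lo), (C, \<zeta> lo)) \<in> direct_limit_rel (HB lo) (HBmap lo) \<longleftrightarrow>
      ((B, \<xi> hi), (C, \<zeta> hi)) \<in> direct_limit_rel (HB hi) (HBmap hi)"
      using flat_section_rel[OF B(3) C(3), of lo True hi] flat_section_rel[OF B(3) C(3), of hi False lo] lo hi lohi
      by (auto simp: source_def)
    then show ?thesis
      using rel_push_iff[OF lo B(1) c(1) C(1) c(3)] rel_push_iff[OF hi B(2) c(2) C(2) c(4)] B C by simp
  qed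
  have add: "continues (max i i') (HBmap lo i (max i i') x \<oplus>\<^bsub>HB lo (max i i')\<^esub> HBmap lo i' (max i i') x')
          (max j j') (HBmap hi j (max j j') y \<oplus>\<^bsub>HB hi (max j j')\<^esub> HBmap hi j' (max j j') y')"
    if L: "continues i x j y" "continues i' x' j' y'"
      and c: "x \<in> carrier (HB lo i)" "y \<in> carrier (HB hi j)" "x' \<in> carrier (HB lo i')" "y' \<in> carrier (HB hi j')"
    for i x j y i' x' j' y'
  proof -
    obtain B0 where B0: "B0 \<ge> i" "B0 \<ge> i'" "B0 \<ge> j" "B0 \<ge> j'" "continues i x j y"
      using that[of "max (max i i') (max j j')"] L by (meson max.cobounded1 max.cobounded2 order_trans)
    obtain C \<zeta> where C: "B0 \<le> C" "flat_section lo hi C \<zeta>" "\<zeta> lo = HBmap lo i' C x'" "\<zeta> hi = HBmap hi j' C y'"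
      using continues_upto[OF L(2) c(3,4)] by blast
    obtain B \<xi> where B: "C \<le> B" "flat_section lo hi B \<xi>" "\<xi> lo = HBmap lo i B x" "\<xi> hi = HBmap hi j B y"
      using continues_upto[OF L(1) c(1,2)] by blast
    define \<zeta>' where "\<zeta>' s = HBmap s C B (\<zeta> s)" for s
    have z: "flat_section lo hi B \<zeta>'" unfolding \<zeta>'_def by (rule flat_section_push[OF C(2) B(1)])
    have z2: "\<zeta>' lo = HBmap lo i' B x'" "\<zeta>' hi = HBmap hi j' B y'"
      unfolding \<zeta>'_def C(3,4)
      using sys_comp[OF HB_directed[OF lo] _ B(1) c(3)] sys_comp[OF HB_directed[OF hi] _ B(1) c(4)] B0 C(1) by simp_all
    have ex: "HBmap r (max m m') B (HBmap r m (max m m') u \<oplus>\<^bsub>HB r (max m m')\<^esub> HBmap r m' (max m m') u') =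
        HBmap r m B u \<oplus>\<^bsub>HB r B\<^esub> HBmap r m' B u'"
      if "r \<in> D" "u \<in> carrier (HB r m)" "u' \<in> carrier (HB r m')" "m \<le> B" "m' \<le> B" for r m m' u u'
    proof -
      note S = HB_directed[OF that(1)]
      have le: "m \<le> max m m'" "m' \<le> max m m'" "max m m' \<le> B" using that by auto
      show ?thesis
        using sys_add[OF S le(3) sys_in[OF S le(1) that(2)] sys_in[OF S le(2) that(3)]]
          sys_comp[OF S le(1,3) that(2)] sys_comp[OF S le(2,3) that(3)] by simp
    qed
    show ?thesis unfolding continues_def
    proof (intro exI conjI)
      show "flat_section lo hi B (\<lambda>s. \<xi> s \<oplus>\<^bsub>HB s B\<^esub> \<zeta>' s)" by (rule flat_section_add[OF B(2) z])
      show "\<xi> lo \<oplus>\<^bsub>HB lo B\<^esub> \<zeta>' lo = HBmap lo (max i i') B (HBmap lo i (max i i') x \<oplus>\<^bsub>HB lo (max i i')\<^esub> HBmap lo i' (max i i') x')"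
        using ex[OF lo c(1,3)] B0 C B z2 by simp
      show "\<xi> hi \<oplus>\<^bsub>HB hi B\<^esub> \<zeta>' hi = HBmap hi (max j j') B (HBmap hi j (max j j') y \<oplus>\<^bsub>HB hi (max j j')\<^esub> HBmap hi j' (max j j') y')"
        using ex[OF hi c(2,4)] B0 C B z2 by simp
    qed (use B0 C B in auto)
  qed
  have smult: "continues i (k \<odot>\<^bsub>HB lo i\<^esub> x) j (k \<odot>\<^bsub>HB hi j\<^esub> y)"
    if L: "continues i x j y" and c: "x \<in> carrier (HB lo i)" "y \<in> carrier (HB hi j)" for k i x j y
  proof -
    obtain B \<xi> where B: "i \<le> B" "j \<le> B" "flat_section lo hi B \<xi>" "\<xi> lo = HBmap lo i B x" "\<xi> hi = HBmap hi j B y"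
      using L(1) unfolding continues_def by blast
    show ?thesis unfolding continues_def
    proof (intro exI conjI)
      show "flat_section lo hi B (\<lambda>s. k \<odot>\<^bsub>HB s B\<^esub> \<xi> s)" by (rule flat_section_smult[OF B(3)])
    qed (use B sys_smult[OF HB_directed[OF lo] B(1) c(1), of k] sys_smult[OF HB_directed[OF hi] B(2) c(2), of k] in auto)
  qed
  show "modules_isomorphic (direct_limit (HB lo) (HBmap lo)) (direct_limit (HB hi) (HBmap hi))"
    by (rule direct_limits_isomorphic[where L = continues, OF HB_directed[OF lo] HB_directed[OF hi]
          continues_total continues_onto uni add smult])
  show "modules_isomorphic (direct_limit (HB hi) (HBmap hi)) (direct_limit (HB lo) (HBmap lo))"
    by (rule direct_limits_isomorphic[where L = "\<lambda>i x j y. continues j y i x", OF HB_directed[OF hi] HB_directed[OF lo]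
          continues_onto continues_total uni[symmetric] add smult])
qed

end

end

section \<open>Homology of finite based complexes\<close>

definition chains :: "'p set \<Rightarrow> ('p \<Rightarrow>\<^sub>0 'k::comm_ring_1) set" where
  "chains P = {x. Poly_Mapping.keys x \<subseteq> P}"

definition matrix_bdry :: "'p set \<Rightarrow> ('p \<times> 'p \<Rightarrow> 'k) \<Rightarrow> ('p \<Rightarrow>\<^sub>0 'k) \<Rightarrow> ('p \<Rightarrow>\<^sub>0 'k::comm_ring_1)" where
  "matrix_bdry P g x = (\<Sum>c1\<in>Poly_Mapping.keys x. \<Sum>c2\<in>P. Poly_Mapping.single c2 (Poly_Mapping.lookup x c1 * g (c1, c2)))"

definition matrix_complex :: "'p set \<Rightarrow> ('p \<times> 'p \<Rightarrow> 'k::comm_ring_1) \<Rightarrow> bool" where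
  "matrix_complex P g \<longleftrightarrow> finite P \<and> (\<forall>c1\<in>P. \<forall>c3\<in>P. (\<Sum>c2\<in>P. g (c1, c2) * g (c2, c3)) = 0)"

abbreviation scale :: "'k \<Rightarrow> ('p \<Rightarrow>\<^sub>0 'k) \<Rightarrow> ('p \<Rightarrow>\<^sub>0 'k::comm_ring_1)" where
  "scale k \<equiv> Poly_Mapping.map ((*) k)"

lemma lookup_scale [simp]: "Poly_Mapping.lookup (scale k x) c = k * Poly_Mapping.lookup x c"
  by transfer (simp add: when_def)

lemma lookup_zero_outside: "x \<in> chains P \<Longrightarrow> c \<notin> P \<Longrightarrow> Poly_Mapping.lookup x c = 0"
  by (auto simp: chains_def in_keys_iff)

lemma chainsI: "(\<And>c. c \<notin> P \<Longrightarrow> Poly_Mapping.lookup x c = 0) \<Longrightarrow> x \<in> chains P"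
  by (auto simp: chains_def in_keys_iff)

lemma chains_zero [simp]: "0 \<in> chains P" by (simp add: chains_def)
lemma chains_add: "x \<in> chains P \<Longrightarrow> y \<in> chains P \<Longrightarrow> x + y \<in> chains P"
  by (rule chainsI) (simp add: lookup_add lookup_zero_outside)
lemma chains_diff: "x \<in> chains P \<Longrightarrow> y \<in> chains P \<Longrightarrow> x - y \<in> chains P"
  by (rule chainsI) (simp add: lookup_minus lookup_zero_outside)
lemma chains_scale: "x \<in> chains P \<Longrightarrow> scale k x \<in> chains P"
  by (rule chainsI) (simp add: lookup_zero_outside)

lemma lookup_matrix_bdry_superset:
  assumes "finite P" "finite S" "x \<in> chains S"
  shows "Poly_Mapping.lookup (matrix_bdry P g x) c =
    (if c \<in> P then \<Sum>c1\<in>S. Poly_Mapping.lookup x c1 * g (c1, c) else 0)"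
proof -
  have "Poly_Mapping.lookup (matrix_bdry P g x) c =
    (\<Sum>c1\<in>Poly_Mapping.keys x. \<Sum>c2\<in>P. Poly_Mapping.lookup x c1 * g (c1, c2) when c2 = c)"
    by (simp add: matrix_bdry_def lookup_sum lookup_single)
  also have "\<dots> = (\<Sum>c1\<in>Poly_Mapping.keys x. if c \<in> P then Poly_Mapping.lookup x c1 * g (c1, c) else 0)"
    using assms(1) by (intro sum.cong) (auto simp: when_def)
  also have "\<dots> = (\<Sum>c1\<in>S. if c \<in> P then Poly_Mapping.lookup x c1 * g (c1, c) else 0)"
    using assms by (intro sum.mono_neutral_left) (auto simp: chains_def in_keys_iff)
  finally show ?thesis by simp
qed

lemma lookup_matrix_bdry:
  "finite P \<Longrightarrow> x \<in> chains P \<Longrightarrow> Poly_Mapping.lookup (matrix_bdry P g x) c =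
    (if c \<in> P then \<Sum>c1\<in>P. Poly_Mapping.lookup x c1 * g (c1, c) else 0)"
  by (rule lookup_matrix_bdry_superset)

lemma matrix_bdry_chains: "finite P \<Longrightarrow> x \<in> chains P \<Longrightarrow> matrix_bdry P g x \<in> chains P"
  by (rule chainsI) (simp add: lookup_matrix_bdry)

lemma matrix_bdry_zero [simp]: "matrix_bdry P g 0 = 0"
  by (simp add: matrix_bdry_def)

lemma matrix_bdry_add:
  "finite P \<Longrightarrow> x \<in> chains P \<Longrightarrow> y \<in> chains P \<Longrightarrow> matrix_bdry P g (x + y) = matrix_bdry P g x + matrix_bdry P g y"
  by (rule poly_mapping_eqI) (simp add: lookup_matrix_bdry chains_add lookup_add distrib_right sum.distrib)

lemma matrix_bdry_diff:
  "finite P \<Longrightarrow> x \<in> chains P \<Longrightarrow> y \<in> chains P \<Longrightarrow> matrix_bdry P g (x - y) = matrix_bdry P g x - matrix_bdry P g y"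
  by (rule poly_mapping_eqI) (simp add: lookup_matrix_bdry chains_diff lookup_minus left_diff_distrib sum_subtractf)

lemma matrix_bdry_scale:
  "finite P \<Longrightarrow> x \<in> chains P \<Longrightarrow> matrix_bdry P g (scale k x) = scale k (matrix_bdry P g x)"
  by (rule poly_mapping_eqI) (simp add: lookup_matrix_bdry chains_scale sum_distrib_left mult.assoc)

lemma matrix_bdry_bdry:
  assumes "matrix_complex P g" "x \<in> chains P"
  shows "matrix_bdry P g (matrix_bdry P g x) = 0"
proof (rule poly_mapping_eqI)
  fix c3
  have P: "finite P" using assms by (simp add: matrix_complex_def)
  have "(\<Sum>c2\<in>P. (\<Sum>c1\<in>P. Poly_Mapping.lookup x c1 * g (c1, c2)) * g (c2, c3)) = 0" if "c3 \<in> P"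
  proof -
    have "(\<Sum>c2\<in>P. (\<Sum>c1\<in>P. Poly_Mapping.lookup x c1 * g (c1, c2)) * g (c2, c3)) =
      (\<Sum>c1\<in>P. Poly_Mapping.lookup x c1 * (\<Sum>c2\<in>P. g (c1, c2) * g (c2, c3)))"
      by (simp add: sum_distrib_left sum_distrib_right mult.assoc) (rule sum.swap)
    also have "\<dots> = 0" using assms that by (simp add: matrix_complex_def)
    finally show ?thesis .
  qed
  then show "Poly_Mapping.lookup (matrix_bdry P g (matrix_bdry P g x)) c3 = Poly_Mapping.lookup 0 c3"
    using assms P by (simp add: lookup_matrix_bdry matrix_bdry_chains)
qed

definition cycles :: "'p set \<Rightarrow> ('p \<times> 'p \<Rightarrow> 'k::comm_ring_1) \<Rightarrow> ('p \<Rightarrow>\<^sub>0 'k) set" where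
  "cycles P g = {x \<in> chains P. matrix_bdry P g x = 0}"

definition boundaries :: "'p set \<Rightarrow> ('p \<times> 'p \<Rightarrow> 'k::comm_ring_1) \<Rightarrow> ('p \<Rightarrow>\<^sub>0 'k) set" where
  "boundaries P g = matrix_bdry P g ` chains P"

definition coset :: "'m::ab_group_add set \<Rightarrow> 'm \<Rightarrow> 'm set" where
  "coset B x = (\<lambda>b. b + x) ` B"

definition add_subgroup :: "'m::ab_group_add set \<Rightarrow> bool" where
  "add_subgroup B \<longleftrightarrow> 0 \<in> B \<and> (\<forall>x\<in>B. \<forall>y\<in>B. x - y \<in> B)"

lemma add_subgroup_uminus: "add_subgroup B \<Longrightarrow> x \<in> B \<Longrightarrow> - x \<in> B"
  unfolding add_subgroup_def by (metis diff_0)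
lemma add_subgroup_add: "add_subgroup B \<Longrightarrow> x \<in> B \<Longrightarrow> y \<in> B \<Longrightarrow> x + y \<in> B"
  using add_subgroup_uminus[of B y] unfolding add_subgroup_def by (metis diff_minus_eq_add)

lemma in_coset: "y \<in> coset B x \<longleftrightarrow> y - x \<in> B"
  by (auto simp: coset_def image_iff algebra_simps) (metis add.commute diff_add_cancel)

lemma coset_eq_iff: "add_subgroup B \<Longrightarrow> coset B x = coset B y \<longleftrightarrow> x - y \<in> B"
proof
  assume B: "add_subgroup B" and "coset B x = coset B y"
  then have "x \<in> coset B y" using in_coset[of x B x] by (simp add: add_subgroup_def)
  then show "x - y \<in> B" by (simp add: in_coset)
next
  assume B: "add_subgroup B" and d: "x - y \<in> B"
  have "z - x \<in> B \<longleftrightarrow> z - y \<in> B" for z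
    using add_subgroup_add[OF B _ d, of "z - x"] B d unfolding add_subgroup_def
    by (metis add_diff_cancel_right' diff_add_cancel diff_diff_eq2)
  then show "coset B x = coset B y" by (auto simp: in_coset)
qed

lemma coset_self: "add_subgroup B \<Longrightarrow> x \<in> coset B x"
  by (simp add: in_coset add_subgroup_def)

lemma coset_UNION:
  assumes "add_subgroup B" "add_subgroup B'" "\<And>y. y - x \<in> B \<Longrightarrow> \<phi> y - \<phi> x \<in> B'"
  shows "(\<Union>y\<in>coset B x. coset B' (\<phi> y)) = coset B' (\<phi> x)"
proof -
  have "coset B' (\<phi> y) = coset B' (\<phi> x)" if "y \<in> coset B x" for y
    using that assms by (simp add: coset_eq_iff in_coset)
  then show ?thesis using coset_self[OF assms(1), of x] by blast
qed

lemma boundaries_subgroup: "finite P \<Longrightarrow> add_subgroup (boundaries P g)"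
  unfolding add_subgroup_def boundaries_def
proof (intro conjI ballI)
  assume P: "finite P"
  show "0 \<in> matrix_bdry P g ` chains P" by (rule image_eqI[of _ _ 0]) simp_all
  fix x y assume "x \<in> matrix_bdry P g ` chains P" "y \<in> matrix_bdry P g ` chains P"
  then show "x - y \<in> matrix_bdry P g ` chains P"
    using matrix_bdry_diff[OF P] chains_diff by (smt (verit, best) image_iff)
qed

lemma boundaries_scale: "finite P \<Longrightarrow> x \<in> boundaries P g \<Longrightarrow> scale k x \<in> boundaries P g"
  unfolding boundaries_def by (auto simp: matrix_bdry_scale[symmetric] chains_scale)

lemma boundaries_chains: "finite P \<Longrightarrow> x \<in> boundaries P g \<Longrightarrow> x \<in> chains P"
  unfolding boundaries_def by (auto simp: matrix_bdry_chains)

lemma boundaries_cycles: "matrix_complex P g \<Longrightarrow> x \<in> boundaries P g \<Longrightarrow> x \<in> cycles P g"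
  unfolding boundaries_def cycles_def by (auto simp: matrix_bdry_bdry matrix_bdry_chains matrix_complex_def)

lemma cycles_add: "finite P \<Longrightarrow> x \<in> cycles P g \<Longrightarrow> y \<in> cycles P g \<Longrightarrow> x + y \<in> cycles P g"
  by (simp add: cycles_def chains_add matrix_bdry_add)
lemma cycles_diff: "finite P \<Longrightarrow> x \<in> cycles P g \<Longrightarrow> y \<in> cycles P g \<Longrightarrow> x - y \<in> cycles P g"
  by (simp add: cycles_def chains_diff matrix_bdry_diff)
lemma cycles_scale: "finite P \<Longrightarrow> x \<in> cycles P g \<Longrightarrow> scale k x \<in> cycles P g"
  by (auto simp: cycles_def chains_scale matrix_bdry_scale poly_mapping_eq_iff fun_eq_iff)

definition matrix_homology :: "'p set \<Rightarrow> ('p \<times> 'p \<Rightarrow> 'k::comm_ring_1) \<Rightarrow> ('k, ('p \<Rightarrow>\<^sub>0 'k) set) module" where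
  "matrix_homology P g = homology_module (free_module P) (matrix_bdry P g)"

lemma free_module_simps [simp]:
  "carrier (free_module P) = chains P" "zero (free_module P) = 0" "add (free_module P) = (+)"
  "smult (free_module P) = scale"
  by (simp_all add: free_module_def chains_def)

lemma a_r_coset_free [simp]: "a_r_coset (free_module P) B x = coset B x"
  by (auto simp: a_r_coset_def' coset_def)

lemma homology_carrier: "carrier (matrix_homology P g) = coset (boundaries P g) ` cycles P g"
  by (simp add: matrix_homology_def homology_module_def Let_def boundaries_def cycles_def)

lemma homology_carrierE:
  assumes "X \<in> carrier (matrix_homology P g)"
  obtains x where "x \<in> cycles P g" "X = coset (boundaries P g) x"
  using assms by (auto simp: homology_carrier)

lemma homology_add:
  assumes "finite P"
  shows "coset (boundaries P g) x \<oplus>\<^bsub>matrix_homology P g\<^esub> coset (boundaries P g) y = coset (boundaries P g) (x + y)"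
proof -
  note B = boundaries_subgroup[OF assms, of g]
  have "(\<exists>u v. u - x \<in> boundaries P g \<and> v - y \<in> boundaries P g \<and> z = u + v) \<longleftrightarrow> z - (x + y) \<in> boundaries P g" for z
  proof
    assume "z - (x + y) \<in> boundaries P g"
    then show "\<exists>u v. u - x \<in> boundaries P g \<and> v - y \<in> boundaries P g \<and> z = u + v"
      by (intro exI[of _ "z - y"] exI[of _ y]) (use B in \<open>auto simp: add_subgroup_def algebra_simps\<close>)
  next
    assume "\<exists>u v. u - x \<in> boundaries P g \<and> v - y \<in> boundaries P g \<and> z = u + v"
    then obtain u v where "u - x \<in> boundaries P g" "v - y \<in> boundaries P g" "z = u + v" by blast
    then show "z - (x + y) \<in> boundaries P g"
      using add_subgroup_add[OF B, of "u - x" "v - y"] by (simp add: algebra_simps)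
  qed
  note eq = this
  have "(\<Union>u\<in>coset (boundaries P g) x. \<Union>v\<in>coset (boundaries P g) y. {u + v}) = coset (boundaries P g) (x + y)"
  proof (rule Set.set_eqI)
    fix z
    have "z \<in> (\<Union>u\<in>coset (boundaries P g) x. \<Union>v\<in>coset (boundaries P g) y. {u + v}) \<longleftrightarrow>
      (\<exists>u v. u \<in> coset (boundaries P g) x \<and> v \<in> coset (boundaries P g) y \<and> z = u + v)" by blast
    also have "\<dots> \<longleftrightarrow> z \<in> coset (boundaries P g) (x + y)" unfolding in_coset by (rule eq)
    finally show "z \<in> (\<Union>u\<in>coset (boundaries P g) x. \<Union>v\<in>coset (boundaries P g) y. {u + v}) \<longleftrightarrow>
      z \<in> coset (boundaries P g) (x + y)" .
  qed
  then show ?thesis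
    by (simp add: matrix_homology_def homology_module_def Let_def set_add_def')
qed

lemma homology_smult:
  assumes "finite P"
  shows "k \<odot>\<^bsub>matrix_homology P g\<^esub> coset (boundaries P g) x = coset (boundaries P g) (scale k x)"
proof -
  have "scale k (y - x) = scale k y - scale k x" for y :: "'a \<Rightarrow>\<^sub>0 'b"
    by (rule poly_mapping_eqI) (simp add: lookup_minus right_diff_distrib)
  then have "(\<Union>y\<in>coset (boundaries P g) x. coset (boundaries P g) (scale k y)) = coset (boundaries P g) (scale k x)"
    by (intro coset_UNION boundaries_subgroup assms) (metis boundaries_scale[OF assms])
  then show ?thesis
    by (simp add: matrix_homology_def homology_module_def Let_def boundaries_def[symmetric])
qed

lemma homology_add_in:
  assumes "finite P" "X \<in> carrier (matrix_homology P g)" "Y \<in> carrier (matrix_homology P g)"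
  shows "X \<oplus>\<^bsub>matrix_homology P g\<^esub> Y \<in> carrier (matrix_homology P g)"
  using assms(2,3) by (auto simp: homology_carrier homology_add[OF assms(1)] cycles_add[OF assms(1)])

lemma homology_smult_in:
  assumes "finite P" "X \<in> carrier (matrix_homology P g)"
  shows "k \<odot>\<^bsub>matrix_homology P g\<^esub> X \<in> carrier (matrix_homology P g)"
  using assms(2) by (auto simp: homology_carrier homology_smult[OF assms(1)] cycles_scale[OF assms(1)])

definition linear_chains :: "'p set \<Rightarrow> 'p set \<Rightarrow> (('p \<Rightarrow>\<^sub>0 'k) \<Rightarrow> ('p \<Rightarrow>\<^sub>0 'k::comm_ring_1)) \<Rightarrow> bool" where
  "linear_chains P Q \<phi> \<longleftrightarrow> (\<forall>x\<in>chains P. \<phi> x \<in> chains Q) \<and> (\<forall>x\<in>chains P. \<forall>y\<in>chains P. \<phi> (x - y) = \<phi> x - \<phi> y) \<and>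
     (\<forall>k. \<forall>x\<in>chains P. \<phi> (scale k x) = scale k (\<phi> x))"

definition chain_map :: "'p set \<Rightarrow> ('p \<times> 'p \<Rightarrow> 'k) \<Rightarrow> 'p set \<Rightarrow> ('p \<times> 'p \<Rightarrow> 'k) \<Rightarrow>
    (('p \<Rightarrow>\<^sub>0 'k) \<Rightarrow> ('p \<Rightarrow>\<^sub>0 'k::comm_ring_1)) \<Rightarrow> bool" where
  "chain_map P g Q q \<phi> \<longleftrightarrow> finite P \<and> finite Q \<and> linear_chains P Q \<phi> \<and>
     (\<forall>x\<in>chains P. \<phi> (matrix_bdry P g x) = matrix_bdry Q q (\<phi> x))"

context
  fixes P Q :: "'p set" and g q :: "'p \<times> 'p \<Rightarrow> 'k::comm_ring_1" and \<phi>
  assumes cm: "chain_map P g Q q \<phi>"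
begin

lemma cm_finite: "finite P" "finite Q" using cm by (auto simp: chain_map_def)
lemma cm_in: "x \<in> chains P \<Longrightarrow> \<phi> x \<in> chains Q" using cm by (auto simp: chain_map_def linear_chains_def)
lemma cm_diff: "x \<in> chains P \<Longrightarrow> y \<in> chains P \<Longrightarrow> \<phi> (x - y) = \<phi> x - \<phi> y"
  using cm by (auto simp: chain_map_def linear_chains_def)
lemma cm_zero: "\<phi> 0 = 0" using cm_diff[of 0 0] by simp
lemma cm_add: "x \<in> chains P \<Longrightarrow> y \<in> chains P \<Longrightarrow> \<phi> (x + y) = \<phi> x + \<phi> y"
  using cm_diff[of x "0 - y"] cm_diff[of 0 y] by (simp add: chains_diff cm_zero)
    (metis add_uminus_conv_diff cm_diff cm_zero chains_diff chains_zero diff_0 diff_minus_eq_add)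
lemma cm_scale: "x \<in> chains P \<Longrightarrow> \<phi> (scale k x) = scale k (\<phi> x)"
  using cm by (auto simp: chain_map_def linear_chains_def)
lemma cm_bdry: "x \<in> chains P \<Longrightarrow> \<phi> (matrix_bdry P g x) = matrix_bdry Q q (\<phi> x)"
  using cm by (auto simp: chain_map_def)
lemma cm_boundaries: "x \<in> boundaries P g \<Longrightarrow> \<phi> x \<in> boundaries Q q"
  by (auto simp: boundaries_def cm_bdry cm_in)
lemma cm_cycles: "x \<in> cycles P g \<Longrightarrow> \<phi> x \<in> cycles Q q"
  using cm_zero by (auto simp: cycles_def cm_in cm_bdry[symmetric])

lemma class_map_coset:
  assumes x: "x \<in> cycles P g"
  shows "(\<Union>x\<in>coset (boundaries P g) x. coset (boundaries Q q) (\<phi> x)) = coset (boundaries Q q) (\<phi> x)"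
proof (intro coset_UNION boundaries_subgroup cm_finite)
  fix y assume y: "y - x \<in> boundaries P g"
  have xc: "x \<in> chains P" using x by (simp add: cycles_def)
  then have "y \<in> chains P" using boundaries_chains[OF cm_finite(1) y] chains_add[of "y - x" P x] by simp
  then show "\<phi> y - \<phi> x \<in> boundaries Q q" using cm_boundaries[OF y] cm_diff xc by simp
qed

end

text \<open>
  Such a map induces an isomorphism in homology (\<open>af_inj\<close>, \<open>af_lift\<close>). In contrast to a chain
  homotopy equivalence no inverse has to be chosen, and comparisons with the same model compose
  strictly.
\<close>

definition acyclic_fibration :: "'p set \<Rightarrow> ('p \<times> 'p \<Rightarrow> 'k) \<Rightarrow> 'p set \<Rightarrow> ('p \<times> 'p \<Rightarrow> 'k) \<Rightarrow>
    (('p \<Rightarrow>\<^sub>0 'k) \<Rightarrow> ('p \<Rightarrow>\<^sub>0 'k::comm_ring_1)) \<Rightarrow> bool" where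
  "acyclic_fibration P g Q q \<phi> \<longleftrightarrow> matrix_complex P g \<and> chain_map P g Q q \<phi> \<and> (\<forall>y\<in>chains Q. \<exists>x\<in>chains P. \<phi> x = y) \<and>
     (\<forall>x\<in>cycles P g. \<phi> x = 0 \<longrightarrow> (\<exists>y\<in>chains P. \<phi> y = 0 \<and> matrix_bdry P g y = x))"

context
  fixes P Q :: "'p set" and g q :: "'p \<times> 'p \<Rightarrow> 'k::comm_ring_1" and \<phi>
  assumes af: "acyclic_fibration P g Q q \<phi>"
begin

lemma af_cm: "chain_map P g Q q \<phi>" and af_cx: "matrix_complex P g"
  using af by (auto simp: acyclic_fibration_def)

lemma af_finite: "finite P" "finite Q" using cm_finite[OF af_cm] .

lemma af_surj: "y \<in> chains Q \<Longrightarrow> \<exists>x\<in>chains P. \<phi> x = y"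
  using af by (auto simp: acyclic_fibration_def)

lemma af_acyclic: "x \<in> cycles P g \<Longrightarrow> \<phi> x = 0 \<Longrightarrow> \<exists>y\<in>chains P. \<phi> y = 0 \<and> matrix_bdry P g y = x"
  using af by (auto simp: acyclic_fibration_def)

lemma af_inj:
  assumes x: "x \<in> cycles P g" and b: "\<phi> x \<in> boundaries Q q"
  shows "x \<in> boundaries P g"
proof -
  note fin = cm_finite[OF af_cm]
  obtain y where y: "y \<in> chains Q" "\<phi> x = matrix_bdry Q q y" using b by (auto simp: boundaries_def)
  obtain w where w: "w \<in> chains P" "\<phi> w = y" using af_surj y by blast
  have dw: "matrix_bdry P g w \<in> boundaries P g" using w by (auto simp: boundaries_def)
  have c: "x - matrix_bdry P g w \<in> cycles P g"
    by (rule cycles_diff[OF fin(1) x boundaries_cycles[OF af_cx dw]])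
  have "\<phi> (x - matrix_bdry P g w) = 0"
    using x w y by (simp add: cm_diff[OF af_cm] matrix_bdry_chains fin cycles_def cm_bdry[OF af_cm])
  then obtain v where "v \<in> chains P" "matrix_bdry P g v = x - matrix_bdry P g w" using af_acyclic[OF c] by blast
  then have "x - matrix_bdry P g w \<in> boundaries P g" by (metis boundaries_def imageI)
  then show ?thesis using add_subgroup_add[OF boundaries_subgroup[OF fin(1)] _ dw] by fastforce
qed

lemma af_lift:
  assumes y: "y \<in> cycles Q q"
  shows "\<exists>x\<in>cycles P g. \<phi> x = y"
proof -
  note fin = cm_finite[OF af_cm]
  obtain w where w: "w \<in> chains P" "\<phi> w = y" using af_surj y by (auto simp: cycles_def)
  have "matrix_bdry P g w \<in> cycles P g" using boundaries_cycles[OF af_cx] w by (auto simp: boundaries_def)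
  moreover have "\<phi> (matrix_bdry P g w) = 0" using w y cm_bdry[OF af_cm] by (simp add: cycles_def)
  ultimately obtain v where v: "v \<in> chains P" "\<phi> v = 0" "matrix_bdry P g v = matrix_bdry P g w" using af_acyclic by blast
  have "w - v \<in> cycles P g" using w v fin by (simp add: cycles_def chains_diff matrix_bdry_diff)
  moreover have "\<phi> (w - v) = y" using w v cm_diff[OF af_cm] by simp
  ultimately show ?thesis by blast
qed

end

section \<open>The topology of a Cerf tuple\<close>

lemma cis_inj_near:
  assumes "cis s = cis u" "\<bar>s - u\<bar> < 2 * pi"
  shows "s = u"
proof -
  have "sin s = sin u \<and> cos s = cos u" using assms(1) by (metis cis.sel)
  then obtain n :: int where n: "s = u + 2 * pi * n" using sin_cos_eq_iff by blast
  then have "\<bar>2 * pi * n\<bar> < 2 * pi" using assms(2) by simp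
  then have "\<bar>real_of_int n\<bar> < 1" by (simp add: abs_mult)
  then have "n = 0" by linarith
  then show ?thesis using n by simp
qed

lemma cis_representative: "\<exists>u\<in>{x - pi..x + pi}. cis u = cis s"
proof -
  define n where "n = \<lfloor>(s - x + pi) / (2 * pi)\<rfloor>"
  have "of_int n \<le> (s - x + pi) / (2 * pi)" "(s - x + pi) / (2 * pi) < of_int n + 1"
    unfolding n_def by linarith+
  then have "2 * pi * n \<le> s - x + pi" "s - x + pi < 2 * pi * (of_int n + 1)"
    by (simp_all add: field_simps)
  then have "s - 2 * pi * n \<in> {x - pi..x + pi}" by (auto simp: algebra_simps)
  moreover have "sin (s - 2 * pi * n) = sin s \<and> cos (s - 2 * pi * n) = cos s"
    by (subst sin_cos_eq_iff) (rule exI[of _ "- n"], simp)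
  then have "cis (s - 2 * pi * n) = cis s" by (simp add: complex_eq_iff)
  ultimately show ?thesis by blast
qed

locale cerf =
  fixes C :: "('i, 'z) cerf_scheme"
  assumes cerf: "cerf_tuple C"
begin

abbreviation arc :: "'i \<Rightarrow> real \<Rightarrow> 'i \<times> complex" where "arc \<equiv> arc_at C"
abbreviation dom :: "'i \<Rightarrow> real set" where "dom \<equiv> pdom C"
abbreviation CT where "CT \<equiv> curve_top C"

lemma in_pts: "p \<in> pts C \<longleftrightarrow> (\<exists>i\<in>comps C. \<exists>t\<in>dom i. p = arc i t)"
  by (auto simp: pts_def arc_at_def)

lemma arc_pts: "i \<in> comps C \<Longrightarrow> t \<in> dom i \<Longrightarrow> arc i t \<in> pts C"
  using in_pts by blast

lemma F2_range: "p \<in> pts C \<Longrightarrow> F2 C p \<in> {0..1}"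
  using cerf by (auto simp: cerf_tuple_def)

lemma dom_connected: "s \<in> dom i \<Longrightarrow> u \<in> dom i \<Longrightarrow> {s..u} \<subseteq> dom i"
  by (auto simp: pdom_def split: if_splits)

lemma dom_closed: "closed (dom i)"
  by (simp add: pdom_def)

lemma param_continuous: "continuous_on S (param C i)"
  by (auto simp: param_def intro!: continuous_intros)

lemma arc_continuous: "i \<in> comps C \<Longrightarrow> continuous_map (top_of_set (dom i)) CT (arc i)"
proof -
  assume i: "i \<in> comps C"
  have "continuous_map (top_of_set (dom i)) (top_of_set (param C i ` dom i)) (param C i)"
    by (auto simp: continuous_map_in_subtopology continuous_map_iff_continuous param_continuous)
  moreover have "continuous_map (top_of_set (param C i ` dom i)) CT (Pair i)"
    unfolding curve_top_def using continuous_map_component_injection[OF i, of "\<lambda>i. top_of_set (param C i ` dom i)"] by simp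
  ultimately have "continuous_map (top_of_set (dom i)) CT (Pair i \<circ> param C i)" by (rule continuous_map_compose)
  moreover have "arc i = Pair i \<circ> param C i" by (simp add: arc_at_def fun_eq_iff)
  ultimately show ?thesis by simp
qed

lemma arc_inj: "inj_on (arc i) (ball t0 1)"
proof (rule inj_onI)
  fix s u assume "s \<in> ball t0 1" "u \<in> ball t0 1" and e: "arc i s = arc i u"
  then have "\<bar>s - u\<bar> < 2" by (auto simp: dist_real_def)
  then have "\<bar>s - u\<bar> < 2 * pi" using pi_gt3 by simp
  then show "s = u" using e cis_inj_near by (auto simp: arc_at_def param_def split: if_splits)
qed

text \<open>
  The component is compact, so the complement of the image of \<open>U\<close> in it is closed; on a circle it
  is the image of a compact set of angles of length \<open>2 * pi\<close>.
\<close>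

lemma arc_open:
  assumes i: "i \<in> comps C" and U: "openin (top_of_set (dom i)) U" "U \<subseteq> ball t0 1"
  shows "openin CT (arc i ` U)"
proof -
  have "closed (param C i ` dom i - param C i ` U)"
  proof (cases "i \<in> circles C")
    case True
    then have oU: "open U" using U(1) by (simp add: pdom_def)
    have "param C i ` dom i - param C i ` U = cis ` ({t0 - pi..t0 + pi} - U)"
    proof
      show "param C i ` dom i - param C i ` U \<subseteq> cis ` ({t0 - pi..t0 + pi} - U)"
      proof
        fix z assume z: "z \<in> param C i ` dom i - param C i ` U"
        then obtain s where "z = cis s" using True by (auto simp: param_def)
        then obtain u where u: "u \<in> {t0 - pi..t0 + pi}" "z = cis u" using cis_representative[of t0 s] by metis
        then have "u \<notin> U" using z True by (auto simp: param_def)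
        then show "z \<in> cis ` ({t0 - pi..t0 + pi} - U)" using u by blast
      qed
      have "cis s \<noteq> cis u" if "u \<in> U" "s \<in> {t0 - pi..t0 + pi} - U" for s u
      proof
        assume e: "cis s = cis u"
        have "\<bar>u - t0\<bar> < 1" using that U(2) by (auto simp: dist_real_def abs_minus_commute)
        then have "\<bar>s - u\<bar> < 2 * pi" using that(2) pi_gt3 by auto
        then show False using cis_inj_near[OF e] that by auto
      qed
      then show "cis ` ({t0 - pi..t0 + pi} - U) \<subseteq> param C i ` dom i - param C i ` U"
        using True by (auto simp: param_def pdom_def)
    qed
    moreover have "compact (cis ` ({t0 - pi..t0 + pi} - U))"
      by (intro compact_continuous_image compact_diff continuous_intros) (auto simp: oU)
    ultimately show ?thesis by (simp add: compact_imp_closed)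
  next
    case False
    have sub: "U \<subseteq> {0..1}" using U(1) openin_imp_subset False by (fastforce simp: pdom_def)
    obtain V where V: "open V" "U = {0..1} \<inter> V" using U(1) False by (auto simp: pdom_def openin_open)
    have "param C i ` dom i - param C i ` U = complex_of_real ` ({0..1} - V)"
      using False V by (auto simp: param_def pdom_def)
    moreover have "compact (complex_of_real ` ({0..1} - V))"
      by (intro compact_continuous_image compact_diff continuous_intros) (auto simp: V)
    ultimately show ?thesis by (simp add: compact_imp_closed)
  qed
  then have "openin (top_of_set (param C i ` dom i)) (param C i ` dom i - (param C i ` dom i - param C i ` U))"
    by (meson openin_diff openin_subtopology_self closed_subset Diff_subset)
  moreover have "param C i ` U \<subseteq> param C i ` dom i" using openin_imp_subset[OF U(1)] by auto
  ultimately have "openin (top_of_set (param C i ` dom i)) (param C i ` U)" by (simp add: double_diff)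
  then have "openin CT (Pair i ` param C i ` U)"
    using open_map_component_injection[OF i, of "\<lambda>i. top_of_set (param C i ` dom i)"]
    unfolding open_map_def curve_top_def by simp
  then show ?thesis by (simp add: image_image arc_at_def)
qed

lemma arc_ball_open: "i \<in> comps C \<Longrightarrow> \<eta> \<le> 1 \<Longrightarrow> openin CT (arc i ` (dom i \<inter> ball t0 \<eta>))"
  by (rule arc_open[of i _ t0]) (auto simp: openin_open)

lemma neighbourhood_arc:
  assumes i: "i \<in> comps C" "t0 \<in> dom i" and O: "openin CT U" "arc i t0 \<in> U"
  obtains \<eta> where "0 < \<eta>" "\<eta> \<le> 1" "arc i ` (dom i \<inter> ball t0 \<eta>) \<subseteq> U"
proof -
  have "openin (top_of_set (dom i)) {t \<in> dom i. arc i t \<in> U}"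
    using openin_continuous_map_preimage[OF arc_continuous[OF i(1)] O(1)] by simp
  then obtain e where "e > 0" "ball t0 e \<inter> dom i \<subseteq> {t \<in> dom i. arc i t \<in> U}"
    using i(2) O(2) by (force simp: openin_contains_ball)
  then show ?thesis by (intro that[of "min e 1"]) auto
qed

lemma legendrian: "i \<in> comps C \<Longrightarrow> legendrian_component C i"
  using cerf by (auto simp: cerf_tuple_def)

lemma continuous_mapI:
  assumes "\<And>i. i \<in> comps C \<Longrightarrow> continuous_on (dom i) (\<lambda>t. f (arc i t))"
  shows "continuous_map CT euclidean f"
proof -
  have "openin CT {p \<in> topspace CT. f p \<in> V}" if V: "open V" for V
  proof (subst openin_subopen, safe)
    fix p assume "p \<in> topspace CT" and f: "f p \<in> V"
    then obtain i t0 where p: "i \<in> comps C" "t0 \<in> dom i" "p = arc i t0"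
      by (auto simp: topspace_curve_top in_pts)
    let ?U = "{t \<in> dom i. f (arc i t) \<in> V} \<inter> ball t0 1"
    have "openin (top_of_set (dom i)) {t \<in> dom i. f (arc i t) \<in> V}"
      using continuous_openin_preimage_gen[OF assms[OF p(1)] V] by (simp add: vimage_def Int_def)
    then have "openin (top_of_set (dom i)) ?U"
      by (metis openin_Int_open open_ball)
    then have "openin CT (arc i ` ?U)" by (rule arc_open[OF p(1), of _ t0]) auto
    then show "\<exists>T. openin CT T \<and> p \<in> T \<and> T \<subseteq> {p \<in> topspace CT. f p \<in> V}"
      by (intro exI[of _ "arc i ` ?U"]) (use p f arc_pts in \<open>auto simp: topspace_curve_top\<close>)
  qed
  then show ?thesis by (auto simp: continuous_map_def)
qed

lemma Fmap_arc_derivative: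
  assumes "i \<in> comps C"
  obtains D where "\<And>t. t \<in> dom i \<Longrightarrow> ((\<lambda>s. Fmap C (arc i s)) has_vector_derivative D t) (at t within dom i)"
  using legendrian[OF assms] unfolding legendrian_component_def smooth_curve_on_def by metis

lemma Fmap_arc_continuous: "i \<in> comps C \<Longrightarrow> continuous_on (dom i) (\<lambda>t. Fmap C (arc i t))"
  by (rule Fmap_arc_derivative[of i], assumption)
     (auto simp: continuous_on_eq_continuous_within intro: has_vector_derivative_continuous)

lemma F2_arc_continuous: "i \<in> comps C \<Longrightarrow> continuous_on (dom i) (\<lambda>t. F2 C (arc i t))"
  unfolding F2_def by (intro continuous_intros Fmap_arc_continuous)
lemma F3_arc_continuous: "i \<in> comps C \<Longrightarrow> continuous_on (dom i) (\<lambda>t. F3 C (arc i t))"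
  unfolding F3_def by (intro continuous_intros Fmap_arc_continuous)

lemma F2_continuous: "continuous_map CT euclideanreal (F2 C)"
  by (rule continuous_mapI) (rule F2_arc_continuous)
lemma F3_continuous: "continuous_map CT euclideanreal (F3 C)"
  by (rule continuous_mapI) (rule F3_arc_continuous)

lemma F3_open: "open V \<Longrightarrow> openin CT {p \<in> pts C. F3 C p \<in> V}"
  using openin_continuous_map_preimage[OF F3_continuous, of V] by (simp add: topspace_curve_top)
lemma F2_open: "open V \<Longrightarrow> openin CT {p \<in> pts C. F2 C p \<in> V}"
  using openin_continuous_map_preimage[OF F2_continuous, of V] by (simp add: topspace_curve_top)

lemma F3_compact: "compact K \<Longrightarrow> compactin CT {p \<in> pts C. F3 C p \<in> K}"
  using compactin_proper_map_preimage[of CT euclideanreal "F3 C" K] cerf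
  by (simp add: cerf_tuple_def topspace_curve_top)

lemma Hausdorff_curve: "Hausdorff_space CT"
  unfolding Hausdorff_space_def
proof (intro allI impI, elim conjE)
  fix p q assume p: "p \<in> topspace CT" and q: "q \<in> topspace CT" and ne: "p \<noteq> q"
  show "\<exists>U V. openin CT U \<and> openin CT V \<and> p \<in> U \<and> q \<in> V \<and> disjnt U V"
  proof (cases "fst p = fst q")
    case False
    have comp_open: "openin CT ({j} \<times> param C j ` dom j)" if "j \<in> comps C" for j
    proof -
      have "openin CT (Pair j ` param C j ` dom j)"
        using open_map_component_injection[OF that, of "\<lambda>i. top_of_set (param C i ` dom i)"]
        unfolding open_map_def curve_top_def by simp
      moreover have "Pair j ` param C j ` dom j = {j} \<times> param C j ` dom j" by auto
      ultimately show ?thesis by simp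
    qed
    show ?thesis
      by (rule exI[of _ "{fst p} \<times> param C (fst p) ` dom (fst p)"], rule exI[of _ "{fst q} \<times> param C (fst q) ` dom (fst q)"])
         (use p q False comp_open in \<open>auto simp: topspace_curve_top pts_def disjnt_def\<close>)
  next
    case True
    then have "snd p \<noteq> snd q" using ne by (simp add: prod_eq_iff)
    then obtain A B where AB: "open A" "open B" "snd p \<in> A" "snd q \<in> B" "A \<inter> B = {}"
      using hausdorff[of "snd p" "snd q"] by auto
    have "openin CT {x \<in> pts C. snd x \<in> A}" if "open A" for A
      using openin_continuous_map_preimage[OF continuous_mapI[of snd], of A] that
      by (simp add: topspace_curve_top arc_at_def param_continuous)
    then show ?thesis
      by (intro exI[of _ "{x \<in> pts C. snd x \<in> A}"] exI[of _ "{x \<in> pts C. snd x \<in> B}"])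
         (use AB p q in \<open>auto simp: topspace_curve_top disjnt_def\<close>)
  qed
qed

text \<open>
  On the compact set \<open>K - U\<close> the function does not vanish, so it is bounded away from zero.
\<close>

lemma compact_zero_neighbourhood:
  assumes K: "compactin CT K" and U: "openin CT U" and \<psi>: "continuous_map CT euclideanreal \<psi>"
    and sub: "\<And>p. p \<in> K \<Longrightarrow> \<psi> p = 0 \<Longrightarrow> p \<in> U"
  shows "\<exists>d>0. \<forall>q\<in>K. \<bar>\<psi> q\<bar> < d \<longrightarrow> q \<in> U"
proof -
  have Kp: "K \<subseteq> topspace CT" using K by (simp add: compactin_def)
  have "compactin CT ((topspace CT - U) \<inter> K)" by (rule closed_Int_compactin[OF _ K]) (use U in auto)
  then have "compactin euclideanreal (\<psi> ` ((topspace CT - U) \<inter> K))" using image_compactin \<psi> by blast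
  then have "closed (\<psi> ` ((topspace CT - U) \<inter> K))" by (simp add: compact_imp_closed)
  moreover have "0 \<notin> \<psi> ` ((topspace CT - U) \<inter> K)" using sub by auto
  ultimately obtain d where d: "d > 0" "ball 0 d \<subseteq> - \<psi> ` ((topspace CT - U) \<inter> K)"
    by (metis ComplI open_Compl open_contains_ball)
  have "q \<in> U" if "q \<in> K" "\<bar>\<psi> q\<bar> < d" for q
  proof (rule ccontr)
    assume "q \<notin> U"
    then have "\<psi> q \<in> \<psi> ` ((topspace CT - U) \<inter> K)" using that Kp by blast
    moreover have "\<psi> q \<in> ball 0 d" using that by simp
    ultimately show False using d(2) by blast
  qed
  then show ?thesis using d(1) by blast
qed

lemma compact_fibre_neighbourhood:
  assumes K: "compactin CT K" and U: "openin CT U" and sub: "\<And>p. p \<in> K \<Longrightarrow> F2 C p = \<tau> \<Longrightarrow> p \<in> U"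
  shows "\<exists>d>0. \<forall>q\<in>K. \<bar>F2 C q - \<tau>\<bar> < d \<longrightarrow> q \<in> U"
proof (rule compact_zero_neighbourhood[OF K U])
  show "continuous_map CT euclideanreal (\<lambda>q. F2 C q - \<tau>)" using F2_continuous by (intro continuous_intros) auto
qed (use sub in auto)

lemma compact_locally_finite:
  assumes K: "compactin Y K" and S: "\<And>p. p \<in> K \<Longrightarrow> \<exists>U. openin Y U \<and> p \<in> U \<and> U \<inter> S \<subseteq> {p}"
  shows "finite (K \<inter> S)"
proof -
  obtain U where U: "\<And>p. p \<in> K \<Longrightarrow> openin Y (U p) \<and> p \<in> U p \<and> U p \<inter> S \<subseteq> {p}" using S by metis
  obtain F where F: "finite F" "F \<subseteq> U ` K" "K \<subseteq> \<Union>F"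
  proof -
    have "(\<forall>V\<in>U ` K. openin Y V) \<and> K \<subseteq> \<Union>(U ` K)" using U by blast
    then have "\<exists>F. finite F \<and> F \<subseteq> U ` K \<and> K \<subseteq> \<Union>F" using K unfolding compactin_def by blast
    then show thesis using that by blast
  qed
  then obtain G where G: "finite G" "G \<subseteq> K" "F = U ` G" by (metis finite_subset_image)
  have "K \<inter> S \<subseteq> G"
  proof
    fix p assume p: "p \<in> K \<inter> S"
    then obtain q where q: "q \<in> G" "p \<in> U q" using F(3) G(3) by blast
    then have "p \<in> {q}" using U[of q] G(2) p by blast
    then show "p \<in> G" using q by simp
  qed
  then show ?thesis using G finite_subset by blast
qed

definition crit :: "('i \<times> complex) set" where "crit = births C \<union> deaths C"

text \<open>
  Small arcs are open, so an interior extremum along an arc is a local extremum on the curve; an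
  interior point of an arc is no endpoint of the curve.
\<close>

lemma crit_arcI:
  assumes i: "i \<in> comps C" and su: "{s..u} \<subseteq> dom i \<inter> ball t0 1" and m: "m \<in> {s<..<u}"
    and ext: "(\<forall>t\<in>{s..u}. F2 C (arc i t) \<le> F2 C (arc i m)) \<or> (\<forall>t\<in>{s..u}. F2 C (arc i m) \<le> F2 C (arc i t))"
  shows "arc i m \<in> crit"
proof -
  have "m \<in> {s..u}" using m by simp
  then have mp: "arc i m \<in> pts C" using su i arc_pts by blast
  have "arc i m \<notin> endpts C"
  proof
    assume "arc i m \<in> endpts C"
    then have "i \<notin> circles C" "m = 0 \<or> m = 1" by (auto simp: endpts_def arc_at_def param_def split: if_splits)
    then have "dom i = {0..1}" by (simp add: pdom_def)
    then have "s \<ge> 0" "u \<le> 1" using su m by (force, force)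
    then show False using \<open>m = 0 \<or> m = 1\<close> m by auto
  qed
  moreover have "openin CT (arc i ` {s<..<u})"
  proof (rule arc_open[OF i, of _ t0])
    show "openin (top_of_set (dom i)) {s<..<u}" using su by (intro open_subset) auto
  qed (use su in auto)
  moreover have "arc i m \<in> arc i ` {s<..<u}" using m by auto
  ultimately show ?thesis using ext mp unfolding crit_def births_def deaths_def
    by (auto intro!: exI[of _ "arc i ` {s<..<u}"])
qed

lemma crit_between:
  assumes i: "i \<in> comps C" and su: "{s..u} \<subseteq> dom i \<inter> ball t0 1" and lt: "s < u"
    and eq: "F2 C (arc i s) = F2 C (arc i u)"
  shows "\<exists>m\<in>{s<..<u}. arc i m \<in> crit"
proof -
  have cont: "continuous_on {s..u} (\<lambda>t. F2 C (arc i t))"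
    using continuous_on_subset[OF F2_arc_continuous[OF i]] su by blast
  obtain M where M: "M \<in> {s..u}" "\<forall>t\<in>{s..u}. F2 C (arc i t) \<le> F2 C (arc i M)"
    using continuous_attains_sup[OF _ _ cont] lt by auto
  obtain m where m: "m \<in> {s..u}" "\<forall>t\<in>{s..u}. F2 C (arc i m) \<le> F2 C (arc i t)"
    using continuous_attains_inf[OF _ _ cont] lt by auto
  consider "M \<in> {s<..<u}" | "m \<in> {s<..<u}" | "M \<in> {s, u}" "m \<in> {s, u}" using M(1) m(1) by fastforce
  then show ?thesis
  proof cases
    case 1 then show ?thesis using crit_arcI[OF i su 1] M by blast
  next
    case 2 then show ?thesis using crit_arcI[OF i su 2] m by blast
  next
    case 3
    then have e: "F2 C (arc i M) = F2 C (arc i s)" "F2 C (arc i m) = F2 C (arc i s)" using eq by auto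
    have "(s + u) / 2 \<in> {s<..<u}" using lt by auto
    moreover have "\<forall>t\<in>{s..u}. F2 C (arc i t) \<le> F2 C (arc i ((s + u) / 2))"
      using M(2) m(2) e calculation by (metis greaterThanLessThan_subseteq_atLeastAtMost_iff order.refl order_trans subsetD)
    ultimately show ?thesis using crit_arcI[OF i su] by blast
  qed
qed

end

section \<open>Vertices and critical points do not accumulate\<close>

lemma discrete_inE:
  assumes "discrete_in X V" "v \<in> V"
  obtains U where "openin X U" "v \<in> U" "U \<inter> V = {v}"
proof -
  have "openin (subtopology X V) {v}" using assms by (auto simp: discrete_in_def)
  then obtain U where "openin X U" "{v} = U \<inter> V" by (auto simp: openin_subtopology)
  then show ?thesis using that[of U] by blast
qed

lemma one_manifold_connected_neighbourhood:
  assumes "one_manifold Y" "openin Y W" "x \<in> W"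
  shows "\<exists>U. openin Y U \<and> connectedin Y U \<and> x \<in> U \<and> U \<subseteq> W"
proof -
  have "x \<in> topspace Y" using assms openin_subset by blast
  then obtain U where U: "openin Y U" "x \<in> U" "subtopology Y U homeomorphic_space euclideanreal \<or>
         subtopology Y U homeomorphic_space top_of_set {0::real..}"
    using assms(1) unfolding one_manifold_def by blast
  have "locally_connected_space (top_of_set {0::real..})"
    by (simp add: locally_connected_is_realinterval is_interval_ci)
  then have lc: "locally_connected_space (subtopology Y U)"
    using U(3) homeomorphic_locally_connected_space locally_connected_space_euclideanreal by blast
  have "openin (subtopology Y U) (U \<inter> W)" using assms(2) by (simp add: openin_subtopology_Int2)
  then obtain A where A: "openin (subtopology Y U) A" "connectedin (subtopology Y U) A" "x \<in> A" "A \<subseteq> U \<inter> W"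
    using lc U(2) assms(3) unfolding locally_connected_space by blast
  have "openin Y A" using A(1) U(1) openin_open_subtopology by blast
  moreover have "connectedin Y A" using A(2) by (simp add: connectedin_subtopology)
  ultimately show ?thesis using A by blast
qed

text \<open>
  The vertices form a discrete subspace, which need not be closed, so that they could accumulate
  at a point outside. This is excluded if they contain whole fibres of a map \<open>\<pi>\<close> along a path: a
  connected neighbourhood of \<open>x0\<close> in the complement of the vertices has an interval as its image
  under \<open>\<pi>\<close>, which contains \<open>t0\<close> and misses \<open>B\<close>. If \<open>t1\<close> in \<open>B\<close> were close to \<open>t0\<close>, this interval
  would end before \<open>t1\<close>, and the path would run inside the vertices beyond \<open>t1\<close>; this contradicts
  discreteness.
\<close>

lemma vertices_no_accumulation:
  fixes \<phi> :: "real \<Rightarrow> 'a" and \<pi> :: "'a \<Rightarrow> real"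
  assumes gs: "graph_structure X V" and x0: "x0 \<in> topspace X" "x0 \<notin> V"
    and U: "openin X U" "x0 \<in> U" and \<pi>: "continuous_map (subtopology X U) euclideanreal \<pi>"
    and \<phi>: "continuous_map (top_of_set J) X \<phi>" "t0 \<in> J" "\<phi> t0 = x0" "\<And>t. t \<in> J \<Longrightarrow> \<phi> t \<in> U \<Longrightarrow> \<pi> (\<phi> t) = t"
    and B: "B \<subseteq> J" "\<And>x. x \<in> U \<Longrightarrow> \<pi> x \<in> B \<Longrightarrow> x \<in> V" "\<And>t. t \<in> B \<Longrightarrow> t \<noteq> t0 \<Longrightarrow> t \<in> interior J"
  shows "\<exists>d>0. \<forall>t\<in>B. \<bar>t - t0\<bar> < d \<longrightarrow> t = t0"
proof -
  let ?Y = "subtopology X (topspace X - V)"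
  have dV: "discrete_in X V" and om: "one_manifold ?Y" using gs by (auto simp: graph_structure_def)
  have "openin ?Y (U \<inter> (topspace X - V))" using U by (auto simp: openin_subtopology)
  then obtain A where A: "openin ?Y A" "connectedin ?Y A" "x0 \<in> A" "A \<subseteq> U \<inter> (topspace X - V)"
    using one_manifold_connected_neighbourhood[OF om, of _ x0] x0 U by blast
  obtain O' where O': "openin X O'" "A = O' \<inter> (topspace X - V)" using A(1) by (auto simp: openin_subtopology)
  define W where "W = O' \<inter> U"
  have W: "openin X W" "x0 \<in> W" using O' U A(3) by (auto simp: W_def)
  have WA: "x \<in> A" if "x \<in> W" "x \<notin> V" for x
    using that O' openin_subset[OF W(1)] by (auto simp: W_def)
  have "connectedin (subtopology X U) A" using A(2,4) by (auto simp: connectedin_subtopology)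
  then have "connectedin euclideanreal (\<pi> ` A)" by (rule connectedin_continuous_map_image[OF \<pi>])
  then have conn: "is_interval (\<pi> ` A)" by (simp add: is_interval_connected_1)
  have t0A: "t0 \<in> \<pi> ` A" using A(3) \<phi>(2,3) \<phi>(4)[of t0] U by force
  have BA: "t \<notin> \<pi> ` A" if "t \<in> B" for t using that A(4) B(2) by blast
  have "openin (top_of_set J) {t \<in> J. \<phi> t \<in> W}"
    using openin_continuous_map_preimage[OF \<phi>(1) W(1)] by simp
  then obtain d where d: "d > 0" "ball t0 d \<inter> J \<subseteq> {t \<in> J. \<phi> t \<in> W}"
    using \<phi>(2,3) W(2) by (force simp: openin_contains_ball)
  have inA: "t \<in> \<pi> ` A" if "t \<in> J" "\<bar>t - t0\<bar> < d" "\<phi> t \<notin> V" for t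
  proof -
    have "\<phi> t \<in> W" using d(2) that by (auto simp: dist_real_def abs_minus_commute)
    then have "\<phi> t \<in> A" "\<pi> (\<phi> t) = t" using WA that \<phi>(4)[of t] by (auto simp: W_def)
    then show ?thesis by force
  qed
  have "t1 = t0" if t1: "t1 \<in> B" "\<bar>t1 - t0\<bar> < d" for t1
  proof (rule ccontr)
    assume ne: "t1 \<noteq> t0"
    then obtain e where e: "e > 0" "ball t1 e \<subseteq> J" using B(3)[OF t1(1)] mem_interior by blast
    define e' where "e' = min e (min \<bar>t1 - t0\<bar> (d - \<bar>t1 - t0\<bar>))"
    have e': "e' > 0" "e' \<le> e" "e' \<le> \<bar>t1 - t0\<bar>" "e' \<le> d - \<bar>t1 - t0\<bar>" using e ne t1 by (auto simp: e'_def)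
    (* The sign of the direction that leads away from t0. *)
    define sg where "sg = sgn (t1 - t0)"
    have sg: "sg = 1 \<and> t1 > t0 \<or> sg = -1 \<and> t1 < t0" using ne by (auto simp: sg_def sgn_if)
    have V: "t1 + sg * \<theta> \<in> J \<and> \<phi> (t1 + sg * \<theta>) \<in> V \<and> \<phi> (t1 + sg * \<theta>) \<in> W" if "0 < \<theta>" "\<theta> < e'" for \<theta>
    proof -
      let ?t = "t1 + sg * \<theta>"
      have J: "?t \<in> J" using e(2) e' that sg by (force simp: dist_real_def subset_eq)
      have near: "\<bar>?t - t0\<bar> < d" using e' that sg by auto
      have "?t \<notin> \<pi> ` A"
      proof
        assume "?t \<in> \<pi> ` A"
        then have "t1 \<in> \<pi> ` A"
          using sg conn[unfolded is_interval_1, rule_format, of t0 "t1 + sg * \<theta>" t1]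
            conn[unfolded is_interval_1, rule_format, of "t1 + sg * \<theta>" t0 t1] t0A that(1) by auto
        then show False using BA t1 by blast
      qed
      then show ?thesis using inA[OF J near] J d(2) near by (auto simp: dist_real_def abs_minus_commute)
    qed
    define t2 where "t2 = t1 + sg * (e'/2)"
    have t2: "t2 \<in> J" "\<phi> t2 \<in> V" "\<phi> t2 \<in> W" using V[of "e'/2"] e' by (auto simp: t2_def)
    obtain P where P: "openin X P" "\<phi> t2 \<in> P" "P \<inter> V = {\<phi> t2}" using discrete_inE[OF dV t2(2)] by blast
    have "openin (top_of_set J) {t \<in> J. \<phi> t \<in> P}"
      using openin_continuous_map_preimage[OF \<phi>(1) P(1)] by simp
    then obtain h where h: "h > 0" "ball t2 h \<inter> J \<subseteq> {t \<in> J. \<phi> t \<in> P}"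
      using t2(1) P(2) by (force simp: openin_contains_ball)
    (* A second parameter beyond t1, different from t2 but close to it. *)
    define \<theta> where "\<theta> = e'/2 + min (h/2) (e'/4)"
    have \<theta>: "0 < \<theta>" "\<theta> < e'" using e' h by (auto simp: \<theta>_def min_def)
    let ?t3 = "t1 + sg * \<theta>"
    have t3: "?t3 \<in> J" "\<phi> ?t3 \<in> V" "\<phi> ?t3 \<in> W" using V[OF \<theta>] by auto
    have "?t3 \<in> ball t2 h" using sg h e' by (auto simp: t2_def \<theta>_def dist_real_def min_def)
    then have "\<phi> ?t3 = \<phi> t2" using h(2) t3 P(3) by blast
    then have "?t3 = t2" using \<phi>(4)[OF t3(1)] \<phi>(4)[OF t2(1)] t3(3) t2(3) by (auto simp: W_def)
    then show False using sg h e' by (auto simp: t2_def \<theta>_def min_def split: if_splits)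
  qed
  then show ?thesis using d(1) by blast
qed

locale morse =
  fixes M :: "('i, 'k::idom) morse"
  assumes morse: "morse_tuple M"
begin

sublocale cerf M
  by unfold_locales (use morse in \<open>simp add: morse_tuple_def\<close>)

abbreviation "PT \<equiv> pair_top M"
abbreviation "V \<equiv> verts M"

lemma topspace_pair: "topspace PT = {(c1, c2). c1 \<in> pts M \<and> c2 \<in> pts M \<and> F2 M c1 = F2 M c2}"
  by (auto simp: pair_top_def topspace_curve_top)

lemma graph: "graph_structure PT V"
  using morse by (simp add: morse_tuple_def)

lemma V_discrete: "discrete_in PT V"
  using graph by (simp add: graph_structure_def)

lemma crit_pts: "c \<in> crit \<Longrightarrow> c \<in> pts M" "c \<in> crit \<Longrightarrow> c \<notin> endpts M"
  by (auto simp: crit_def births_def deaths_def)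

lemma crit_pair_in_V: "(c1, c2) \<in> topspace PT \<Longrightarrow> c1 \<in> crit \<or> c2 \<in> crit \<Longrightarrow> (c1, c2) \<in> V"
  using morse by (auto simp: morse_tuple_def crit_def birth_pairs_def death_pairs_def)

lemma openin_pair:
  "openin CT A \<Longrightarrow> openin CT B \<Longrightarrow> openin PT {x \<in> topspace PT. fst x \<in> A \<and> snd x \<in> B}"
proof -
  assume "openin CT A" "openin CT B"
  then have "openin (prod_topology CT CT) (A \<times> B)" by (simp add: openin_prod_Times_iff)
  moreover have "{x \<in> topspace PT. fst x \<in> A \<and> snd x \<in> B} = (A \<times> B) \<inter> {(c1, c2). F2 M c1 = F2 M c2}"
    using openin_subset[OF \<open>openin CT A\<close>] openin_subset[OF \<open>openin CT B\<close>]
    by (auto simp: topspace_pair topspace_curve_top)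
  ultimately show ?thesis unfolding pair_top_def openin_subtopology by blast
qed

lemma continuous_into_pair:
  assumes "continuous_map Y CT f" "continuous_map Y CT g" "\<And>y. y \<in> topspace Y \<Longrightarrow> F2 M (f y) = F2 M (g y)"
  shows "continuous_map Y PT (\<lambda>y. (f y, g y))"
  unfolding pair_top_def continuous_map_in_subtopology
  using assms by (auto simp: continuous_map_pairwise comp_def)

text \<open>
  Every pair with a critical entry is a vertex. Critical points on an arc that accumulate at \<open>p\<close>
  would thus give whole fibres of vertices which accumulate at the pair \<open>(p,p)\<close>.
\<close>

lemma crit_isolated:
  assumes p: "p \<in> pts M"
  shows "\<exists>U. openin CT U \<and> p \<in> U \<and> U \<inter> crit \<subseteq> {p}"
proof -
  obtain i t0 where it: "i \<in> comps M" "t0 \<in> dom i" "p = arc i t0" using p by (auto simp: in_pts)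
  have pp: "(p, p) \<in> topspace PT" using p by (simp add: topspace_pair)
  show ?thesis
  proof (cases "(p, p) \<in> V")
    case True
    obtain P where P: "openin PT P" "(p, p) \<in> P" "P \<inter> V = {(p, p)}" using discrete_inE[OF V_discrete True] by blast
    have "continuous_map CT PT (\<lambda>y. (y, y))" by (rule continuous_into_pair) auto
    then have "openin CT {c \<in> topspace CT. (c, c) \<in> P}" using P(1) by (rule openin_continuous_map_preimage)
    moreover have "c = p" if "(c, c) \<in> P" "c \<in> crit" for c
      using crit_pair_in_V[of c c] that P(3) crit_pts by (auto simp: topspace_pair)
    ultimately show ?thesis using P p
      by (intro exI[of _ "{c \<in> topspace CT. (c, c) \<in> P}"]) (auto simp: topspace_curve_top)
  next
    case False
    define J where "J = dom i \<inter> ball t0 1"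
    define U where "U = {x \<in> topspace PT. fst x \<in> arc i ` J \<and> snd x \<in> pts M}"
    define \<pi> where "\<pi> x = the_inv_into J (arc i) (fst x)" for x :: "('i \<times> complex) \<times> ('i \<times> complex)"
    have inj: "inj_on (arc i) J" using arc_inj[of i t0] by (rule inj_on_subset) (auto simp: J_def)
    have \<pi>: "\<pi> (arc i t, c) = t" if "t \<in> J" for t c using that inj by (simp add: \<pi>_def the_inv_into_f_f)
    have Jo: "openin CT (arc i ` J)" unfolding J_def by (rule arc_ball_open[OF it(1)]) simp
    have Uo: "openin PT U" unfolding U_def
      by (rule openin_pair[OF Jo]) (metis openin_topspace topspace_curve_top)
    have \<pi>c: "continuous_map (subtopology PT U) euclideanreal \<pi>"
      unfolding continuous_map_def
    proof (intro conjI allI impI)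
      fix S :: "real set" assume "openin euclideanreal S"
      then have S: "open S" by simp
      have oJS: "openin (top_of_set (dom i)) (J \<inter> S)"
        using openin_open_Int[of "ball t0 1 \<inter> S" "dom i"] S by (simp add: J_def Int_assoc open_Int)
      have "openin CT (arc i ` (J \<inter> S))"
        by (rule arc_open[OF it(1) oJS]) (auto simp: J_def)
      then have "openin PT {x \<in> topspace PT. fst x \<in> arc i ` (J \<inter> S) \<and> snd x \<in> pts M}"
        by (rule openin_pair) (metis openin_topspace topspace_curve_top)
      note op = this
      have "\<pi> x \<in> S \<longleftrightarrow> fst x \<in> arc i ` (J \<inter> S)" if xU: "x \<in> U" for x
      proof -
        obtain t where t: "t \<in> J" "fst x = arc i t" using xU by (auto simp: U_def)
        then have "\<pi> x = t" using \<pi>[of t "snd x"] by (metis prod.collapse)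
        then show ?thesis using t inj by (auto dest: inj_onD)
      qed
      then have "{x \<in> U. \<pi> x \<in> S} = {x \<in> U. fst x \<in> arc i ` (J \<inter> S)}" by (intro Collect_cong conj_cong) simp_all
      also have "\<dots> = {x \<in> topspace PT. fst x \<in> arc i ` (J \<inter> S) \<and> snd x \<in> pts M} \<inter> U"
        unfolding U_def by blast
      moreover have "topspace (subtopology PT U) = U" using openin_subset[OF Uo] by (simp add: Int_absorb1)
      ultimately have "{x \<in> topspace (subtopology PT U). \<pi> x \<in> S} =
         {x \<in> topspace PT. fst x \<in> arc i ` (J \<inter> S) \<and> snd x \<in> pts M} \<inter> U" by simp
      then show "openin (subtopology PT U) {x \<in> topspace (subtopology PT U). \<pi> x \<in> S}"
        using op unfolding openin_subtopology by blast
    qed simp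
    have "\<exists>d>0. \<forall>t\<in>{t \<in> J. arc i t \<in> crit}. \<bar>t - t0\<bar> < d \<longrightarrow> t = t0"
    proof (rule vertices_no_accumulation[OF graph pp False Uo _ \<pi>c])
      have "continuous_map (top_of_set J) CT (arc i)"
        using arc_continuous[OF it(1)] unfolding J_def by (rule continuous_map_from_subtopology_mono) auto
      then show "continuous_map (top_of_set J) PT (\<lambda>t. (arc i t, arc i t))"
        by (intro continuous_into_pair) auto
      show "t0 \<in> J" using it by (simp add: J_def)
      show "(p, p) \<in> U" using pp p \<open>t0 \<in> J\<close> it by (auto simp: U_def)
      show "(arc i t0, arc i t0) = (p, p)" using it by simp
      show "\<pi> (arc i t, arc i t) = t" if "t \<in> J" for t using \<pi>[OF that] .
      show "{t \<in> J. arc i t \<in> crit} \<subseteq> J" by blast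
      show "x \<in> V" if xU: "x \<in> U" and xc: "\<pi> x \<in> {t \<in> J. arc i t \<in> crit}" for x
      proof -
        obtain t where t: "t \<in> J" "fst x = arc i t" using xU by (auto simp: U_def)
        then have "\<pi> x = t" using \<pi>[of t "snd x"] by (metis prod.collapse)
        then have "fst x \<in> crit" using xc t by simp
        moreover have "(fst x, snd x) \<in> topspace PT" using xU by (simp add: U_def)
        ultimately have "(fst x, snd x) \<in> V" by (intro crit_pair_in_V) simp_all
        then show ?thesis by simp
      qed
      show "t \<in> interior J" if "t \<in> {t \<in> J. arc i t \<in> crit}" "t \<noteq> t0" for t
      proof (cases "i \<in> circles M")
        case True
        then show ?thesis using that by (simp add: J_def pdom_def interior_open)
      next
        case False
        then have "t \<noteq> 0" "t \<noteq> 1"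
          using that crit_pts(2)[of "arc i t"] it(1) by (auto simp: endpts_def arc_at_def param_def)
        then have "t \<in> {0<..<1} \<inter> ball t0 1" using that False by (auto simp: J_def pdom_def)
        moreover have "{0<..<1} \<inter> ball t0 1 \<subseteq> J" using False by (auto simp: J_def pdom_def)
        ultimately show ?thesis by (meson interior_maximal open_Int open_ball open_greaterThanLessThan subsetD)
      qed
    qed
    then obtain d where d: "d > 0" "\<forall>t\<in>{t \<in> J. arc i t \<in> crit}. \<bar>t - t0\<bar> < d \<longrightarrow> t = t0" by blast
    show ?thesis
    proof (intro exI conjI)
      show "openin CT (arc i ` (dom i \<inter> ball t0 (min 1 d)))" by (rule arc_ball_open[OF it(1)]) simp
      show "p \<in> arc i ` (dom i \<inter> ball t0 (min 1 d))" using it d(1) by auto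
      show "arc i ` (dom i \<inter> ball t0 (min 1 d)) \<inter> crit \<subseteq> {p}"
        using d(2) it(3) by (auto simp: J_def dist_real_def abs_minus_commute)
    qed
  qed
qed

text \<open>
  Between two points with the same parameter there is an interior extremum.
\<close>

lemma F2_arc_inj:
  assumes i: "i \<in> comps M" and conv: "\<And>s u. s \<in> S \<Longrightarrow> u \<in> S \<Longrightarrow> {s..u} \<subseteq> S" and S: "S \<subseteq> dom i \<inter> ball t0 1"
    and nc: "\<And>s u m. s \<in> S \<Longrightarrow> u \<in> S \<Longrightarrow> s < m \<Longrightarrow> m < u \<Longrightarrow> arc i m \<notin> crit"
  shows "inj_on (\<lambda>t. F2 M (arc i t)) S"
proof -
  have "F2 M (arc i s) \<noteq> F2 M (arc i u)" if "s \<in> S" "u \<in> S" "s < u" for s u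
    using crit_between[OF i _ that(3)] conv[OF that(1,2)] S nc[OF that(1,2)] by fastforce
  then show ?thesis by (auto simp: inj_on_def) (metis linorder_less_linear)
qed

lemma arc_neighbourhood_at:
  assumes it: "i \<in> comps M" "t0 \<in> dom i" "p = arc i t0" and U: "openin CT U" "p \<in> U"
  shows "\<exists>\<eta>>0. \<eta> \<le> 1 \<and>
    arc i ` (dom i \<inter> ball t0 \<eta>) \<subseteq> U \<and> arc i ` (dom i \<inter> ball t0 \<eta>) \<inter> crit \<subseteq> {p} \<and>
    inj_on (\<lambda>t. F2 M (arc i t)) (dom i \<inter> ball t0 \<eta> \<inter> {..t0}) \<and>
    inj_on (\<lambda>t. F2 M (arc i t)) (dom i \<inter> ball t0 \<eta> \<inter> {t0..}) \<and>
    (p \<notin> crit \<longrightarrow> inj_on (\<lambda>t. F2 M (arc i t)) (dom i \<inter> ball t0 \<eta>))"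
proof -
  have p: "p \<in> pts M" using it arc_pts by simp
  obtain W where W: "openin CT W" "p \<in> W" "W \<inter> crit \<subseteq> {p}" using crit_isolated[OF p] by blast
  obtain \<eta> where \<eta>: "0 < \<eta>" "\<eta> \<le> 1" "arc i ` (dom i \<inter> ball t0 \<eta>) \<subseteq> U \<inter> W"
    by (rule neighbourhood_arc[OF it(1,2), of "U \<inter> W"]) (use U W it(3) in auto)
  have crit: "arc i ` (dom i \<inter> ball t0 \<eta>) \<inter> crit \<subseteq> {p}" using \<eta>(3) W(3) by blast
  have conv: "{s..u} \<subseteq> dom i \<inter> ball t0 \<eta>" if "s \<in> dom i \<inter> ball t0 \<eta>" "u \<in> dom i \<inter> ball t0 \<eta>" for s u
    using dom_connected[of s i u] that by (auto simp: dist_real_def)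
  have sub: "dom i \<inter> ball t0 \<eta> \<subseteq> dom i \<inter> ball t0 1" using \<eta> by auto
  have nc: "arc i m \<notin> crit" if "s \<in> dom i \<inter> ball t0 \<eta>" "u \<in> dom i \<inter> ball t0 \<eta>" "s < m" "m < u" "m \<noteq> t0 \<or> p \<notin> crit" for s u m
  proof -
    have "m \<in> {s..u}" using that by simp
    then have m: "m \<in> dom i \<inter> ball t0 \<eta>" using conv[OF that(1,2)] by blast
    then have "arc i m = p \<longrightarrow> m = t0" using inj_onD[OF arc_inj, of i m t0 t0] sub it by auto
    then show ?thesis using crit m that(5) by blast
  qed
  show ?thesis
  proof (rule exI[of _ \<eta>], intro conjI impI)
    show "arc i ` (dom i \<inter> ball t0 \<eta>) \<subseteq> U" using \<eta>(3) by blast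
    show "inj_on (\<lambda>t. F2 M (arc i t)) (dom i \<inter> ball t0 \<eta> \<inter> {..t0})"
    proof (rule F2_arc_inj[OF it(1), of _ t0])
      show "{s..u} \<subseteq> dom i \<inter> ball t0 \<eta> \<inter> {..t0}" if "s \<in> dom i \<inter> ball t0 \<eta> \<inter> {..t0}" "u \<in> dom i \<inter> ball t0 \<eta> \<inter> {..t0}" for s u
        using conv[of s u] that by auto
    qed (use sub nc in auto)
    show "inj_on (\<lambda>t. F2 M (arc i t)) (dom i \<inter> ball t0 \<eta> \<inter> {t0..})"
    proof (rule F2_arc_inj[OF it(1), of _ t0])
      show "{s..u} \<subseteq> dom i \<inter> ball t0 \<eta> \<inter> {t0..}" if "s \<in> dom i \<inter> ball t0 \<eta> \<inter> {t0..}" "u \<in> dom i \<inter> ball t0 \<eta> \<inter> {t0..}" for s u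
        using conv[of s u] that by auto
    qed (use sub nc in auto)
    show "inj_on (\<lambda>t. F2 M (arc i t)) (dom i \<inter> ball t0 \<eta>)" if "p \<notin> crit"
      by (rule F2_arc_inj[OF it(1) conv sub]) (use nc that in auto)
  qed (use it \<eta> crit in auto)
qed

lemma arc_neighbourhood:
  assumes p: "p \<in> pts M" and U: "openin CT U" "p \<in> U"
  shows "\<exists>i t0 \<eta>. i \<in> comps M \<and> t0 \<in> dom i \<and> p = arc i t0 \<and> 0 < \<eta> \<and> \<eta> \<le> 1 \<and>
    arc i ` (dom i \<inter> ball t0 \<eta>) \<subseteq> U \<and> arc i ` (dom i \<inter> ball t0 \<eta>) \<inter> crit \<subseteq> {p} \<and>
    inj_on (\<lambda>t. F2 M (arc i t)) (dom i \<inter> ball t0 \<eta> \<inter> {..t0}) \<and>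
    inj_on (\<lambda>t. F2 M (arc i t)) (dom i \<inter> ball t0 \<eta> \<inter> {t0..}) \<and>
    (p \<notin> crit \<longrightarrow> inj_on (\<lambda>t. F2 M (arc i t)) (dom i \<inter> ball t0 \<eta>))"
proof -
  obtain i t0 where it: "i \<in> comps M" "t0 \<in> dom i" "p = arc i t0" using p by (auto simp: in_pts)
  show ?thesis using arc_neighbourhood_at[OF it U] it by blast
qed

section \<open>Branches\<close>

definition near01 :: "real \<Rightarrow> real \<Rightarrow> real set" where
  "near01 \<tau> e = {\<tau> - e<..<\<tau> + e} \<inter> {0..1}"

text \<open>
  Near a point that is no birth and no death the parameter is injective along the arc, and the
  branch is its inverse. An endpoint of the curve lies over 0 or 1, which is why the inverse is
  defined on the whole of a neighbourhood in \<open>[0,1]\<close>.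
\<close>

lemma branch_is_branch:
  assumes p: "p \<in> pts M" "p \<notin> crit"
  shows "is_branch M p (branch M p)"
proof -
  have "openin CT (topspace CT)" by simp
  then obtain i t0 \<eta> where it: "i \<in> comps M" "t0 \<in> dom i" "p = arc i t0" "0 < \<eta>" "\<eta> \<le> 1"
    "inj_on (\<lambda>t. F2 M (arc i t)) (dom i \<inter> ball t0 \<eta>)"
    using arc_neighbourhood[OF p(1), of "topspace CT"] p by (auto simp: topspace_curve_top simp del: ball_eq_greaterThanLessThan)
  define f where "f t = F2 M (arc i t)" for t
  define S where "S = dom i \<inter> cball t0 (\<eta>/2)"
  have Sb: "S \<subseteq> dom i \<inter> ball t0 \<eta>" using it by (auto simp: S_def)
  have inj: "inj_on f S" using it(6) Sb unfolding f_def by (rule inj_on_subset)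
  have S: "compact S" "t0 \<in> S" using it dom_closed[of i] by (auto simp: S_def compact_Int_closed closed_Int_compact)
  have "connected S" unfolding S_def pdom_def
    by (auto simp: cball_eq_atLeastAtMost intro!: convex_connected convex_Int)
  have fc: "continuous_on S f" unfolding f_def using F2_arc_continuous[OF it(1)] by (rule continuous_on_subset) (auto simp: S_def)
  have "compact (f ` S)" "connected (f ` S)" "f ` S \<noteq> {}"
    using S fc \<open>connected S\<close> by (auto intro: compact_continuous_image connected_continuous_image)
  then obtain c d where cd: "f ` S = {c..d}" "c \<le> d" by (metis connected_compact_interval_1 atLeastatMost_empty_iff)
  have t0cd: "f t0 \<in> {c..d}" using S cd by blast
  have dom_S: "\<exists>\<theta>. \<theta> \<noteq> t0 \<and> \<theta> \<in> S"
  proof -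
    have "t0 + \<eta>/2 \<in> S \<or> t0 - \<eta>/2 \<in> S" using it by (auto simp: S_def pdom_def dist_real_def split: if_splits)
    then show ?thesis using it(4) by force
  qed
  then have "c < d"
  proof -
    obtain \<theta> where "\<theta> \<noteq> t0" "\<theta> \<in> S" using dom_S by blast
    then have "f \<theta> \<noteq> f t0" "f \<theta> \<in> {c..d}" using inj S cd by (auto simp: inj_on_def)
    then show ?thesis using t0cd by auto
  qed
  have f01: "f t \<in> {0..1}" if "t \<in> S" for t using F2_range[OF arc_pts[OF it(1)]] that by (auto simp: f_def S_def)
  then have cd01: "0 \<le> c" "d \<le> 1" using cd \<open>c < d\<close> f01 by (metis atLeastAtMost_iff image_iff less_eq_real_def order.refl)+
  have lo: "f t0 = 0" if "f t0 = c"
  proof -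
    have "p \<in> endpts M"
    proof (rule ccontr)
      assume "p \<notin> endpts M"
      moreover have "\<forall>q\<in>arc i ` (dom i \<inter> ball t0 (\<eta>/2)). F2 M p \<le> F2 M q"
      proof
        fix q assume "q \<in> arc i ` (dom i \<inter> ball t0 (\<eta>/2))"
        moreover have "dom i \<inter> ball t0 (\<eta>/2) \<subseteq> S" by (auto simp: S_def)
        ultimately obtain t where "t \<in> S" "q = arc i t" by blast
        then show "F2 M p \<le> F2 M q" using cd that it by (auto simp: f_def)
      qed
      moreover have "openin CT (arc i ` (dom i \<inter> ball t0 (\<eta>/2)))" by (rule arc_ball_open[OF it(1)]) (use it in simp)
      moreover have "p \<in> arc i ` (dom i \<inter> ball t0 (\<eta>/2))" using it by auto
      ultimately have "p \<in> births M" using p unfolding births_def by blast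
      then show False using p by (simp add: crit_def)
    qed
    then have "f t0 \<in> {0, 1}" using morse it(3) by (auto simp: morse_tuple_def cerf_tuple_def f_def)
    then show ?thesis using that cd01 \<open>c < d\<close> by auto
  qed
  have hi: "f t0 = 1" if "f t0 = d"
  proof -
    have "p \<in> endpts M"
    proof (rule ccontr)
      assume "p \<notin> endpts M"
      moreover have "\<forall>q\<in>arc i ` (dom i \<inter> ball t0 (\<eta>/2)). F2 M q \<le> F2 M p"
      proof
        fix q assume "q \<in> arc i ` (dom i \<inter> ball t0 (\<eta>/2))"
        moreover have "dom i \<inter> ball t0 (\<eta>/2) \<subseteq> S" by (auto simp: S_def)
        ultimately obtain t where "t \<in> S" "q = arc i t" by blast
        then show "F2 M q \<le> F2 M p" using cd that it by (auto simp: f_def)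
      qed
      moreover have "openin CT (arc i ` (dom i \<inter> ball t0 (\<eta>/2)))" by (rule arc_ball_open[OF it(1)]) (use it in simp)
      moreover have "p \<in> arc i ` (dom i \<inter> ball t0 (\<eta>/2))" using it by auto
      ultimately have "p \<in> deaths M" using p unfolding deaths_def by blast
      then show False using p by (simp add: crit_def)
    qed
    then have "f t0 \<in> {0, 1}" using morse it(3) by (auto simp: morse_tuple_def cerf_tuple_def f_def)
    then show ?thesis using that cd01 \<open>c < d\<close> by auto
  qed
  define e where "e = min (if f t0 = c then 1 else f t0 - c) (if f t0 = d then 1 else d - f t0)"
  define e' where "e' = min e (d - c)"
  have e: "e' > 0" using t0cd \<open>c < d\<close> by (auto simp: e_def e'_def)
  have sub: "{f t0 - e'<..<f t0 + e'} \<inter> {0..1} \<subseteq> {c..d}"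
    using lo hi t0cd e by (auto simp: e_def e'_def min_def split: if_splits)
  define g where "g r = arc i (the_inv_into S f r)" for r
  have gc: "continuous_on {c..d} (the_inv_into S f)"
    using continuous_on_inv_into[OF fc S(1) inj] cd by simp
  have gS: "the_inv_into S f r \<in> S" "f (the_inv_into S f r) = r" if "r \<in> {c..d}" for r
    using the_inv_into_into[OF inj, of r S] f_the_inv_into_f[OF inj, of r] that cd by auto
  have "is_branch M p g" unfolding is_branch_def
  proof (intro conjI exI[of _ e'])
    show "g (F2 M p) = p" using the_inv_into_f_f[OF inj S(2)] it by (simp add: g_def f_def)
    have "continuous_map (top_of_set {c..d}) (top_of_set (dom i)) (the_inv_into S f)"
      using gc gS by (auto simp: continuous_map_in_subtopology continuous_map_iff_continuous S_def)
    then have "continuous_map (top_of_set {c..d}) CT (arc i \<circ> the_inv_into S f)"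
      by (rule continuous_map_compose[OF _ arc_continuous[OF it(1)]])
    moreover have "g = arc i \<circ> the_inv_into S f" by (simp add: g_def fun_eq_iff)
    ultimately have "continuous_map (top_of_set {c..d}) CT g" by simp
    then show "continuous_map (top_of_set ({F2 M p - e'<..<F2 M p + e'} \<inter> {0..1})) CT g"
      by (rule continuous_map_from_subtopology_mono) (use sub it in \<open>simp add: f_def\<close>)
    show "\<forall>t\<in>{F2 M p - e'<..<F2 M p + e'} \<inter> {0..1}. F2 M (g t) = t"
      using gS sub it unfolding g_def f_def by blast
  qed (use e in auto)
  then show ?thesis unfolding branch_def by (rule someI[of "is_branch M p"])
qed

lemma branch_at: "p \<in> pts M \<Longrightarrow> p \<notin> crit \<Longrightarrow> branch M p (F2 M p) = p"
  using branch_is_branch by (simp add: is_branch_def)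

lemma branch_continuous:
  assumes p: "p \<in> pts M" "p \<notin> crit"
  obtains e where "e > 0" "continuous_map (top_of_set (near01 (F2 M p) e)) CT (branch M p)"
    "\<And>r. r \<in> near01 (F2 M p) e \<Longrightarrow> F2 M (branch M p r) = r"
  using branch_is_branch[OF p] unfolding is_branch_def near01_def by blast

lemma near01_mono: "e' \<le> e \<Longrightarrow> near01 \<tau> e' \<subseteq> near01 \<tau> e"
  by (auto simp: near01_def)

lemma continuous_path_near:
  fixes t0 :: real
  assumes c: "continuous_map (top_of_set J) CT \<sigma>" "t0 \<in> J" and U: "openin CT U" "\<sigma> t0 \<in> U"
  obtains d where "d > 0" "\<And>t. t \<in> J \<Longrightarrow> \<bar>t - t0\<bar> < d \<Longrightarrow> \<sigma> t \<in> U"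
proof -
  have "openin (top_of_set J) {t \<in> J. \<sigma> t \<in> U}"
    using openin_continuous_map_preimage[OF c(1) U(1)] by simp
  then obtain d where "d > 0" "ball t0 d \<inter> J \<subseteq> {t \<in> J. \<sigma> t \<in> U}"
    using c(2) U(2) by (force simp: openin_contains_ball)
  moreover have "t \<in> ball t0 d" if "\<bar>t - t0\<bar> < d" for t using that by (simp add: dist_real_def abs_minus_commute)
  ultimately have "d > 0" "\<And>t. t \<in> J \<Longrightarrow> \<bar>t - t0\<bar> < d \<Longrightarrow> \<sigma> t \<in> U" by blast+
  then show ?thesis by (rule that)
qed

lemma branch_unique:
  assumes p: "p \<in> pts M" "p \<notin> crit" and U: "openin CT U" "p \<in> U"
  shows "\<exists>W. openin CT W \<and> p \<in> W \<and> W \<subseteq> U \<and> W \<inter> crit = {} \<and> (\<exists>e>0. \<forall>r\<in>near01 (F2 M p) e. branch M p r \<in> W \<and>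
     F2 M (branch M p r) = r \<and> (\<forall>q\<in>W. F2 M q = r \<longrightarrow> q = branch M p r))"
proof -
  obtain i t0 \<eta> where it: "i \<in> comps M" "t0 \<in> dom i" "p = arc i t0" "0 < \<eta>" "\<eta> \<le> 1"
    "arc i ` (dom i \<inter> ball t0 \<eta>) \<subseteq> U" "inj_on (\<lambda>t. F2 M (arc i t)) (dom i \<inter> ball t0 \<eta>)"
    "arc i ` (dom i \<inter> ball t0 \<eta>) \<inter> crit \<subseteq> {p}"
    using arc_neighbourhood[OF p(1) U] p(2) by blast
  let ?W = "arc i ` (dom i \<inter> ball t0 \<eta>)"
  have W: "openin CT ?W" "p \<in> ?W" using arc_ball_open[OF it(1,5)] it by auto
  obtain e where e: "e > 0" "continuous_map (top_of_set (near01 (F2 M p) e)) CT (branch M p)"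
    "\<And>r. r \<in> near01 (F2 M p) e \<Longrightarrow> F2 M (branch M p r) = r" using branch_continuous[OF p] by blast
  have "F2 M p \<in> near01 (F2 M p) e" using e F2_range[OF p(1)] by (simp add: near01_def)
  then obtain d where d: "d > 0" "\<And>t. t \<in> near01 (F2 M p) e \<Longrightarrow> \<bar>t - F2 M p\<bar> < d \<Longrightarrow> branch M p t \<in> ?W"
    using continuous_path_near[OF e(2) _ W(1)] W(2) branch_at[OF p] by metis
  have uni: "q = q'" if qq: "q \<in> ?W" "q' \<in> ?W" "F2 M q = F2 M q'" for q q'
  proof -
    obtain s s' where "q = arc i s" "q' = arc i s'" "s \<in> dom i \<inter> ball t0 \<eta>" "s' \<in> dom i \<inter> ball t0 \<eta>"
      using qq by blast
    then show ?thesis using inj_onD[OF it(7), of s s'] qq(3) by simp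
  qed
  have "branch M p r \<in> ?W \<and> F2 M (branch M p r) = r \<and> (\<forall>q\<in>?W. F2 M q = r \<longrightarrow> q = branch M p r)"
    if r: "r \<in> near01 (F2 M p) (min e d)" for r
  proof -
    have re: "r \<in> near01 (F2 M p) e" "\<bar>r - F2 M p\<bar> < d" using r by (auto simp: near01_def)
    then have b: "branch M p r \<in> ?W" "F2 M (branch M p r) = r" using d e by auto
    moreover have "q = branch M p r" if "q \<in> ?W" "F2 M q = r" for q
      by (rule uni) (use b that in auto)
    ultimately show ?thesis by blast
  qed
  moreover have "min e d > 0" using e d by simp
  moreover have "?W \<inter> crit = {}" using it(8) p(2) by blast
  ultimately show ?thesis using W it(6) by blast
qed

text \<open>
  A small arc around a point consists of two halves, on each of which the parameter is injective.
\<close>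

lemma fibre_at_most_two:
  assumes p: "p \<in> pts M" and U: "openin CT U" "p \<in> U"
  shows "\<exists>W. openin CT W \<and> p \<in> W \<and> W \<subseteq> U \<and> W \<inter> crit \<subseteq> {p} \<and> (\<forall>q\<in>W. F2 M q = F2 M p \<longrightarrow> q = p) \<and>
     (\<forall>q1\<in>W. \<forall>q2\<in>W. \<forall>q3\<in>W. F2 M q1 = F2 M q2 \<longrightarrow> F2 M q2 = F2 M q3 \<longrightarrow> q1 = q2 \<or> q1 = q3 \<or> q2 = q3)"
proof -
  obtain i t0 \<eta> where it: "i \<in> comps M" "t0 \<in> dom i" "p = arc i t0" "0 < \<eta>" "\<eta> \<le> 1"
    "arc i ` (dom i \<inter> ball t0 \<eta>) \<subseteq> U" "arc i ` (dom i \<inter> ball t0 \<eta>) \<inter> crit \<subseteq> {p}"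
    "inj_on (\<lambda>t. F2 M (arc i t)) (dom i \<inter> ball t0 \<eta> \<inter> {..t0})"
    "inj_on (\<lambda>t. F2 M (arc i t)) (dom i \<inter> ball t0 \<eta> \<inter> {t0..})"
    using arc_neighbourhood[OF p(1) U] by blast
  let ?W = "arc i ` (dom i \<inter> ball t0 \<eta>)"
  have eq: "s = u" if "s \<in> dom i \<inter> ball t0 \<eta>" "u \<in> dom i \<inter> ball t0 \<eta>" "F2 M (arc i s) = F2 M (arc i u)" "s \<le> t0 \<and> u \<le> t0 \<or> s \<ge> t0 \<and> u \<ge> t0" for s u
    using inj_onD[OF it(8), of s u] inj_onD[OF it(9), of s u] that by auto
  have 1: "q = p" if q: "q \<in> ?W" "F2 M q = F2 M p" for q
  proof -
    obtain s where s: "q = arc i s" "s \<in> dom i \<inter> ball t0 \<eta>" using q by blast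
    have "s = t0" by (rule eq) (use s q it in auto)
    then show ?thesis using s it by simp
  qed
  have 2: "q1 = q2 \<or> q1 = q3 \<or> q2 = q3" if q: "q1 \<in> ?W" "q2 \<in> ?W" "q3 \<in> ?W" "F2 M q1 = F2 M q2" "F2 M q2 = F2 M q3" for q1 q2 q3
  proof -
    obtain s1 s2 s3 where s: "q1 = arc i s1" "q2 = arc i s2" "q3 = arc i s3" "s1 \<in> dom i \<inter> ball t0 \<eta>"
      "s2 \<in> dom i \<inter> ball t0 \<eta>" "s3 \<in> dom i \<inter> ball t0 \<eta>" using q(1-3) by blast
    have "F2 M (arc i s1) = F2 M (arc i s2)" "F2 M (arc i s1) = F2 M (arc i s3)" "F2 M (arc i s2) = F2 M (arc i s3)"
      using s q(4,5) by simp_all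
    then have "s1 = s2 \<or> s1 = s3 \<or> s2 = s3"
      using eq[OF s(4,5)] eq[OF s(4,6)] eq[OF s(5,6)] by linarith
    then show ?thesis unfolding s(1-3) by (elim disjE) simp_all
  qed
  have "openin CT ?W" "p \<in> ?W" using arc_ball_open[OF it(1,5)] it by auto
  then show ?thesis using it(6,7) 1 2 by (intro exI[of _ ?W] conjI ballI impI) simp_all
qed

end

section \<open>The flow line counter along paths\<close>

context morse
begin

text \<open>
  At a pair which is no vertex this does not follow from discreteness. Both entries of such a pair
  are noncritical, so that all nearby pairs over a common parameter lie on the single path formed
  by the two branches, and \<open>vertices_no_accumulation\<close> applies.
\<close>

lemma V_isolated:
  assumes x: "x \<in> topspace PT"
  shows "\<exists>U. openin PT U \<and> x \<in> U \<and> U \<inter> V \<subseteq> {x}"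
proof (cases "x \<in> V")
  case True
  then show ?thesis by (metis discrete_inE[OF V_discrete] order.refl)
next
  case False
  obtain c1 c2 where c: "x = (c1, c2)" "c1 \<in> pts M" "c2 \<in> pts M" "F2 M c1 = F2 M c2"
    using x by (auto simp: topspace_pair)
  have nc: "c1 \<notin> crit" "c2 \<notin> crit" using crit_pair_in_V[of c1 c2] x False c by auto
  define \<tau> where "\<tau> = F2 M c1"
  have \<tau>: "0 \<le> \<tau>" "\<tau> \<le> 1" using F2_range[OF c(2)] by (auto simp: \<tau>_def)
  obtain W1 e1 where W1: "openin CT W1" "c1 \<in> W1" "e1 > 0" "\<forall>r\<in>near01 \<tau> e1. branch M c1 r \<in> W1 \<and>
     F2 M (branch M c1 r) = r \<and> (\<forall>q\<in>W1. F2 M q = r \<longrightarrow> q = branch M c1 r)"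
    using branch_unique[OF c(2) nc(1) openin_topspace[of CT]] c unfolding \<tau>_def by (auto simp: topspace_curve_top)
  obtain W2 e2 where W2: "openin CT W2" "c2 \<in> W2" "e2 > 0" "\<forall>r\<in>near01 \<tau> e2. branch M c2 r \<in> W2 \<and>
     F2 M (branch M c2 r) = r \<and> (\<forall>q\<in>W2. F2 M q = r \<longrightarrow> q = branch M c2 r)"
    using branch_unique[OF c(3) nc(2) openin_topspace[of CT]] c unfolding \<tau>_def by (auto simp: topspace_curve_top)
  obtain e3 where e3: "e3 > 0" "continuous_map (top_of_set (near01 \<tau> e3)) CT (branch M c1)"
    using branch_continuous[OF c(2) nc(1)] unfolding \<tau>_def by metis
  obtain e4 where e4: "e4 > 0" "continuous_map (top_of_set (near01 \<tau> e4)) CT (branch M c2)"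
    using branch_continuous[OF c(3) nc(2)] c(4) unfolding \<tau>_def by metis
  (* Neither 0 nor 1 is closer to \<tau> than h, unless it equals \<tau>. *)
  obtain h :: real where h: "h > 0" "\<tau> > 0 \<Longrightarrow> h \<le> \<tau>" "\<tau> < 1 \<Longrightarrow> h \<le> 1 - \<tau>"
  proof -
    have "\<exists>h>0. (\<tau> > 0 \<longrightarrow> h \<le> \<tau>) \<and> (\<tau> < 1 \<longrightarrow> h \<le> 1 - \<tau>)"
      by (rule exI[of _ "if \<tau> = 0 \<or> \<tau> = 1 then 1 else min \<tau> (1 - \<tau>)"]) (use \<tau> in \<open>auto simp: min_def\<close>)
    then show thesis using that by blast
  qed
  define e where "e = min (min e1 e2) (min (min e3 e4) h)"
  have e: "e > 0" "e \<le> e1" "e \<le> e2" "e \<le> e3" "e \<le> e4" "\<tau> > 0 \<Longrightarrow> e \<le> \<tau>" "\<tau> < 1 \<Longrightarrow> e \<le> 1 - \<tau>"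
    using W1(3) W2(3) e3(1) e4(1) h by (auto simp: e_def)
  define J where "J = near01 \<tau> e"
  define \<phi> where "\<phi> r = (branch M c1 r, branch M c2 r)" for r
  define W where "W = W1 \<inter> {p \<in> pts M. F2 M p \<in> {\<tau> - e<..<\<tau> + e}}"
  define U where "U = {x \<in> topspace PT. fst x \<in> W \<and> snd x \<in> W2}"
  have Wo: "openin CT W" unfolding W_def by (intro openin_Int W1(1) F2_open open_greaterThanLessThan)
  have Uo: "openin PT U" unfolding U_def by (rule openin_pair[OF Wo W2(1)])
  have xU: "x \<in> U" using x c W1 W2 e(1) by (auto simp: U_def W_def \<tau>_def)
  have J: "J \<subseteq> near01 \<tau> e1" "J \<subseteq> near01 \<tau> e2" "J \<subseteq> near01 \<tau> e3" "J \<subseteq> near01 \<tau> e4"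
    using e near01_mono unfolding J_def by auto
  have key: "y = \<phi> (F2 M (fst y))" "F2 M (fst y) \<in> J" if "y \<in> U" for y
  proof -
    have y: "fst y \<in> W1" "snd y \<in> W2" "fst y \<in> pts M" "F2 M (fst y) = F2 M (snd y)" "F2 M (fst y) \<in> {\<tau> - e<..<\<tau> + e}"
      using that by (auto simp: U_def W_def topspace_pair)
    then show F: "F2 M (fst y) \<in> J" using F2_range[OF y(3)] by (simp add: J_def near01_def)
    have "fst y = branch M c1 (F2 M (fst y))" using W1(4) F J(1) y(1) by blast
    moreover have "F2 M (fst y) \<in> near01 \<tau> e2" using F J(2) by blast
    then have "\<forall>q\<in>W2. F2 M q = F2 M (fst y) \<longrightarrow> q = branch M c2 (F2 M (fst y))" using W2(4) by blast
    then have "snd y = branch M c2 (F2 M (fst y))" using y(2) y(4)[symmetric] by blast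
    ultimately show "y = \<phi> (F2 M (fst y))" by (simp add: \<phi>_def prod_eq_iff)
  qed
  have \<phi>\<tau>: "\<phi> \<tau> = x" using branch_at[OF c(2) nc(1)] branch_at[OF c(3) nc(2)] c by (simp add: \<phi>_def \<tau>_def)
  have "\<exists>d>0. \<forall>t\<in>{r \<in> J. \<phi> r \<in> V}. \<bar>t - \<tau>\<bar> < d \<longrightarrow> t = \<tau>"
  proof (rule vertices_no_accumulation[OF graph x False Uo xU, of "\<lambda>y. F2 M (fst y)"])
    have "continuous_map PT CT fst"
      unfolding pair_top_def by (intro continuous_map_from_subtopology continuous_map_fst)
    then have "continuous_map PT euclideanreal (F2 M \<circ> fst)" by (rule continuous_map_compose[OF _ F2_continuous])
    then show "continuous_map (subtopology PT U) euclideanreal (\<lambda>y. F2 M (fst y))"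
      by (simp add: comp_def continuous_map_from_subtopology)
    show "continuous_map (top_of_set J) PT \<phi>" unfolding \<phi>_def
    proof (rule continuous_into_pair)
      show "continuous_map (top_of_set J) CT (branch M c1)" by (rule continuous_map_from_subtopology_mono[OF e3(2) J(3)])
      show "continuous_map (top_of_set J) CT (branch M c2)" by (rule continuous_map_from_subtopology_mono[OF e4(2) J(4)])
      show "F2 M (branch M c1 y) = F2 M (branch M c2 y)" if "y \<in> topspace (top_of_set J)" for y
      proof -
        have "F2 M (branch M c1 y) = y" using that J(1) W1(4) by auto
        moreover have "F2 M (branch M c2 y) = y" using that J(2) W2(4) by auto
        ultimately show ?thesis by simp
      qed
    qed
    show "\<tau> \<in> J" using e(1) \<tau> by (simp add: J_def near01_def)
    show "F2 M (fst (\<phi> t)) = t" if "t \<in> J" for t using that J W1(4) by (auto simp: \<phi>_def)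
    show "y \<in> V" if "y \<in> U" "F2 M (fst y) \<in> {r \<in> J. \<phi> r \<in> V}" for y using that key[OF that(1)] by simp
    show "t \<in> interior J" if "t \<in> {r \<in> J. \<phi> r \<in> V}" "t \<noteq> \<tau>" for t
    proof (rule interiorI)
      show "open ({\<tau> - e<..<\<tau> + e} \<inter> {0<..<1})" by (intro open_Int) auto
      show "{\<tau> - e<..<\<tau> + e} \<inter> {0<..<1} \<subseteq> J" by (auto simp: J_def near01_def)
      have "t \<noteq> 0" "t \<noteq> 1" using that e(6,7) \<tau> by (auto simp: J_def near01_def)
      then show "t \<in> {\<tau> - e<..<\<tau> + e} \<inter> {0<..<1}" using that by (auto simp: J_def near01_def)
    qed
  qed (use \<phi>\<tau> in auto)
  then obtain d where d: "d > 0" "\<forall>t\<in>{r \<in> J. \<phi> r \<in> V}. \<bar>t - \<tau>\<bar> < d \<longrightarrow> t = \<tau>" by blast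
  define W' where "W' = W \<inter> {p \<in> pts M. F2 M p \<in> {\<tau> - d<..<\<tau> + d}}"
  have "openin CT W'" unfolding W'_def by (intro openin_Int Wo F2_open open_greaterThanLessThan)
  then have "openin PT {x \<in> topspace PT. fst x \<in> W' \<and> snd x \<in> W2}" by (rule openin_pair[OF _ W2(1)])
  moreover have "x \<in> {x \<in> topspace PT. fst x \<in> W' \<and> snd x \<in> W2}"
    using xU d(1) c by (auto simp: U_def W'_def \<tau>_def)
  moreover have "y \<notin> V" if "y \<in> {x \<in> topspace PT. fst x \<in> W' \<and> snd x \<in> W2}" for y
  proof
    assume "y \<in> V"
    have yU: "y \<in> U" using that by (auto simp: U_def W'_def)
    have "F2 M (fst y) = \<tau>" using d(2) key[OF yU] \<open>y \<in> V\<close> that by (auto simp: W'_def)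
    then show False using key[OF yU] \<phi>\<tau> \<open>y \<in> V\<close> False by simp
  qed
  ultimately show ?thesis by blast
qed

text \<open>
  The image of the path is connected and avoids the vertices, so it lies in one edge.
\<close>

lemma gamma_constant_on_path:
  assumes J: "is_interval J" and c: "continuous_map (top_of_set J) CT \<sigma>" "continuous_map (top_of_set J) CT \<theta>"
    and F: "\<And>r. r \<in> J \<Longrightarrow> F2 M (\<sigma> r) = F2 M (\<theta> r)" and nV: "\<And>r. r \<in> J \<Longrightarrow> (\<sigma> r, \<theta> r) \<notin> V"
    and st: "s \<in> J" "t \<in> J"
  shows "\<gamma> M (\<sigma> s, \<theta> s) = \<gamma> M (\<sigma> t, \<theta> t)"
proof -
  let ?Y = "subtopology PT (topspace PT - V)" and ?\<phi> = "\<lambda>r. (\<sigma> r, \<theta> r)"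
  have cm: "continuous_map (top_of_set J) PT ?\<phi>" by (rule continuous_into_pair[OF c]) (use F in auto)
  have "connectedin PT (?\<phi> ` J)"
    by (rule connectedin_continuous_map_image[OF cm]) (use is_interval_connected[OF J] in \<open>simp add: connectedin_subtopology\<close>)
  moreover have "?\<phi> ` J \<subseteq> topspace PT - V" using cm nV by (auto simp: continuous_map_def)
  ultimately have "connectedin ?Y (?\<phi> ` J)" by (simp add: connectedin_subtopology)
  note con = this
  have s: "?\<phi> s \<in> ?\<phi> ` J" using st(1) by (rule imageI)
  define E where "E = connected_component_of_set ?Y (?\<phi> s)"
  have "?\<phi> s \<in> topspace ?Y" using connectedin_subset_topspace[OF con] s by (rule subsetD)
  then have E: "E \<in> connected_components_of ?Y" "?\<phi> ` J \<subseteq> E"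
    using connected_component_of_maximal[OF con s] unfolding E_def
    by (simp_all only: connected_component_in_connected_components_of)
  have "constant_on_edges PT V (\<gamma> M)" using morse by (simp add: morse_tuple_def)
  then show ?thesis using E st unfolding constant_on_edges_def by blast
qed

lemma path_avoids_V:
  assumes c: "continuous_map (top_of_set J) CT \<sigma>" "continuous_map (top_of_set J) CT \<theta>" "t0 \<in> J"
    and F: "\<And>r. r \<in> J \<Longrightarrow> F2 M (\<sigma> r) = r \<and> F2 M (\<theta> r) = (r::real)"
  shows "\<exists>d>0. \<forall>r\<in>J. \<bar>r - t0\<bar> < d \<longrightarrow> r \<noteq> t0 \<longrightarrow> (\<sigma> r, \<theta> r) \<notin> V"
proof -
  have cm: "continuous_map (top_of_set J) PT (\<lambda>r. (\<sigma> r, \<theta> r))" by (rule continuous_into_pair[OF c(1,2)]) (use F in auto)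
  then have "(\<sigma> t0, \<theta> t0) \<in> topspace PT" using c(3) by (auto simp: continuous_map_def)
  then obtain U where U: "openin PT U" "(\<sigma> t0, \<theta> t0) \<in> U" "U \<inter> V \<subseteq> {(\<sigma> t0, \<theta> t0)}" using V_isolated by blast
  have "openin (top_of_set J) {r \<in> J. (\<sigma> r, \<theta> r) \<in> U}" using openin_continuous_map_preimage[OF cm U(1)] by simp
  then obtain d where d: "d > 0" "ball t0 d \<inter> J \<subseteq> {r \<in> J. (\<sigma> r, \<theta> r) \<in> U}"
    using c(3) U(2) by (force simp: openin_contains_ball)
  have "(\<sigma> r, \<theta> r) \<notin> V" if r: "r \<in> J" "\<bar>r - t0\<bar> < d" "r \<noteq> t0" for r
  proof
    assume v: "(\<sigma> r, \<theta> r) \<in> V"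
    have "r \<in> ball t0 d \<inter> J" using r by (simp add: dist_real_def abs_minus_commute)
    then have "(\<sigma> r, \<theta> r) = (\<sigma> t0, \<theta> t0)" using d(2) U(3) v by blast
    then show False using F[OF r(1)] F[OF c(3)] r(3) by simp
  qed
  then show ?thesis using d(1) by blast
qed

text \<open>
  A half-open neighbourhood of \<open>\<tau>\<close> on one side. Statements before and after \<open>\<tau>\<close> differ only in the
  boolean.
\<close>

definition side :: "bool \<Rightarrow> real \<Rightarrow> real \<Rightarrow> real set" where
  "side fw \<tau> e = (if fw then {\<tau>..<\<tau> + e} else {\<tau> - e<..\<tau>})"

lemma side_mono: "e' \<le> e \<Longrightarrow> side fw \<tau> e' \<subseteq> side fw \<tau> e" by (auto simp: side_def)

lemma side_near: "r \<in> side fw \<tau> e \<Longrightarrow> \<bar>r - \<tau>\<bar> < e" by (auto simp: side_def split: if_splits)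

definition follows :: "bool \<Rightarrow> real \<Rightarrow> real \<Rightarrow> (real \<Rightarrow> 'i \<times> complex) \<Rightarrow> bool" where
  "follows fw \<tau> e \<sigma> \<longleftrightarrow> 0 < e \<and> continuous_map (top_of_set (side fw \<tau> e)) CT \<sigma> \<and> (\<forall>r\<in>side fw \<tau> e. F2 M (\<sigma> r) = r)"

lemma follows_mono: "follows fw \<tau> e \<sigma> \<Longrightarrow> 0 < e' \<Longrightarrow> e' \<le> e \<Longrightarrow> follows fw \<tau> e' \<sigma>"
  unfolding follows_def using side_mono[of e' e fw \<tau>] by (auto intro: continuous_map_from_subtopology_mono)

definition gamma_side :: "bool \<Rightarrow> real \<Rightarrow> (real \<Rightarrow> 'i \<times> complex) \<Rightarrow> (real \<Rightarrow> 'i \<times> complex) \<Rightarrow> 'k" where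
  "gamma_side fw = (if fw then \<gamma>plus M else \<gamma>minus M)"

text \<open>
  Both paths stay away from the vertices shortly before or after \<open>\<tau>\<close>, so the coefficient is
  constant there, and the limit is that constant.
\<close>

lemma gamma_side_limit:
  assumes "follows fw \<tau> e1 \<sigma>" "follows fw \<tau> e2 \<theta>"
  shows "\<exists>d>0. \<forall>r\<in>side fw \<tau> d - {\<tau>}. \<gamma> M (\<sigma> r, \<theta> r) = gamma_side fw \<tau> \<sigma> \<theta>"
proof -
  define e where "e = min e1 e2"
  have e: "e > 0" using assms by (auto simp: e_def follows_def)
  have fo: "follows fw \<tau> e \<sigma>" "follows fw \<tau> e \<theta>" using follows_mono assms e by (auto simp: e_def)
  then have c: "continuous_map (top_of_set (side fw \<tau> e)) CT \<sigma>" "continuous_map (top_of_set (side fw \<tau> e)) CT \<theta>"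
    and F: "\<And>r. r \<in> side fw \<tau> e \<Longrightarrow> F2 M (\<sigma> r) = r \<and> F2 M (\<theta> r) = r" by (auto simp: follows_def)
  have "\<tau> \<in> side fw \<tau> e" using e by (simp add: side_def)
  from path_avoids_V[OF c this F] obtain d where d: "d > 0" "\<forall>r\<in>side fw \<tau> e. \<bar>r - \<tau>\<bar> < d \<longrightarrow> r \<noteq> \<tau> \<longrightarrow> (\<sigma> r, \<theta> r) \<notin> V"
    by blast
  define J where "J = side fw \<tau> (min d e) - {\<tau>}"
  have Js: "J \<subseteq> side fw \<tau> e" using side_mono[of "min d e" e fw \<tau>] by (auto simp: J_def)
  have const: "\<gamma> M (\<sigma> s, \<theta> s) = \<gamma> M (\<sigma> t, \<theta> t)" if "s \<in> J" "t \<in> J" for s t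
  proof (rule gamma_constant_on_path[OF _ continuous_map_from_subtopology_mono[OF c(1) Js]
        continuous_map_from_subtopology_mono[OF c(2) Js] _ _ that])
    show "is_interval J" by (auto simp: J_def side_def is_interval_1)
    fix r assume r: "r \<in> J"
    then have "r \<in> side fw \<tau> e" "\<bar>r - \<tau>\<bar> < d" "r \<noteq> \<tau>" using Js side_near[of r fw \<tau> "min d e"] by (auto simp: J_def)
    then show "F2 M (\<sigma> r) = F2 M (\<theta> r)" "(\<sigma> r, \<theta> r) \<notin> V" using F[of r] d(2) by auto
  qed
  define t0 where "t0 = (if fw then \<tau> + min d e / 2 else \<tau> - min d e / 2)"
  have t0: "t0 \<in> J" using d e by (auto simp: J_def side_def t0_def min_def)
  define G where "G = (if fw then at_right \<tau> else at_left \<tau>)"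
  have G: "G \<noteq> bot" by (simp add: G_def)
  have ev: "eventually (\<lambda>t. t \<in> J) G"
    unfolding J_def side_def G_def using d e
    by (auto intro!: eventually_at_rightI[of \<tau> "\<tau> + min d e"] eventually_at_leftI[of "\<tau> - min d e" \<tau>])
  have "gamma_side fw \<tau> \<sigma> \<theta> = (THE v. eventually (\<lambda>t. \<gamma> M (\<sigma> t, \<theta> t) = v) G)"
    by (simp add: gamma_side_def G_def \<gamma>plus_def \<gamma>minus_def)
  also have "\<dots> = \<gamma> M (\<sigma> t0, \<theta> t0)"
  proof (rule the_equality)
    show "eventually (\<lambda>t. \<gamma> M (\<sigma> t, \<theta> t) = \<gamma> M (\<sigma> t0, \<theta> t0)) G"
      using ev by eventually_elim (rule const[OF _ t0])
    fix v assume "eventually (\<lambda>t. \<gamma> M (\<sigma> t, \<theta> t) = v) G"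
    with ev have "eventually (\<lambda>t. v = \<gamma> M (\<sigma> t0, \<theta> t0)) G"
      by eventually_elim (drule const[OF _ t0], simp)
    then show "v = \<gamma> M (\<sigma> t0, \<theta> t0)" using G by simp
  qed
  finally have "\<gamma> M (\<sigma> r, \<theta> r) = gamma_side fw \<tau> \<sigma> \<theta>" if "r \<in> J" for r using const[OF that t0] by simp
  then show ?thesis using d(1) e by (intro exI[of _ "min d e"]) (simp add: J_def)
qed

definition "regular_params = {0..1} - \<Lambda> M"

text \<open>
  The pairs with both heights in \<open>[a,b]\<close> form a compact set, since \<open>F3\<close> is proper, and vertices do
  not accumulate.
\<close>

lemma V_compact_finite:
  "finite {x \<in> V. F3 M (fst x) \<in> {a..b} \<and> F3 M (snd x) \<in> {a..b}}"
proof -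
  define K where "K = {p \<in> pts M. F3 M p \<in> {a..b}}"
  have Kc: "compactin CT K" unfolding K_def by (rule F3_compact) simp
  have closed: "closedin (prod_topology CT CT) {x \<in> topspace (prod_topology CT CT). F2 M (fst x) = F2 M (snd x)}"
  proof (rule closedin_continuous_maps_eq)
    show "continuous_map (prod_topology CT CT) euclideanreal (\<lambda>x. F2 M (fst x))"
      using continuous_map_compose[OF continuous_map_fst F2_continuous] by (simp add: comp_def)
    show "continuous_map (prod_topology CT CT) euclideanreal (\<lambda>x. F2 M (snd x))"
      using continuous_map_compose[OF continuous_map_snd F2_continuous] by (simp add: comp_def)
  qed simp
  have "finite (((K \<times> K) \<inter> topspace PT) \<inter> V)"
  proof (rule compact_locally_finite)
    have "compactin (prod_topology CT CT) (K \<times> K)" using Kc by (simp add: compactin_Times)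
    then have "compactin (prod_topology CT CT) ({x \<in> topspace (prod_topology CT CT). F2 M (fst x) = F2 M (snd x)} \<inter> (K \<times> K))"
      by (rule closed_Int_compactin[OF closed])
    moreover have "{x \<in> topspace (prod_topology CT CT). F2 M (fst x) = F2 M (snd x)} \<inter> (K \<times> K) = (K \<times> K) \<inter> topspace PT"
      by (auto simp: topspace_pair topspace_curve_top)
    ultimately show "compactin PT ((K \<times> K) \<inter> topspace PT)"
      unfolding pair_top_def compactin_subtopology by (auto simp: topspace_pair pair_top_def)
  qed (use V_isolated in auto)
  moreover have "{x \<in> V. F3 M (fst x) \<in> {a..b} \<and> F3 M (snd x) \<in> {a..b}} \<subseteq> ((K \<times> K) \<inter> topspace PT) \<inter> V"
    using V_discrete by (auto simp: discrete_in_def K_def topspace_pair mem_Times_iff)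
  ultimately show ?thesis by (rule finite_subset[rotated])
qed

lemma V_countable: "countable V"
proof -
  have "V \<subseteq> (\<Union>n. {x \<in> V. F3 M (fst x) \<in> {- real n..real n} \<and> F3 M (snd x) \<in> {- real n..real n}})"
  proof
    fix x assume v: "x \<in> V"
    obtain n :: nat where "max \<bar>F3 M (fst x)\<bar> \<bar>F3 M (snd x)\<bar> \<le> real n" using real_arch_simple by blast
    then show "x \<in> (\<Union>n. {x \<in> V. F3 M (fst x) \<in> {- real n..real n} \<and> F3 M (snd x) \<in> {- real n..real n}})"
      using v by (intro UN_I[of n]) (auto simp: abs_le_iff)
  qed
  then show ?thesis using V_compact_finite by (meson countable_UN countable_finite countable_subset countableI_type)
qed

text \<open>
  There are countably many vertices, as finitely many of them lie in a window of bounded height.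
\<close>

lemma regular_dense:
  assumes "x \<in> {0..1}" "y \<in> {0..1}" "x < y"
  shows "\<exists>z\<in>regular_params. x < z \<and> z < y"
proof -
  have "\<Lambda> M \<subseteq> pair_param M ` V"
    using morse unfolding \<Lambda>_def handle_slides_def by (auto simp: morse_tuple_def)
  then have "countable (\<Lambda> M)" using V_countable by (meson countable_image countable_subset)
  then have "\<not> {x<..<y} \<subseteq> \<Lambda> M" using assms(3) countable_subset uncountable_open_interval by blast
  then obtain z where "z \<in> {x<..<y}" "z \<notin> \<Lambda> M" by blast
  then show ?thesis using assms by (intro bexI[of _ z]) (auto simp: regular_params_def)
qed

lemma fib_pts: "c \<in> fib M r \<Longrightarrow> c \<in> pts M" "c \<in> fib M r \<Longrightarrow> F2 M c = r"
  by (auto simp: fib_def)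

text \<open>
  A point has a neighbourhood which contains no other point with the same parameter, and a window
  lies in a compact set.
\<close>

lemma gens_finite: "finite (gens M a b r)"
proof -
  have "finite ({p \<in> pts M. F3 M p \<in> {a..b}} \<inter> fib M r)"
  proof (rule compact_locally_finite)
    show "compactin CT {p \<in> pts M. F3 M p \<in> {a..b}}" by (rule F3_compact) simp
    fix p assume "p \<in> {p \<in> pts M. F3 M p \<in> {a..b}}"
    then have p: "p \<in> pts M" by simp
    have "p \<in> topspace CT" using p by (simp add: topspace_curve_top)
    then obtain W where W: "openin CT W" "p \<in> W" "\<forall>q\<in>W. F2 M q = F2 M p \<longrightarrow> q = p"
      using fibre_at_most_two[OF p openin_topspace] by blast
    show "\<exists>W. openin CT W \<and> p \<in> W \<and> W \<inter> fib M r \<subseteq> {p}"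
    proof (cases "F2 M p = r")
      case True
      have "W \<inter> fib M r \<subseteq> {p}"
      proof
        fix q assume "q \<in> W \<inter> fib M r"
        then have "q \<in> W" "F2 M q = F2 M p" using True fib_pts(2) by auto
        then show "q \<in> {p}" using W(3) by blast
      qed
      then show ?thesis using W by blast
    next
      case False
      have "openin CT {q \<in> pts M. F2 M q \<in> - {r}}" by (rule F2_open) auto
      then show ?thesis using False p by (intro exI[of _ "{q \<in> pts M. F2 M q \<in> - {r}}"]) (auto simp: fib_def)
    qed
  qed
  then show ?thesis by (rule finite_subset[rotated]) (auto simp: gens_def fib_def)
qed

lemma gamma_decreasing:
  assumes "r \<in> regular_params" "c1 \<in> fib M r" "c2 \<in> fib M r" "\<gamma> M (c1, c2) \<noteq> 0"
  shows "F3 M c2 < F3 M c1"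
proof -
  have "axiom_\<gamma>1 M" using morse by (simp add: morse_tuple_def)
  then show ?thesis using assms unfolding axiom_\<gamma>1_def regular_params_def by (meson linorder_not_less)
qed

lemma delta_decreasing:
  assumes "(c1, c2) \<in> handle_slides M" "\<delta> M (c1, c2) \<noteq> 0"
  shows "F3 M c2 < F3 M c1"
proof -
  have "axiom_\<gamma>1 M" using morse by (simp add: morse_tuple_def)
  then show ?thesis using assms unfolding axiom_\<gamma>1_def by (auto simp: linorder_not_less[symmetric])
qed

text \<open>
  The sum over the whole fibre reduces to the window, because a nonzero product forces the middle
  point to lie between \<open>c1\<close> and \<open>c3\<close>.
\<close>

lemma window_complex:
  assumes r: "r \<in> regular_params"
  shows "matrix_complex (gens M a b r) (\<gamma> M)"
  unfolding matrix_complex_def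
proof (intro conjI ballI gens_finite)
  fix c1 c3 assume c: "c1 \<in> gens M a b r" "c3 \<in> gens M a b r"
  have cf: "c1 \<in> fib M r" "c3 \<in> fib M r" using c by (auto simp: gens_def)
  let ?f = "\<lambda>c2. \<gamma> M (c1, c2) * \<gamma> M (c2, c3) when c2 \<in> fib M r"
  have "axiom_\<gamma>2 M" using morse by (simp add: morse_tuple_def)
  then have "Sum_any ?f = 0" using r cf unfolding axiom_\<gamma>2_def regular_params_def by blast
  moreover have "{c2. ?f c2 \<noteq> 0} \<subseteq> gens M a b r"
  proof
    fix c2 assume "c2 \<in> {c2. ?f c2 \<noteq> 0}"
    then have c2: "c2 \<in> fib M r" "\<gamma> M (c1, c2) \<noteq> 0" "\<gamma> M (c2, c3) \<noteq> 0" by (auto simp: when_def split: if_splits)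
    then have "F3 M c2 < F3 M c1" "F3 M c3 < F3 M c2" using gamma_decreasing[OF r] cf by blast+
    then show "c2 \<in> gens M a b r" using c c2 by (auto simp: gens_def)
  qed
  then have "Sum_any ?f = (\<Sum>c2\<in>gens M a b r. ?f c2)" by (rule Sum_any.expand_superset[OF gens_finite])
  moreover have "\<dots> = (\<Sum>c2\<in>gens M a b r. \<gamma> M (c1, c2) * \<gamma> M (c2, c3))"
    by (intro sum.cong) (auto simp: gens_def)
  ultimately show "(\<Sum>c2\<in>gens M a b r. \<gamma> M (c1, c2) * \<gamma> M (c2, c3)) = 0" by simp
qed

end

section \<open>Handle-slides and cancelling pairs in linear algebra\<close>

text \<open>
  Solved in the order of decreasing height.
\<close>

lemma unitriangular_solve:
  fixes h :: "'p \<Rightarrow> real" and dl :: "'p \<times> 'p \<Rightarrow> 'k::comm_ring_1"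
  assumes "finite P" and tri: "\<And>c1 c2. dl (c1, c2) \<noteq> 0 \<Longrightarrow> h c2 < h c1"
  shows "\<exists>x. \<forall>c\<in>P. x c + (\<Sum>c1\<in>P. x c1 * dl (c1, c)) = y c"
  using assms(1)
proof (induction P rule: finite_ranking_induct[where f = "\<lambda>c. - h c"])
  case (insert p S)
  then obtain x where x: "\<forall>c\<in>S. x c + (\<Sum>c1\<in>S. x c1 * dl (c1, c)) = y c" by blast
  show ?case
  proof (cases "p \<in> S")
    case True
    then show ?thesis using x by (auto simp: insert_absorb)
  next
    case False
    have z: "dl (p, c) = 0" if "c \<in> insert p S" for c
      using tri[of p c] insert(2)[of c] that by force
    define x' where "x' = x(p := y p - (\<Sum>c1\<in>S. x c1 * dl (c1, p)))"
    have s: "(\<Sum>c1\<in>S. x' c1 * dl (c1, c)) = (\<Sum>c1\<in>S. x c1 * dl (c1, c))" for c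
      using False by (intro sum.cong) (auto simp: x'_def)
    have "x' c + (\<Sum>c1\<in>insert p S. x' c1 * dl (c1, c)) = y c" if "c \<in> insert p S" for c
      using that x False insert(1) z[OF that] by (auto simp: s) (auto simp: x'_def)
    then show ?thesis by blast
  qed
qed simp

lemma unitriangular_kernel:
  fixes h :: "'p \<Rightarrow> real" and dl :: "'p \<times> 'p \<Rightarrow> 'k::comm_ring_1"
  assumes "finite P" and tri: "\<And>c1 c2. dl (c1, c2) \<noteq> 0 \<Longrightarrow> h c2 < h c1"
    and "\<forall>c\<in>P. x c + (\<Sum>c1\<in>P. x c1 * dl (c1, c)) = 0"
  shows "\<forall>c\<in>P. x c = 0"
  using assms(1,3)
proof (induction P rule: finite_ranking_induct[where f = "\<lambda>c. - h c"])
  case (insert p S)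
  show ?case
  proof (cases "p \<in> S")
    case True
    then show ?thesis using insert by (simp add: insert_absorb)
  next
    case False
    have z: "dl (p, c) = 0" if "c \<in> insert p S" for c
      using tri[of p c] insert(2)[of c] that by force
    have S: "x c + (\<Sum>c1\<in>S. x c1 * dl (c1, c)) = 0" if "c \<in> insert p S" for c
      using insert(4) that z[OF that] False insert(1) by force
    then have "\<forall>c\<in>S. x c = 0" using insert(3) by blast
    moreover have "x p = 0" using S[of p] calculation by simp
    ultimately show ?thesis by blast
  qed
qed simp

text \<open>
  The boundary of \<open>p\<close> is an invertible multiple of \<open>m\<close>, while \<open>p\<close> occurs in no boundary and \<open>m\<close> is
  a cycle. Other generators may still have \<open>m\<close> in their boundary.
\<close>

definition cancelling_pair :: "('p \<times> 'p \<Rightarrow> 'k::comm_ring_1) \<Rightarrow> 'p set \<Rightarrow> 'p set \<Rightarrow> bool" where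
  "cancelling_pair g G B \<longleftrightarrow> (\<exists>p m u. p \<noteq> m \<and> p \<notin> B \<and> m \<notin> B \<and> G = B \<union> {p, m} \<and> g (p, m) * u = 1 \<and>
     (\<forall>x\<in>G. g (x, p) = 0 \<and> g (m, x) = 0) \<and> (\<forall>x\<in>G - {m}. g (p, x) = 0))"

text \<open>
  The coordinates of \<open>z\<close> at the generators \<open>\<beta> c\<close>, multiplied by the matrix \<open>1 + dl\<close>. Generators
  outside the image of \<open>\<beta>\<close> are forgotten.
\<close>

definition restrict_along :: "('p \<Rightarrow> 'q) \<Rightarrow> 'p set \<Rightarrow> ('p \<times> 'p \<Rightarrow> 'k::comm_ring_1) \<Rightarrow> ('q \<Rightarrow>\<^sub>0 'k) \<Rightarrow> ('p \<Rightarrow>\<^sub>0 'k)" where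
  "restrict_along \<beta> P dl z = (\<Sum>c\<in>P. Poly_Mapping.single c
     (Poly_Mapping.lookup z (\<beta> c) + (\<Sum>c1\<in>P. Poly_Mapping.lookup z (\<beta> c1) * dl (c1, c))))"

lemma lookup_restrict_along:
  "finite P \<Longrightarrow> Poly_Mapping.lookup (restrict_along \<beta> P dl z) c =
    (if c \<in> P then Poly_Mapping.lookup z (\<beta> c) + (\<Sum>c1\<in>P. Poly_Mapping.lookup z (\<beta> c1) * dl (c1, c)) else 0)"
  by (simp add: restrict_along_def lookup_sum lookup_single when_def)

lemma linear_restrict_along: "finite P \<Longrightarrow> linear_chains G P (restrict_along \<beta> P dl)"
  unfolding linear_chains_def
proof (intro conjI ballI allI)
  fix x y and k
  assume P: "finite P"
  show "restrict_along \<beta> P dl x \<in> chains P" by (rule chainsI) (simp add: lookup_restrict_along P)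
  show "restrict_along \<beta> P dl (x - y) = restrict_along \<beta> P dl x - restrict_along \<beta> P dl y"
    by (rule poly_mapping_eqI) (simp add: lookup_restrict_along P lookup_minus left_diff_distrib sum_subtractf)
  show "restrict_along \<beta> P dl (scale k x) = scale k (restrict_along \<beta> P dl x)"
    by (rule poly_mapping_eqI) (simp add: lookup_restrict_along P distrib_left sum_distrib_left mult.assoc)
qed

text \<open>
  The relation \<open>rel\<close> says that \<open>1 + dl\<close> intertwines the two boundary operators, as it does at a
  handle-slide. The matrix \<open>1 + dl\<close> is invertible since \<open>dl\<close> strictly decreases the height \<open>h\<close>;
  so the map is onto, and its kernel is zero or spanned by the cancelling pair. In the latter case
  a cycle in the kernel is a multiple of \<open>m\<close>, and it is the boundary of a multiple of \<open>p\<close>.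
\<close>

lemma restrict_along_fibration:
  fixes G :: "'p set" and g :: "'p \<times> 'p \<Rightarrow> 'k::comm_ring_1" and h :: "'p \<Rightarrow> real"
  assumes cx: "matrix_complex G g" and P: "finite P" and inj: "inj_on \<beta> P"
    and tri: "\<And>c1 c2. dl (c1, c2) \<noteq> 0 \<Longrightarrow> h c2 < h c1"
    and rel: "\<And>c1 c3. c1 \<in> P \<Longrightarrow> c3 \<in> P \<Longrightarrow> g (\<beta> c1, \<beta> c3) + (\<Sum>c2\<in>P. g (\<beta> c1, \<beta> c2) * dl (c2, c3)) =
        q (c1, c3) + (\<Sum>c2\<in>P. dl (c1, c2) * q (c2, c3))"
    and G: "G = \<beta> ` P \<or> cancelling_pair g G (\<beta> ` P)"
  shows "acyclic_fibration G g P q (restrict_along \<beta> P dl)"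
proof -
  let ?\<rho> = "restrict_along \<beta> P dl"
  have fG: "finite G" using cx by (simp add: matrix_complex_def)
  have sub: "\<beta> ` P \<subseteq> G" using G by (auto simp: cancelling_pair_def)
  have lin: "linear_chains G P ?\<rho>" by (rule linear_restrict_along[OF P])
  have dz: "Poly_Mapping.lookup (matrix_bdry G g z) (\<beta> c) = (\<Sum>c1\<in>P. Poly_Mapping.lookup z (\<beta> c1) * g (\<beta> c1, \<beta> c))"
    if z: "z \<in> chains G" and c: "c \<in> P" for z c
  proof -
    have "Poly_Mapping.lookup (matrix_bdry G g z) (\<beta> c) = (\<Sum>x\<in>G. Poly_Mapping.lookup z x * g (x, \<beta> c))"
      using lookup_matrix_bdry[OF fG z] c sub by auto
    also have "\<dots> = (\<Sum>x\<in>\<beta> ` P. Poly_Mapping.lookup z x * g (x, \<beta> c))"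
    proof (rule sum.mono_neutral_right[OF fG sub], rule ballI)
      fix x assume x: "x \<in> G - \<beta> ` P"
      then obtain p m where pm: "p \<notin> \<beta> ` P" "m \<notin> \<beta> ` P" "G = \<beta> ` P \<union> {p, m}" "\<forall>x\<in>G. g (m, x) = 0" "\<forall>x\<in>G - {m}. g (p, x) = 0"
        using G unfolding cancelling_pair_def by blast
      have "\<beta> c \<in> G" "\<beta> c \<noteq> m" using c sub pm by auto
      then show "Poly_Mapping.lookup z x * g (x, \<beta> c) = 0" using x pm by auto
    qed
    also have "\<dots> = (\<Sum>c1\<in>P. Poly_Mapping.lookup z (\<beta> c1) * g (\<beta> c1, \<beta> c))"
      by (rule sum.reindex_cong[OF inj]) simp_all
    finally show ?thesis .
  qed
  have cm: "?\<rho> (matrix_bdry G g z) = matrix_bdry P q (?\<rho> z)" if z: "z \<in> chains G" for z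
  proof (rule poly_mapping_eqI)
    fix c
    let ?z = "\<lambda>c. Poly_Mapping.lookup z (\<beta> c)"
    have r: "?\<rho> z \<in> chains P" using lin z by (simp add: linear_chains_def)
    show "Poly_Mapping.lookup (?\<rho> (matrix_bdry G g z)) c = Poly_Mapping.lookup (matrix_bdry P q (?\<rho> z)) c"
    proof (cases "c \<in> P")
      case True
      have "Poly_Mapping.lookup (?\<rho> (matrix_bdry G g z)) c =
        (\<Sum>c1\<in>P. ?z c1 * g (\<beta> c1, \<beta> c)) + (\<Sum>c2\<in>P. (\<Sum>c1\<in>P. ?z c1 * g (\<beta> c1, \<beta> c2)) * dl (c2, c))"
        using True by (simp add: lookup_restrict_along P dz[OF z] cong: sum.cong)
      also have "(\<Sum>c2\<in>P. (\<Sum>c1\<in>P. ?z c1 * g (\<beta> c1, \<beta> c2)) * dl (c2, c)) =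
        (\<Sum>c1\<in>P. ?z c1 * (\<Sum>c2\<in>P. g (\<beta> c1, \<beta> c2) * dl (c2, c)))"
        by (simp add: sum_distrib_left sum_distrib_right mult.assoc) (rule sum.swap)
      also have "(\<Sum>c1\<in>P. ?z c1 * g (\<beta> c1, \<beta> c)) + \<dots> =
        (\<Sum>c1\<in>P. ?z c1 * (q (c1, c) + (\<Sum>c2\<in>P. dl (c1, c2) * q (c2, c))))"
        unfolding sum.distrib[symmetric] distrib_left[symmetric] using rel True by (intro sum.cong) auto
      also have "\<dots> = (\<Sum>c1\<in>P. ?z c1 * q (c1, c)) + (\<Sum>c1\<in>P. \<Sum>c2\<in>P. ?z c1 * (dl (c1, c2) * q (c2, c)))"
        by (simp add: distrib_left sum.distrib sum_distrib_left)
      also have "(\<Sum>c1\<in>P. \<Sum>c2\<in>P. ?z c1 * (dl (c1, c2) * q (c2, c))) = (\<Sum>c2\<in>P. (\<Sum>c1\<in>P. ?z c1 * dl (c1, c2)) * q (c2, c))"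
        by (subst sum.swap) (simp add: sum_distrib_right mult.assoc)
      also have "(\<Sum>c1\<in>P. ?z c1 * q (c1, c)) + \<dots> = Poly_Mapping.lookup (matrix_bdry P q (?\<rho> z)) c"
        using True by (simp add: lookup_matrix_bdry[OF P r] lookup_restrict_along P distrib_right sum.distrib cong: sum.cong)
      finally show ?thesis .
    qed (simp add: lookup_restrict_along P lookup_matrix_bdry[OF P r])
  qed
  have surj: "\<exists>x\<in>chains G. ?\<rho> x = y" if y: "y \<in> chains P" for y
  proof -
    have "\<exists>x. \<forall>c\<in>P. x c + (\<Sum>c1\<in>P. x c1 * dl (c1, c)) = Poly_Mapping.lookup y c"
      by (rule unitriangular_solve[OF P tri])
    then obtain x where x: "\<forall>c\<in>P. x c + (\<Sum>c1\<in>P. x c1 * dl (c1, c)) = Poly_Mapping.lookup y c" ..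
    define z where "z = (\<Sum>c\<in>P. Poly_Mapping.single (\<beta> c) (x c))"
    have lz: "Poly_Mapping.lookup z (\<beta> c) = x c" if "c \<in> P" for c
    proof -
      have "Poly_Mapping.lookup z (\<beta> c) = (\<Sum>c1\<in>P. if c1 = c then x c1 else 0)"
        unfolding z_def lookup_sum using that inj by (intro sum.cong) (auto simp: lookup_single when_def dest: inj_onD)
      then show ?thesis using that P by simp
    qed
    have "z \<in> chains G"
      by (rule chainsI) (use sub in \<open>auto simp: z_def lookup_sum lookup_single when_def intro!: sum.neutral\<close>)
    moreover have "?\<rho> z = y"
    proof (rule poly_mapping_eqI)
      fix c
      have "Poly_Mapping.lookup (?\<rho> z) c = (if c \<in> P then x c + (\<Sum>c1\<in>P. x c1 * dl (c1, c)) else 0)"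
        by (simp add: lookup_restrict_along P lz cong: sum.cong)
      also have "\<dots> = Poly_Mapping.lookup y c" using bspec[OF x, of c] lookup_zero_outside[OF y, of c] by (cases "c \<in> P") simp_all
      finally show "Poly_Mapping.lookup (?\<rho> z) c = Poly_Mapping.lookup y c" .
    qed
    ultimately show ?thesis by blast
  qed
  have ker: "\<exists>y\<in>chains G. ?\<rho> y = 0 \<and> matrix_bdry G g y = z" if z: "z \<in> cycles G g" and r0: "?\<rho> z = 0" for z
  proof -
    have zc: "z \<in> chains G" "matrix_bdry G g z = 0" using z by (auto simp: cycles_def)
    have "\<forall>c\<in>P. Poly_Mapping.lookup z (\<beta> c) + (\<Sum>c1\<in>P. Poly_Mapping.lookup z (\<beta> c1) * dl (c1, c)) = 0"
      using lookup_restrict_along[OF P, of \<beta> dl z] r0 by (metis lookup_zero)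
    then have z0: "\<forall>c\<in>P. Poly_Mapping.lookup z (\<beta> c) = 0" 
      using unitriangular_kernel[of P dl h "\<lambda>c. Poly_Mapping.lookup z (\<beta> c)"] P tri by blast
    show ?thesis
    proof (cases "G = \<beta> ` P")
      case True
      have "z = 0"
      proof (rule poly_mapping_eqI)
        fix c
        show "Poly_Mapping.lookup z c = Poly_Mapping.lookup 0 c"
        proof (cases "c \<in> G")
          case c: True
          then show ?thesis using z0 True by auto
        qed (simp add: lookup_zero_outside[OF zc(1)])
      qed
      moreover have "?\<rho> 0 = 0" by (rule poly_mapping_eqI) (simp add: lookup_restrict_along P)
      ultimately show ?thesis by (intro bexI[of _ 0]) auto
    next
      case False
      then have "cancelling_pair g G (\<beta> ` P)" using G by simp
      then obtain p m u where pm: "p \<noteq> m" "p \<notin> \<beta> ` P" "m \<notin> \<beta> ` P" "G = \<beta> ` P \<union> {p, m}" "g (p, m) * u = 1"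
        "\<forall>x\<in>G. g (x, p) = 0 \<and> g (m, x) = 0" "\<forall>x\<in>G - {m}. g (p, x) = 0"
        unfolding cancelling_pair_def by (elim exE conjE)
      have fin: "finite (\<beta> ` P)" using P by simp
      have "(\<Sum>x\<in>G. Poly_Mapping.lookup z x * g (x, m)) = 0"
        using lookup_matrix_bdry[OF fG zc(1), of g m] zc(2) pm(4) by simp
      moreover have "(\<Sum>x\<in>\<beta> ` P. Poly_Mapping.lookup z x * g (x, m)) = 0" using z0 by (intro sum.neutral) auto
      ultimately have "Poly_Mapping.lookup z p * g (p, m) = 0"
        using pm(1-3) pm(6) fin unfolding pm(4) by (simp add: Un_commute)
      then have "Poly_Mapping.lookup z p * (g (p, m) * u) = 0" by (simp add: mult.assoc[symmetric])
      then have zp: "Poly_Mapping.lookup z p = 0" using pm(5) by simp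
      define y where "y = Poly_Mapping.single p (Poly_Mapping.lookup z m * u)"
      have y: "y \<in> chains G" by (rule chainsI) (use pm(4) in \<open>auto simp: y_def lookup_single when_def\<close>)
      have "?\<rho> y = 0"
      proof (rule poly_mapping_eqI)
        fix c
        have "Poly_Mapping.lookup y (\<beta> c) = 0" if "c \<in> P" for c
          using that pm(2) by (auto simp: y_def lookup_single when_def)
        then show "Poly_Mapping.lookup (?\<rho> y) c = Poly_Mapping.lookup 0 c" by (simp add: lookup_restrict_along P cong: sum.cong)
      qed
      moreover have "matrix_bdry G g y = z"
      proof (rule poly_mapping_eqI)
        fix c
        have s: "(\<Sum>x\<in>G. Poly_Mapping.lookup y x * g (x, c)) = Poly_Mapping.lookup z m * u * g (p, c)"
        proof -
          have "(\<Sum>x\<in>G. Poly_Mapping.lookup y x * g (x, c)) = (\<Sum>x\<in>G. if x = p then Poly_Mapping.lookup z m * u * g (p, c) else 0)"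
            by (intro sum.cong) (auto simp: y_def lookup_single when_def)
          then show ?thesis using fG pm(4) by simp
        qed
        show "Poly_Mapping.lookup (matrix_bdry G g y) c = Poly_Mapping.lookup z c"
        proof (cases "c \<in> G")
          case True
          then consider "c = m" | "c = p" | "c \<in> \<beta> ` P" using pm(4) by auto
          then show ?thesis
          proof cases
            case 1
            then show ?thesis using True s lookup_matrix_bdry[OF fG y, of g c] pm(5) by (simp add: mult.assoc mult.commute[of u])
          next
            case 2
            then show ?thesis using True s lookup_matrix_bdry[OF fG y, of g c] pm(6) zp by simp
          next
            case 3
            then have "c \<noteq> m" using pm by auto
            then show ?thesis using True s lookup_matrix_bdry[OF fG y, of g c] pm(7) z0 3 by auto
          qed
        qed (use lookup_matrix_bdry[OF fG y, of g c] lookup_zero_outside[OF zc(1)] in simp)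
      qed
      ultimately show ?thesis using y by blast
    qed
  qed
  show ?thesis unfolding acyclic_fibration_def chain_map_def
    using cx fG P lin cm surj ker by blast
qed

section \<open>Births and deaths\<close>

context morse
begin

lemma crit_unique:
  assumes "c \<in> crit" "c' \<in> crit" "F2 M c = F2 M c'"
  shows "c = c'"
proof -
  have inj: "inj_on (F2 M) (births M)" "inj_on (F2 M) (deaths M)"
    and disj: "pair_param M ` death_pairs M \<inter> pair_param M ` birth_pairs M = {}"
    using morse by (auto simp: morse_tuple_def)
  have "False" if b: "b \<in> births M" and d: "d \<in> deaths M" and e: "F2 M b = F2 M d" for b d
  proof -
    have "b \<in> pts M" "d \<in> pts M" using b d by (auto simp: births_def deaths_def)
    then have "(b, b) \<in> birth_pairs M" "(d, d) \<in> death_pairs M"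
      using b d by (auto simp: birth_pairs_def death_pairs_def topspace_pair)
    then have "F2 M b \<in> pair_param M ` birth_pairs M" "F2 M d \<in> pair_param M ` death_pairs M"
      by (force simp: pair_param_def)+
    then show False using disj e by (metis IntI empty_iff)
  qed
  then show ?thesis using assms inj unfolding crit_def by (metis UnE inj_onD)
qed

lemma crit_param: "c \<in> crit \<Longrightarrow> F2 M c \<in> pair_param M ` death_pairs M \<union> pair_param M ` birth_pairs M"
proof -
  assume c: "c \<in> crit"
  then have "(c, c) \<in> topspace PT" using crit_pts by (auto simp: topspace_pair)
  then have "(c, c) \<in> death_pairs M \<union> birth_pairs M" using c by (auto simp: crit_def birth_pairs_def death_pairs_def)
  then show ?thesis by (force simp: pair_param_def)
qed

lemma crit_not_regular: "c \<in> crit \<Longrightarrow> F2 M c \<notin> regular_params"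
  using crit_param[of c] by (auto simp: regular_params_def \<Lambda>_def)

lemma crit_not_handle: "c \<in> crit \<Longrightarrow> F2 M c \<notin> pair_param M ` handle_slides M"
  using crit_param[of c] morse unfolding morse_tuple_def by (metis (no_types, lifting) IntI Un_iff empty_iff)

lemma V_not_regular: "x \<in> V \<Longrightarrow> F2 M (fst x) \<notin> regular_params"
  unfolding regular_params_def \<Lambda>_def handle_slides_def pair_param_def by blast

lemma branch_follows:
  assumes c: "c \<in> pts M" "c \<notin> crit" "F2 M c \<noteq> (if fw then 1 else 0)"
  shows "\<exists>e. follows fw (F2 M c) e (branch M c)"
proof -
  let ?\<tau> = "F2 M c"
  obtain e where e: "e > 0" "continuous_map (top_of_set (near01 ?\<tau> e)) CT (branch M c)"
    "\<And>r. r \<in> near01 ?\<tau> e \<Longrightarrow> F2 M (branch M c r) = r" using branch_continuous[OF c(1,2)] by blast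
  (* The neighbourhood on the side of \<tau> must not leave [0,1]. *)
  define d where "d = min e (if fw then 1 - ?\<tau> else ?\<tau>)"
  have d: "d > 0" using e(1) F2_range[OF c(1)] c(3) by (auto simp: d_def)
  have "side fw ?\<tau> d \<subseteq> near01 ?\<tau> e" using F2_range[OF c(1)] by (auto simp: d_def side_def near01_def split: if_splits)
  then have "follows fw ?\<tau> d (branch M c)" unfolding follows_def
    using d e(3) continuous_map_from_subtopology_mono[OF e(2)] by blast
  then show ?thesis by blast
qed

text \<open>
  What a birth or a death leaves behind at a nearby parameter \<open>r\<close>: the points \<open>E\<close> form a
  cancelling pair with respect to the points which continue \<open>N\<close>.
\<close>

definition pair_at :: "('i \<times> complex) set \<Rightarrow> ('i \<times> complex) set \<Rightarrow> real \<Rightarrow> bool" where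
  "pair_at N E r \<longleftrightarrow> (\<exists>p m u. p \<noteq> m \<and> E = {p, m} \<and> \<gamma> M (p, m) * u = 1 \<and> \<gamma> M (p, p) = 0 \<and> \<gamma> M (m, m) = 0 \<and> \<gamma> M (m, p) = 0 \<and>
     (\<forall>c\<in>N. \<gamma> M (branch M c r, p) = 0 \<and> \<gamma> M (m, branch M c r) = 0 \<and> \<gamma> M (p, branch M c r) = 0))"

text \<open>
  A birth has its two branches after \<open>\<tau>\<close>, a death before \<open>\<tau>\<close>; on the other side of \<open>\<tau>\<close> there is no
  point of the curve nearby, by the extremum property. The two branches are all of the curve on
  their side because fibres near \<open>c0\<close> have at most two points.
\<close>

lemma cancelling_pair_near:
  assumes c0: "c0 \<in> crit" "F2 M c0 = \<tau>" and U: "openin CT U" "c0 \<in> U"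
    and N: "finite N" "\<And>c. c \<in> N \<Longrightarrow> c \<in> fib M \<tau> \<and> c \<notin> crit"
    and U1: "openin CT U1" "c0 \<in> U1" "\<And>q. q \<in> U1 \<Longrightarrow> if fw then \<tau> \<le> F2 M q else F2 M q \<le> \<tau>"
    and pm: "p \<tau> = c0" "m \<tau> = c0" "follows fw \<tau> e0 p" "follows fw \<tau> e0 m" "\<And>t. t \<in> side fw \<tau> e0 - {\<tau>} \<Longrightarrow> p t \<noteq> m t"
    and ax: "gamma_side fw \<tau> p m * u = 1"
      "\<forall>s\<in>branch M ` (fib M \<tau> - {c0}) \<union> {p, m}. gamma_side fw \<tau> s p = 0 \<and> gamma_side fw \<tau> m s = 0"
      "\<forall>s\<in>branch M ` (fib M \<tau> - {c0}) \<union> {p}. gamma_side fw \<tau> p s = 0"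
  shows "\<exists>W. openin CT W \<and> c0 \<in> W \<and> W \<subseteq> U \<and> (\<exists>e>0. \<forall>r. 0 < \<bar>r - \<tau>\<bar> \<longrightarrow> \<bar>r - \<tau>\<bar> < e \<longrightarrow>
     W \<inter> fib M r = {} \<or> pair_at N (W \<inter> fib M r) r)"
proof -
  have c0p: "c0 \<in> pts M" "c0 \<in> crit" using c0 crit_pts by auto
  obtain W1 where W1: "openin CT W1" "c0 \<in> W1" "W1 \<subseteq> U"
    "\<forall>q1\<in>W1. \<forall>q2\<in>W1. \<forall>q3\<in>W1. F2 M q1 = F2 M q2 \<longrightarrow> F2 M q2 = F2 M q3 \<longrightarrow> q1 = q2 \<or> q1 = q3 \<or> q2 = q3"
    using fibre_at_most_two[OF c0p(1) U] by metis
  define W where "W = W1 \<inter> U1"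
  have W: "openin CT W" "c0 \<in> W" "W \<subseteq> U" using W1 U1 by (auto simp: W_def)
  let ?I = "side fw \<tau> e0"
  have e0: "e0 > 0" "continuous_map (top_of_set ?I) CT p" "continuous_map (top_of_set ?I) CT m"
    and Fpm: "\<And>t. t \<in> ?I \<Longrightarrow> F2 M (p t) = t \<and> F2 M (m t) = t"
    using pm(3,4) by (auto simp: follows_def)
  have pts: "p t \<in> pts M" "m t \<in> pts M" if "t \<in> ?I" for t
    using e0(2,3) that by (auto simp: continuous_map_def topspace_curve_top Pi_iff)
  have \<tau>1: "\<tau> \<noteq> (if fw then 1 else 0)"
  proof -
    let ?t = "if fw then \<tau> + e0/2 else \<tau> - e0/2"
    have t: "?t \<in> ?I" using e0(1) by (auto simp: side_def)
    then have "?t \<in> {0..1}" using F2_range[OF pts(1)[OF t]] Fpm[OF t] by (auto simp only:)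
    then show ?thesis using e0(1) by (auto split: if_splits)
  qed
  have \<tau>in: "\<tau> \<in> ?I" using e0(1) by (simp add: side_def)
  obtain d1 where d1: "d1 > 0" "\<And>t. t \<in> ?I \<Longrightarrow> \<bar>t - \<tau>\<bar> < d1 \<Longrightarrow> p t \<in> W"
    using continuous_path_near[OF e0(2) \<tau>in W(1)] W(2) pm(1) by metis
  obtain d2 where d2: "d2 > 0" "\<And>t. t \<in> ?I \<Longrightarrow> \<bar>t - \<tau>\<bar> < d2 \<Longrightarrow> m t \<in> W"
    using continuous_path_near[OF e0(3) \<tau>in W(1)] W(2) pm(2) by metis
  let ?S = "{p, m} \<union> branch M ` N"
  have fo: "\<exists>e. follows fw \<tau> e \<sigma>" if s: "\<sigma> \<in> ?S" for \<sigma>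
  proof (cases "\<sigma> = p \<or> \<sigma> = m")
    case False
    then obtain c where c: "c \<in> N" "\<sigma> = branch M c" using s by blast
    then have "c \<in> pts M" "c \<notin> crit" "F2 M c = \<tau>" using N(2) fib_pts by blast+
    then show ?thesis using branch_follows[of c fw] \<tau>1 c(2) by simp
  qed (use pm(3,4) in blast)
  have "\<exists>d>0. \<forall>(\<sigma>, \<theta>)\<in>?S \<times> ?S. \<forall>r\<in>side fw \<tau> d - {\<tau>}. \<gamma> M (\<sigma> r, \<theta> r) = gamma_side fw \<tau> \<sigma> \<theta>"
  proof (rule finite_common_radius)
    show "finite (?S \<times> ?S)" using N(1) by simp
  next
    fix x assume "x \<in> ?S \<times> ?S"
    then obtain \<sigma> \<theta> where x: "x = (\<sigma>, \<theta>)" "\<sigma> \<in> ?S" "\<theta> \<in> ?S" by (rule SigmaE)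
    obtain e1 where e1: "follows fw \<tau> e1 \<sigma>" using fo[OF x(2)] ..
    obtain e2 where e2: "follows fw \<tau> e2 \<theta>" using fo[OF x(3)] ..
    show "\<exists>d>0. case x of (\<sigma>, \<theta>) \<Rightarrow> \<forall>r\<in>side fw \<tau> d - {\<tau>}. \<gamma> M (\<sigma> r, \<theta> r) = gamma_side fw \<tau> \<sigma> \<theta>"
      unfolding x(1) prod.case by (rule gamma_side_limit[OF e1 e2])
  next
    fix x e e' assume x: "case x of (\<sigma>, \<theta>) \<Rightarrow> \<forall>r\<in>side fw \<tau> e - {\<tau>}. \<gamma> M (\<sigma> r, \<theta> r) = gamma_side fw \<tau> \<sigma> \<theta>" and "e' \<le> (e::real)"
    then have "side fw \<tau> e' \<subseteq> side fw \<tau> e" by (intro side_mono)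
    then show "case x of (\<sigma>, \<theta>) \<Rightarrow> \<forall>r\<in>side fw \<tau> e' - {\<tau>}. \<gamma> M (\<sigma> r, \<theta> r) = gamma_side fw \<tau> \<sigma> \<theta>"
      using x by (auto split: prod.splits)
  qed
  then obtain d3 where d3: "d3 > 0" "\<And>\<sigma> \<theta> r. \<lbrakk>\<sigma> \<in> ?S; \<theta> \<in> ?S; r \<in> side fw \<tau> d3 - {\<tau>}\<rbrakk> \<Longrightarrow>
     \<gamma> M (\<sigma> r, \<theta> r) = gamma_side fw \<tau> \<sigma> \<theta>" by blast
  define e where "e = min (min e0 d1) (min d2 d3)"
  have e: "e > 0" "e \<le> e0" "e \<le> d1" "e \<le> d2" "e \<le> d3" using e0(1) d1(1) d2(1) d3(1) by (auto simp: e_def)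
  have off: "W \<inter> fib M r = {}" if "r \<notin> side fw \<tau> e" "\<bar>r - \<tau>\<bar> < e" for r
    using U1(3) that by (force simp: W_def fib_def side_def split: if_splits)
  have on: "pair_at N (W \<inter> fib M r) r" if r: "r \<in> side fw \<tau> e" "r \<noteq> \<tau>" for r
    unfolding pair_at_def
  proof (intro exI conjI ballI)
    have rin: "r \<in> ?I - {\<tau>}" "r \<in> ?I" "r \<in> side fw \<tau> d3 - {\<tau>}"
      using r subsetD[OF side_mono[OF e(2)] r(1)] subsetD[OF side_mono[OF e(5)] r(1)] by auto
    have F: "F2 M (p r) = r" "F2 M (m r) = r" and ne: "p r \<noteq> m r" using Fpm[OF rin(2)] pm(5)[OF rin(1)] by auto
    have inW: "p r \<in> W" "m r \<in> W" using d1(2)[OF rin(2)] d2(2)[OF rin(2)] side_near[OF r(1)] e by auto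
    show "p r \<noteq> m r" by (rule ne)
    show "W \<inter> fib M r = {p r, m r}"
    proof
      show "{p r, m r} \<subseteq> W \<inter> fib M r" using inW F pts[OF rin(2)] by (simp add: fib_def)
      show "W \<inter> fib M r \<subseteq> {p r, m r}"
      proof
        fix q assume q: "q \<in> W \<inter> fib M r"
        then have "q \<in> W1" "F2 M q = F2 M (p r)" "F2 M (p r) = F2 M (m r)" using F fib_pts(2) by (auto simp: W_def)
        moreover have "p r \<in> W1" "m r \<in> W1" using inW by (auto simp: W_def)
        ultimately have "q = p r \<or> q = m r \<or> p r = m r" using W1(4) by blast
        then show "q \<in> {p r, m r}" using ne by auto
      qed
    qed
    have in': "p \<in> ?S" "m \<in> ?S" by auto
    show "\<gamma> M (p r, m r) * u = 1" "\<gamma> M (p r, p r) = 0" "\<gamma> M (m r, m r) = 0" "\<gamma> M (m r, p r) = 0"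
      using d3(2)[OF in' rin(3)] d3(2)[OF in'(1,1) rin(3)] d3(2)[OF in'(2,2) rin(3)] d3(2)[OF in'(2,1) rin(3)] ax by auto
    fix c assume c: "c \<in> N"
    then have cin: "branch M c \<in> ?S" by blast
    have "c \<in> fib M \<tau> - {c0}" using N(2)[OF c] c0p(2) by auto
    then have "branch M c \<in> branch M ` (fib M \<tau> - {c0})" by blast
    then have "gamma_side fw \<tau> (branch M c) p = 0" "gamma_side fw \<tau> m (branch M c) = 0" "gamma_side fw \<tau> p (branch M c) = 0"
      using ax(2,3) by blast+
    then show "\<gamma> M (branch M c r, p r) = 0" "\<gamma> M (m r, branch M c r) = 0" "\<gamma> M (p r, branch M c r) = 0"
      using d3(2)[OF cin in'(1) rin(3)] d3(2)[OF in'(2) cin rin(3)] d3(2)[OF in'(1) cin rin(3)] by simp_all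
  qed
  have "W \<inter> fib M r = {} \<or> pair_at N (W \<inter> fib M r) r" if "0 < \<bar>r - \<tau>\<bar>" "\<bar>r - \<tau>\<bar> < e" for r
    using off[of r] on[of r] that by fastforce
  then show ?thesis using W e(1) by blast
qed

lemma crit_local:
  assumes c0: "c0 \<in> crit" "F2 M c0 = \<tau>" and U: "openin CT U" "c0 \<in> U" and N: "finite N" "\<And>c. c \<in> N \<Longrightarrow> c \<in> fib M \<tau> \<and> c \<notin> crit"
  shows "\<exists>W. openin CT W \<and> c0 \<in> W \<and> W \<subseteq> U \<and> (\<exists>e>0. \<forall>r. 0 < \<bar>r - \<tau>\<bar> \<longrightarrow> \<bar>r - \<tau>\<bar> < e \<longrightarrow>
     W \<inter> fib M r = {} \<or> pair_at N (W \<inter> fib M r) r)"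
proof (cases "c0 \<in> births M")
  case True
  obtain U1 where U1: "openin CT U1" "c0 \<in> U1" "\<forall>p\<in>U1. \<tau> \<le> F2 M p" using True c0(2) by (auto simp: births_def)
  have "axiom_\<gamma>4 M" using morse by (simp add: morse_tuple_def)
  then obtain p m u where ax: "birth_branches M c0 p m" "\<gamma>plus M \<tau> p m * u = 1"
    "\<forall>s\<in>branch M ` (fib M \<tau> - {c0}) \<union> {p, m}. \<gamma>plus M \<tau> s p = 0 \<and> \<gamma>plus M \<tau> m s = 0"
    "\<forall>s\<in>branch M ` (fib M \<tau> - {c0}) \<union> {p}. \<gamma>plus M \<tau> p s = 0"
    using True c0(2) unfolding axiom_\<gamma>4_def Let_def by blast
  obtain e0 where e0: "e0 > 0" "p \<tau> = c0" "m \<tau> = c0" "continuous_map (top_of_set {\<tau>..<\<tau> + e0}) CT p"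
    "continuous_map (top_of_set {\<tau>..<\<tau> + e0}) CT m" "\<And>t. t \<in> {\<tau><..<\<tau> + e0} \<Longrightarrow> F2 M (p t) = t \<and> F2 M (m t) = t \<and> p t \<noteq> m t"
    using ax(1) c0(2) unfolding birth_branches_def by blast
  have "F2 M (p t) = t \<and> F2 M (m t) = t" if "t \<in> {\<tau>..<\<tau> + e0}" for t
    using e0(2,3) e0(6)[of t] that c0(2) by (cases "t = \<tau>") auto
  then show ?thesis
    using e0 ax by (intro cancelling_pair_near[OF c0 U N U1(1,2), of True p m e0 u])
      (use U1(3) in \<open>auto simp: follows_def side_def gamma_side_def\<close>)
next
  case False
  then have c0d: "c0 \<in> deaths M" using c0(1) by (simp add: crit_def)
  obtain U1 where U1: "openin CT U1" "c0 \<in> U1" "\<forall>p\<in>U1. F2 M p \<le> \<tau>" using c0d c0(2) by (auto simp: deaths_def)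
  have "axiom_\<gamma>5 M" using morse by (simp add: morse_tuple_def)
  then obtain p m u where ax: "death_branches M c0 p m" "\<gamma>minus M \<tau> p m * u = 1"
    "\<forall>s\<in>branch M ` (fib M \<tau> - {c0}) \<union> {p, m}. \<gamma>minus M \<tau> s p = 0 \<and> \<gamma>minus M \<tau> m s = 0"
    "\<forall>s\<in>branch M ` (fib M \<tau> - {c0}) \<union> {p}. \<gamma>minus M \<tau> p s = 0"
    using c0d c0(2) unfolding axiom_\<gamma>5_def Let_def by blast
  obtain e0 where e0: "e0 > 0" "p \<tau> = c0" "m \<tau> = c0" "continuous_map (top_of_set {\<tau> - e0<..\<tau>}) CT p"
    "continuous_map (top_of_set {\<tau> - e0<..\<tau>}) CT m" "\<And>t. t \<in> {\<tau> - e0<..<\<tau>} \<Longrightarrow> F2 M (p t) = t \<and> F2 M (m t) = t \<and> p t \<noteq> m t"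
    using ax(1) c0(2) unfolding death_branches_def by blast
  have "F2 M (p t) = t \<and> F2 M (m t) = t" if "t \<in> {\<tau> - e0<..\<tau>}" for t
    using e0(2,3) e0(6)[of t] that c0(2) by (cases "t = \<tau>") auto
  then show ?thesis
    using e0 ax by (intro cancelling_pair_near[OF c0 U N U1(1,2), of False p m e0 u])
      (use U1(3) in \<open>auto simp: follows_def side_def gamma_side_def\<close>)
qed

end

section \<open>The model complex at a parameter\<close>

lemma Hausdorff_finite_separation:
  assumes "Hausdorff_space X" "finite S" "S \<subseteq> topspace X"
  shows "\<exists>U. (\<forall>x\<in>S. openin X (U x) \<and> x \<in> U x) \<and> (\<forall>x\<in>S. \<forall>y\<in>S. x \<noteq> y \<longrightarrow> U x \<inter> U y = {})"
proof -
  have "\<forall>x\<in>S. \<forall>y\<in>S. \<exists>A. \<exists>B. x \<noteq> y \<longrightarrow> openin X A \<and> openin X B \<and> x \<in> A \<and> y \<in> B \<and> A \<inter> B = {}"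
  proof (intro ballI)
    fix x y assume xy: "x \<in> S" "y \<in> S"
    show "\<exists>A. \<exists>B. x \<noteq> y \<longrightarrow> openin X A \<and> openin X B \<and> x \<in> A \<and> y \<in> B \<and> A \<inter> B = {}"
    proof (cases "x = y")
      case False
      have "x \<in> topspace X" "y \<in> topspace X" using xy assms(3) by auto
      then obtain A B where "openin X A" "openin X B" "x \<in> A" "y \<in> B" "disjnt A B"
        using assms(1) False unfolding Hausdorff_space_def by metis
      then show ?thesis unfolding disjnt_def by (intro exI[of _ A] exI[of _ B]) simp
    qed simp
  qed
  then obtain A B where AB: "\<And>x y. \<lbrakk>x \<in> S; y \<in> S; x \<noteq> y\<rbrakk> \<Longrightarrow>
     openin X (A x y) \<and> openin X (B x y) \<and> x \<in> A x y \<and> y \<in> B x y \<and> A x y \<inter> B x y = {}" by metis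
  define U where "U x = (\<Inter>y\<in>S. if y = x then topspace X else A x y \<inter> B y x)" for x
  have "openin X (U x) \<and> x \<in> U x" if x: "x \<in> S" for x
  proof
    show "openin X (U x)" unfolding U_def
    proof (rule openin_Inter)
      fix T assume "T \<in> (\<lambda>y. if y = x then topspace X else A x y \<inter> B y x) ` S"
      then obtain y where y: "y \<in> S" "T = (if y = x then topspace X else A x y \<inter> B y x)" by blast
      show "openin X T" using y(2) AB[OF x y(1)] AB[OF y(1) x] by (cases "y = x") auto
    qed (use x assms(2) in auto)
    have "x \<in> (if y = x then topspace X else A x y \<inter> B y x)" if "y \<in> S" for y
      using AB[OF x that] AB[OF that x] x assms(3) by (cases "y = x") auto
    then show "x \<in> U x" unfolding U_def by blast
  qed
  moreover have "U x \<inter> U y = {}" if "x \<in> S" "y \<in> S" "x \<noteq> y" for x y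
  proof -
    have "U x \<subseteq> A x y \<inter> B y x" unfolding U_def using INT_lower[OF that(2), of "\<lambda>y. if y = x then topspace X else A x y \<inter> B y x"] that(3) by simp
    moreover have "U y \<subseteq> A y x \<inter> B x y" unfolding U_def using INT_lower[OF that(1), of "\<lambda>x. if x = y then topspace X else A y x \<inter> B x y"] that(3) by simp
    ultimately have "U x \<subseteq> A x y" "U y \<subseteq> B x y" by auto
    then show ?thesis using AB[OF that] by blast
  qed
  ultimately show ?thesis by blast
qed

context morse
begin

definition "trace_set = {(F2 M q, F3 M q) | q. q \<in> pts M}"

text \<open>
  The generators of the model. Each of them continues to all parameters near \<open>\<tau>\<close>.
\<close>

definition stay :: "real \<Rightarrow> real \<Rightarrow> real \<Rightarrow> ('i \<times> complex) set" where
  "stay \<tau> a b = gens M a b \<tau> - crit"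

text \<open>
  The axiom on handle-slides compares the two sides of a parameter, so it says nothing at 0 and 1;
  the jump is set to zero there.
\<close>

definition jump :: "real \<Rightarrow> 'i cpair \<Rightarrow> 'k" where
  "jump \<tau> x = (if x \<in> handle_slides M \<and> 0 < \<tau> \<and> \<tau> < 1 then \<delta> M x else 0)"

text \<open>
  The model has the coefficients before \<open>\<tau>\<close> (see \<open>base\<close>). Complexes at \<open>r \<le> \<tau>\<close> map to it without
  correction, those at \<open>r > \<tau>\<close> by the change of basis of the handle-slide.
\<close>

definition jump_at :: "real \<Rightarrow> real \<Rightarrow> 'i cpair \<Rightarrow> 'k" where
  "jump_at \<tau> r = (if \<tau> < r then jump \<tau> else (\<lambda>_. 0))"

text \<open>
  The coefficients just before \<open>\<tau>\<close>; at \<open>\<tau> = 0\<close>, where there is no such side, those just after.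
\<close>

definition base :: "real \<Rightarrow> 'i cpair \<Rightarrow> 'k" where
  "base \<tau> x = (if \<tau> = 0 then \<gamma>plus M \<tau> (branch M (fst x)) (branch M (snd x))
     else \<gamma>minus M \<tau> (branch M (fst x)) (branch M (snd x)))"

abbreviation rho :: "real \<Rightarrow> real \<Rightarrow> real \<Rightarrow> real \<Rightarrow> (('i \<times> complex) \<Rightarrow>\<^sub>0 'k) \<Rightarrow> (('i \<times> complex) \<Rightarrow>\<^sub>0 'k)" where
  "rho \<tau> a b r \<equiv> restrict_along (\<lambda>c. branch M c r) (stay \<tau> a b) (jump_at \<tau> r)"

lemma stay_finite: "finite (stay \<tau> a b)"
  using gens_finite by (simp add: stay_def)

lemma stayD: "c \<in> stay \<tau> a b \<Longrightarrow> c \<in> pts M \<and> c \<notin> crit \<and> F2 M c = \<tau> \<and> c \<in> fib M \<tau> \<and> a < F3 M c \<and> F3 M c < b"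
  by (auto simp: stay_def gens_def fib_def)

lemma jump_decreasing: "jump_at \<tau> r (c1, c2) \<noteq> 0 \<Longrightarrow> F3 M c2 < F3 M c1"
  using delta_decreasing[of c1 c2] by (auto simp: jump_at_def jump_def split: if_splits)

lemma branch_near:
  assumes c: "c \<in> pts M" "c \<notin> crit" and U: "openin CT U" "c \<in> U"
  shows "\<exists>e>0. \<forall>r\<in>near01 (F2 M c) e. branch M c r \<in> U \<and> branch M c r \<in> pts M \<and> F2 M (branch M c r) = r"
proof -
  obtain W e where W: "openin CT W" "W \<subseteq> U" "e > 0" "\<forall>r\<in>near01 (F2 M c) e. branch M c r \<in> W \<and> F2 M (branch M c r) = r"
    using branch_unique[OF c U] by metis
  have "W \<subseteq> pts M" using openin_subset[OF W(1)] by (simp add: topspace_curve_top)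
  then show ?thesis using W by blast
qed

text \<open>
  At \<open>\<tau>\<close> the point lies off the ends of the window, so nearby it stays on the same side of each.
\<close>

lemma branch_window:
  assumes c: "c \<in> fib M \<tau>" "c \<notin> crit" and reg: "(\<tau>, a) \<notin> trace_set" "(\<tau>, b) \<notin> trace_set"
  shows "\<exists>e>0. \<forall>r\<in>near01 \<tau> e. branch M c r \<in> gens M a b r \<longleftrightarrow> c \<in> gens M a b \<tau>"
proof -
  have cp: "c \<in> pts M" "F2 M c = \<tau>" using fib_pts[OF c(1)] by auto
  have ne: "F3 M c \<noteq> a" "F3 M c \<noteq> b" using reg cp unfolding trace_set_def by blast+
  define S where "S = (if a < F3 M c then {a<..} else {..<a}) \<inter> (if F3 M c < b then {..<b} else {b<..})"
  have "open S" by (auto simp: S_def)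
  then have U: "openin CT {p \<in> pts M. F3 M p \<in> S}" by (rule F3_open)
  have cU: "c \<in> {p \<in> pts M. F3 M p \<in> S}" using cp ne by (auto simp: S_def)
  obtain e where e: "e > 0" "\<forall>r\<in>near01 \<tau> e. branch M c r \<in> {p \<in> pts M. F3 M p \<in> S} \<and> branch M c r \<in> pts M \<and> F2 M (branch M c r) = r"
    using branch_near[OF cp(1) c(2) U cU] cp(2) by auto
  have "branch M c r \<in> gens M a b r \<longleftrightarrow> c \<in> gens M a b \<tau>" if "r \<in> near01 \<tau> e" for r
    using bspec[OF e(2) that] c(1) by (auto simp: gens_def fib_def S_def split: if_splits)
  then show ?thesis using e(1) by blast
qed

lemma no_vertices_near:
  "\<exists>e>0. \<forall>r. r \<noteq> \<tau> \<longrightarrow> \<bar>r - \<tau>\<bar> < e \<longrightarrow> (\<forall>c1\<in>gens M a b r. \<forall>c2\<in>gens M a b r. (c1, c2) \<notin> V)"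
proof -
  let ?S = "(\<lambda>x. F2 M (fst x)) ` {x \<in> V. F3 M (fst x) \<in> {a..b} \<and> F3 M (snd x) \<in> {a..b}}"
  have "finite ?S" using V_compact_finite by blast
  then obtain d where d: "d > 0" "\<forall>x\<in>?S. x \<noteq> \<tau> \<longrightarrow> d \<le> dist \<tau> x" using finite_set_avoid by blast
  have "(c1, c2) \<notin> V" if "r \<noteq> \<tau>" "\<bar>r - \<tau>\<bar> < d" "c1 \<in> gens M a b r" "c2 \<in> gens M a b r" for r c1 c2
  proof
    assume "(c1, c2) \<in> V"
    then have "(c1, c2) \<in> {x \<in> V. F3 M (fst x) \<in> {a..b} \<and> F3 M (snd x) \<in> {a..b}}"
      using that by (auto simp: gens_def)
    moreover have "F2 M (fst (c1, c2)) = r" using that by (simp add: gens_def fib_def)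
    ultimately have "r \<in> ?S" by (metis (no_types, lifting) imageI)
    then have "r \<noteq> \<tau> \<longrightarrow> d \<le> dist \<tau> r" using d(2) by (rule bspec[rotated])
    then show False using that by (simp add: dist_real_def abs_minus_commute)
  qed
  then show ?thesis using d(1) by blast
qed

lemma gamma_across:
  assumes c: "c1 \<in> fib M \<tau>" "c1 \<notin> crit" "c2 \<in> fib M \<tau>" "c2 \<notin> crit" and nV: "(c1, c2) \<notin> V"
  shows "\<exists>e>0. \<forall>r\<in>near01 \<tau> e. \<gamma> M (branch M c1 r, branch M c2 r) = \<gamma> M (c1, c2)"
proof -
  have cp: "c1 \<in> pts M" "c2 \<in> pts M" "F2 M c1 = \<tau>" "F2 M c2 = \<tau>" using c fib_pts by auto
  obtain e1 where e1: "e1 > 0" "continuous_map (top_of_set (near01 \<tau> e1)) CT (branch M c1)"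
    "\<And>r. r \<in> near01 \<tau> e1 \<Longrightarrow> F2 M (branch M c1 r) = r" using branch_continuous[OF cp(1) c(2)] cp(3) by metis
  obtain e2 where e2: "e2 > 0" "continuous_map (top_of_set (near01 \<tau> e2)) CT (branch M c2)"
    "\<And>r. r \<in> near01 \<tau> e2 \<Longrightarrow> F2 M (branch M c2 r) = r" using branch_continuous[OF cp(2) c(4)] cp(4) by metis
  have at: "branch M c1 \<tau> = c1" "branch M c2 \<tau> = c2" using branch_at cp c by metis+
  define J where "J = near01 \<tau> (min e1 e2)"
  have Js: "J \<subseteq> near01 \<tau> e1" "J \<subseteq> near01 \<tau> e2" by (auto simp: J_def near01_def)
  have \<tau>J: "\<tau> \<in> J" using e1 e2 F2_range[OF cp(1)] cp(3) by (simp add: J_def near01_def)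
  have cJ: "continuous_map (top_of_set J) CT (branch M c1)" "continuous_map (top_of_set J) CT (branch M c2)"
    using continuous_map_from_subtopology_mono[OF e1(2) Js(1)] continuous_map_from_subtopology_mono[OF e2(2) Js(2)] .
  have FJ: "F2 M (branch M c1 r) = r \<and> F2 M (branch M c2 r) = r" if "r \<in> J" for r using e1(3) e2(3) Js that by blast
  from path_avoids_V[OF cJ \<tau>J FJ] obtain d where d: "d > 0"
    "\<forall>r\<in>J. \<bar>r - \<tau>\<bar> < d \<longrightarrow> r \<noteq> \<tau> \<longrightarrow> (branch M c1 r, branch M c2 r) \<notin> V" by blast
  define J' where "J' = near01 \<tau> (min d (min e1 e2))"
  have J': "J' \<subseteq> J" by (auto simp: J'_def J_def near01_def)
  have \<tau>J': "\<tau> \<in> J'" using d(1) \<tau>J by (auto simp: J_def J'_def near01_def)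
  have "\<gamma> M (branch M c1 r, branch M c2 r) = \<gamma> M (branch M c1 \<tau>, branch M c2 \<tau>)" if r: "r \<in> J'" for r
  proof (rule gamma_constant_on_path[OF _ continuous_map_from_subtopology_mono[OF cJ(1) J']
        continuous_map_from_subtopology_mono[OF cJ(2) J'] _ _ r \<tau>J'])
    show "is_interval J'" by (auto simp: J'_def near01_def is_interval_1)
    fix t assume t: "t \<in> J'"
    then show "F2 M (branch M c1 t) = F2 M (branch M c2 t)" using FJ[of t] J' by auto
    have "t \<in> J" "\<bar>t - \<tau>\<bar> < d" using t J' by (auto simp: J'_def near01_def)
    then show "(branch M c1 t, branch M c2 t) \<notin> V" using d(2) nV at by (cases "t = \<tau>") auto
  qed
  then show ?thesis using d(1) e1(1) e2(1) at unfolding J'_def by (intro exI[of _ "min d (min e1 e2)"]) auto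
qed

abbreviation side_values :: "real \<Rightarrow> real \<Rightarrow> 'i \<times> complex \<Rightarrow> 'i \<times> complex \<Rightarrow> bool" where
  "side_values \<tau> r c1 c2 \<equiv> (\<tau> < r \<longrightarrow> \<gamma> M (branch M c1 r, branch M c2 r) = \<gamma>plus M \<tau> (branch M c1) (branch M c2)) \<and>
    (r < \<tau> \<longrightarrow> \<gamma> M (branch M c1 r, branch M c2 r) = \<gamma>minus M \<tau> (branch M c1) (branch M c2))"

lemma gamma_sides:
  assumes c: "c1 \<in> fib M \<tau>" "c1 \<notin> crit" "c2 \<in> fib M \<tau>" "c2 \<notin> crit"
  shows "\<exists>e>0. \<forall>r\<in>near01 \<tau> e. side_values \<tau> r c1 c2"
proof -
  have cp: "c1 \<in> pts M" "c2 \<in> pts M" "F2 M c1 = \<tau>" "F2 M c2 = \<tau>" using c fib_pts by auto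
  have "\<exists>d>0. \<forall>r\<in>near01 \<tau> d. r \<in> side fw \<tau> d - {\<tau>} \<longrightarrow>
    \<gamma> M (branch M c1 r, branch M c2 r) = gamma_side fw \<tau> (branch M c1) (branch M c2)" for fw
  proof (cases "\<tau> = (if fw then 1 else 0)")
    case True
    then have "r = \<tau>" if "r \<in> near01 \<tau> 1" "r \<in> side fw \<tau> 1" for r
      using that by (auto simp: near01_def side_def split: if_splits)
    then show ?thesis by (intro exI[of _ 1]) auto
  next
    case False
    then obtain e1 e2 where "follows fw \<tau> e1 (branch M c1)" "follows fw \<tau> e2 (branch M c2)"
      using branch_follows[OF cp(1) c(2), of fw] branch_follows[OF cp(2) c(4), of fw] cp by auto
    from gamma_side_limit[OF this] show ?thesis by blast
  qed
  from this[of True] this[of False] obtain d1 d2 where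
    d1: "d1 > 0" "\<forall>r\<in>near01 \<tau> d1. r \<in> side True \<tau> d1 - {\<tau>} \<longrightarrow> \<gamma> M (branch M c1 r, branch M c2 r) = \<gamma>plus M \<tau> (branch M c1) (branch M c2)"
    and d2: "d2 > 0" "\<forall>r\<in>near01 \<tau> d2. r \<in> side False \<tau> d2 - {\<tau>} \<longrightarrow> \<gamma> M (branch M c1 r, branch M c2 r) = \<gamma>minus M \<tau> (branch M c1) (branch M c2)"
    unfolding gamma_side_def if_True if_False by blast
  then show ?thesis by (intro exI[of _ "min d1 d2"]) (auto simp: near01_def side_def)
qed

text \<open>
  The inequality may become an equality in the limit, since two branches may meet in height at
  \<open>\<tau>\<close>; this is still enough to confine sums to a window.
\<close>

lemma side_decreasing:
  assumes c: "c1 \<in> fib M \<tau>" "c1 \<notin> crit" "c2 \<in> fib M \<tau>" "c2 \<notin> crit"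
  shows "\<tau> < 1 \<Longrightarrow> \<gamma>plus M \<tau> (branch M c1) (branch M c2) \<noteq> 0 \<Longrightarrow> F3 M c2 \<le> F3 M c1"
    and "0 < \<tau> \<Longrightarrow> \<gamma>minus M \<tau> (branch M c1) (branch M c2) \<noteq> 0 \<Longrightarrow> F3 M c2 \<le> F3 M c1"
proof -
  have cp: "c1 \<in> pts M" "c2 \<in> pts M" "F2 M c1 = \<tau>" "F2 M c2 = \<tau>" using c fib_pts by auto
  have \<tau>: "\<tau> \<in> {0..1}" using F2_range[OF cp(1)] cp(3) by simp
  obtain e0 where e0: "e0 > 0" "\<forall>r\<in>near01 \<tau> e0. side_values \<tau> r c1 c2"
    using gamma_sides[OF c] by blast
  have main: "F3 M c2 \<le> F3 M c1"
    if ex: "\<And>e. e > 0 \<Longrightarrow> e \<le> e0 \<Longrightarrow> \<exists>r\<in>near01 \<tau> e \<inter> regular_params. \<gamma> M (branch M c1 r, branch M c2 r) \<noteq> 0"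
  proof (rule ccontr)
    assume lt: "\<not> F3 M c2 \<le> F3 M c1"
    define l where "l = (F3 M c1 + F3 M c2) / 2"
    have l: "F3 M c1 < l" "l < F3 M c2" using lt by (auto simp: l_def)
    have "openin CT {p \<in> pts M. F3 M p \<in> {..<l}}" "openin CT {p \<in> pts M. F3 M p \<in> {l<..}}" by (rule F3_open, simp)+
    then obtain e1 e2 where e1: "e1 > 0" "\<forall>r\<in>near01 \<tau> e1. branch M c1 r \<in> {p \<in> pts M. F3 M p \<in> {..<l}} \<and> branch M c1 r \<in> pts M \<and> F2 M (branch M c1 r) = r"
      and e2: "e2 > 0" "\<forall>r\<in>near01 \<tau> e2. branch M c2 r \<in> {p \<in> pts M. F3 M p \<in> {l<..}} \<and> branch M c2 r \<in> pts M \<and> F2 M (branch M c2 r) = r"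
      using branch_near[OF cp(1) c(2), of "{p \<in> pts M. F3 M p \<in> {..<l}}"] branch_near[OF cp(2) c(4), of "{p \<in> pts M. F3 M p \<in> {l<..}}"] cp l by auto
    obtain r where r: "r \<in> near01 \<tau> (min e0 (min e1 e2))" "r \<in> regular_params" "\<gamma> M (branch M c1 r, branch M c2 r) \<noteq> 0"
      using ex[of "min e0 (min e1 e2)"] e0(1) e1(1) e2(1) by auto
    have "r \<in> near01 \<tau> e1" "r \<in> near01 \<tau> e2" using r(1) by (auto simp: near01_def)
    then have b: "branch M c1 r \<in> fib M r" "branch M c2 r \<in> fib M r" "F3 M (branch M c1 r) < l" "l < F3 M (branch M c2 r)"
      using e1(2) e2(2) by (auto simp: fib_def)
    then show False using gamma_decreasing[OF r(2) b(1,2) r(3)] by simp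
  qed
  show "F3 M c2 \<le> F3 M c1" if t: "\<tau> < 1" and nz: "\<gamma>plus M \<tau> (branch M c1) (branch M c2) \<noteq> 0"
  proof (rule main)
    fix e :: real assume e: "e > 0" "e \<le> e0"
    obtain r where r: "r \<in> regular_params" "\<tau> < r" "r < min 1 (\<tau> + e)"
      using regular_dense[of \<tau> "min 1 (\<tau> + e)"] \<tau> t e by auto
    then have "r \<in> near01 \<tau> e" "r \<in> near01 \<tau> e0" using \<tau> e by (auto simp: near01_def)
    then show "\<exists>r\<in>near01 \<tau> e \<inter> regular_params. \<gamma> M (branch M c1 r, branch M c2 r) \<noteq> 0" using e0(2) r nz by (intro bexI[of _ r]) auto
  qed
  show "F3 M c2 \<le> F3 M c1" if t: "0 < \<tau>" and nz: "\<gamma>minus M \<tau> (branch M c1) (branch M c2) \<noteq> 0"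
  proof (rule main)
    fix e :: real assume e: "e > 0" "e \<le> e0"
    obtain r where r: "r \<in> regular_params" "max 0 (\<tau> - e) < r" "r < \<tau>"
      using regular_dense[of "max 0 (\<tau> - e)" \<tau>] \<tau> t e by auto
    then have "r \<in> near01 \<tau> e" "r \<in> near01 \<tau> e0" using \<tau> e by (auto simp: near01_def)
    then show "\<exists>r\<in>near01 \<tau> e \<inter> regular_params. \<gamma> M (branch M c1 r, branch M c2 r) \<noteq> 0" using e0(2) r nz by (intro bexI[of _ r]) auto
  qed
qed

lemma base_decreasing:
  assumes "c1 \<in> fib M \<tau>" "c1 \<notin> crit" "c2 \<in> fib M \<tau>" "c2 \<notin> crit" "base \<tau> (c1, c2) \<noteq> 0"
  shows "F3 M c2 \<le> F3 M c1"
proof -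
  have "\<tau> \<in> {0..1}" using assms(1) F2_range fib_pts by metis
  then show ?thesis using side_decreasing[OF assms(1-4)] assms(5) by (cases "\<tau> = 0") (auto simp: base_def)
qed

lemma sides_agree:
  assumes c: "c1 \<in> fib M \<tau>" "c1 \<notin> crit" "c2 \<in> fib M \<tau>" "c2 \<notin> crit" and nV: "(c1, c2) \<notin> V"
  shows "\<tau> < 1 \<Longrightarrow> \<gamma>plus M \<tau> (branch M c1) (branch M c2) = \<gamma> M (c1, c2)"
    and "0 < \<tau> \<Longrightarrow> \<gamma>minus M \<tau> (branch M c1) (branch M c2) = \<gamma> M (c1, c2)"
proof -
  have \<tau>: "\<tau> \<in> {0..1}" using c(1) F2_range fib_pts by metis
  obtain e1 where e1: "e1 > 0" "\<forall>r\<in>near01 \<tau> e1. side_values \<tau> r c1 c2"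
    using gamma_sides[OF c] by blast
  obtain e2 where e2: "e2 > 0" "\<forall>r\<in>near01 \<tau> e2. \<gamma> M (branch M c1 r, branch M c2 r) = \<gamma> M (c1, c2)"
    using gamma_across[OF c nV] by blast
  show "\<gamma>plus M \<tau> (branch M c1) (branch M c2) = \<gamma> M (c1, c2)" if "\<tau> < 1"
  proof -
    define m where "m = min (min e1 e2) (1 - \<tau>)"
    define r where "r = \<tau> + m / 2"
    have m: "0 < m" "m \<le> e1" "m \<le> e2" "m \<le> 1 - \<tau>" using e1(1) e2(1) that by (auto simp: m_def)
    have "0 \<le> \<tau>" using \<tau> by simp
    then have "\<tau> < r" "r \<in> near01 \<tau> e1" "r \<in> near01 \<tau> e2" using m by (simp_all add: r_def near01_def)
    then show ?thesis using bspec[OF e1(2), of r] bspec[OF e2(2), of r] by simp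
  qed
  show "\<gamma>minus M \<tau> (branch M c1) (branch M c2) = \<gamma> M (c1, c2)" if "0 < \<tau>"
  proof -
    define m where "m = min (min e1 e2) \<tau>"
    define r where "r = \<tau> - m / 2"
    have m: "0 < m" "m \<le> e1" "m \<le> e2" "m \<le> \<tau>" using e1(1) e2(1) that by (auto simp: m_def)
    have "\<tau> \<le> 1" using \<tau> by simp
    then have "r < \<tau>" "r \<in> near01 \<tau> e1" "r \<in> near01 \<tau> e2" using m by (simp_all add: r_def near01_def)
    then show ?thesis using bspec[OF e1(2), of r] bspec[OF e2(2), of r] by simp
  qed
qed

lemma V_noncrit_handle:
  assumes "(c1, c2) \<in> V" "c1 \<notin> crit" "c2 \<notin> crit"
  shows "(c1, c2) \<in> handle_slides M"
  using assms by (auto simp: handle_slides_def crit_def birth_pairs_def death_pairs_def)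

lemma handle_slide_fib:
  assumes "(c1, c2) \<in> handle_slides M"
  shows "c1 \<in> fib M (F2 M c1)" "c2 \<in> fib M (F2 M c1)" "c1 \<notin> crit" "c2 \<notin> crit" "F2 M c1 \<in> pair_param M ` handle_slides M"
proof -
  have "(c1, c2) \<in> topspace PT" using assms V_discrete by (auto simp: handle_slides_def discrete_in_def)
  then show f: "c1 \<in> fib M (F2 M c1)" "c2 \<in> fib M (F2 M c1)" by (auto simp: topspace_pair fib_def)
  show h: "F2 M c1 \<in> pair_param M ` handle_slides M" using assms by (force simp: pair_param_def)
  show "c1 \<notin> crit" using crit_not_handle h by blast
  show "c2 \<notin> crit" using crit_not_handle[of c2] h fib_pts(2)[OF f(2)] by metis
qed

text \<open>
  This is the handle-slide axiom with all terms that involve \<open>\<delta>\<close> brought to the side of the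
  coefficients which they multiply. Its sums reduce to the window, as the middle point lies
  between \<open>c1\<close> and \<open>c3\<close> in height. If there is no handle-slide at \<open>\<tau>\<close>, both sides have the same
  limits.
\<close>

lemma jump_relation:
  assumes \<tau>: "0 \<le> \<tau>" "\<tau> < 1" and c: "c1 \<in> stay \<tau> a b" "c3 \<in> stay \<tau> a b"
  shows "\<gamma>plus M \<tau> (branch M c1) (branch M c3) + (\<Sum>c2\<in>stay \<tau> a b. \<gamma>plus M \<tau> (branch M c1) (branch M c2) * jump \<tau> (c2, c3)) =
    base \<tau> (c1, c3) + (\<Sum>c2\<in>stay \<tau> a b. jump \<tau> (c1, c2) * base \<tau> (c2, c3))"
proof (cases "\<tau> = 0")
  case True
  then show ?thesis by (simp add: jump_def base_def)
next
  case False
  then have t0: "0 < \<tau>" using \<tau> by simp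
  have base: "base \<tau> (x, y) = \<gamma>minus M \<tau> (branch M x) (branch M y)" for x y using False by (simp add: base_def)
  have jump: "jump \<tau> x = (if x \<in> handle_slides M then \<delta> M x else 0)" for x using t0 \<tau> by (simp add: jump_def)
  note s1 = stayD[OF c(1)] and s3 = stayD[OF c(2)]
  show ?thesis
  proof (cases "\<tau> \<in> pair_param M ` handle_slides M")
    case False
    have nh: "(x, y) \<notin> handle_slides M" if "x \<in> stay \<tau> a b" for x y
      using False handle_slide_fib(5)[of x y] stayD[OF that] by auto
    have "(c1, c3) \<notin> V" using V_noncrit_handle[of c1 c3] nh[OF c(1)] s1 s3 by blast
    then have "\<gamma>plus M \<tau> (branch M c1) (branch M c3) = \<gamma>minus M \<tau> (branch M c1) (branch M c3)"
      using sides_agree[of c1 \<tau> c3] s1 s3 \<tau> t0 by simp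
    then show ?thesis using nh c(1) by (simp add: base jump)
  next
    case True
    have nocrit: "x \<notin> crit" if "x \<in> fib M \<tau>" for x using crit_not_handle[of x] True fib_pts(2)[OF that] by auto
    have stayI: "x \<in> stay \<tau> a b" if "x \<in> fib M \<tau>" "F3 M c3 \<le> F3 M x" "F3 M x \<le> F3 M c1" for x
      using that nocrit s1 s3 by (auto simp: stay_def gens_def)
    let ?f = "\<lambda>c2. \<delta> M (c1, c2) * \<gamma>minus M \<tau> (branch M c2) (branch M c3) when (c1, c2) \<in> handle_slides M"
    let ?g = "\<lambda>c2. \<delta> M (c2, c3) * \<gamma>plus M \<tau> (branch M c1) (branch M c2) when (c2, c3) \<in> handle_slides M"
    have "axiom_\<gamma>3 M" using morse by (simp add: morse_tuple_def)
    then have ax: "\<gamma>plus M \<tau> (branch M c1) (branch M c3) = \<gamma>minus M \<tau> (branch M c1) (branch M c3) + Sum_any ?f - Sum_any ?g"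
      using True t0 \<tau>(2) s1 s3 unfolding axiom_\<gamma>3_def by blast
    have "{c2. ?f c2 \<noteq> 0} \<subseteq> stay \<tau> a b"
    proof
      fix c2 assume "c2 \<in> {c2. ?f c2 \<noteq> 0}"
      then have h: "(c1, c2) \<in> handle_slides M" "\<delta> M (c1, c2) \<noteq> 0" "\<gamma>minus M \<tau> (branch M c2) (branch M c3) \<noteq> 0"
        by (auto simp: when_def split: if_splits)
      have f: "c2 \<in> fib M \<tau>" using handle_slide_fib(2)[OF h(1)] s1 by simp
      show "c2 \<in> stay \<tau> a b"
        using stayI[OF f] side_decreasing(2)[of c2 \<tau> c3] delta_decreasing[OF h(1,2)] f nocrit s3 t0 h(3) by auto
    qed
    then have "Sum_any ?f = (\<Sum>c2\<in>stay \<tau> a b. ?f c2)" by (rule Sum_any.expand_superset[OF stay_finite])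
    also have "\<dots> = (\<Sum>c2\<in>stay \<tau> a b. jump \<tau> (c1, c2) * base \<tau> (c2, c3))" by (intro sum.cong) (auto simp: jump base when_def)
    finally have F: "Sum_any ?f = (\<Sum>c2\<in>stay \<tau> a b. jump \<tau> (c1, c2) * base \<tau> (c2, c3))" .
    have "{c2. ?g c2 \<noteq> 0} \<subseteq> stay \<tau> a b"
    proof
      fix c2 assume "c2 \<in> {c2. ?g c2 \<noteq> 0}"
      then have h: "(c2, c3) \<in> handle_slides M" "\<delta> M (c2, c3) \<noteq> 0" "\<gamma>plus M \<tau> (branch M c1) (branch M c2) \<noteq> 0"
        by (auto simp: when_def split: if_splits)
      have f: "c2 \<in> fib M \<tau>" using handle_slide_fib(1,2)[OF h(1)] s3 by (auto simp: fib_def)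
      show "c2 \<in> stay \<tau> a b"
        using stayI[OF f] side_decreasing(1)[of c1 \<tau> c2] delta_decreasing[OF h(1,2)] f nocrit s1 \<tau> h(3) by auto
    qed
    then have "Sum_any ?g = (\<Sum>c2\<in>stay \<tau> a b. ?g c2)" by (rule Sum_any.expand_superset[OF stay_finite])
    also have "\<dots> = (\<Sum>c2\<in>stay \<tau> a b. \<gamma>plus M \<tau> (branch M c1) (branch M c2) * jump \<tau> (c2, c3))"
      by (intro sum.cong) (auto simp: jump when_def)
    finally show ?thesis using ax F base by (simp add: algebra_simps)
  qed
qed

text \<open>
  The points over \<open>\<tau>\<close> have disjoint neighbourhoods in each of which the fibre over \<open>r\<close> is the
  single point of a branch, empty, or a cancelling pair. By compactness these neighbourhoods
  contain the whole window over \<open>r\<close>. At most one point over \<open>\<tau>\<close> is critical.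
\<close>

lemma gens_near:
  assumes \<tau>: "\<tau> \<in> {0..1}" and reg: "(\<tau>, a) \<notin> trace_set" "(\<tau>, b) \<notin> trace_set"
  shows "\<exists>e>0. \<forall>r\<in>near01 \<tau> e. r \<noteq> \<tau> \<or> \<tau> \<in> regular_params \<longrightarrow>
     inj_on (\<lambda>c. branch M c r) (stay \<tau> a b) \<and>
     (gens M a b r = (\<lambda>c. branch M c r) ` stay \<tau> a b \<or> cancelling_pair (\<gamma> M) (gens M a b r) ((\<lambda>c. branch M c r) ` stay \<tau> a b))"
proof -
  let ?G = "gens M a b \<tau>" and ?P = "stay \<tau> a b"
  have G: "finite ?G" "?G \<subseteq> topspace CT" using gens_finite by (auto simp: gens_def fib_def topspace_curve_top)
  from Hausdorff_finite_separation[OF Hausdorff_curve G] obtain U0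
    where "(\<forall>c\<in>?G. openin CT (U0 c) \<and> c \<in> U0 c) \<and> (\<forall>x\<in>?G. \<forall>y\<in>?G. x \<noteq> y \<longrightarrow> U0 x \<inter> U0 y = {})" ..
  note U0 = this[THEN conjunct1] this[THEN conjunct2]
  define U where "U c = U0 c \<inter> {p \<in> pts M. F3 M p \<in> {a<..<b}}" for c
  have U: "openin CT (U c)" "c \<in> U c" if "c \<in> ?G" for c
    unfolding U_def using bspec[OF U0(1) that] that by (auto simp: gens_def fib_def intro!: openin_Int F3_open[of "{a<..<b}", simplified])
  define Q where "Q c W e \<longleftrightarrow> (\<forall>r\<in>near01 \<tau> e. r \<noteq> \<tau> \<or> \<tau> \<in> regular_params \<longrightarrow>
     (c \<notin> crit \<longrightarrow> W \<inter> fib M r = {branch M c r}) \<and> (c \<in> crit \<longrightarrow> W \<inter> fib M r = {} \<or> pair_at ?P (W \<inter> fib M r) r))" for c W e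
  have "\<exists>W. openin CT W \<and> c \<in> W \<and> W \<subseteq> U c \<and> (\<exists>e>0. Q c W e)" if c: "c \<in> ?G" for c
  proof (cases "c \<in> crit")
    case True
    have F: "F2 M c = \<tau>" using c by (simp add: gens_def fib_def)
    have nreg: "\<tau> \<notin> regular_params" using crit_not_regular[OF True] F by simp
    obtain W e where W: "openin CT W" "c \<in> W" "W \<subseteq> U c" "e > 0" "\<forall>r. 0 < \<bar>r - \<tau>\<bar> \<longrightarrow> \<bar>r - \<tau>\<bar> < e \<longrightarrow>
       W \<inter> fib M r = {} \<or> pair_at ?P (W \<inter> fib M r) r"
    proof -
      have "\<exists>W. openin CT W \<and> c \<in> W \<and> W \<subseteq> U c \<and> (\<exists>e>0. \<forall>r. 0 < \<bar>r - \<tau>\<bar> \<longrightarrow> \<bar>r - \<tau>\<bar> < e \<longrightarrow>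
         W \<inter> fib M r = {} \<or> pair_at ?P (W \<inter> fib M r) r)"
        by (rule crit_local[OF True F U[OF c] stay_finite]) (use stayD in blast)
      then show thesis using that by blast
    qed
    have "W \<inter> fib M r = {} \<or> pair_at ?P (W \<inter> fib M r) r" if "r \<in> near01 \<tau> e" "r \<noteq> \<tau>" for r
    proof -
      have "0 < \<bar>r - \<tau>\<bar>" "\<bar>r - \<tau>\<bar> < e" using that by (auto simp: near01_def)
      then show ?thesis using W(5) by blast
    qed
    then have "Q c W e" unfolding Q_def using True nreg by blast
    then show ?thesis using W by blast
  next
    case False
    have cp: "c \<in> pts M" "F2 M c = \<tau>" using c by (auto simp: gens_def fib_def)
    obtain W e where W: "openin CT W" "c \<in> W" "W \<subseteq> U c" "e > 0" "\<forall>r\<in>near01 \<tau> e. branch M c r \<in> W \<and>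
       F2 M (branch M c r) = r \<and> (\<forall>q\<in>W. F2 M q = r \<longrightarrow> q = branch M c r)"
      using branch_unique[OF cp(1) False U[OF c]] cp(2) by metis
    have "W \<subseteq> pts M" using openin_subset[OF W(1)] by (simp add: topspace_curve_top)
    have "W \<inter> fib M r = {branch M c r}" if r: "r \<in> near01 \<tau> e" for r
    proof
      show "{branch M c r} \<subseteq> W \<inter> fib M r" using bspec[OF W(5) r] subsetD[OF \<open>W \<subseteq> pts M\<close>, of "branch M c r"] by (simp add: fib_def)
      show "W \<inter> fib M r \<subseteq> {branch M c r}"
      proof
        fix q assume "q \<in> W \<inter> fib M r"
        then have "q \<in> W" "F2 M q = r" using fib_pts(2) by auto
        then show "q \<in> {branch M c r}" using bspec[OF W(5) r] by blast
      qed
    qed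
    then have "Q c W e" unfolding Q_def using False by blast
    then show ?thesis using W by blast
  qed
  then have "\<forall>c\<in>?G. \<exists>W. openin CT W \<and> c \<in> W \<and> W \<subseteq> U c \<and> (\<exists>e>0. Q c W e)" by blast
  from bchoice[OF this] obtain W
    where W0: "\<forall>c\<in>?G. openin CT (W c) \<and> c \<in> W c \<and> W c \<subseteq> U c \<and> (\<exists>e>0. Q c (W c) e)" ..
  then have W: "openin CT (W c) \<and> c \<in> W c \<and> W c \<subseteq> U c \<and> (\<exists>e>0. Q c (W c) e)" if "c \<in> ?G" for c
    using that by (rule bspec)
  have "\<exists>e>0. \<forall>c\<in>?G. Q c (W c) e"
  proof (rule finite_common_radius[OF G(1)])
    fix c e e' assume "Q c (W c) e" "e' \<le> (e::real)"
    then show "Q c (W c) e'" unfolding Q_def using near01_mono[of e' e \<tau>] by (meson subsetD)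
  next
    fix c assume "c \<in> ?G"
    then show "\<exists>e>0. Q c (W c) e" using W[of c] by simp
  qed
  then obtain e1 where e1: "e1 > 0" "\<forall>c\<in>?G. Q c (W c) e1" by (elim exE conjE)
  have "\<exists>d>0. \<forall>q\<in>{p \<in> pts M. F3 M p \<in> {a..b}}. \<bar>F2 M q - \<tau>\<bar> < d \<longrightarrow> q \<in> (\<Union>c\<in>?G. W c)"
  proof (rule compact_fibre_neighbourhood)
    show "compactin CT {p \<in> pts M. F3 M p \<in> {a..b}}" by (rule F3_compact) simp
    show "openin CT (\<Union>c\<in>?G. W c)" using W by blast
    fix p assume p: "p \<in> {p \<in> pts M. F3 M p \<in> {a..b}}" "F2 M p = \<tau>"
    then have "(\<tau>, F3 M p) \<in> trace_set" unfolding trace_set_def by blast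
    then have "F3 M p \<noteq> a" "F3 M p \<noteq> b" using reg by auto
    then have "p \<in> ?G" using p by (auto simp: gens_def fib_def)
    then show "p \<in> (\<Union>c\<in>?G. W c)" using W by blast
  qed
  then obtain d where d: "d > 0" "\<And>q. \<lbrakk>q \<in> pts M; F3 M q \<in> {a..b}; \<bar>F2 M q - \<tau>\<bar> < d\<rbrakk> \<Longrightarrow> q \<in> (\<Union>c\<in>?G. W c)" by blast
  show ?thesis
  proof (intro exI[of _ "min e1 d"] conjI ballI impI)
    show "min e1 d > 0" using e1 d by simp
    fix r assume r: "r \<in> near01 \<tau> (min e1 d)" and reg': "r \<noteq> \<tau> \<or> \<tau> \<in> regular_params"
    have re: "r \<in> near01 \<tau> e1" "\<bar>r - \<tau>\<bar> < d" using r by (auto simp: near01_def)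
    have nc: "W c \<inter> fib M r = {branch M c r}" if "c \<in> ?P" for c
      using bspec[OF e1(2), of c] re(1) reg' that unfolding Q_def stay_def by blast
    have disj: "W c \<inter> W c' = {}" if "c \<in> ?G" "c' \<in> ?G" "c \<noteq> c'" for c c'
      using W[OF that(1)] W[OF that(2)] bspec[OF bspec[OF U0(2) that(1)] that(2)] that(3) unfolding U_def by blast
    have PG: "?P \<subseteq> ?G" by (auto simp: stay_def)
    show "inj_on (\<lambda>c. branch M c r) ?P"
    proof (rule inj_onI)
      fix c c' assume c: "c \<in> ?P" "c' \<in> ?P" "branch M c r = branch M c' r"
      then have "branch M c r \<in> W c" "branch M c r \<in> W c'" using nc[of c] nc[of c'] by auto
      then show "c = c'" using disj[of c c'] c PG by blast
    qed
    have gens: "gens M a b r = (\<Union>c\<in>?G. W c \<inter> fib M r)"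
    proof
      show "gens M a b r \<subseteq> (\<Union>c\<in>?G. W c \<inter> fib M r)"
        using d(2) re(2) by (force simp: gens_def fib_def)
      show "(\<Union>c\<in>?G. W c \<inter> fib M r) \<subseteq> gens M a b r"
      proof
        fix q assume "q \<in> (\<Union>c\<in>?G. W c \<inter> fib M r)"
        then obtain c where "c \<in> ?G" "q \<in> W c" "q \<in> fib M r" by blast
        then show "q \<in> gens M a b r" using W[of c] by (auto simp: gens_def U_def)
      qed
    qed
    have im: "(\<Union>c\<in>?P. W c \<inter> fib M r) = (\<lambda>c. branch M c r) ` ?P"
      by (rule trans[OF SUP_cong[OF refl nc]]) auto
    show "gens M a b r = (\<lambda>c. branch M c r) ` ?P \<or> cancelling_pair (\<gamma> M) (gens M a b r) ((\<lambda>c. branch M c r) ` ?P)"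
    proof (cases "\<exists>c0\<in>?G. c0 \<in> crit")
      case False
      then have "?G = ?P" by (auto simp: stay_def)
      then show ?thesis using gens im by simp
    next
      case True
      then obtain c0 where c0: "c0 \<in> ?G" "c0 \<in> crit" by blast
      have "c = c0" if "c \<in> ?G" "c \<in> crit" for c
        using crit_unique[OF that(2) c0(2)] that(1) c0(1) by (simp add: gens_def fib_def)
      note only = this
      have "?G \<subseteq> insert c0 ?P"
      proof
        fix c assume "c \<in> ?G"
        then show "c \<in> insert c0 ?P" using only[of c] by (cases "c \<in> crit") (simp_all add: stay_def)
      qed
      then have "?G = insert c0 ?P" using c0(1) PG by (intro equalityI) simp_all
      then have g: "gens M a b r = (\<lambda>c. branch M c r) ` ?P \<union> (W c0 \<inter> fib M r)" using gens im by (simp add: Un_commute)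
      have "W c0 \<inter> fib M r = {} \<or> pair_at ?P (W c0 \<inter> fib M r) r"
        using bspec[OF e1(2) c0(1)] re(1) reg' c0(2) unfolding Q_def by blast
      then show ?thesis
      proof
        assume "pair_at ?P (W c0 \<inter> fib M r) r"
        then obtain p m u where pm: "p \<noteq> m" "W c0 \<inter> fib M r = {p, m}" "\<gamma> M (p, m) * u = 1" "\<gamma> M (p, p) = 0" "\<gamma> M (m, m) = 0"
          "\<gamma> M (m, p) = 0" "\<forall>c\<in>?P. \<gamma> M (branch M c r, p) = 0 \<and> \<gamma> M (m, branch M c r) = 0 \<and> \<gamma> M (p, branch M c r) = 0"
          unfolding pair_at_def by (elim exE conjE)
        have out: "x \<notin> (\<lambda>c. branch M c r) ` ?P" if "x \<in> W c0" for x
        proof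
          assume "x \<in> (\<lambda>c. branch M c r) ` ?P"
          then obtain c where c: "c \<in> ?P" "x = branch M c r" by blast
          then have "x \<in> W c" "c \<in> ?G" "c \<noteq> c0" using nc[OF c(1)] c0(2) by (auto simp: stay_def)
          then show False using disj[of c c0] c0(1) that by blast
        qed
        have "cancelling_pair (\<gamma> M) (gens M a b r) ((\<lambda>c. branch M c r) ` ?P)"
          unfolding cancelling_pair_def g pm(2)
        proof (intro exI conjI ballI)
          show "p \<notin> (\<lambda>c. branch M c r) ` ?P" "m \<notin> (\<lambda>c. branch M c r) ` ?P" using out[of p] out[of m] pm(2) by auto
          fix x assume "x \<in> (\<lambda>c. branch M c r) ` ?P \<union> {p, m}"
          then show "\<gamma> M (x, p) = 0" "\<gamma> M (m, x) = 0" using pm by auto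
        next
          fix x assume "x \<in> (\<lambda>c. branch M c r) ` ?P \<union> {p, m} - {m}"
          then show "\<gamma> M (p, x) = 0" using pm by auto
        qed (use pm in auto)
        then show ?thesis ..
      qed (use g in simp)
    qed
  qed
qed

lemma relation_near:
  assumes \<tau>: "\<tau> \<in> {0..1}"
  shows "\<exists>e>0. \<forall>r\<in>near01 \<tau> e. r \<noteq> \<tau> \<or> \<tau> \<in> regular_params \<longrightarrow> (\<forall>c1\<in>stay \<tau> a b. \<forall>c3\<in>stay \<tau> a b.
     \<gamma> M (branch M c1 r, branch M c3 r) + (\<Sum>c2\<in>stay \<tau> a b. \<gamma> M (branch M c1 r, branch M c2 r) * jump_at \<tau> r (c2, c3)) =
        base \<tau> (c1, c3) + (\<Sum>c2\<in>stay \<tau> a b. jump_at \<tau> r (c1, c2) * base \<tau> (c2, c3)))"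
proof -
  let ?P = "stay \<tau> a b"
  have "\<exists>e>0. \<forall>(c1, c2)\<in>?P \<times> ?P. \<forall>r\<in>near01 \<tau> e. side_values \<tau> r c1 c2"
  proof (rule finite_common_radius)
    fix x assume "x \<in> ?P \<times> ?P"
    then obtain c1 c2 where x: "x = (c1, c2)" "c1 \<in> ?P" "c2 \<in> ?P" by (rule SigmaE)
    show "\<exists>e>0. case x of (c1, c2) \<Rightarrow> \<forall>r\<in>near01 \<tau> e. side_values \<tau> r c1 c2"
      unfolding x(1) prod.case using gamma_sides[of c1 \<tau> c2] stayD[OF x(2)] stayD[OF x(3)] by blast
  next
    fix x e e' assume a: "case x of (c1, c2) \<Rightarrow> \<forall>r\<in>near01 \<tau> e. side_values \<tau> r c1 c2" and "e' \<le> (e::real)"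
    have "near01 \<tau> e' \<subseteq> near01 \<tau> e" by (rule near01_mono) fact
    then show "case x of (c1, c2) \<Rightarrow> \<forall>r\<in>near01 \<tau> e'. side_values \<tau> r c1 c2"
      using a by (auto split: prod.splits)
  qed (simp add: stay_finite)
  then obtain e where e: "e > 0" "\<And>c1 c2 r. \<lbrakk>c1 \<in> ?P; c2 \<in> ?P; r \<in> near01 \<tau> e\<rbrakk> \<Longrightarrow>
    side_values \<tau> r c1 c2" by blast
  show ?thesis
  proof (intro exI[of _ e] conjI ballI impI)
    fix r c1 c3 assume r: "r \<in> near01 \<tau> e" "r \<noteq> \<tau> \<or> \<tau> \<in> regular_params" and c: "c1 \<in> ?P" "c3 \<in> ?P"
    have r01: "0 \<le> r" "r \<le> 1" using r(1) by (auto simp: near01_def)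
    consider "\<tau> < r" | "r < \<tau>" | "r = \<tau>" by linarith
    then show "\<gamma> M (branch M c1 r, branch M c3 r) + (\<Sum>c2\<in>?P. \<gamma> M (branch M c1 r, branch M c2 r) * jump_at \<tau> r (c2, c3)) =
        base \<tau> (c1, c3) + (\<Sum>c2\<in>?P. jump_at \<tau> r (c1, c2) * base \<tau> (c2, c3))"
    proof cases
      case 1
      have "\<gamma> M (branch M c1 r, branch M c2 r) = \<gamma>plus M \<tau> (branch M c1) (branch M c2)" if "c2 \<in> ?P" for c2
        using e(2)[OF c(1) that r(1)] 1 by blast
      then show ?thesis using jump_relation[OF _ _ c] \<tau> 1 r01 c by (simp add: jump_at_def cong: sum.cong)
    next
      case 2
      then show ?thesis using e(2)[OF c r(1)] r01 by (simp add: jump_at_def base_def)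
    next
      case 3
      then have reg: "\<tau> \<in> regular_params" using r by simp
      note s1 = stayD[OF c(1)] and s3 = stayD[OF c(2)]
      have nV: "(c1, c3) \<notin> V" using V_not_regular[of "(c1, c3)"] reg s1 by auto
      have "base \<tau> (c1, c3) = \<gamma> M (c1, c3)"
        using sides_agree[OF _ _ _ _ nV, of \<tau>] s1 s3 \<tau> by (cases "\<tau> = 0") (auto simp: base_def)
      then show ?thesis using branch_at[of c1] branch_at[of c3] s1 s3 3 by (simp add: jump_at_def)
    qed
  qed (rule e(1))
qed

text \<open>
  The map sends a generator that continues some \<open>c\<close> over \<open>\<tau>\<close> to \<open>c\<close>, corrected by the
  handle-slides at \<open>\<tau>\<close> if \<open>r > \<tau>\<close>, and kills the pair that comes from a birth or death at \<open>\<tau>\<close>.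
\<close>

lemma local_fibration:
  assumes \<tau>: "\<tau> \<in> {0..1}" and reg: "(\<tau>, a) \<notin> trace_set" "(\<tau>, b) \<notin> trace_set"
  shows "\<exists>e>0. \<forall>r\<in>regular_params. \<bar>r - \<tau>\<bar> < e \<longrightarrow>
     acyclic_fibration (gens M a b r) (\<gamma> M) (stay \<tau> a b) (base \<tau>) (rho \<tau> a b r)"
proof -
  obtain e1 where e1: "e1 > 0" "\<forall>r\<in>near01 \<tau> e1. r \<noteq> \<tau> \<or> \<tau> \<in> regular_params \<longrightarrow>
     inj_on (\<lambda>c. branch M c r) (stay \<tau> a b) \<and>
     (gens M a b r = (\<lambda>c. branch M c r) ` stay \<tau> a b \<or> cancelling_pair (\<gamma> M) (gens M a b r) ((\<lambda>c. branch M c r) ` stay \<tau> a b))"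
    using gens_near[OF assms] by blast
  obtain e2 where e2: "e2 > 0" "\<forall>r\<in>near01 \<tau> e2. r \<noteq> \<tau> \<or> \<tau> \<in> regular_params \<longrightarrow> (\<forall>c1\<in>stay \<tau> a b. \<forall>c3\<in>stay \<tau> a b.
     \<gamma> M (branch M c1 r, branch M c3 r) + (\<Sum>c2\<in>stay \<tau> a b. \<gamma> M (branch M c1 r, branch M c2 r) * jump_at \<tau> r (c2, c3)) =
        base \<tau> (c1, c3) + (\<Sum>c2\<in>stay \<tau> a b. jump_at \<tau> r (c1, c2) * base \<tau> (c2, c3)))"
    using relation_near[OF \<tau>] by blast
  show ?thesis
  proof (intro exI[of _ "min e1 e2"] conjI ballI impI)
    fix r assume r: "r \<in> regular_params" "\<bar>r - \<tau>\<bar> < min e1 e2"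
    have rn: "r \<in> near01 \<tau> e1" "r \<in> near01 \<tau> e2" "r \<noteq> \<tau> \<or> \<tau> \<in> regular_params"
      using r by (auto simp: near01_def regular_params_def)
    show "acyclic_fibration (gens M a b r) (\<gamma> M) (stay \<tau> a b) (base \<tau>) (rho \<tau> a b r)"
    proof (rule restrict_along_fibration[where h = "F3 M", OF window_complex[OF r(1)] stay_finite])
      show "inj_on (\<lambda>c. branch M c r) (stay \<tau> a b)" using e1(2) rn by blast
      show "F3 M c2 < F3 M c1" if "jump_at \<tau> r (c1, c2) \<noteq> 0" for c1 c2 by (rule jump_decreasing[OF that])
      show "gens M a b r = (\<lambda>c. branch M c r) ` stay \<tau> a b \<or> cancelling_pair (\<gamma> M) (gens M a b r) ((\<lambda>c. branch M c r) ` stay \<tau> a b)"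
        using e1(2) rn by blast
      show "\<gamma> M (branch M c1 r, branch M c3 r) + (\<Sum>c2\<in>stay \<tau> a b. \<gamma> M (branch M c1 r, branch M c2 r) * jump_at \<tau> r (c2, c3)) =
        base \<tau> (c1, c3) + (\<Sum>c2\<in>stay \<tau> a b. jump_at \<tau> r (c1, c2) * base \<tau> (c2, c3))"
        if "c1 \<in> stay \<tau> a b" "c3 \<in> stay \<tau> a b" for c1 c3 using e2(2) rn that by blast
    qed
  qed (use e1 e2 in auto)
qed

end

section \<open>Maps in homology\<close>

text \<open>
  The value on a class is written as a union over its representatives, as in the definition of
  \<^const>\<open>homology_map\<close>.
\<close>

definition induced_map :: "'p set \<Rightarrow> ('p \<times> 'p \<Rightarrow> 'k) \<Rightarrow> (('q \<Rightarrow>\<^sub>0 'k) \<Rightarrow> ('p \<Rightarrow>\<^sub>0 'k::comm_ring_1)) \<Rightarrow>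
    ('q \<Rightarrow>\<^sub>0 'k) set \<Rightarrow> ('p \<Rightarrow>\<^sub>0 'k) set" where
  "induced_map Q q \<phi> X = (\<Union>x\<in>X. coset (boundaries Q q) (\<phi> x))"

lemma induced_map_in:
  assumes "chain_map P g Q q \<phi>" "X \<in> carrier (matrix_homology P g)"
  shows "induced_map Q q \<phi> X \<in> carrier (matrix_homology Q q)"
proof -
  obtain x where x: "x \<in> cycles P g" "X = coset (boundaries P g) x" using assms(2) by (rule homology_carrierE)
  then show ?thesis
    unfolding induced_map_def using class_map_coset[OF assms(1) x(1)] cm_cycles[OF assms(1) x(1)] by (simp add: homology_carrier)
qed

lemma induced_map_add:
  assumes cm: "chain_map P g Q q \<phi>" and X: "X \<in> carrier (matrix_homology P g)" "Y \<in> carrier (matrix_homology P g)"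
  shows "induced_map Q q \<phi> (X \<oplus>\<^bsub>matrix_homology P g\<^esub> Y) = induced_map Q q \<phi> X \<oplus>\<^bsub>matrix_homology Q q\<^esub> induced_map Q q \<phi> Y"
proof -
  note fin = cm_finite[OF cm]
  obtain x where x: "x \<in> cycles P g" "X = coset (boundaries P g) x" using X(1) by (rule homology_carrierE)
  obtain y where y: "y \<in> cycles P g" "Y = coset (boundaries P g) y" using X(2) by (rule homology_carrierE)
  have "x \<in> chains P" "y \<in> chains P" using x y by (auto simp: cycles_def)
  then show ?thesis
    by (simp add: induced_map_def x(2) y(2) homology_add[OF fin(1)] homology_add[OF fin(2)]
        class_map_coset[OF cm] x(1) y(1) cycles_add[OF fin(1)] cm_add[OF cm])
qed

lemma induced_map_smult:
  assumes cm: "chain_map P g Q q \<phi>" and X: "X \<in> carrier (matrix_homology P g)"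
  shows "induced_map Q q \<phi> (k \<odot>\<^bsub>matrix_homology P g\<^esub> X) = k \<odot>\<^bsub>matrix_homology Q q\<^esub> induced_map Q q \<phi> X"
proof -
  note fin = cm_finite[OF cm]
  obtain x where x: "x \<in> cycles P g" "X = coset (boundaries P g) x" using X by (rule homology_carrierE)
  have "x \<in> chains P" using x by (auto simp: cycles_def)
  then show ?thesis
    by (simp add: induced_map_def x(2) homology_smult[OF fin(1)] homology_smult[OF fin(2)]
        class_map_coset[OF cm] x(1) cycles_scale[OF fin(1)] cm_scale[OF cm])
qed

lemma induced_map_comp:
  assumes cm: "chain_map P g Q q \<phi>" and cm': "chain_map Q q R r \<psi>" and cm'': "chain_map P g R r \<omega>"
    and comp: "\<And>x. x \<in> chains P \<Longrightarrow> \<psi> (\<phi> x) = \<omega> x" and X: "X \<in> carrier (matrix_homology P g)"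
  shows "induced_map R r \<psi> (induced_map Q q \<phi> X) = induced_map R r \<omega> X"
proof -
  obtain x where x: "x \<in> cycles P g" "X = coset (boundaries P g) x" using X by (rule homology_carrierE)
  have "x \<in> chains P" using x by (auto simp: cycles_def)
  then show ?thesis
    by (simp add: induced_map_def x(2) class_map_coset[OF cm x(1)] class_map_coset[OF cm' cm_cycles[OF cm x(1)]]
        class_map_coset[OF cm'' x(1)] comp)
qed

lemma chain_map_comp:
  assumes "chain_map P g Q q \<phi>" "chain_map Q q R r \<psi>"
  shows "chain_map P g R r (\<lambda>x. \<psi> (\<phi> x))"
  using assms unfolding chain_map_def linear_chains_def by simp

lemma acyclic_induced_map_inj:
  assumes af: "acyclic_fibration P g Q q \<phi>"
    and X: "X \<in> carrier (matrix_homology P g)" "Y \<in> carrier (matrix_homology P g)"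
    and eq: "induced_map Q q \<phi> X = induced_map Q q \<phi> Y"
  shows "X = Y"
proof -
  note cm = af_cm[OF af] and fin = af_finite[OF af]
  obtain x where x: "x \<in> cycles P g" "X = coset (boundaries P g) x" using X(1) by (rule homology_carrierE)
  obtain y where y: "y \<in> cycles P g" "Y = coset (boundaries P g) y" using X(2) by (rule homology_carrierE)
  have c: "x \<in> chains P" "y \<in> chains P" using x y by (auto simp: cycles_def)
  have "\<phi> x - \<phi> y \<in> boundaries Q q"
    using eq by (simp add: induced_map_def x(2) y(2) class_map_coset[OF cm] x(1) y(1) coset_eq_iff boundaries_subgroup fin)
  then have "\<phi> (x - y) \<in> boundaries Q q" using cm_diff[OF cm] c by simp
  then have "x - y \<in> boundaries P g" by (rule af_inj[OF af cycles_diff[OF fin(1) x(1) y(1)]])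
  then show ?thesis by (simp add: x y coset_eq_iff boundaries_subgroup fin)
qed

lemma acyclic_induced_map_surj:
  assumes af: "acyclic_fibration P g Q q \<phi>" and Y: "Y \<in> carrier (matrix_homology Q q)"
  shows "\<exists>X\<in>carrier (matrix_homology P g). induced_map Q q \<phi> X = Y"
proof -
  obtain y where y: "y \<in> cycles Q q" "Y = coset (boundaries Q q) y" using Y by (rule homology_carrierE)
  obtain x where x: "x \<in> cycles P g" "\<phi> x = y" using af_lift[OF af y(1)] by blast
  have "induced_map Q q \<phi> (coset (boundaries P g) x) = Y"
    using class_map_coset[OF af_cm[OF af] x(1)] x y by (simp add: induced_map_def)
  then show ?thesis using x(1) by (intro bexI[of _ "coset (boundaries P g) x"]) (auto simp: homology_carrier)
qed

text \<open>
  For maps from one complex to two models which factor over a linear map between the models. The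
  linear map is a chain map because \<open>\<phi>'\<close> is onto, and it is injective in homology because \<open>\<phi>\<close> is.
\<close>

lemma acyclic_fibration_factor:
  fixes g q q' :: "'p \<times> 'p \<Rightarrow> 'k::comm_ring_1"
  assumes af: "acyclic_fibration P g Q q \<phi>" and af': "acyclic_fibration P g Q' q' \<phi>'"
    and lin: "linear_chains Q' Q \<theta>" and comp: "\<And>x. x \<in> chains P \<Longrightarrow> \<theta> (\<phi>' x) = \<phi> x"
  shows "chain_map Q' q' Q q \<theta>"
    and "X \<in> carrier (matrix_homology Q' q') \<Longrightarrow> Y \<in> carrier (matrix_homology Q' q') \<Longrightarrow>
      induced_map Q q \<theta> X = induced_map Q q \<theta> Y \<Longrightarrow> X = Y"
proof -
  note cm = af_cm[OF af] and cm' = af_cm[OF af'] and fin = af_finite[OF af] and fin' = af_finite[OF af']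
  show t: "chain_map Q' q' Q q \<theta>"
    unfolding chain_map_def
  proof (intro conjI ballI lin fin(2) fin'(2))
    fix y :: "'p \<Rightarrow>\<^sub>0 'k" assume "y \<in> chains Q'"
    then obtain x where x: "x \<in> chains P" "\<phi>' x = y" using af_surj[OF af'] by blast
    have "\<theta> (matrix_bdry Q' q' y) = \<theta> (\<phi>' (matrix_bdry P g x))" using cm_bdry[OF cm'] x by simp
    also have "\<dots> = matrix_bdry Q q (\<phi> x)"
      using comp[OF matrix_bdry_chains[OF fin(1) x(1), of g]] cm_bdry[OF cm x(1)] by simp
    finally show "\<theta> (matrix_bdry Q' q' y) = matrix_bdry Q q (\<theta> y)" using comp x by auto
  qed
  assume X: "X \<in> carrier (matrix_homology Q' q')" "Y \<in> carrier (matrix_homology Q' q')"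
    and eq: "induced_map Q q \<theta> X = induced_map Q q \<theta> Y"
  obtain X' where X': "X' \<in> carrier (matrix_homology P g)" "induced_map Q' q' \<phi>' X' = X"
    using acyclic_induced_map_surj[OF af' X(1)] by blast
  obtain Y' where Y': "Y' \<in> carrier (matrix_homology P g)" "induced_map Q' q' \<phi>' Y' = Y"
    using acyclic_induced_map_surj[OF af' X(2)] by blast
  have "induced_map Q q \<phi> X' = induced_map Q q \<phi> Y'"
    using induced_map_comp[OF cm' t cm comp X'(1)] induced_map_comp[OF cm' t cm comp Y'(1)] eq X'(2) Y'(2) by simp
  then have "X' = Y'" using acyclic_induced_map_inj[OF af X'(1) Y'(1)] by blast
  then show "X = Y" using X'(2) Y'(2) by simp
qed

text \<open>
  The formula of \<^const>\<open>window_map\<close>, for an arbitrary set of generators.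
\<close>

definition truncate :: "'p set \<Rightarrow> ('p \<Rightarrow>\<^sub>0 'k) \<Rightarrow> ('p \<Rightarrow>\<^sub>0 'k::comm_ring_1)" where
  "truncate P x = (\<Sum>c\<in>Poly_Mapping.keys x \<inter> P. Poly_Mapping.single c (Poly_Mapping.lookup x c))"

lemma lookup_truncate: "Poly_Mapping.lookup (truncate P x) c = (if c \<in> P then Poly_Mapping.lookup x c else 0)"
  by (simp add: truncate_def lookup_sum lookup_single when_def in_keys_iff)

text \<open>
  The hypothesis holds for windows: the boundary operator decreases heights, and the ends of the
  new window are at least as high.
\<close>

lemma truncate_chain_map:
  fixes g :: "'p \<times> 'p \<Rightarrow> 'k::comm_ring_1"
  assumes fin: "finite P" "finite P'"
    and g: "\<And>c1 c2. \<lbrakk>c1 \<in> P; c2 \<in> P'; c1 \<notin> P' \<or> c2 \<notin> P\<rbrakk> \<Longrightarrow> g (c1, c2) = 0"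
  shows "chain_map P g P' g (truncate P')"
  unfolding chain_map_def linear_chains_def
proof (intro conjI ballI allI fin)
  fix x y :: "'p \<Rightarrow>\<^sub>0 'k" and k assume x: "x \<in> chains P"
  show t: "truncate P' x \<in> chains P'" by (rule chainsI) (simp add: lookup_truncate)
  show "truncate P' (x - y) = truncate P' x - truncate P' y"
    by (rule poly_mapping_eqI) (simp add: lookup_truncate lookup_minus)
  show "truncate P' (scale k x) = scale k (truncate P' x)"
    by (rule poly_mapping_eqI) (simp add: lookup_truncate)
  show "truncate P' (matrix_bdry P g x) = matrix_bdry P' g (truncate P' x)"
  proof (rule poly_mapping_eqI)
    fix c
    have "(if c \<in> P then \<Sum>c1\<in>P. Poly_Mapping.lookup x c1 * g (c1, c) else 0) =
      (\<Sum>c1\<in>P'. Poly_Mapping.lookup (truncate P' x) c1 * g (c1, c))" if c: "c \<in> P'"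
    proof -
      have "(\<Sum>c1\<in>P'. Poly_Mapping.lookup (truncate P' x) c1 * g (c1, c)) =
        (\<Sum>c1\<in>P \<inter> P'. Poly_Mapping.lookup x c1 * g (c1, c))"
        by (intro sum.mono_neutral_cong_right fin) (use lookup_zero_outside[OF x] in \<open>fastforce simp: lookup_truncate\<close>)+
      also have "\<dots> = (if c \<in> P then \<Sum>c1\<in>P. Poly_Mapping.lookup x c1 * g (c1, c) else 0)"
      proof (cases "c \<in> P")
        case True
        have "(\<Sum>c1\<in>P. Poly_Mapping.lookup x c1 * g (c1, c)) = (\<Sum>c1\<in>P \<inter> P'. Poly_Mapping.lookup x c1 * g (c1, c))"
          by (intro sum.mono_neutral_right fin) (use g[OF _ c] in auto)
        then show ?thesis using True by simp
      next
        case False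
        then show ?thesis using g[OF _ c] by (auto intro!: sum.neutral)
      qed
      finally show ?thesis by simp
    qed
    then show "Poly_Mapping.lookup (truncate P' (matrix_bdry P g x)) c = Poly_Mapping.lookup (matrix_bdry P' g (truncate P' x)) c"
      by (simp add: lookup_truncate lookup_matrix_bdry[OF fin(1) x] lookup_matrix_bdry[OF fin(2) t])
  qed
qed

lemma HMw_homology: "HMw M a b r = matrix_homology (gens M a b r) (\<gamma> M)"
proof -
  have "bdry M a b r = matrix_bdry (gens M a b r) (\<gamma> M)" by (simp add: fun_eq_iff bdry_def matrix_bdry_def)
  then show ?thesis by (simp add: HMw_def CM_def matrix_homology_def)
qed

lemma HMw_map_class: "HMw_map M a' b' r = induced_map (gens M a' b' r) (\<gamma> M) (truncate (gens M a' b' r))"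
proof -
  have "bdry M a' b' r = matrix_bdry (gens M a' b' r) (\<gamma> M)" "window_map M a' b' r = truncate (gens M a' b' r)"
    by (simp_all add: fun_eq_iff bdry_def matrix_bdry_def window_map_def truncate_def)
  then show ?thesis
    by (simp add: fun_eq_iff HMw_map_def homology_map_def CM_def induced_map_def boundaries_def)
qed

section \<open>Links between nearby parameters\<close>

context morse
begin

abbreviation "HH r a b \<equiv> matrix_homology (gens M a b r) (\<gamma> M)"
abbreviation "push r a' b' \<equiv> induced_map (gens M a' b' r) (\<gamma> M) (truncate (gens M a' b' r))"

definition link :: "real \<Rightarrow> real \<Rightarrow> real \<Rightarrow> real \<Rightarrow> real \<Rightarrow> (('i \<times> complex) \<Rightarrow>\<^sub>0 'k) set \<Rightarrow> (('i \<times> complex) \<Rightarrow>\<^sub>0 'k) set \<Rightarrow> bool" where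
  "link \<tau> a b s t X Y \<longleftrightarrow> induced_map (stay \<tau> a b) (base \<tau>) (rho \<tau> a b s) X = induced_map (stay \<tau> a b) (base \<tau>) (rho \<tau> a b t) Y"

lemma truncate_window:
  assumes "r \<in> regular_params" "a \<le> a'" "b \<le> b'"
  shows "chain_map (gens M a b r) (\<gamma> M) (gens M a' b' r) (\<gamma> M) (truncate (gens M a' b' r))"
proof (rule truncate_chain_map[OF gens_finite gens_finite], rule ccontr)
  fix c1 c2 assume c: "c1 \<in> gens M a b r" "c2 \<in> gens M a' b' r" "c1 \<notin> gens M a' b' r \<or> c2 \<notin> gens M a b r"
    and "\<gamma> M (c1, c2) \<noteq> 0"
  then have "F3 M c2 < F3 M c1" using gamma_decreasing[OF assms(1), of c1 c2] by (auto simp: gens_def)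
  then show False using c assms by (auto simp: gens_def)
qed

lemma truncate_stay:
  assumes "a \<le> a'" "b \<le> b'"
  shows "chain_map (stay \<tau> a b) (base \<tau>) (stay \<tau> a' b') (base \<tau>) (truncate (stay \<tau> a' b'))"
proof (rule truncate_chain_map[OF stay_finite stay_finite], rule ccontr)
  fix c1 c2 assume c: "c1 \<in> stay \<tau> a b" "c2 \<in> stay \<tau> a' b'" "c1 \<notin> stay \<tau> a' b' \<or> c2 \<notin> stay \<tau> a b"
    and nz: "base \<tau> (c1, c2) \<noteq> 0"
  have "F3 M c2 \<le> F3 M c1" using stayD[OF c(1)] stayD[OF c(2)] by (intro base_decreasing[OF _ _ _ _ nz]) auto
  then show False using c assms by (auto simp: gens_def stay_def)
qed

lemma truncate_id: "x \<in> chains P \<Longrightarrow> truncate P x = x"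
  by (rule poly_mapping_eqI) (simp add: lookup_truncate lookup_zero_outside)

lemma push_id:
  assumes "r \<in> regular_params" "X \<in> carrier (HH r a b)"
  shows "push r a b X = X"
proof -
  obtain x where x: "x \<in> cycles (gens M a b r) (\<gamma> M)" "X = coset (boundaries (gens M a b r) (\<gamma> M)) x"
    using assms(2) by (rule homology_carrierE)
  then show ?thesis unfolding induced_map_def
    using class_map_coset[OF truncate_window[OF assms(1) order.refl order.refl] x(1)] by (simp add: cycles_def truncate_id)
qed

lemma push_comp:
  assumes "r \<in> regular_params" "a \<le> a'" "b \<le> b'" "a' \<le> a''" "b' \<le> b''" "X \<in> carrier (HH r a b)"
  shows "push r a'' b'' (push r a' b' X) = push r a'' b'' X"
proof (rule induced_map_comp[OF truncate_window truncate_window truncate_window _ assms(6)])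
  fix x assume x: "x \<in> chains (gens M a b r)"
  show "truncate (gens M a'' b'' r) (truncate (gens M a' b' r) x) = truncate (gens M a'' b'' r) x"
  proof (rule poly_mapping_eqI)
    fix c
    show "Poly_Mapping.lookup (truncate (gens M a'' b'' r) (truncate (gens M a' b' r) x)) c = Poly_Mapping.lookup (truncate (gens M a'' b'' r) x) c"
    proof (cases "c \<in> gens M a b r")
      case True
      then show ?thesis using assms by (auto simp: lookup_truncate gens_def)
    qed (simp add: lookup_truncate lookup_zero_outside[OF x])
  qed
qed (use assms in auto)

text \<open>
  The maps to the model induce isomorphisms in homology.
\<close>

lemma link_near:
  assumes "\<tau> \<in> {0..1}" "(\<tau>, a) \<notin> trace_set" "(\<tau>, b) \<notin> trace_set"
  shows "\<exists>e>0. \<forall>s\<in>regular_params. \<forall>t\<in>regular_params. \<bar>s - \<tau>\<bar> < e \<longrightarrow> \<bar>t - \<tau>\<bar> < e \<longrightarrow> (\<forall>X\<in>carrier (HH s a b).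
          (\<exists>Y\<in>carrier (HH t a b). link \<tau> a b s t X Y) \<and>
          (\<forall>Y\<in>carrier (HH t a b). \<forall>Y'\<in>carrier (HH t a b). link \<tau> a b s t X Y \<longrightarrow> link \<tau> a b s t X Y' \<longrightarrow> Y = Y') \<and>
          (\<forall>X'\<in>carrier (HH s a b). \<forall>Y\<in>carrier (HH t a b). \<forall>Y'\<in>carrier (HH t a b).
             link \<tau> a b s t X Y \<longrightarrow> link \<tau> a b s t X' Y' \<longrightarrow>
             link \<tau> a b s t (X \<oplus>\<^bsub>HH s a b\<^esub> X') (Y \<oplus>\<^bsub>HH t a b\<^esub> Y')) \<and>
          (\<forall>k. \<forall>Y\<in>carrier (HH t a b). link \<tau> a b s t X Y \<longrightarrow> link \<tau> a b s t (k \<odot>\<^bsub>HH s a b\<^esub> X) (k \<odot>\<^bsub>HH t a b\<^esub> Y)))"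
proof -
  obtain e where e: "e > 0" "\<forall>r\<in>regular_params. \<bar>r - \<tau>\<bar> < e \<longrightarrow>
     acyclic_fibration (gens M a b r) (\<gamma> M) (stay \<tau> a b) (base \<tau>) (rho \<tau> a b r)" using local_fibration[OF assms] by blast
  show ?thesis
  proof (intro exI[of _ e] conjI ballI impI allI e(1))
    fix s t X assume st: "s \<in> regular_params" "t \<in> regular_params" "\<bar>s - \<tau>\<bar> < e" "\<bar>t - \<tau>\<bar> < e" and X: "X \<in> carrier (HH s a b)"
    note afs = e(2)[rule_format, OF st(1,3)] and aft = e(2)[rule_format, OF st(2,4)]
    note cms = af_cm[OF afs] and cmt = af_cm[OF aft]
    show "\<exists>Y\<in>carrier (HH t a b). link \<tau> a b s t X Y"
      using acyclic_induced_map_surj[OF aft induced_map_in[OF cms X]] unfolding link_def by metis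
    show "Y = Y'" if "Y \<in> carrier (HH t a b)" "Y' \<in> carrier (HH t a b)" "link \<tau> a b s t X Y" "link \<tau> a b s t X Y'" for Y Y'
      by (rule acyclic_induced_map_inj[OF aft that(1,2)]) (use that(3,4) in \<open>simp add: link_def\<close>)
    show "link \<tau> a b s t (X \<oplus>\<^bsub>HH s a b\<^esub> X') (Y \<oplus>\<^bsub>HH t a b\<^esub> Y')"
      if "X' \<in> carrier (HH s a b)" "Y \<in> carrier (HH t a b)" "Y' \<in> carrier (HH t a b)" "link \<tau> a b s t X Y" "link \<tau> a b s t X' Y'" for X' Y Y'
      using that(4,5) unfolding link_def induced_map_add[OF cms X that(1)] induced_map_add[OF cmt that(2,3)] by simp
    show "link \<tau> a b s t (k \<odot>\<^bsub>HH s a b\<^esub> X) (k \<odot>\<^bsub>HH t a b\<^esub> Y)" if "Y \<in> carrier (HH t a b)" "link \<tau> a b s t X Y" for k Y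
      using that(2) unfolding link_def induced_map_smult[OF cms X] induced_map_smult[OF cmt that(1)] by simp
  qed
qed

lemma stay_window_near:
  assumes reg: "(\<tau>, a) \<notin> trace_set" "(\<tau>, b) \<notin> trace_set" and N: "finite N" "\<And>c. c \<in> N \<Longrightarrow> c \<in> fib M \<tau> \<and> c \<notin> crit"
  shows "\<exists>e>0. \<forall>r\<in>near01 \<tau> e. \<forall>c\<in>N. branch M c r \<in> gens M a b r \<longleftrightarrow> c \<in> stay \<tau> a b"
proof -
  have "\<exists>e>0. \<forall>c\<in>N. \<forall>r\<in>near01 \<tau> e. branch M c r \<in> gens M a b r \<longleftrightarrow> c \<in> stay \<tau> a b"
  proof (rule finite_common_radius[OF N(1)])
    fix c assume "c \<in> N"
    then show "\<exists>e>0. \<forall>r\<in>near01 \<tau> e. branch M c r \<in> gens M a b r \<longleftrightarrow> c \<in> stay \<tau> a b"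
      using branch_window[OF _ _ reg, of c] N(2) by (simp add: stay_def)
  next
    fix c e e' assume "\<forall>r\<in>near01 \<tau> e. branch M c r \<in> gens M a b r \<longleftrightarrow> c \<in> stay \<tau> a b" "e' \<le> (e::real)"
    then show "\<forall>r\<in>near01 \<tau> e'. branch M c r \<in> gens M a b r \<longleftrightarrow> c \<in> stay \<tau> a b" using near01_mono[of e' e \<tau>] by blast
  qed
  then show ?thesis by blast
qed

lemma regular_near01: "r \<in> regular_params \<Longrightarrow> \<bar>r - \<tau>\<bar> < e \<Longrightarrow> r \<in> near01 \<tau> e"
  by (auto simp: regular_params_def near01_def)

text \<open>
  Which window a branch belongs to does not change near \<open>\<tau>\<close>, for any of the two windows. The
  correction by handle-slides respects truncation, because it decreases heights.
\<close>

lemma rho_truncate_near: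
  assumes reg: "(\<tau>, a) \<notin> trace_set" "(\<tau>, b) \<notin> trace_set" "(\<tau>, a') \<notin> trace_set" "(\<tau>, b') \<notin> trace_set" and ab: "a \<le> a'" "b \<le> b'"
  shows "\<exists>e>0. \<forall>s\<in>regular_params. \<bar>s - \<tau>\<bar> < e \<longrightarrow> (\<forall>x\<in>chains (gens M a b s).
    rho \<tau> a' b' s (truncate (gens M a' b' s) x) = truncate (stay \<tau> a' b') (rho \<tau> a b s x))"
proof -
  let ?N = "stay \<tau> a b \<union> stay \<tau> a' b'"
  have N: "finite ?N" "\<And>c. c \<in> ?N \<Longrightarrow> c \<in> fib M \<tau> \<and> c \<notin> crit" using stay_finite stayD by blast+
  obtain e1 where e1: "e1 > 0" "\<forall>r\<in>near01 \<tau> e1. \<forall>c\<in>?N. branch M c r \<in> gens M a b r \<longleftrightarrow> c \<in> stay \<tau> a b"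
    using stay_window_near[OF reg(1,2) N] by blast
  obtain e2 where e2: "e2 > 0" "\<forall>r\<in>near01 \<tau> e2. \<forall>c\<in>?N. branch M c r \<in> gens M a' b' r \<longleftrightarrow> c \<in> stay \<tau> a' b'"
    using stay_window_near[OF reg(3,4) N] by blast
  show ?thesis
  proof (intro exI[of _ "min e1 e2"] conjI ballI impI)
    fix s and x :: "('i \<times> complex) \<Rightarrow>\<^sub>0 'k" assume s: "s \<in> regular_params" "\<bar>s - \<tau>\<bar> < min e1 e2" and x: "x \<in> chains (gens M a b s)"
    have w1: "branch M c s \<in> gens M a b s \<longleftrightarrow> c \<in> stay \<tau> a b" if "c \<in> ?N" for c
      using e1(2) regular_near01[of s \<tau> e1] s that by auto
    have w2: "branch M c s \<in> gens M a' b' s \<longleftrightarrow> c \<in> stay \<tau> a' b'" if "c \<in> ?N" for c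
      using e2(2) regular_near01[of s \<tau> e2] s that by auto
    have v: "Poly_Mapping.lookup (truncate (gens M a' b' s) x) (branch M c s) = Poly_Mapping.lookup x (branch M c s)" if "c \<in> stay \<tau> a' b'" for c
      using w2[of c] that by (simp add: lookup_truncate)
    have z: "Poly_Mapping.lookup x (branch M c s) = 0" if "c \<in> stay \<tau> a' b'" "c \<notin> stay \<tau> a b" for c
      using w1[of c] that by (intro lookup_zero_outside[OF x]) simp
    show "rho \<tau> a' b' s (truncate (gens M a' b' s) x) = truncate (stay \<tau> a' b') (rho \<tau> a b s x)"
    proof (rule poly_mapping_eqI)
      fix c
      have "Poly_Mapping.lookup x (branch M c s) + (\<Sum>c1\<in>stay \<tau> a' b'. Poly_Mapping.lookup x (branch M c1 s) * jump_at \<tau> s (c1, c)) =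
        (if c \<in> stay \<tau> a b then Poly_Mapping.lookup x (branch M c s) + (\<Sum>c1\<in>stay \<tau> a b. Poly_Mapping.lookup x (branch M c1 s) * jump_at \<tau> s (c1, c)) else 0)"
        if c: "c \<in> stay \<tau> a' b'"
      proof -
        have "(\<Sum>c1\<in>stay \<tau> a' b'. Poly_Mapping.lookup x (branch M c1 s) * jump_at \<tau> s (c1, c)) =
          (\<Sum>c1\<in>stay \<tau> a b \<inter> stay \<tau> a' b'. Poly_Mapping.lookup x (branch M c1 s) * jump_at \<tau> s (c1, c))"
          by (intro sum.mono_neutral_right stay_finite) (use z in auto)
        also have "\<dots> = (if c \<in> stay \<tau> a b then \<Sum>c1\<in>stay \<tau> a b. Poly_Mapping.lookup x (branch M c1 s) * jump_at \<tau> s (c1, c) else 0)"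
        proof (cases "c \<in> stay \<tau> a b")
          case True
          have "jump_at \<tau> s (c1, c) = 0" if "c1 \<in> stay \<tau> a b - stay \<tau> a b \<inter> stay \<tau> a' b'" for c1
            by (rule ccontr) (use that c ab jump_decreasing[of \<tau> s c1 c] in \<open>auto simp: stay_def gens_def\<close>)
          then have "(\<Sum>c1\<in>stay \<tau> a b. Poly_Mapping.lookup x (branch M c1 s) * jump_at \<tau> s (c1, c)) =
            (\<Sum>c1\<in>stay \<tau> a b \<inter> stay \<tau> a' b'. Poly_Mapping.lookup x (branch M c1 s) * jump_at \<tau> s (c1, c))"
            by (intro sum.mono_neutral_right stay_finite) auto
          then show ?thesis using True by simp
        next
          case False
          have "jump_at \<tau> s (c1, c) = 0" if "c1 \<in> stay \<tau> a b \<inter> stay \<tau> a' b'" for c1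
            by (rule ccontr) (use that c False ab jump_decreasing[of \<tau> s c1 c] in \<open>auto simp: stay_def gens_def\<close>)
          then show ?thesis using False by (auto intro!: sum.neutral)
        qed
        finally show ?thesis using z[OF c] by simp
      qed
      then show "Poly_Mapping.lookup (rho \<tau> a' b' s (truncate (gens M a' b' s) x)) c =
        Poly_Mapping.lookup (truncate (stay \<tau> a' b') (rho \<tau> a b s x)) c"
        by (simp add: lookup_truncate[of "stay \<tau> a' b'"] lookup_restrict_along stay_finite v)
    qed
  qed (use e1(1) e2(1) in simp)
qed

lemma link_push:
  assumes \<tau>: "\<tau> \<in> {0..1}" and reg: "(\<tau>, a) \<notin> trace_set" "(\<tau>, b) \<notin> trace_set" "(\<tau>, a') \<notin> trace_set" "(\<tau>, b') \<notin> trace_set"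
    and ab: "a \<le> a'" "b \<le> b'"
  shows "\<exists>e>0. \<forall>s\<in>regular_params. \<forall>t\<in>regular_params. \<bar>s - \<tau>\<bar> < e \<longrightarrow> \<bar>t - \<tau>\<bar> < e \<longrightarrow>
    (\<forall>X\<in>carrier (HH s a b). \<forall>Y\<in>carrier (HH t a b). link \<tau> a b s t X Y \<longrightarrow> link \<tau> a' b' s t (push s a' b' X) (push t a' b' Y))"
proof -
  obtain e1 where e1: "e1 > 0" "\<forall>r\<in>regular_params. \<bar>r - \<tau>\<bar> < e1 \<longrightarrow>
     acyclic_fibration (gens M a b r) (\<gamma> M) (stay \<tau> a b) (base \<tau>) (rho \<tau> a b r)" using local_fibration[OF \<tau> reg(1,2)] by blast
  obtain e2 where e2: "e2 > 0" "\<forall>r\<in>regular_params. \<bar>r - \<tau>\<bar> < e2 \<longrightarrow>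
     acyclic_fibration (gens M a' b' r) (\<gamma> M) (stay \<tau> a' b') (base \<tau>) (rho \<tau> a' b' r)" using local_fibration[OF \<tau> reg(3,4)] by blast
  obtain e3 where e3: "e3 > 0" "\<forall>s\<in>regular_params. \<bar>s - \<tau>\<bar> < e3 \<longrightarrow> (\<forall>x\<in>chains (gens M a b s).
    rho \<tau> a' b' s (truncate (gens M a' b' s) x) = truncate (stay \<tau> a' b') (rho \<tau> a b s x))"
    using rho_truncate_near[OF reg ab] by blast
  have key: "induced_map (stay \<tau> a' b') (base \<tau>) (rho \<tau> a' b' s) (push s a' b' X) =
    induced_map (stay \<tau> a' b') (base \<tau>) (truncate (stay \<tau> a' b')) (induced_map (stay \<tau> a b) (base \<tau>) (rho \<tau> a b s) X)"
    if s: "s \<in> regular_params" "\<bar>s - \<tau>\<bar> < min e1 (min e2 e3)" and X: "X \<in> carrier (HH s a b)" for s X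
  proof -
    have cm1: "chain_map (gens M a b s) (\<gamma> M) (stay \<tau> a b) (base \<tau>) (rho \<tau> a b s)"
      and cm2: "chain_map (gens M a' b' s) (\<gamma> M) (stay \<tau> a' b') (base \<tau>) (rho \<tau> a' b' s)"
      using e1(2) e2(2) s by (auto intro: af_cm)
    note cm = chain_map_comp[OF cm1 truncate_stay[OF ab]]
    have "induced_map (stay \<tau> a' b') (base \<tau>) (rho \<tau> a' b' s) (push s a' b' X) =
      induced_map (stay \<tau> a' b') (base \<tau>) (\<lambda>x. truncate (stay \<tau> a' b') (rho \<tau> a b s x)) X"
      by (rule induced_map_comp[OF truncate_window[OF s(1) ab] cm2 cm _ X]) (use e3(2) s in auto)
    then show ?thesis using induced_map_comp[OF cm1 truncate_stay[OF ab] cm refl X] by simp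
  qed
  show ?thesis
  proof (intro exI[of _ "min e1 (min e2 e3)"] conjI ballI impI)
    fix s t X Y assume a: "s \<in> regular_params" "t \<in> regular_params" "\<bar>s - \<tau>\<bar> < min e1 (min e2 e3)" "\<bar>t - \<tau>\<bar> < min e1 (min e2 e3)"
      "X \<in> carrier (HH s a b)" "Y \<in> carrier (HH t a b)" and l: "link \<tau> a b s t X Y"
    show "link \<tau> a' b' s t (push s a' b' X) (push t a' b' Y)"
      unfolding link_def key[OF a(1,3,5)] key[OF a(2,4,6)] using l by (simp add: link_def)
  qed (use e1(1) e2(1) e3(1) in simp)
qed

lemma trace_avoided_near:
  assumes "(\<tau>, l) \<notin> trace_set"
  shows "\<exists>e>0. \<forall>\<tau>'. \<bar>\<tau>' - \<tau>\<bar> < e \<longrightarrow> (\<tau>', l) \<notin> trace_set"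
proof -
  have "\<exists>d>0. \<forall>q\<in>{p \<in> pts M. F3 M p \<in> {l}}. \<bar>F2 M q - \<tau>\<bar> < d \<longrightarrow> q \<in> {}"
  proof (rule compact_fibre_neighbourhood)
    show "compactin CT {p \<in> pts M. F3 M p \<in> {l}}" by (rule F3_compact) simp
    fix p assume "p \<in> {p \<in> pts M. F3 M p \<in> {l}}" "F2 M p = \<tau>"
    then have "(\<tau>, l) = (F2 M p, F3 M p)" "p \<in> pts M" by auto
    then have "(\<tau>, l) \<in> trace_set" unfolding trace_set_def by blast
    then show "p \<in> {}" using assms by simp
  qed simp
  then obtain d where d: "d > 0" "\<forall>q\<in>{p \<in> pts M. F3 M p \<in> {l}}. \<not> \<bar>F2 M q - \<tau>\<bar> < d" by blast
  have "(\<tau>', l) \<notin> trace_set" if "\<bar>\<tau>' - \<tau>\<bar> < d" for \<tau>'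
  proof
    assume "(\<tau>', l) \<in> trace_set"
    then obtain q where "q \<in> pts M" "F2 M q = \<tau>'" "F3 M q = l" by (auto simp: trace_set_def)
    then have "q \<in> {p \<in> pts M. F3 M p \<in> {l}}" "\<bar>F2 M q - \<tau>\<bar> < d" using that by auto
    then show False using d(2) by blast
  qed
  then show ?thesis using d(1) by blast
qed

text \<open>
  Both branches follow the unique path through \<open>branch M c \<tau>'\<close>.
\<close>

lemma branch_of_branch:
  assumes c: "c \<in> pts M" "c \<notin> crit"
  shows "\<exists>e>0. \<forall>\<tau>'\<in>near01 (F2 M c) e. branch M c \<tau>' \<notin> crit \<longrightarrow>
    (\<exists>e'>0. \<forall>s\<in>near01 \<tau>' e'. branch M (branch M c \<tau>') s = branch M c s)"
proof -
  obtain e where e: "e > 0" "continuous_map (top_of_set (near01 (F2 M c) e)) CT (branch M c)"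
    "\<And>r. r \<in> near01 (F2 M c) e \<Longrightarrow> F2 M (branch M c r) = r" using branch_continuous[OF c] by metis
  have "\<exists>e'>0. \<forall>s\<in>near01 \<tau>' e'. branch M (branch M c \<tau>') s = branch M c s"
    if t: "\<tau>' \<in> near01 (F2 M c) e" and nc: "branch M c \<tau>' \<notin> crit" for \<tau>'
  proof -
    have p: "branch M c \<tau>' \<in> pts M"
      using continuous_map_image_subset_topspace[OF e(2)] t by (auto simp: topspace_curve_top)
    have U: "openin CT (topspace CT)" by simp
    have U': "branch M c \<tau>' \<in> topspace CT" using p by (simp add: topspace_curve_top)
    obtain W e1 where W: "openin CT W" "branch M c \<tau>' \<in> W" "e1 > 0" "\<forall>r\<in>near01 \<tau>' e1. branch M (branch M c \<tau>') r \<in> W \<and>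
       F2 M (branch M (branch M c \<tau>') r) = r \<and> (\<forall>q\<in>W. F2 M q = r \<longrightarrow> q = branch M (branch M c \<tau>') r)"
      using branch_unique[OF p nc U U', unfolded e(3)[OF t]] by (elim exE conjE) (rule that)
    obtain d where d: "d > 0" "\<And>s. s \<in> near01 (F2 M c) e \<Longrightarrow> \<bar>s - \<tau>'\<bar> < d \<Longrightarrow> branch M c s \<in> W"
      by (rule continuous_path_near[OF e(2) t W(1,2)]) (rule that)
    define d' where "d' = min e1 (min d (e - \<bar>\<tau>' - F2 M c\<bar>))"
    have "d' > 0" using d(1) W(3) t by (auto simp: d'_def near01_def)
    moreover have "branch M (branch M c \<tau>') s = branch M c s" if s: "s \<in> near01 \<tau>' d'" for s
    proof -
      have s1: "s \<in> near01 \<tau>' e1" "s \<in> near01 (F2 M c) e" "\<bar>s - \<tau>'\<bar> < d" using s t by (auto simp: d'_def near01_def)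
      have "branch M c s \<in> W" "F2 M (branch M c s) = s" using d(2) s1 e(3) by auto
      moreover have "\<forall>q\<in>W. F2 M q = s \<longrightarrow> q = branch M (branch M c \<tau>') s" using bspec[OF W(4) s1(1)] by (elim conjE)
      ultimately have "branch M c s = branch M (branch M c \<tau>') s" using bspec by blast
      then show ?thesis ..
    qed
    ultimately show ?thesis by blast
  qed
  then show ?thesis using e(1) by blast
qed

text \<open>
  For \<open>s\<close> close to \<open>\<tau>'\<close>, the parameters \<open>s\<close> and \<open>\<tau>'\<close> lie on the same side of \<open>\<tau>\<close>, so that the
  correction at \<open>\<tau>\<close> is the same for both. There is no correction at \<open>\<tau>'\<close>.
\<close>

lemma rho_factor:
  assumes ne: "\<tau>' \<noteq> \<tau>" and s: "\<bar>s - \<tau>'\<bar> < \<bar>\<tau>' - \<tau>\<bar>"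
    and stay: "\<And>c. c \<in> stay \<tau> a b \<Longrightarrow> branch M c \<tau>' \<in> stay \<tau>' a b"
    and br: "\<And>c. c \<in> stay \<tau> a b \<Longrightarrow> branch M (branch M c \<tau>') s = branch M c s"
    and nV: "\<And>c1 c2. c1 \<in> stay \<tau>' a b \<Longrightarrow> c2 \<in> stay \<tau>' a b \<Longrightarrow> (c1, c2) \<notin> V"
  shows "restrict_along (\<lambda>c. branch M c \<tau>') (stay \<tau> a b) (jump_at \<tau> \<tau>') (rho \<tau>' a b s x) = rho \<tau> a b s x"
proof (rule poly_mapping_eqI)
  fix c
  have j: "jump_at \<tau> \<tau>' = jump_at \<tau> s" using ne s by (auto simp: jump_at_def)
  have j': "jump_at \<tau>' s (c1, c2) = 0" if "c1 \<in> stay \<tau>' a b" "c2 \<in> stay \<tau>' a b" for c1 c2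
    using nV[OF that] by (simp add: jump_at_def jump_def handle_slides_def)
  have v: "Poly_Mapping.lookup (rho \<tau>' a b s x) (branch M d \<tau>') = Poly_Mapping.lookup x (branch M d s)" if "d \<in> stay \<tau> a b" for d
    using stay[OF that] br[OF that] by (simp add: lookup_restrict_along stay_finite j')
  show "Poly_Mapping.lookup (restrict_along (\<lambda>c. branch M c \<tau>') (stay \<tau> a b) (jump_at \<tau> \<tau>') (rho \<tau>' a b s x)) c =
    Poly_Mapping.lookup (rho \<tau> a b s x) c"
    unfolding lookup_restrict_along[OF stay_finite, of _ "\<tau>"] j using v by simp
qed

text \<open>
  In a fixed window no vertices occur close to \<open>\<tau>\<close> except at \<open>\<tau>\<close> itself. The model at another such
  parameter \<open>\<tau>'\<close> is thus spanned by all points in the window, and the maps to the model at \<open>\<tau>\<close>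
  factor through it.
\<close>

lemma link_compatible:
  assumes \<tau>: "\<tau> \<in> {0..1}" and reg: "(\<tau>, a) \<notin> trace_set" "(\<tau>, b) \<notin> trace_set"
  shows "\<exists>e>0. \<forall>\<tau>'\<in>{0..1}. \<bar>\<tau>' - \<tau>\<bar> < e \<longrightarrow> (\<tau>', a) \<notin> trace_set \<and> (\<tau>', b) \<notin> trace_set \<and>
    (\<exists>e'>0. \<forall>s\<in>regular_params. \<forall>t\<in>regular_params. \<bar>s - \<tau>'\<bar> < e' \<longrightarrow> \<bar>t - \<tau>'\<bar> < e' \<longrightarrow>
      (\<forall>X\<in>carrier (HH s a b). \<forall>Y\<in>carrier (HH t a b). link \<tau> a b s t X Y \<longleftrightarrow> link \<tau>' a b s t X Y))"
proof -
  let ?P = "stay \<tau> a b"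
  have P: "c \<in> fib M \<tau> \<and> c \<notin> crit" if "c \<in> ?P" for c using stayD[OF that] by blast
  obtain e1 where e1: "e1 > 0" "\<forall>\<tau>'. \<bar>\<tau>' - \<tau>\<bar> < e1 \<longrightarrow> (\<tau>', a) \<notin> trace_set" using trace_avoided_near[OF reg(1)] by blast
  obtain e2 where e2: "e2 > 0" "\<forall>\<tau>'. \<bar>\<tau>' - \<tau>\<bar> < e2 \<longrightarrow> (\<tau>', b) \<notin> trace_set" using trace_avoided_near[OF reg(2)] by blast
  obtain e3 where e3: "e3 > 0" "\<forall>r. r \<noteq> \<tau> \<longrightarrow> \<bar>r - \<tau>\<bar> < e3 \<longrightarrow> (\<forall>c1\<in>gens M a b r. \<forall>c2\<in>gens M a b r. (c1, c2) \<notin> V)"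
    using no_vertices_near by blast
  obtain e4 where e4: "e4 > 0" "\<forall>r\<in>near01 \<tau> e4. \<forall>c\<in>?P. branch M c r \<in> gens M a b r \<longleftrightarrow> c \<in> ?P"
    using stay_window_near[OF reg stay_finite P] by blast
  obtain e5 where e5: "e5 > 0" "\<forall>r\<in>regular_params. \<bar>r - \<tau>\<bar> < e5 \<longrightarrow>
     acyclic_fibration (gens M a b r) (\<gamma> M) (stay \<tau> a b) (base \<tau>) (rho \<tau> a b r)" using local_fibration[OF \<tau> reg] by blast
  have "\<exists>e>0. \<forall>c\<in>?P. \<forall>\<tau>'\<in>near01 \<tau> e. branch M c \<tau>' \<notin> crit \<longrightarrow>
    (\<exists>e'>0. \<forall>s\<in>near01 \<tau>' e'. branch M (branch M c \<tau>') s = branch M c s)"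
  proof (rule finite_common_radius[OF stay_finite])
    fix c assume c: "c \<in> ?P"
    show "\<exists>e>0. \<forall>\<tau>'\<in>near01 \<tau> e. branch M c \<tau>' \<notin> crit \<longrightarrow>
      (\<exists>e'>0. \<forall>s\<in>near01 \<tau>' e'. branch M (branch M c \<tau>') s = branch M c s)"
      using branch_of_branch[of c] stayD[OF c] by simp
  next
    fix c e e' assume "\<forall>\<tau>'\<in>near01 \<tau> e. branch M c \<tau>' \<notin> crit \<longrightarrow>
      (\<exists>e'>0. \<forall>s\<in>near01 \<tau>' e'. branch M (branch M c \<tau>') s = branch M c s)" and le: "e' \<le> (e::real)"
    then show "\<forall>\<tau>'\<in>near01 \<tau> e'. branch M c \<tau>' \<notin> crit \<longrightarrow>
      (\<exists>e'>0. \<forall>s\<in>near01 \<tau>' e'. branch M (branch M c \<tau>') s = branch M c s)" using near01_mono[OF le, of \<tau>] by (meson subsetD)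
  qed
  then obtain e6 where e6: "e6 > 0" "\<forall>c\<in>?P. \<forall>\<tau>'\<in>near01 \<tau> e6. branch M c \<tau>' \<notin> crit \<longrightarrow>
    (\<exists>e'>0. \<forall>s\<in>near01 \<tau>' e'. branch M (branch M c \<tau>') s = branch M c s)" by (elim exE conjE)
  define e where "e = min e1 (min e2 (min e3 (min e4 (min e5 e6))))"
  have e: "e > 0" "e \<le> e1" "e \<le> e2" "e \<le> e3" "e \<le> e4" "e \<le> e5" "e \<le> e6"
    using e1(1) e2(1) e3(1) e4(1) e5(1) e6(1) by (auto simp: e_def)
  have main: "\<exists>e'>0. \<forall>s\<in>regular_params. \<forall>t\<in>regular_params. \<bar>s - \<tau>'\<bar> < e' \<longrightarrow> \<bar>t - \<tau>'\<bar> < e' \<longrightarrow>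
      (\<forall>X\<in>carrier (HH s a b). \<forall>Y\<in>carrier (HH t a b). link \<tau> a b s t X Y \<longleftrightarrow> link \<tau>' a b s t X Y)"
    if t: "\<tau>' \<in> {0..1}" "\<bar>\<tau>' - \<tau>\<bar> < e" and ne: "\<tau>' \<noteq> \<tau>" for \<tau>'
  proof -
    have tn: "\<tau>' \<in> near01 \<tau> e4" "\<tau>' \<in> near01 \<tau> e6" using t e by (auto simp: near01_def)
    have "\<bar>\<tau>' - \<tau>\<bar> < e3" using t(2) e(4) by simp
    then have nV: "(c1, c2) \<notin> V" if "c1 \<in> gens M a b \<tau>'" "c2 \<in> gens M a b \<tau>'" for c1 c2
      using e3(2) ne that by blast
    have ncrit: "c \<notin> crit" if c: "c \<in> gens M a b \<tau>'" for c
    proof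
      assume cr: "c \<in> crit"
      have "(c, c) \<in> topspace PT" using c by (simp add: topspace_pair gens_def fib_def)
      then have "(c, c) \<in> V" using crit_pair_in_V cr by blast
      then show False using nV[OF c c] by blast
    qed
    have stay': "stay \<tau>' a b = gens M a b \<tau>'" using ncrit by (auto simp: stay_def)
    have st: "branch M c \<tau>' \<in> stay \<tau>' a b" if "c \<in> ?P" for c
      using bspec[OF bspec[OF e4(2) tn(1)] that] that stay' by simp
    have reg': "(\<tau>', a) \<notin> trace_set" "(\<tau>', b) \<notin> trace_set" using e1(2) e2(2) t e by auto
    have "\<exists>e'>0. \<forall>c\<in>?P. \<forall>s\<in>near01 \<tau>' e'. branch M (branch M c \<tau>') s = branch M c s"
    proof (rule finite_common_radius[OF stay_finite])
      fix c assume c: "c \<in> ?P"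
      have "branch M c \<tau>' \<notin> crit" using st[OF c] stay' ncrit by blast
      then show "\<exists>e'>0. \<forall>s\<in>near01 \<tau>' e'. branch M (branch M c \<tau>') s = branch M c s"
        using bspec[OF bspec[OF e6(2) c] tn(2)] by simp
    next
      fix c d d' assume "\<forall>s\<in>near01 \<tau>' d. branch M (branch M c \<tau>') s = branch M c s" and le: "d' \<le> (d::real)"
      then show "\<forall>s\<in>near01 \<tau>' d'. branch M (branch M c \<tau>') s = branch M c s" using near01_mono[OF le, of \<tau>'] by (meson subsetD)
    qed
    then obtain f1 where f1: "f1 > 0" "\<forall>c\<in>?P. \<forall>s\<in>near01 \<tau>' f1. branch M (branch M c \<tau>') s = branch M c s" by (elim exE conjE)
    obtain f2 where f2: "f2 > 0" "\<forall>r\<in>regular_params. \<bar>r - \<tau>'\<bar> < f2 \<longrightarrow>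
      acyclic_fibration (gens M a b r) (\<gamma> M) (stay \<tau>' a b) (base \<tau>') (rho \<tau>' a b r)" using local_fibration[OF t(1) reg'] by blast
    define f where "f = min f1 (min f2 (min (e - \<bar>\<tau>' - \<tau>\<bar>) \<bar>\<tau>' - \<tau>\<bar>))"
    have f: "f > 0" "f \<le> f1" "f \<le> f2" "f \<le> e - \<bar>\<tau>' - \<tau>\<bar>" "f \<le> \<bar>\<tau>' - \<tau>\<bar>"
      using f1(1) f2(1) t(2) ne unfolding f_def by linarith+
    let ?\<theta> = "restrict_along (\<lambda>c. branch M c \<tau>') ?P (jump_at \<tau> \<tau>')"
    have lin: "linear_chains (stay \<tau>' a b) ?P ?\<theta>" by (rule linear_restrict_along[OF stay_finite])
    have af: "acyclic_fibration (gens M a b s) (\<gamma> M) ?P (base \<tau>) (rho \<tau> a b s)"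
      and af': "acyclic_fibration (gens M a b s) (\<gamma> M) (stay \<tau>' a b) (base \<tau>') (rho \<tau>' a b s)"
      and comp: "\<And>x. ?\<theta> (rho \<tau>' a b s x) = rho \<tau> a b s x" if s: "s \<in> regular_params" "\<bar>s - \<tau>'\<bar> < f" for s
    proof -
      have "\<bar>s - \<tau>\<bar> < e5" using s f e by linarith
      then show "acyclic_fibration (gens M a b s) (\<gamma> M) ?P (base \<tau>) (rho \<tau> a b s)" using e5(2) s(1) by blast
      show "acyclic_fibration (gens M a b s) (\<gamma> M) (stay \<tau>' a b) (base \<tau>') (rho \<tau>' a b s)" using f2(2) s f by simp
      have sn: "s \<in> near01 \<tau>' f1" using regular_near01[OF s(1), of \<tau>' f1] s f by simp
      show "?\<theta> (rho \<tau>' a b s x) = rho \<tau> a b s x" for x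
      proof (rule rho_factor[OF ne])
        show "\<bar>s - \<tau>'\<bar> < \<bar>\<tau>' - \<tau>\<bar>" using s(2) f(5) by simp
        show "branch M (branch M c \<tau>') s = branch M c s" if "c \<in> ?P" for c using bspec[OF bspec[OF f1(2) that] sn] .
        show "(c1, c2) \<notin> V" if "c1 \<in> stay \<tau>' a b" "c2 \<in> stay \<tau>' a b" for c1 c2 using nV that stay' by simp
      qed (rule st)
    qed
    show ?thesis
    proof (intro exI[of _ f] conjI ballI impI f(1))
      fix s t X Y assume s: "s \<in> regular_params" "\<bar>s - \<tau>'\<bar> < f" and t: "t \<in> regular_params" "\<bar>t - \<tau>'\<bar> < f"
        and X: "X \<in> carrier (HH s a b)" and Y: "Y \<in> carrier (HH t a b)"
      note fac = acyclic_fibration_factor[OF af[OF s] af'[OF s] lin comp[OF s]]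
      let ?X = "induced_map (stay \<tau>' a b) (base \<tau>') (rho \<tau>' a b s) X" and ?Y = "induced_map (stay \<tau>' a b) (base \<tau>') (rho \<tau>' a b t) Y"
      have "induced_map ?P (base \<tau>) ?\<theta> ?X = induced_map ?P (base \<tau>) (rho \<tau> a b s) X"
        by (rule induced_map_comp[OF af_cm[OF af'[OF s]] fac(1) af_cm[OF af[OF s]] comp[OF s] X])
      moreover have "induced_map ?P (base \<tau>) ?\<theta> ?Y = induced_map ?P (base \<tau>) (rho \<tau> a b t) Y"
        by (rule induced_map_comp[OF af_cm[OF af'[OF t]] fac(1) af_cm[OF af[OF t]] comp[OF t] Y])
      moreover have "?X \<in> carrier (matrix_homology (stay \<tau>' a b) (base \<tau>'))" "?Y \<in> carrier (matrix_homology (stay \<tau>' a b) (base \<tau>'))"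
        using induced_map_in[OF af_cm[OF af'[OF s]] X] induced_map_in[OF af_cm[OF af'[OF t]] Y] .
      ultimately show "link \<tau> a b s t X Y \<longleftrightarrow> link \<tau>' a b s t X Y"
        unfolding link_def using fac(2)[of ?X ?Y] by metis
    qed
  qed
  show ?thesis
  proof (rule exI[of _ e], intro conjI ballI impI e(1))
    fix \<tau>' assume t: "\<tau>' \<in> {0..1}" "\<bar>\<tau>' - \<tau>\<bar> < e"
    show "(\<tau>', a) \<notin> trace_set" "(\<tau>', b) \<notin> trace_set" using e1(2) e2(2) t e by auto
    show "\<exists>e'>0. \<forall>s\<in>regular_params. \<forall>t\<in>regular_params. \<bar>s - \<tau>'\<bar> < e' \<longrightarrow> \<bar>t - \<tau>'\<bar> < e' \<longrightarrow>
      (\<forall>X\<in>carrier (HH s a b). \<forall>Y\<in>carrier (HH t a b). link \<tau> a b s t X Y \<longleftrightarrow> link \<tau>' a b s t X Y)"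
      using main[OF t] by (cases "\<tau>' = \<tau>") (auto intro!: exI[of _ 1])
  qed
qed

end

section \<open>Stretching the levels\<close>

text \<open>
  If the primitive of \<open>1/\<Phi>\<close> were bounded, it would have a limit, and the integral would be finite.
\<close>

lemma half_line_primitive:
  fixes \<Phi> :: "real \<Rightarrow> real"
  assumes cont: "continuous_on {b..} \<Phi>" and pos: "\<And>s. b \<le> s \<Longrightarrow> \<Phi> s > 0"
    and div: "(\<integral>\<^sup>+s\<in>{b..}. ennreal (1 / \<Phi> s) \<partial>lborel) = \<infinity>"
  shows "\<exists>A. continuous_on {b..} A \<and> (\<forall>s t. b \<le> s \<longrightarrow> s < t \<longrightarrow> A s < A t) \<and>
    (\<forall>s>b. (A has_real_derivative 1 / \<Phi> s) (at s)) \<and> (\<forall>C. \<exists>s\<ge>b. C < A s)"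
proof -
  (* Constant continuation to the left of b gives an integrand which is continuous everywhere. *)
  define h where "h s = 1 / \<Phi> (max s b)" for s
  have "continuous_on UNIV (\<lambda>s. \<Phi> (max s b))"
    by (rule continuous_on_compose2[OF cont]) (auto intro!: continuous_intros)
  then have hc: "continuous_on UNIV h" unfolding h_def
    by (intro continuous_intros) (use pos in \<open>auto simp: less_imp_neq[symmetric] intro: less_imp_neq[symmetric]\<close>)
  have hpos: "h s > 0" for s using pos[of "max s b"] by (simp add: h_def)
  define A where "A s = integral {b - 1..s} h" for s
  have DA: "(A has_real_derivative h s) (at s)" if "b - 1 < s" for s
  proof -
    have "((\<lambda>x. integral {b - 1..x} h) has_real_derivative h s) (at s within {b - 1..s + 1})"
      by (rule integral_has_real_derivative) (use that hc continuous_on_subset in auto)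
    then show ?thesis using that unfolding A_def by (simp add: at_within_Icc_at)
  qed
  have mono: "A s < A t" if "b \<le> s" "s < t" for s t
  proof (rule DERIV_pos_imp_increasing[OF that(2)])
    fix x assume "s \<le> x" "x \<le> t"
    then show "\<exists>y. DERIV A x :> y \<and> y > 0"
      using DA[of x] hpos[of x] that(1) by (intro exI[of _ "h x"]) auto
  qed
  have cA: "continuous_on {b..} A"
    by (rule DERIV_continuous_on[where D = h]) (rule has_field_derivative_at_within[OF DA], simp)
  have unb: "\<exists>s\<ge>b. C < A s" for C
  proof (rule ccontr)
    assume "\<not> ?thesis"
    then have bd: "A s \<le> C" if "b \<le> s" for s using that by (meson not_less)
    have inc: "mono_on {b..} A" using mono by (auto simp: mono_on_def le_less)
    define L where "L = (SUP s\<in>{b..}. A s)"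
    have bdd: "bdd_above (A ` {b..})" using bd by (auto intro!: bdd_aboveI[of _ C])
    have "(A \<longlongrightarrow> L) at_top"
    proof (rule increasing_tendsto)
      show "eventually (\<lambda>s. A s \<le> L) at_top"
        using eventually_ge_at_top[of b] by eventually_elim (use bdd in \<open>auto simp: L_def intro!: cSUP_upper\<close>)
      fix x assume "x < L"
      then obtain s where s: "b \<le> s" "x < A s" unfolding L_def using less_cSUP_iff[of "{b..}" A x] bdd by auto
      show "eventually (\<lambda>t. x < A t) at_top"
        using eventually_ge_at_top[of s] by eventually_elim (use s mono in \<open>force simp: le_less\<close>)
    qed
    then have "(\<integral>\<^sup>+x. ennreal (h x) * indicator {b..} x \<partial>lborel) = ennreal (L - A b)"
      by (intro nn_integral_FTC_atLeast[where F = A])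
         (use DA hpos hc in \<open>auto intro: borel_measurable_continuous_onI less_imp_le\<close>)
    moreover have "(\<integral>\<^sup>+x. ennreal (h x) * indicator {b..} x \<partial>lborel) = (\<integral>\<^sup>+s\<in>{b..}. ennreal (1 / \<Phi> s) \<partial>lborel)"
      by (intro nn_integral_cong) (auto simp: h_def indicator_def max_def)
    ultimately show False using div by simp
  qed
  have "(A has_real_derivative 1 / \<Phi> s) (at s)" if "b < s" for s
    using DA[of s] that by (simp add: h_def max_def)
  then show ?thesis using cA mono unb by blast
qed

text \<open>
  In this coordinate a point that moves with the maximal speed \<open>\<Phi>\<close> has speed one; divergence of
  the integrals says that it needs infinite time to escape. On \<open>[a,b]\<close> the coordinate is the
  identity up to a constant, and at \<open>a\<close> and \<open>b\<close> it may fail to be differentiable.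
\<close>

lemma time_coordinate:
  fixes \<Phi> :: "real \<Rightarrow> real"
  assumes ab: "a \<le> b" and cont: "continuous_on (UNIV - {a<..<b}) \<Phi>" and pos: "\<forall>s\<in>UNIV - {a<..<b}. \<Phi> s > 0"
    and top: "(\<integral>\<^sup>+s\<in>{b..}. ennreal (1 / \<Phi> s) \<partial>lborel) = \<infinity>"
    and bot: "(\<integral>\<^sup>+s\<in>{..a}. ennreal (1 / \<Phi> s) \<partial>lborel) = \<infinity>"
  shows "\<exists>T S. strict_mono T \<and> continuous_on UNIV T \<and> (\<forall>x. T (S x) = x) \<and> (\<forall>x. S (T x) = x) \<and>
    (\<forall>s. s < a \<or> b < s \<longrightarrow> (T has_real_derivative 1 / \<Phi> s) (at s))"
proof -
  have "continuous_on {b..} \<Phi>" by (rule continuous_on_subset[OF cont]) auto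
  from half_line_primitive[OF this _ top] pos obtain A where A: "continuous_on {b..} A" "\<And>s t. b \<le> s \<Longrightarrow> s < t \<Longrightarrow> A s < A t"
    "\<And>s. b < s \<Longrightarrow> (A has_real_derivative 1 / \<Phi> s) (at s)" "\<And>C. \<exists>s\<ge>b. C < A s" by auto
  define \<Psi> where "\<Psi> s = \<Phi> (- s)" for s
  have c2: "continuous_on {-a..} \<Psi>" unfolding \<Psi>_def
    by (rule continuous_on_compose2[OF cont]) (auto intro!: continuous_intros)
  have p2: "\<Psi> s > 0" if "- a \<le> s" for s using pos that by (auto simp: \<Psi>_def)
  have d2: "(\<integral>\<^sup>+s\<in>{-a..}. ennreal (1 / \<Psi> s) \<partial>lborel) = \<infinity>"
  proof -
    have m: "(\<lambda>s. ennreal (1 / \<Phi> s) * indicator {..a} s) \<in> borel_measurable lborel"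
    proof -
      have "continuous_on UNIV (\<lambda>s. \<Phi> (min s a))"
        by (rule continuous_on_compose2[OF cont]) (auto intro!: continuous_intros)
      then have "(\<lambda>s. \<Phi> (min s a)) \<in> borel_measurable borel" by (rule borel_measurable_continuous_onI)
      then have "(\<lambda>s. ennreal (1 / \<Phi> (min s a)) * indicator {..a} s) \<in> borel_measurable borel" by measurable
      moreover have "(\<lambda>s. ennreal (1 / \<Phi> (min s a)) * indicator {..a} s) = (\<lambda>s. ennreal (1 / \<Phi> s) * indicator {..a} s)"
        by (auto simp: fun_eq_iff indicator_def min_def)
      ultimately show ?thesis by simp
    qed
    have "(\<integral>\<^sup>+s. ennreal (1 / \<Phi> s) * indicator {..a} s \<partial>lborel) =
      ennreal \<bar>- 1\<bar> * (\<integral>\<^sup>+s. ennreal (1 / \<Phi> (0 + (- 1) * s)) * indicator {..a} (0 + (- 1) * s) \<partial>lborel)"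
      by (rule nn_integral_real_affine) (use m in simp_all)
    also have "\<dots> = (\<integral>\<^sup>+s\<in>{-a..}. ennreal (1 / \<Psi> s) \<partial>lborel)"
      by (simp add: \<Psi>_def) (intro nn_integral_cong, auto simp: indicator_def)
    finally show ?thesis using bot by simp
  qed
  from half_line_primitive[OF c2 p2 d2] obtain B where B: "continuous_on {-a..} B" "\<And>s t. - a \<le> s \<Longrightarrow> s < t \<Longrightarrow> B s < B t"
    "\<And>s. - a < s \<Longrightarrow> (B has_real_derivative 1 / \<Psi> s) (at s)" "\<And>C. \<exists>s\<ge>-a. C < B s" by auto
  (* The three summands vary on the intervals above b, below a and between a and b, respectively. *)
  define T where "T s = A (max s b) - B (max (- s) (- a)) + max a (min s b)" for s
  have cT: "continuous_on UNIV T" unfolding T_def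
    by (intro continuous_intros continuous_on_compose2[OF A(1)] continuous_on_compose2[OF B(1)]) auto
  have mA: "A s \<le> A t" if "b \<le> s" "s \<le> t" for s t using A(2)[of s t] that by (cases "s = t") auto
  have mB: "B s \<le> B t" if "- a \<le> s" "s \<le> t" for s t using B(2)[of s t] that by (cases "s = t") auto
  have sT: "strict_mono T"
  proof (rule strict_monoI)
    fix s t :: real assume st: "s < t"
    have 1: "A (max s b) \<le> A (max t b)" "B (max (- t) (- a)) \<le> B (max (- s) (- a))" "max a (min s b) \<le> max a (min t b)"
      using st by (auto intro!: mA mB simp: max_def min_def)
    consider "b < t" | "s < a" | "t \<le> b" "a \<le> s" by linarith
    then show "T s < T t"
    proof cases
      case 1
      then have "A (max s b) < A (max t b)" using st by (intro A(2)) auto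
      then show ?thesis using \<open>B (max (- t) (- a)) \<le> B (max (- s) (- a))\<close> \<open>max a (min s b) \<le> max a (min t b)\<close> unfolding T_def by linarith
    next
      case 2
      then have "B (max (- t) (- a)) < B (max (- s) (- a))" using st by (intro B(2)) auto
      then show ?thesis using \<open>A (max s b) \<le> A (max t b)\<close> \<open>max a (min s b) \<le> max a (min t b)\<close> unfolding T_def by linarith
    next
      case 3
      then have "max a (min s b) < max a (min t b)" using st by auto
      then show ?thesis using \<open>A (max s b) \<le> A (max t b)\<close> \<open>B (max (- t) (- a)) \<le> B (max (- s) (- a))\<close> unfolding T_def by linarith
    qed
  qed
  have DT: "(T has_real_derivative 1 / \<Phi> s) (at s)" if "s < a \<or> b < s" for s
  proof (cases "b < s")
    case True
    have "((\<lambda>x. A x - B (- a) + b) has_real_derivative 1 / \<Phi> s) (at s)"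
      using A(3)[OF True] by (auto intro!: derivative_eq_intros)
    moreover have "s \<in> {b<..}" using True by simp
    moreover have "A x - B (- a) + b = T x" if "x \<in> {b<..}" for x using that ab by (simp add: T_def max_def min_def)
    ultimately show ?thesis by (rule has_field_derivative_transform_within_open[OF _ open_greaterThan])
  next
    case False
    then have sa: "s < a" using that by simp
    have "((\<lambda>x. A b - B (- x) + a) has_real_derivative 1 / \<Phi> s) (at s)"
      using B(3)[of "- s"] sa by (auto intro!: derivative_eq_intros DERIV_chain2[where g = uminus and f = B] simp: \<Psi>_def)
    moreover have "s \<in> {..<a}" using sa by simp
    moreover have "A b - B (- x) + a = T x" if "x \<in> {..<a}" for x using that ab by (simp add: T_def max_def min_def)
    ultimately show ?thesis by (rule has_field_derivative_transform_within_open[OF _ open_lessThan])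
  qed
  have surj: "\<exists>x. T x = y" for y
  proof -
    obtain s where s: "b \<le> s" "y + B (- a) - b < A s" using A(4) by blast
    obtain t where t: "- a \<le> t" "A b + a - y < B t" using B(4) by blast
    have "T s \<ge> y" using s ab by (simp add: T_def max_absorb1 max_absorb2 min_absorb2)
    moreover have "T (- t) \<le> y" using t ab by (simp add: T_def max_absorb1 max_absorb2 min_absorb1)
    moreover have "- t \<le> s" using s t ab by simp
    ultimately show ?thesis using IVT'[of T "- t" y s] continuous_on_subset[OF cT] by auto
  qed
  obtain S where S: "\<And>x. T (S x) = x" using surj by metis
  have "S (T x) = x" for x using S[of "T x"] strict_mono_eq[OF sT] by simp
  then show ?thesis using sT cT S DT by blast
qed

text \<open>
  Where the derivative of \<open>w\<close> is dominated by that of \<open>f\<close>, and \<open>f\<close> is injective and hence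
  monotone, \<open>f - w\<close> and \<open>f + w\<close> are monotone in the same direction as \<open>f\<close>.
\<close>

lemma dominated_increment:
  fixes f w :: "real \<Rightarrow> real"
  assumes xy: "x < y" and cont: "continuous_on {x..y} f" "continuous_on {x..y} w" and inj: "inj_on f {x..y}"
    and der: "\<And>z. x < z \<Longrightarrow> z < y \<Longrightarrow> \<exists>f' w'. (f has_real_derivative f') (at z) \<and> (w has_real_derivative w') (at z) \<and> \<bar>w'\<bar> \<le> \<bar>f'\<bar>"
  shows "\<bar>w y - w x\<bar> \<le> \<bar>f y - f x\<bar>"
proof -
  have main: "\<bar>w y - w x\<bar> \<le> g y - g x"
    if g: "mono_on {x..y} g" "continuous_on {x..y} g"
      and der: "\<And>z. x < z \<Longrightarrow> z < y \<Longrightarrow> \<exists>g' w'. (g has_real_derivative g') (at z) \<and> (w has_real_derivative w') (at z) \<and> \<bar>w'\<bar> \<le> \<bar>g'\<bar>" for g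
  proof -
    have d: "\<exists>g' w'. (g has_real_derivative g') (at z) \<and> (w has_real_derivative w') (at z) \<and> \<bar>w'\<bar> \<le> g'" if z: "x < z" "z < y" for z
    proof -
      obtain g' w' where gw: "(g has_real_derivative g') (at z)" "(w has_real_derivative w') (at z)" "\<bar>w'\<bar> \<le> \<bar>g'\<bar>" using der[OF z] by blast
      have "g' \<ge> 0" by (rule mono_on_imp_deriv_nonneg[OF g(1) gw(1)]) (use z in auto)
      then show ?thesis using gw by (intro exI[of _ g'] exI[of _ w']) simp
    qed
    have "g x - w x \<le> g y - w y"
    proof (rule DERIV_nonneg_imp_increasing_open[where f = "\<lambda>x. g x - w x"])
      fix z assume "x < z" "z < y"
      then obtain g' w' where "(g has_real_derivative g') (at z)" "(w has_real_derivative w') (at z)" "\<bar>w'\<bar> \<le> g'" using d by blast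
      then show "\<exists>y. ((\<lambda>x. g x - w x) has_real_derivative y) (at z) \<and> 0 \<le> y" by (intro exI[of _ "g' - w'"]) (auto intro!: derivative_eq_intros)
    qed (use xy g cont in \<open>auto intro!: continuous_intros\<close>)
    moreover have "g x + w x \<le> g y + w y"
    proof (rule DERIV_nonneg_imp_increasing_open[where f = "\<lambda>x. g x + w x"])
      fix z assume "x < z" "z < y"
      then obtain g' w' where "(g has_real_derivative g') (at z)" "(w has_real_derivative w') (at z)" "\<bar>w'\<bar> \<le> g'" using d by blast
      then show "\<exists>y. ((\<lambda>x. g x + w x) has_real_derivative y) (at z) \<and> 0 \<le> y" by (intro exI[of _ "g' + w'"]) (auto intro!: derivative_eq_intros)
    qed (use xy g cont in \<open>auto intro!: continuous_intros\<close>)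
    ultimately show ?thesis by linarith
  qed
  have "(\<forall>s\<in>{x..y}. \<forall>t\<in>{x..y}. s < t \<longrightarrow> f s < f t) \<or> (\<forall>s\<in>{x..y}. \<forall>t\<in>{x..y}. s < t \<longrightarrow> f t < f s)"
    using injective_eq_monotone_map[OF is_interval_cc cont(1)] inj by (auto simp: monotone_on_def)
  then show ?thesis
  proof
    assume "\<forall>s\<in>{x..y}. \<forall>t\<in>{x..y}. s < t \<longrightarrow> f s < f t"
    then have "mono_on {x..y} f" by (auto simp: mono_on_def le_less)
    from main[OF this cont(1) der] show ?thesis by simp
  next
    assume "\<forall>s\<in>{x..y}. \<forall>t\<in>{x..y}. s < t \<longrightarrow> f t < f s"
    then have m: "mono_on {x..y} (\<lambda>s. - f s)" by (auto simp: mono_on_def le_less)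
    have "\<bar>w y - w x\<bar> \<le> - f y - - f x"
    proof (rule main[OF m])
      fix z assume "x < z" "z < y"
      then obtain f' w' where "(f has_real_derivative f') (at z)" "(w has_real_derivative w') (at z)" "\<bar>w'\<bar> \<le> \<bar>f'\<bar>" using der by blast
      then show "\<exists>g' w'. ((\<lambda>s. - f s) has_real_derivative g') (at z) \<and> (w has_real_derivative w') (at z) \<and> \<bar>w'\<bar> \<le> \<bar>g'\<bar>"
        by (intro exI[of _ "- f'"] exI[of _ w']) (auto intro!: derivative_eq_intros)
    qed (use cont in \<open>auto intro!: continuous_intros\<close>)
    then show ?thesis by simp
  qed
qed

section \<open>Staircases\<close>

lemma step_on_const: "(\<And>x. x \<in> {lo..hi} \<Longrightarrow> (x, l) \<notin> Z) \<Longrightarrow> step_on Z lo hi (\<lambda>_. l)"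
  unfolding step_on_def by (intro ballI exI[of _ "1::real"] conjI exI[of _ "{l}"]) auto

lemma step_on_glue:
  assumes \<alpha>: "step_on Z lo m \<alpha>" and \<beta>: "step_on Z m hi \<beta>" and m: "lo \<le> m" "m \<le> hi"
  shows "step_on Z lo hi (\<lambda>s. if s \<le> m then \<alpha> s else \<beta> s)"
  unfolding step_on_def
proof
  fix \<tau> assume \<tau>: "\<tau> \<in> {lo..hi}"
  consider "\<tau> < m" | "m < \<tau>" | "\<tau> = m" by linarith
  then show "\<exists>d>0. \<exists>A. finite A \<and> (\<forall>l\<in>A. (\<tau>, l) \<notin> Z) \<and> (\<forall>s\<in>{lo..hi}. \<bar>s - \<tau>\<bar> < d \<longrightarrow> (if s \<le> m then \<alpha> s else \<beta> s) \<in> A)"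
  proof cases
    case 1
    then have "\<tau> \<in> {lo..m}" using \<tau> by auto
    then obtain d A where A: "d > 0" "finite A" "\<forall>l\<in>A. (\<tau>, l) \<notin> Z" "\<forall>s\<in>{lo..m}. \<bar>s - \<tau>\<bar> < d \<longrightarrow> \<alpha> s \<in> A"
      using \<alpha> unfolding step_on_def by blast
    then show ?thesis using 1 by (intro exI[of _ "min d (m - \<tau>)"] conjI exI[of _ A]) auto
  next
    case 2
    then have "\<tau> \<in> {m..hi}" using \<tau> by auto
    then obtain d A where A: "d > 0" "finite A" "\<forall>l\<in>A. (\<tau>, l) \<notin> Z" "\<forall>s\<in>{m..hi}. \<bar>s - \<tau>\<bar> < d \<longrightarrow> \<beta> s \<in> A"
      using \<beta> unfolding step_on_def by blast
    then show ?thesis using 2 by (intro exI[of _ "min d (\<tau> - m)"] conjI exI[of _ A]) auto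
  next
    case 3
    then have t: "\<tau> \<in> {lo..m}" "\<tau> \<in> {m..hi}" using m by auto
    obtain d A where A: "d > 0" "finite A" "\<forall>l\<in>A. (\<tau>, l) \<notin> Z" "\<forall>s\<in>{lo..m}. \<bar>s - \<tau>\<bar> < d \<longrightarrow> \<alpha> s \<in> A"
      using \<alpha> t unfolding step_on_def by blast
    obtain e B where B: "e > 0" "finite B" "\<forall>l\<in>B. (\<tau>, l) \<notin> Z" "\<forall>s\<in>{m..hi}. \<bar>s - \<tau>\<bar> < e \<longrightarrow> \<beta> s \<in> B"
      using \<beta> t unfolding step_on_def by blast
    show ?thesis using A B by (intro exI[of _ "min d e"] conjI exI[of _ "A \<union> B"]) auto
  qed
qed

text \<open>
  Near the point \<open>(\<tau>,u)\<close> the set lies in the cone of slopes at most one. In particular it meets a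
  line of slope two through this point in that point only.
\<close>

definition below_slope :: "(real \<times> real) set \<Rightarrow> real \<Rightarrow> real \<Rightarrow> bool" where
  "below_slope Z \<tau> u \<longleftrightarrow> (\<exists>d>0. \<forall>(s, v)\<in>Z. \<bar>s - \<tau>\<bar> < d \<longrightarrow> \<bar>v - u\<bar> < d \<longrightarrow> \<bar>v - u\<bar> \<le> \<bar>s - \<tau>\<bar>)"

text \<open>
  Follow the line \<open>g\<close> of slope two through \<open>(lo,u)\<close>. To the left of a point \<open>\<tau>\<close> the horizontal
  segment through \<open>g s\<close> stays outside the cone at \<open>(\<tau>,g \<tau>)\<close>, since it keeps a distance of
  \<open>2(\<tau> - s)\<close> from the level \<open>g \<tau>\<close>; to the right the same holds for the segment through \<open>g t\<close>.
  Stairs built from such segments stay between the values of \<open>g\<close> at the ends, which makes them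
  composable.
\<close>

lemma rising_stair:
  assumes lohi: "lo \<le> hi" and cone: "\<And>\<tau>. \<tau> \<in> {lo..hi} \<Longrightarrow> below_slope Z \<tau> (u + 2 * (\<tau> - lo))"
  shows "\<exists>\<alpha>. step_on Z lo hi \<alpha> \<and> mono_on {lo..hi} \<alpha> \<and> (\<forall>s\<in>{lo..hi}. u \<le> \<alpha> s \<and> \<alpha> s \<le> u + 2 * (hi - lo) + 1)"
proof (cases "lo = hi")
  case True
  obtain d where d: "d > 0" "\<forall>(s, v)\<in>Z. \<bar>s - lo\<bar> < d \<longrightarrow> \<bar>v - u\<bar> < d \<longrightarrow> \<bar>v - u\<bar> \<le> \<bar>s - lo\<bar>"
    using cone[of lo] lohi unfolding below_slope_def by auto
  (* Over a single parameter the line is a point, which may be occupied; a level slightly above is free. *)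
  define l where "l = u + min d 1 / 2"
  have l: "u < l" "l < u + d" "l \<le> u + 1" using d(1) by (auto simp: l_def)
  have "(lo, l) \<notin> Z"
  proof
    assume "(lo, l) \<in> Z"
    then show False using bspec[OF d(2)] d(1) l by fastforce
  qed
  then have "step_on Z lo hi (\<lambda>_. l)" using True by (intro step_on_const) simp
  then show ?thesis using True l by (intro exI[of _ "\<lambda>_. l"]) (auto simp: mono_on_def)
next
  case False
  define g where "g t = u + 2 * (t - lo)" for t
  define Q where "Q s t \<longleftrightarrow> (s < t \<longrightarrow> (\<exists>\<alpha>. step_on Z s t \<alpha> \<and> mono_on {s..t} \<alpha> \<and> (\<forall>x\<in>{s..t}. g s \<le> \<alpha> x \<and> \<alpha> x \<le> g t)))" for s t
  have gm: "s \<le> t \<Longrightarrow> g s \<le> g t" for s t by (simp add: g_def)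
  have const: "Q s t" if l: "l = g s \<or> l = g t" and nz: "\<And>x. x \<in> {s..t} \<Longrightarrow> s < t \<Longrightarrow> (x, l) \<notin> Z" for s t l
    unfolding Q_def using gm[of s t] l nz
    by (intro impI exI[of _ "\<lambda>_. l"] conjI step_on_const) (auto simp: mono_on_def)
  have trans: "Q x z" if Q: "Q x y" "Q y z" and xy: "x \<le> y" "y \<le> z" for x y z
  proof (cases "x = y \<or> y = z")
    case True
    then show ?thesis using Q by auto
  next
    case False
    obtain \<alpha> where \<alpha>: "step_on Z x y \<alpha>" "mono_on {x..y} \<alpha>" "\<forall>s\<in>{x..y}. g x \<le> \<alpha> s \<and> \<alpha> s \<le> g y"
      using Q(1) False xy unfolding Q_def by auto
    obtain \<beta> where \<beta>: "step_on Z y z \<beta>" "mono_on {y..z} \<beta>" "\<forall>s\<in>{y..z}. g y \<le> \<beta> s \<and> \<beta> s \<le> g z"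
      using Q(2) False xy unfolding Q_def by auto
    let ?\<alpha> = "\<lambda>s. if s \<le> y then \<alpha> s else \<beta> s"
    have "mono_on {x..z} ?\<alpha>"
    proof (rule mono_onI)
      fix s t assume st: "s \<in> {x..z}" "t \<in> {x..z}" "s \<le> t"
      consider "t \<le> y" | "y < s" | "s \<le> y" "y < t" by linarith
      then show "?\<alpha> s \<le> ?\<alpha> t"
      proof cases
        case 1
        then show ?thesis using mono_onD[OF \<alpha>(2), of s t] st by simp
      next
        case 2
        then show ?thesis using mono_onD[OF \<beta>(2), of s t] st by simp
      next
        case 3
        then show ?thesis using bspec[OF \<alpha>(3), of s] bspec[OF \<beta>(3), of t] st by simp
      qed
    qed
    moreover have "g x \<le> ?\<alpha> s \<and> ?\<alpha> s \<le> g z" if "s \<in> {x..z}" for s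
      using bspec[OF \<alpha>(3), of s] bspec[OF \<beta>(3), of s] gm[OF xy(1)] gm[OF xy(2)] that by auto
    ultimately show ?thesis unfolding Q_def using step_on_glue[OF \<alpha>(1) \<beta>(1) xy] by blast
  qed
  have "Q lo hi"
  proof (rule chain_on_dense[where D = UNIV])
    show "\<exists>z\<in>UNIV. x < z \<and> z < y" if "x < y" for x y :: real using dense[OF that] by blast
    show "Q x z" if "x \<le> y" "y \<le> z" "Q x y" "Q y z" for x y z by (rule trans[OF that(3,4,1,2)])
    fix \<tau> assume \<tau>: "\<tau> \<in> {lo..hi}"
    obtain d where d: "d > 0" "\<forall>(s, v)\<in>Z. \<bar>s - \<tau>\<bar> < d \<longrightarrow> \<bar>v - g \<tau>\<bar> < d \<longrightarrow> \<bar>v - g \<tau>\<bar> \<le> \<bar>s - \<tau>\<bar>"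
      using cone[OF \<tau>] unfolding below_slope_def g_def by blast
    have nz: "\<bar>v - g \<tau>\<bar> \<le> \<bar>s - \<tau>\<bar>" if "(s, v) \<in> Z" "\<bar>s - \<tau>\<bar> < d" "\<bar>v - g \<tau>\<bar> < d" for s v
      using bspec[OF d(2) that(1)] that(2,3) by simp
    have left: "Q x y" if "\<bar>x - \<tau>\<bar> < d / 2" "y \<le> \<tau>" for x y
    proof (rule const)
      fix z assume z: "z \<in> {x..y}" "x < y"
      show "(z, g x) \<notin> Z"
      proof
        assume "(z, g x) \<in> Z"
        then have "\<bar>g x - g \<tau>\<bar> \<le> \<bar>z - \<tau>\<bar>" by (rule nz) (use z that in \<open>auto simp: g_def\<close>)
        then show False using z that by (simp add: g_def)
      qed
    qed simp
    have right: "Q x y" if "\<bar>y - \<tau>\<bar> < d / 2" "\<tau> \<le> x" for x y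
    proof (rule const)
      fix z assume z: "z \<in> {x..y}" "x < y"
      show "(z, g y) \<notin> Z"
      proof
        assume "(z, g y) \<in> Z"
        then have "\<bar>g y - g \<tau>\<bar> \<le> \<bar>z - \<tau>\<bar>" by (rule nz) (use z that in \<open>auto simp: g_def\<close>)
        then show False using z that by (simp add: g_def)
      qed
    qed simp
    show "\<exists>d>0. \<forall>x\<in>UNIV \<inter> {lo..hi}. \<forall>y\<in>UNIV \<inter> {lo..hi}. \<bar>x - \<tau>\<bar> < d \<longrightarrow> \<bar>y - \<tau>\<bar> < d \<longrightarrow> x \<le> y \<longrightarrow> Q x y"
    proof (intro exI[of _ "d / 2"] conjI ballI impI)
      fix x y assume xy: "\<bar>x - \<tau>\<bar> < d / 2" "\<bar>y - \<tau>\<bar> < d / 2" "x \<le> y"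
      consider "y \<le> \<tau>" | "\<tau> \<le> x" | "x \<le> \<tau>" "\<tau> \<le> y" by linarith
      then show "Q x y"
      proof cases
        case 3
        show ?thesis by (rule trans[OF left right 3]) (use xy in auto)
      qed (use left right xy in auto)
    qed (use d in simp)
  qed (use lohi in auto)
  then obtain \<alpha> where \<alpha>: "step_on Z lo hi \<alpha>" "mono_on {lo..hi} \<alpha>" "\<forall>x\<in>{lo..hi}. g lo \<le> \<alpha> x \<and> \<alpha> x \<le> g hi"
    using False lohi unfolding Q_def by auto
  then show ?thesis by (intro exI[of _ \<alpha>]) (force simp: g_def)
qed

text \<open>
  By reflection of the parameter.
\<close>

lemma falling_stair:
  assumes lohi: "lo \<le> hi" and cone: "\<And>\<tau>. \<tau> \<in> {lo..hi} \<Longrightarrow> below_slope Z \<tau> (u + 2 * (hi - \<tau>))"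
  shows "\<exists>\<alpha>. step_on Z lo hi \<alpha> \<and> antimono_on {lo..hi} \<alpha> \<and> (\<forall>s\<in>{lo..hi}. u \<le> \<alpha> s \<and> \<alpha> s \<le> u + 2 * (hi - lo) + 1)"
proof -
  let ?Z = "(\<lambda>(s, v). (- s, v)) ` Z"
  have "below_slope ?Z \<tau> (u + 2 * (\<tau> - - hi))" if t: "\<tau> \<in> {-hi..-lo}" for \<tau>
  proof -
    obtain d where d: "d > 0" "\<forall>(s, v)\<in>Z. \<bar>s - - \<tau>\<bar> < d \<longrightarrow> \<bar>v - (u + 2 * (hi - - \<tau>))\<bar> < d \<longrightarrow> \<bar>v - (u + 2 * (hi - - \<tau>))\<bar> \<le> \<bar>s - - \<tau>\<bar>"
      using cone[of "- \<tau>"] t unfolding below_slope_def by auto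
    have "\<bar>- s - \<tau>\<bar> = \<bar>s - - \<tau>\<bar>" "\<tau> - - hi = hi - - \<tau>" for s by auto
    then show ?thesis unfolding below_slope_def using d by (intro exI[of _ d]) auto
  qed
  then obtain \<alpha> where \<alpha>: "step_on ?Z (- hi) (- lo) \<alpha>" "mono_on {-hi..-lo} \<alpha>"
    "\<forall>s\<in>{-hi..-lo}. u \<le> \<alpha> s \<and> \<alpha> s \<le> u + 2 * (- lo - - hi) + 1"
    using rising_stair[of "- hi" "- lo" ?Z u] lohi by auto
  have "step_on Z lo hi (\<lambda>s. \<alpha> (- s))"
    unfolding step_on_def
  proof
    fix \<tau> assume "\<tau> \<in> {lo..hi}"
    then have "- \<tau> \<in> {-hi..-lo}" by simp
    then obtain d A where A: "d > 0" "finite A" "\<forall>l\<in>A. (- \<tau>, l) \<notin> ?Z" "\<forall>s\<in>{-hi..-lo}. \<bar>s - - \<tau>\<bar> < d \<longrightarrow> \<alpha> s \<in> A"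
      using \<alpha>(1) unfolding step_on_def by blast
    have "\<forall>l\<in>A. (\<tau>, l) \<notin> Z" using A(3) by force
    moreover have "\<forall>s\<in>{lo..hi}. \<bar>s - \<tau>\<bar> < d \<longrightarrow> \<alpha> (- s) \<in> A" using A(4) by (auto simp: abs_minus_commute)
    ultimately show "\<exists>d>0. \<exists>A. finite A \<and> (\<forall>l\<in>A. (\<tau>, l) \<notin> Z) \<and> (\<forall>s\<in>{lo..hi}. \<bar>s - \<tau>\<bar> < d \<longrightarrow> \<alpha> (- s) \<in> A)"
      using A(1,2) by blast
  qed
  moreover have "antimono_on {lo..hi} (\<lambda>s. \<alpha> (- s))" using \<alpha>(2) by (auto simp: monotone_on_def)
  moreover have "\<forall>s\<in>{lo..hi}. u \<le> \<alpha> (- s) \<and> \<alpha> (- s) \<le> u + 2 * (hi - lo) + 1" using \<alpha>(3) by (auto simp: algebra_simps)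
  ultimately show ?thesis by blast
qed

text \<open>
  Levels are measured with \<open>T\<close>, with inverse \<open>S\<close>. Outside \<open>[a,b]\<close> the set \<open>Z\<close> is assumed to have
  slopes at most one.
\<close>

locale stretched =
  fixes Z :: "(real \<times> real) set" and a b :: real and T S :: "real \<Rightarrow> real"
  assumes T: "strict_mono T" "\<And>x. T (S x) = x"
    and cone: "\<And>\<tau> u. u < T a \<or> T b < u \<Longrightarrow> below_slope ((\<lambda>(s, v). (s, T v)) ` Z) \<tau> u"
begin

lemma S_mono_iff: "S x \<le> S y \<longleftrightarrow> x \<le> y"
  using strict_mono_less_eq[OF T(1), of "S x" "S y"] T(2) by simp

lemma S_le: "S x \<le> y \<longleftrightarrow> x \<le> T y" and le_S: "y \<le> S x \<longleftrightarrow> T y \<le> x"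
  using strict_mono_less_eq[OF T(1), of "S x" y] strict_mono_less_eq[OF T(1), of y "S x"] T(2) by auto

lemma step_on_unstretch:
  assumes "step_on ((\<lambda>(s, v). (s, T v)) ` Z) lo hi \<alpha>"
  shows "step_on Z lo hi (\<lambda>s. S (\<alpha> s))"
  unfolding step_on_def
proof
  fix \<tau> assume "\<tau> \<in> {lo..hi}"
  then obtain d A where A: "d > 0" "finite A" "\<forall>l\<in>A. (\<tau>, l) \<notin> (\<lambda>(s, v). (s, T v)) ` Z" "\<forall>s\<in>{lo..hi}. \<bar>s - \<tau>\<bar> < d \<longrightarrow> \<alpha> s \<in> A"
    using assms unfolding step_on_def by blast
  have "(\<tau>, S l) \<notin> Z" if "l \<in> A" for l
  proof
    assume "(\<tau>, S l) \<in> Z"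
    then have "(\<lambda>(s, v). (s, T v)) (\<tau>, S l) \<in> (\<lambda>(s, v). (s, T v)) ` Z" by (rule imageI)
    then show False using A(3) that T(2) by simp
  qed
  then show "\<exists>d>0. \<exists>A. finite A \<and> (\<forall>l\<in>A. (\<tau>, l) \<notin> Z) \<and> (\<forall>s\<in>{lo..hi}. \<bar>s - \<tau>\<bar> < d \<longrightarrow> S (\<alpha> s) \<in> A)"
    using A by (intro exI[of _ d] conjI exI[of _ "S ` A"]) auto
qed

text \<open>
  The line of slope two has to stay outside \<open>[a,b]\<close>; over \<open>[lo,hi]\<close> it climbs by at most two, and
  its stair by at most three.
\<close>

lemma stair:
  assumes lohi: "0 \<le> lo" "lo \<le> hi" "hi \<le> 1" and u: "T b < u \<or> u + 2 < T a"
  shows "\<exists>\<alpha>. step_on Z lo hi \<alpha> \<and> along fw lo hi \<alpha> \<and> (\<forall>s\<in>{lo..hi}. S u \<le> \<alpha> s \<and> \<alpha> s \<le> S (u + 3))"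
proof -
  let ?Z = "(\<lambda>(s, v). (s, T v)) ` Z"
  have "below_slope ?Z \<tau> (u + 2 * (\<tau> - lo))" "below_slope ?Z \<tau> (u + 2 * (hi - \<tau>))" if "\<tau> \<in> {lo..hi}" for \<tau>
    using u that lohi by (auto intro!: cone)
  then obtain \<alpha> where \<alpha>: "step_on ?Z lo hi \<alpha>" "along fw lo hi \<alpha>" "\<forall>s\<in>{lo..hi}. u \<le> \<alpha> s \<and> \<alpha> s \<le> u + 2 * (hi - lo) + 1"
    using rising_stair[OF lohi(2), of ?Z u] falling_stair[OF lohi(2), of ?Z u] unfolding along_def by (cases fw) auto
  have "along fw lo hi (\<lambda>s. S (\<alpha> s))" using \<alpha>(2) by (auto simp: along_def monotone_on_def S_mono_iff split: if_splits)
  moreover have "S u \<le> S (\<alpha> s) \<and> S (\<alpha> s) \<le> S (u + 3)" if "s \<in> {lo..hi}" for s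
    using bspec[OF \<alpha>(3) that] lohi by (simp add: S_mono_iff)
  ultimately show ?thesis using step_on_unstretch[OF \<alpha>(1)] by blast
qed

lemma stair_above:
  assumes lohi: "0 \<le> lo" "lo \<le> hi" "hi \<le> 1"
  shows "\<exists>l' \<alpha>. step_on Z lo hi \<alpha> \<and> along fw lo hi \<alpha> \<and> (\<forall>s\<in>{lo..hi}. l \<le> \<alpha> s \<and> \<alpha> s \<le> l')"
proof -
  let ?u = "T (max l (b + 1))"
  have "T b < ?u" using strict_mono_less[OF T(1)] by simp
  then obtain \<alpha> where \<alpha>: "step_on Z lo hi \<alpha>" "along fw lo hi \<alpha>" "\<forall>s\<in>{lo..hi}. S ?u \<le> \<alpha> s \<and> \<alpha> s \<le> S (?u + 3)"
    using stair[OF lohi] by blast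
  have "l \<le> S ?u" using strict_mono_less_eq[OF T(1)] by (simp add: le_S)
  then show ?thesis using \<alpha> by (intro exI[of _ "S (?u + 3)"] exI[of _ \<alpha>]) force
qed

lemma stair_below:
  assumes lohi: "0 \<le> lo" "lo \<le> hi" "hi \<le> 1"
  shows "\<exists>\<alpha>. step_on Z lo hi \<alpha> \<and> along fw lo hi \<alpha> \<and> (\<forall>s\<in>{lo..hi}. \<alpha> s \<le> l)"
proof -
  (* The stair climbs by at most three and has to end below both l and a. *)
  let ?u = "T (min l (a - 1)) - 3"
  have "T (min l (a - 1)) < T a" using strict_mono_less[OF T(1)] by simp
  then have "?u + 2 < T a" by simp
  then obtain \<alpha> where \<alpha>: "step_on Z lo hi \<alpha>" "along fw lo hi \<alpha>" "\<forall>s\<in>{lo..hi}. S ?u \<le> \<alpha> s \<and> \<alpha> s \<le> S (?u + 3)"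
    using stair[OF lohi] by blast
  have "S (?u + 3) \<le> l" using strict_mono_less_eq[OF T(1)] by (simp add: S_le)
  then show ?thesis using \<alpha> by (intro exI[of _ \<alpha>]) force
qed

end

section \<open>Speed of the branches\<close>

context morse
begin

text \<open>
  The branch is the arc composed with the local inverse of its parameter \<open>F2\<close>. At an interior
  point of the arc where the derivative of \<open>F2\<close> does not vanish, \<open>F2\<close> is not extremal and hence
  lies strictly between 0 and 1, so that the branch is defined on both sides.
\<close>

lemma dF3_dr_arc:
  assumes i: "i \<in> comps M" and t: "t \<in> interior (dom i)" and nc: "arc i t \<notin> crit"
    and D2: "((\<lambda>s. F2 M (arc i s)) has_real_derivative D2) (at t)" "D2 \<noteq> 0"
    and D3: "((\<lambda>s. F3 M (arc i s)) has_real_derivative D3) (at t)"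
  shows "dF3_dr M (arc i t) = D3 / D2"
proof -
  let ?f = "\<lambda>s. F2 M (arc i s)" and ?p = "arc i t"
  have td: "t \<in> dom i" using t interior_subset by blast
  have p: "?p \<in> pts M" by (rule arc_pts[OF i td])
  have "?p \<in> topspace CT" using p by (simp add: topspace_curve_top)
  from arc_neighbourhood_at[OF i td refl openin_topspace this] nc
  obtain \<eta> where \<eta>: "\<eta> > 0" "\<eta> \<le> 1" "inj_on ?f (dom i \<inter> ball t \<eta>)" by blast
  obtain e0 where e0: "e0 > 0" "cball t e0 \<subseteq> dom i" using t by (meson mem_interior_cball)
  define d where "d = min e0 (\<eta> / 2)"
  have d: "d > 0" "d \<le> 1" "cball t d \<subseteq> dom i" "cball t d \<subseteq> ball t \<eta>" using e0 \<eta> by (auto simp: d_def)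
  have inj: "inj_on ?f (cball t d)" by (rule inj_on_subset[OF \<eta>(3)]) (use d in auto)
  have dm: "z \<in> cball t d" if "\<bar>z - t\<bar> \<le> d" for z using that by (simp add: dist_real_def abs_minus_commute)
  have range: "0 \<le> ?f z \<and> ?f z \<le> 1" if "\<bar>z - t\<bar> \<le> d" for z
    using F2_range[OF arc_pts[OF i, of z]] dm[OF that] d(3) by auto
  have "?f t \<noteq> 1"
  proof
    assume "?f t = 1"
    then have "D2 = 0" by (intro DERIV_local_max[OF D2(1) d(1)]) (use range in \<open>auto simp: abs_minus_commute\<close>)
    then show False using D2(2) by simp
  qed
  moreover have "?f t \<noteq> 0"
  proof
    assume "?f t = 0"
    then have "D2 = 0" by (intro DERIV_local_min[OF D2(1) d(1)]) (use range in \<open>auto simp: abs_minus_commute\<close>)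
    then show False using D2(2) by simp
  qed
  ultimately have r01: "0 < ?f t" "?f t < 1" using range[of t] d(1) by auto
  define g where "g = the_inv_into (cball t d) ?f"
  have gf: "g (?f z) = z" if "\<bar>z - t\<bar> \<le> d" for z
    unfolding g_def by (rule the_inv_into_f_f[OF inj dm[OF that]])
  define d' where "d' = d / 2"
  have d': "d' > 0" "d' < d" using d(1) by (auto simp: d'_def)
  have "isCont g (?f t)"
  proof (rule isCont_inverse_function[where f = ?f and x = t and d = d'])
    fix z assume z: "\<bar>z - t\<bar> \<le> d'"
    show "g (?f z) = z" using z d' by (intro gf) simp
    have "z \<in> ball t d" using z d' by (simp add: dist_real_def abs_minus_commute)
    moreover have "continuous_on (ball t d) ?f"
      using continuous_on_subset[OF F2_arc_continuous[OF i]] d(3) by (meson ball_subset_cball order.trans)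
    ultimately show "isCont ?f z" by (simp add: continuous_on_eq_continuous_at)
  qed (rule d'(1))
  have "openin CT (arc i ` (dom i \<inter> ball t d))" by (rule arc_ball_open[OF i d(2)])
  moreover have "?p \<in> arc i ` (dom i \<inter> ball t d)" using td d(1) by simp
  ultimately obtain e where e: "e > 0" "\<forall>r\<in>near01 (?f t) e. branch M ?p r \<in> arc i ` (dom i \<inter> ball t d) \<and> branch M ?p r \<in> pts M \<and> F2 M (branch M ?p r) = r"
    using branch_near[OF p nc] by blast
  have br: "?f (g r) = r \<and> branch M ?p r = arc i (g r)" if r: "r \<in> near01 (?f t) e" for r
  proof -
    obtain z where z: "z \<in> ball t d" "branch M ?p r = arc i z" "F2 M (branch M ?p r) = r" using bspec[OF e(2) r] by auto
    then have "g r = z" using gf[of z] by (simp add: dist_real_def abs_minus_commute)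
    then show ?thesis using z by simp
  qed
  define J where "J = {max 0 (?f t - e)<..<min 1 (?f t + e)}"
  have J: "open J" "?f t \<in> J" "J \<subseteq> near01 (?f t) e" using r01 e(1) by (auto simp: J_def near01_def)
  have "DERIV g (?f t) :> inverse D2"
  proof (rule DERIV_inverse_function[where f = ?f and a = "max 0 (?f t - e)" and b = "min 1 (?f t + e)"])
    show "DERIV ?f (g (?f t)) :> D2" using gf[of t] d(1) D2(1) by simp
    show "?f (g y) = y" if "max 0 (?f t - e) < y" "y < min 1 (?f t + e)" for y
      using br[of y] J(3) that by (auto simp: J_def)
  qed (use D2(2) r01 e(1) \<open>isCont g (?f t)\<close> in auto)
  moreover have "DERIV (\<lambda>s. F3 M (arc i s)) (g (?f t)) :> D3" using gf[of t] d(1) D3 by simp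
  ultimately have "DERIV (\<lambda>r. F3 M (arc i (g r))) (?f t) :> D3 * inverse D2"
    by (rule DERIV_chain2[where f = "\<lambda>s. F3 M (arc i s)" and g = g, rotated])
  then have "DERIV (\<lambda>r. F3 M (branch M ?p r)) (?f t) :> D3 * inverse D2"
    by (rule has_field_derivative_transform_within_open[OF _ J(1,2)]) (use br J(3) in auto)
  then have "((\<lambda>r. F3 M (branch M ?p r)) has_vector_derivative D3 / D2) (at (F2 M ?p) within {0..1})"
    using r01 by (simp add: at_within_Icc_at has_real_derivative_iff_has_vector_derivative divide_inverse)
  then show ?thesis unfolding dF3_dr_def
    using r01 by (simp add: at_within_Icc_at vector_derivative_at)
qed

text \<open>
  Where \<open>F2\<close> has derivative zero along the arc, the bound on slopes says nothing, but there the
  Legendrian condition makes the derivative of \<open>F3\<close> vanish as well.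
\<close>

lemma arc_slope_bound:
  fixes \<Phi> :: "real \<Rightarrow> real"
  assumes bound: "\<forall>c\<in>pts M. F2_regular M c \<and> F3 M c \<notin> {a<..<b} \<longrightarrow> \<bar>dF3_dr M c\<bar> \<le> \<Phi> (F3 M c)"
    and i: "i \<in> comps M" and t: "t \<in> interior (dom i)" and nc: "arc i t \<notin> crit" and out: "F3 M (arc i t) \<notin> {a<..<b}"
  shows "\<exists>D2 D3. ((\<lambda>s. F2 M (arc i s)) has_real_derivative D2) (at t) \<and>
    ((\<lambda>s. F3 M (arc i s)) has_real_derivative D3) (at t) \<and> \<bar>D3\<bar> \<le> \<Phi> (F3 M (arc i t)) * \<bar>D2\<bar>"
proof -
  have td: "t \<in> dom i" using t interior_subset by blast
  obtain D where "\<And>t. t \<in> dom i \<Longrightarrow> ((\<lambda>t. Fmap M (arc i t)) has_vector_derivative D t) (at t within dom i)"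
    using Fmap_arc_derivative[OF i] by blast
  from this[OF td] have D: "((\<lambda>t. Fmap M (arc i t)) has_vector_derivative D t) (at t)"
    using at_within_interior[OF t] by simp
  let ?D2 = "fst (snd (D t))" and ?D3 = "snd (snd (D t))"
  have D2: "((\<lambda>s. F2 M (arc i s)) has_real_derivative ?D2) (at t)"
    unfolding F2_def has_real_derivative_iff_has_vector_derivative
    using D by (auto simp: has_vector_derivative_def intro!: derivative_eq_intros)
  have D3: "((\<lambda>s. F3 M (arc i s)) has_real_derivative ?D3) (at t)"
    unfolding F3_def has_real_derivative_iff_has_vector_derivative
    using D by (auto simp: has_vector_derivative_def intro!: derivative_eq_intros)
  have "vel M i t = D t" unfolding vel_def using D at_within_interior[OF t] by (simp add: vector_derivative_at)
  then have leg: "?D3 + F1 M (arc i t) * ?D2 = 0"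
    using legendrian[OF i] td unfolding legendrian_component_def by auto
  have "\<bar>?D3\<bar> \<le> \<Phi> (F3 M (arc i t)) * \<bar>?D2\<bar>"
  proof (cases "?D2 = 0")
    case True
    then show ?thesis using leg by simp
  next
    case False
    have "vector_derivative (\<lambda>s. F2 M (arc i s)) (at t within dom i) = ?D2"
      using D2 at_within_interior[OF t] by (simp add: vector_derivative_at has_real_derivative_iff_has_vector_derivative)
    then have "F2_regular M (arc i t)"
      unfolding F2_regular_def using td False by (intro bexI[of _ t]) (auto simp: arc_at_def)
    then have "\<bar>dF3_dr M (arc i t)\<bar> \<le> \<Phi> (F3 M (arc i t))" using bound arc_pts[OF i td] out by blast
    then show ?thesis using dF3_dr_arc[OF i t nc D2 False D3] False by (simp add: abs_divide pos_divide_le_eq)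
  qed
  then show ?thesis using D2 D3 by blast
qed

text \<open>
  On each half of a small arc around \<open>p\<close> the parameter is injective and all other points are
  noncritical, so that the derivative bound can be integrated. Hence \<open>p\<close> may be a birth, a death
  or an endpoint.
\<close>

lemma stretched_lipschitz:
  fixes \<Phi> T :: "real \<Rightarrow> real"
  assumes bound: "\<forall>c\<in>pts M. F2_regular M c \<and> F3 M c \<notin> {a<..<b} \<longrightarrow> \<bar>dF3_dr M c\<bar> \<le> \<Phi> (F3 M c)"
    and pos: "\<forall>s\<in>UNIV - {a<..<b}. \<Phi> s > 0" and cT: "continuous_on UNIV T"
    and dT: "\<And>s. s < a \<or> b < s \<Longrightarrow> (T has_real_derivative 1 / \<Phi> s) (at s)"
    and p: "p \<in> pts M" "F3 M p < a \<or> b < F3 M p"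
  shows "\<exists>U. openin CT U \<and> p \<in> U \<and> (\<forall>q\<in>U. \<bar>T (F3 M q) - T (F3 M p)\<bar> \<le> \<bar>F2 M q - F2 M p\<bar>)"
proof -
  let ?O = "{q \<in> pts M. F3 M q \<in> {..<a} \<union> {b<..}}"
  have O: "openin CT ?O" by (rule F3_open) auto
  have "p \<in> ?O" using p by auto
  from arc_neighbourhood[OF p(1) O this] obtain i t0 \<eta> where i: "i \<in> comps M" and t0: "t0 \<in> dom i" and pt: "p = arc i t0"
    and \<eta>: "0 < \<eta>" "\<eta> \<le> 1" and sub: "arc i ` (dom i \<inter> ball t0 \<eta>) \<subseteq> ?O" and cr: "arc i ` (dom i \<inter> ball t0 \<eta>) \<inter> crit \<subseteq> {p}"
    and injl: "inj_on (\<lambda>t. F2 M (arc i t)) (dom i \<inter> ball t0 \<eta> \<inter> {..t0})"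
    and injr: "inj_on (\<lambda>t. F2 M (arc i t)) (dom i \<inter> ball t0 \<eta> \<inter> {t0..})" by blast
  let ?f = "\<lambda>t. F2 M (arc i t)" and ?w = "\<lambda>t. T (F3 M (arc i t))"
  have der: "\<exists>f' w'. (?f has_real_derivative f') (at z) \<and> (?w has_real_derivative w') (at z) \<and> \<bar>w'\<bar> \<le> \<bar>f'\<bar>"
    if z: "x < z" "z < y" and xy: "{x..y} \<subseteq> dom i \<inter> ball t0 \<eta>" "z \<noteq> t0" for x y z
  proof -
    have zi: "z \<in> interior (dom i)"
      using z xy by (intro interiorI[of "{x<..<y}"]) auto
    have zd: "z \<in> dom i \<inter> ball t0 \<eta>" by (rule subsetD[OF xy(1)]) (use z in simp)
    have out: "F3 M (arc i z) < a \<or> b < F3 M (arc i z)" using zd sub by blast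
    have "arc i z \<noteq> p"
      using inj_onD[OF arc_inj, of i z t0 t0] zd \<eta> xy(2) pt by auto
    then have nc: "arc i z \<notin> crit" using cr zd by blast
    have o': "F3 M (arc i z) \<notin> {a<..<b}" using out by auto
    from arc_slope_bound[OF bound i zi nc o'] obtain D2 D3 where D: "(?f has_real_derivative D2) (at z)"
      "((\<lambda>s. F3 M (arc i s)) has_real_derivative D3) (at z)" "\<bar>D3\<bar> \<le> \<Phi> (F3 M (arc i z)) * \<bar>D2\<bar>" by blast
    have "(?w has_real_derivative 1 / \<Phi> (F3 M (arc i z)) * D3) (at z)"
      by (rule DERIV_chain2[OF dT[OF out] D(2)])
    moreover have "\<bar>1 / \<Phi> (F3 M (arc i z)) * D3\<bar> \<le> \<bar>D2\<bar>"
      using D(3) bspec[OF pos, of "F3 M (arc i z)"] o' by (simp add: abs_mult pos_divide_le_eq mult.commute)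
    ultimately show ?thesis using D(1) by blast
  qed
  have cf: "continuous_on S ?f" and cw: "continuous_on S ?w" if "S \<subseteq> dom i" for S
    using continuous_on_subset[OF F2_arc_continuous[OF i] that]
      continuous_on_compose2[OF cT continuous_on_subset[OF F3_arc_continuous[OF i] that]] by auto
  have main: "\<bar>?w t - ?w t0\<bar> \<le> \<bar>?f t - ?f t0\<bar>" if t: "t \<in> dom i \<inter> ball t0 \<eta>" for t
  proof -
    consider "t = t0" | "t0 < t" | "t < t0" by linarith
    then show ?thesis
    proof cases
      case 2
      have s: "{t0..t} \<subseteq> dom i \<inter> ball t0 \<eta>" using dom_connected[OF t0, of t] t by (auto simp: dist_real_def)
      have "{t0..t} \<subseteq> dom i" using s by blast
      then show ?thesis
        by (intro dominated_increment[OF 2] cf cw inj_on_subset[OF injr] der) (use s in auto)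
    next
      case 3
      have s: "{t..t0} \<subseteq> dom i \<inter> ball t0 \<eta>" using dom_connected[of t i t0] t0 t by (auto simp: dist_real_def)
      have s': "{t..t0} \<subseteq> dom i" using s by blast
      have "\<bar>?w t0 - ?w t\<bar> \<le> \<bar>?f t0 - ?f t\<bar>"
        by (intro dominated_increment[OF 3] cf cw inj_on_subset[OF injl] der) (use s s' in auto)
      then show ?thesis by (simp add: abs_minus_commute)
    qed simp
  qed
  show ?thesis
  proof (intro exI conjI)
    show "openin CT (arc i ` (dom i \<inter> ball t0 \<eta>))" by (rule arc_ball_open[OF i \<eta>(2)])
    show "p \<in> arc i ` (dom i \<inter> ball t0 \<eta>)" using t0 \<eta> pt by simp
    show "\<forall>q\<in>arc i ` (dom i \<inter> ball t0 \<eta>). \<bar>T (F3 M q) - T (F3 M p)\<bar> \<le> \<bar>F2 M q - F2 M p\<bar>" using main pt by auto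
  qed
qed

text \<open>
  Around each point of the curve over \<open>(\<tau>,u)\<close> the Lipschitz bound gives the cone. By compactness
  of the part of the curve with heights near \<open>u\<close>, the rest of the curve keeps a positive distance
  from \<open>(\<tau>,u)\<close>.
\<close>

lemma trace_below_slope:
  assumes T: "strict_mono T" "continuous_on UNIV T" "\<And>x. T (S x) = x"
    and lip: "\<And>p. p \<in> pts M \<Longrightarrow> F3 M p < a \<or> b < F3 M p \<Longrightarrow>
      \<exists>U. openin CT U \<and> p \<in> U \<and> (\<forall>q\<in>U. \<bar>T (F3 M q) - T (F3 M p)\<bar> \<le> \<bar>F2 M q - F2 M p\<bar>)"
    and u: "u < T a \<or> T b < u"
  shows "below_slope ((\<lambda>(s, v). (s, T v)) ` trace_set) \<tau> u"
proof -
  define K where "K = {p \<in> pts M. F3 M p \<in> {S (u - 1)..S (u + 1)}}"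
  have K: "compactin CT K" unfolding K_def by (rule F3_compact) simp
  (* The distance to (\<tau>,u) in the stretched coordinates. *)
  define \<psi> where "\<psi> q = max \<bar>F2 M q - \<tau>\<bar> \<bar>T (F3 M q) - u\<bar>" for q
  have "continuous_map CT euclideanreal (\<lambda>q. T (F3 M q))"
    using continuous_map_compose[OF F3_continuous, of euclideanreal T] T(2) by (simp add: comp_def)
  then have \<psi>: "continuous_map CT euclideanreal \<psi>" unfolding \<psi>_def
    using F2_continuous by (intro continuous_intros) auto
  define N where "N = \<Union>{U. openin CT U \<and> (\<forall>q\<in>U. \<bar>T (F3 M q) - u\<bar> \<le> \<bar>F2 M q - \<tau>\<bar>)}"
  have N: "openin CT N" unfolding N_def by blast
  have "p \<in> N" if p: "p \<in> K" "\<psi> p = 0" for p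
  proof -
    have e: "F2 M p = \<tau>" "T (F3 M p) = u" using p(2) by (auto simp: \<psi>_def max_def split: if_splits)
    have "F3 M p < a \<or> b < F3 M p" using u strict_mono_less[OF T(1)] e(2) by auto
    moreover have "p \<in> pts M" using p(1) by (simp add: K_def)
    ultimately obtain U where "openin CT U" "p \<in> U" "\<forall>q\<in>U. \<bar>T (F3 M q) - T (F3 M p)\<bar> \<le> \<bar>F2 M q - F2 M p\<bar>"
      using lip by blast
    then show ?thesis unfolding N_def e by blast
  qed
  from compact_zero_neighbourhood[OF K N \<psi> this] obtain d where d: "d > 0" "\<forall>q\<in>K. \<bar>\<psi> q\<bar> < d \<longrightarrow> q \<in> N" by blast
  have "\<bar>T (F3 M q) - u\<bar> \<le> \<bar>F2 M q - \<tau>\<bar>"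
    if q: "q \<in> pts M" "\<bar>F2 M q - \<tau>\<bar> < min d 1" "\<bar>T (F3 M q) - u\<bar> < min d 1" for q
  proof -
    have "T (S (u - 1)) \<le> T (F3 M q)" "T (F3 M q) \<le> T (S (u + 1))" using q(3) T(3) by auto
    then have "q \<in> K" using q(1) strict_mono_less_eq[OF T(1)] by (simp add: K_def)
    moreover have "\<bar>\<psi> q\<bar> < d" using q by (simp add: \<psi>_def)
    ultimately show ?thesis using d(2) unfolding N_def by blast
  qed
  then show ?thesis unfolding below_slope_def trace_set_def using d(1) by (intro exI[of _ "min d 1"]) auto
qed

end

section \<open>Invariance\<close>

lemma HM_iterated_limit:
  "HM M r = direct_limit (\<lambda>b. inverse_limit (\<lambda>a. HMw M a b r) (\<lambda>a a'. HMw_map M a' b r)) (\<lambda>b b' h a. HMw_map M a b' r (h a))"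
proof -
  have "HM_below M r = (\<lambda>b. inverse_limit (\<lambda>a. HMw M a b r) (\<lambda>a a'. HMw_map M a' b r))" by (simp add: fun_eq_iff HM_below_def)
  then show ?thesis by (simp add: HM_def)
qed

theorem theoremB:
  fixes M :: "('i, 'k::idom) morse"
    and a b r0 r1 :: real
    and \<Phi> :: "real \<Rightarrow> real"
  assumes pid: "principal_domain (ring_of_type :: 'k ring)"
    and M: "morse_tuple M"
    and ab: "a \<le> b"
    and \<Phi>_cont: "continuous_on (UNIV - {a<..<b}) \<Phi>"
    and \<Phi>_pos: "\<forall>s\<in>UNIV - {a<..<b}. \<Phi> s > 0"
    and bound: "\<forall>c\<in>pts M. F2_regular M c \<and> F3 M c \<notin> {a<..<b} \<longrightarrow> \<bar>dF3_dr M c\<bar> \<le> \<Phi> (F3 M c)"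
    and div_top: "(\<integral>\<^sup>+s\<in>{b..}. ennreal (1 / \<Phi> s) \<partial>lborel) = \<infinity>"
    and div_bot: "(\<integral>\<^sup>+s\<in>{..a}. ennreal (1 / \<Phi> s) \<partial>lborel) = \<infinity>"
    and r0: "r0 \<in> {0..1} - \<Lambda> M"
    and r1: "r1 \<in> {0..1} - \<Lambda> M"
  shows "modules_isomorphic (HM M r0) (HM M r1)"
proof -
  interpret morse M using M by unfold_locales
  obtain T S where T: "strict_mono T" "continuous_on UNIV T" "\<And>x. T (S x) = x"
    "\<And>s. s < a \<or> b < s \<Longrightarrow> (T has_real_derivative 1 / \<Phi> s) (at s)"
    using time_coordinate[OF ab \<Phi>_cont \<Phi>_pos div_top div_bot] by blast
  interpret stretched trace_set a b T S
  proof
    show "below_slope ((\<lambda>(s, v). (s, T v)) ` trace_set) \<tau> u" if "u < T a \<or> T b < u" for \<tau> u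
      using trace_below_slope[OF T(1-3) stretched_lipschitz[OF bound \<Phi>_pos T(2,4)] that] .
  qed (use T in auto)
  interpret continuation regular_params "\<lambda>r a b. HMw M a b r" "\<lambda>r a b. HMw_map M a b r" trace_set link
  proof (unfold HMw_homology HMw_map_class, unfold_locales)
    fix r a b a' b' X Y k assume r: "r \<in> regular_params"
    note fin = gens_finite[of a b r]
    show "X \<oplus>\<^bsub>HH r a b\<^esub> Y \<in> carrier (HH r a b)" if "X \<in> carrier (HH r a b)" "Y \<in> carrier (HH r a b)"
      by (rule homology_add_in[OF fin that])
    show "k \<odot>\<^bsub>HH r a b\<^esub> X \<in> carrier (HH r a b)" if "X \<in> carrier (HH r a b)"
      by (rule homology_smult_in[OF fin that])
    show "push r a b X = X" if "X \<in> carrier (HH r a b)" by (rule push_id[OF r that])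
    assume w: "a \<le> a'" "b \<le> b'"
    note cm = truncate_window[OF r w]
    show "push r a' b' X \<in> carrier (HH r a' b')" if "X \<in> carrier (HH r a b)" by (rule induced_map_in[OF cm that])
    show "push r a' b' (X \<oplus>\<^bsub>HH r a b\<^esub> Y) = push r a' b' X \<oplus>\<^bsub>HH r a' b'\<^esub> push r a' b' Y"
      if "X \<in> carrier (HH r a b)" "Y \<in> carrier (HH r a b)" by (rule induced_map_add[OF cm that])
    show "push r a' b' (k \<odot>\<^bsub>HH r a b\<^esub> X) = k \<odot>\<^bsub>HH r a' b'\<^esub> push r a' b' X" if "X \<in> carrier (HH r a b)"
      by (rule induced_map_smult[OF cm that])
    fix a'' b''
    show "push r a'' b'' (push r a' b' X) = push r a'' b'' X" if "a' \<le> a''" "b' \<le> b''" "X \<in> carrier (HH r a b)"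
      by (rule push_comp[OF r w that])
  qed (use link_near link_push link_compatible regular_dense in \<open>auto simp: regular_params_def link_def intro: stair_above stair_below\<close>)
  have D: "r0 \<in> regular_params" "r1 \<in> regular_params" using r0 r1 by (auto simp: regular_params_def)
  show ?thesis
    unfolding HM_iterated_limit using limits_isomorphic[of r0 r1] limits_isomorphic[of r1 r0] D by (cases "r0 \<le> r1") auto
qed

end
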